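(* Let $T\in(0,\infty)$, and suppose $d_n\in\{1,\dots,n\}$, $d_n\to\infty$, $\lambda_n\to\lambda\in(0,\infty)$, and $\boldsymbol{x}^n,\boldsymbol{x}\in\boldsymbol{\ell}_1^\downarrow$ are deterministic with $n x^n_i\in\mathbb{N}_0$ for all $i$ and $\|\boldsymbol{x}^n-\boldsymbol{x}\|_1\to0$. Suppose that $\{\boldsymbol{\varphi}^n\}_{n\in\mathbb{N}}$ is a sequence in $\bar{\mathcal{A}}_b$ such that for some $M_0\in(0,\infty)$, $\sup_{n\in\mathbb{N}}\sum_{i=0}^\infty\int_{\mathbb{X}_T}\ell(\varphi^n_i(s,y))\,ds\,dy\le M_0$ a.s. Let $(\bar{\boldsymbol{X}}^n,\bar{\boldsymbol{Y}}^n,\bar{\boldsymbol{\eta}}^n)$ be the controlled processes associated with $\boldsymbol{\varphi}^n$, as defined in the context. Suppose also that $\{(\bar{\boldsymbol{X}}^n,\bar{\boldsymbol{Y}}^n,\bar{\boldsymbol{\eta}}^n,\boldsymbol{\varphi}^n)\}_{n\in\mathbb{N}}$ converges along a subsequence, in distribution in $\mathbb{D}([0,T]:\boldsymbol{\ell}_1^\downarrow\times\boldsymbol{\ell}_1\times\mathbb{R}^\infty)\times S_{M_0}$, to $(\bar{\boldsymbol{X}},\bar{\boldsymbol{Y}},\bar{\boldsymbol{\eta}},\boldsymbol{\varphi})$ given on some probability space $(\Omega^*,\mathcal{F}^*,\mathbb{P}^* )$. Then the following holds $\mathbb{P}^*$-a.s. (a) For all $t\in[0,T]$, $$\bar Y_1(t)=x_1+\lambda\int_{\mathbb{X}_t}\varphi_0(s,y)\,ds\,dy-\int_{\mathbb{X}_t}\mathbf{1}_{[0,\bar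 X_1(s)-\bar X_2(s))}(y)\varphi_1(s,y)\,ds\,dy,$$ $$\bar Y_i(t)=x_i-\int_{\mathbb{X}_t}\mathbf{1}_{[0,\bar X_i(s)-\bar X_{i+1}(s))}(y)\varphi_i(s,y)\,ds\,dy,\quad i\ge2.$$ (b) $(\bar{\boldsymbol{X}},\bar{\boldsymbol{Y}})\in\mathcal{C}$ and $\boldsymbol{\varphi}\in\mathcal{S}(\bar{\boldsymbol{X}},\bar{\boldsymbol{Y}})$. In particular, $\bar X_1(t)=\bar Y_1(t)-\bar\eta_1(t)$ and $\bar X_i(t)=\bar Y_i(t)+\bar\eta_{i-1}(t)-\bar\eta_i(t)$ for $i\ge2$, $t\in[0,T]$, and for every $i\in\mathbb{N}$, $\bar\eta_i(0)=0$, $\bar\eta_i$ is non-decreasing, and $\int_0^t(1-\bar X_i(s))\,\bar\eta_i(ds)=0$ for all $t\in[0,T]$.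
   Context: Spaces. $\boldsymbol{\ell}_1$ is the space of real sequences $\boldsymbol{x}=(x_1,x_2,\dots)$ with $\|\boldsymbol{x}\|_1=\sum_i|x_i|<\infty$; $\boldsymbol{\ell}_1^\downarrow=\{\boldsymbol{x}\in\boldsymbol{\ell}_1:x_i\ge x_{i+1},\ x_i\in[0,1]\ \forall i\}$ with norm $\|\cdot\|_1$; $\mathbb{R}^\infty$ has the product topology. $\mathbb{D}([0,T]:S)$ is the space of right-continuous functions with left limits with the Skorokhod topology; $\mathbb{C}([0,T]:S)$ is the space of continuous functions. $\mathbb{X}_t=[0,t]\times[0,1]$, $\ell(z)=z\log z-z+1$ for $z\ge0$. $S_M$, for $M\in(0,\infty)$, is the set of $\boldsymbol{h}=\{h_i\}_{i\in\mathbb{N}_0}$ of measurable $h_i:[0,T]\times[0,1]\to\mathbb{R}_+$ with $\sum_{i=0}^\infty\int_{\mathbb{X}_T}\ell(h_i(s,y))\,ds\,dy\le M$; each $h_i$ is identified with the finite measure $h_i(s,y)\,ds\,dy$ on $[0,T]\times[0,1]$, and $S_M$ has the topology inherited from the countable product of spaces of finite measures on $[0,T]\times[0,1]$ with the weak convergence topology (it is compact). Controls. On a complete probability space, $\{D_i\}_{i\in\mathbb{N}_0}$ are i.i.d. Poisson random measures on $[0,T]\times[0,1]\times\mathbb{R}_+$ with Lebesgue intensity, and $\{\mathcal{F}_t\}$ is the augmentation of the filtration generated by $D_i((0,s]\times H\times B)$, $s\le t$, $H\in\mathcal{B}([0,1])$, $B\in\mathcal{B}(\mathbb{R}_+)$,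 $i\in\mathbb{N}_0$. $\bar{\mathcal{A}}_+$ is the class of maps $\varphi:\Omega\times[0,T]\times[0,1]\to\mathbb{R}_+$ measurable with respect to the product of the $\{\mathcal{F}_t\}$-predictable $\sigma$-field and $\mathcal{B}([0,1])$. For $m\in\mathbb{N}$, $\bar{\mathcal{A}}_{b,m}$ is the set of $(\varphi_i)_{i\in\mathbb{N}_0}$ with all $\varphi_i\in\bar{\mathcal{A}}_+$, $\frac1m\le\varphi_i\le m$ everywhere for $i\le m$, and $\varphi_i\equiv1$ for $i>m$; $\bar{\mathcal{A}}_b=\bigcup_{m\ge1}\bar{\mathcal{A}}_{b,m}$. For $\varphi\in\bar{\mathcal{A}}_+$, $D_i^\varphi([0,t]\times H)=\int_{[0,t]\times H\times\mathbb{R}_+}\mathbf{1}_{[0,\varphi(s,y))}(z)\,D_i(ds\,dy\,dz)$. Controlled processes. Let $\beta_n(x)=\prod_{i=0}^{d_n-1}\left(\frac{x-i/n}{1-i/n}\right)^+$, $x\in[0,1]$. For $\boldsymbol{\varphi}^n\in\bar{\mathcal{A}}_b$, $(\bar{\boldsymbol{X}}^n,\bar{\boldsymbol{Y}}^n,\bar{\boldsymbol{\eta}}^n)$ (sequences indexed by $i\ge1$) is given by $\bar X^n_0\equiv1$, $\bar\eta^n_0\equiv0$, $\bar X^n_i=\bar Y^n_i+\bar\eta^n_{i-1}-\bar\eta^n_i$ for $i\ge1$, and $$\bar Y^n_1(t)=x^n_1+\tfrac1n\int_{\mathbb{X}_t}D_0^{n\lambda_n\varphi^n_0}(ds\,dy)-\tfrac1n\int_{\mathbb{X}_t}\mathbf{1}_{[0,\bar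 X^n_1(s-)-\bar X^n_2(s-))}(y)D_1^{n\varphi^n_1}(ds\,dy),$$ $$\bar Y^n_i(t)=x^n_i-\tfrac1n\int_{\mathbb{X}_t}\mathbf{1}_{[0,\bar X^n_i(s-)-\bar X^n_{i+1}(s-))}(y)D_i^{n\varphi^n_i}(ds\,dy)\ (i\ge2),$$ $$\bar\eta^n_i(t)=\tfrac1n\int_{\mathbb{X}_t}\mathbf{1}_{[0,\beta_n(\bar X^n_i(s-)))}(y)D_0^{n\lambda_n\varphi^n_0}(ds\,dy)\ (i\ge1).$$ The sets $\mathcal{C}$ and $\mathcal{S}$. $\mathcal{C}$ is the set of $(\boldsymbol{\zeta},\boldsymbol{\psi})\in\mathbb{C}([0,T]:\boldsymbol{\ell}_1^\downarrow\times\boldsymbol{\ell}_1)$ such that (i) $\boldsymbol{\zeta}(0)=\boldsymbol{\psi}(0)=\boldsymbol{x}$ and each $\zeta_i,\psi_i$ is absolutely continuous on $[0,T]$; (ii) there is $\boldsymbol{\eta}=(\eta_i)_{i\ge1}\in\mathbb{C}([0,T]:\mathbb{R}^\infty)$ such that, with $\eta_0\equiv0$, $\zeta_i=\psi_i+\eta_{i-1}-\eta_i$ on $[0,T]$ for all $i\in\mathbb{N}$, and for each $i\ge1$: $\eta_i(0)=0$, $\eta_i$ is nondecreasing, and $\int_0^T(1-\zeta_i(s))\,\eta_i(ds)=0$. For $(\boldsymbol{\zeta},\boldsymbol{\psi})\in\mathcal{C}$, $\mathcal{S}(\boldsymbol{\zeta},\boldsymbol{\psi})$ is the set of sequences $(\varphi_i)_{i\in\mathbb{N}_0}$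 of measurable functions $[0,T]\times[0,1]\to\mathbb{R}_+$ such that the two displayed equations in part (a) hold with $(\bar{\boldsymbol{X}},\bar{\boldsymbol{Y}})$ replaced by $(\boldsymbol{\zeta},\boldsymbol{\psi})$. *)

theory Defs
  imports "HOL-Probability.Probability"
begin

section \<open>Sequence spaces\<close>

text \<open>
  A sequence \<open>(x\<^sub>i)\<close> indexed by \<open>i \<ge> 1\<close> is represented by a function \<open>x :: nat \<Rightarrow> real\<close> whose unused
  coordinate is pinned by \<open>x 0 = 0\<close>, so that all subscripts agree with the usual notation
  and the convention \<open>\<eta>\<^sub>0 = 0\<close> is built in.
\<close>

definition ell1 :: "(nat \<Rightarrow> real) set" where
  "ell1 = {x. x 0 = 0 \<and> (\<lambda>i. \<bar>x i\<bar>) summable_on UNIV}"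

definition ell1_norm :: "(nat \<Rightarrow> real) \<Rightarrow> real" where
  "ell1_norm x = (\<Sum>\<^sub>\<infinity>i. \<bar>x i\<bar>)"

definition ell1_down :: "(nat \<Rightarrow> real) set" where
  "ell1_down = {x \<in> ell1. \<forall>i\<ge>1. x (Suc i) \<le> x i \<and> x i \<in> {0..1}}"

definition ell1_metric :: "(nat \<Rightarrow> real) metric" where
  "ell1_metric = metric (ell1, \<lambda>x y. ell1_norm (\<lambda>i. x i - y i))"

definition ell1_down_metric :: "(nat \<Rightarrow> real) metric" where
  "ell1_down_metric = submetric ell1_metric ell1_down"

text \<open>
  The library distance on \<open>nat \<Rightarrow> real\<close> (theory \<open>Function_Metric\<close>) induces the product topology.
\<close>
definition Rinf_metric :: "(nat \<Rightarrow> real) metric" where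
  "Rinf_metric = submetric euclidean_metric {x. x 0 = 0}"

lemma Metric_space_ell1: "Metric_space ell1 (\<lambda>x y. ell1_norm (\<lambda>i. x i - y i))"
proof
  have sd: "(\<lambda>i. \<bar>u i - v i\<bar>) summable_on UNIV" if "u \<in> ell1" "v \<in> ell1" for u v :: "nat \<Rightarrow> real"
    by (rule summable_on_comparison_test[OF summable_on_add[of "\<lambda>i. \<bar>u i\<bar>" UNIV "\<lambda>i. \<bar>v i\<bar>"]])
       (use that in \<open>auto simp: ell1_def abs_triangle_ineq4\<close>)
  fix x y z :: "nat \<Rightarrow> real"
  show "0 \<le> ell1_norm (\<lambda>i. x i - y i)"
    unfolding ell1_norm_def by (rule infsum_nonneg) auto
  show "ell1_norm (\<lambda>i. x i - y i) = ell1_norm (\<lambda>i. y i - x i)"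
    by (simp add: ell1_norm_def abs_minus_commute)
  assume x: "x \<in> ell1" and y: "y \<in> ell1"
  show "ell1_norm (\<lambda>i. x i - y i) = 0 \<longleftrightarrow> x = y"
  proof
    assume "ell1_norm (\<lambda>i. x i - y i) = 0"
    then have le: "(\<Sum>\<^sub>\<infinity>i. \<bar>x i - y i\<bar>) \<le> 0" by (simp add: ell1_norm_def)
    have "\<bar>x i - y i\<bar> = 0" for i
      by (rule nonneg_infsum_le_0D[OF le sd[OF x y]]) auto
    then show "x = y" by (simp add: fun_eq_iff)
  qed (simp add: ell1_norm_def)
  assume z: "z \<in> ell1"
  have "ell1_norm (\<lambda>i. x i - z i) \<le> (\<Sum>\<^sub>\<infinity>i. \<bar>x i - y i\<bar> + \<bar>y i - z i\<bar>)"
    unfolding ell1_norm_def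
    by (rule infsum_mono) (use sd x y z in \<open>auto intro!: summable_on_add\<close>)
  also have "\<dots> = ell1_norm (\<lambda>i. x i - y i) + ell1_norm (\<lambda>i. y i - z i)"
    unfolding ell1_norm_def by (rule infsum_add) (use sd x y z in auto)
  finally show "ell1_norm (\<lambda>i. x i - z i) \<le> ell1_norm (\<lambda>i. x i - y i) + ell1_norm (\<lambda>i. y i - z i)" .
qed

lemma mspace_ell1 [simp]: "mspace ell1_metric = ell1"
  and mdist_ell1 [simp]: "mdist ell1_metric = (\<lambda>x y. ell1_norm (\<lambda>i. x i - y i))"
  by (simp_all add: ell1_metric_def Metric_space.mspace_metric[OF Metric_space_ell1]
      Metric_space.mdist_metric[OF Metric_space_ell1])

lemma mspace_ell1_down [simp]: "mspace ell1_down_metric = ell1_down"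
  by (auto simp: ell1_down_metric_def ell1_down_def)

section \<open>Skorokhod space\<close>

definition cadlag_space :: "real \<Rightarrow> 'a metric \<Rightarrow> (real \<Rightarrow> 'a) set" where
  "cadlag_space T m = {f \<in> {0..T} \<rightarrow>\<^sub>E mspace m.
     (\<forall>t\<in>{0..<T}. limitin (mtopology_of m) f (f t) (at_right t)) \<and>
     (\<forall>t\<in>{0<..T}. \<exists>l. limitin (mtopology_of m) f l (at_left t))}"

definition time_changes :: "real \<Rightarrow> (real \<Rightarrow> real) set" where
  "time_changes T = {\<tau>. strict_mono_on {0..T} \<tau> \<and> \<tau> ` {0..T} = {0..T}}"

definition skorokhod_dist :: "real \<Rightarrow> 'a metric \<Rightarrow> (real \<Rightarrow> 'a) \<Rightarrow> (real \<Rightarrow> 'a) \<Rightarrow> real" where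
  "skorokhod_dist T m f g = enn2real (INF \<tau>\<in>time_changes T.
     max (SUP t\<in>{0..T}. ennreal \<bar>\<tau> t - t\<bar>) (SUP t\<in>{0..T}. ennreal (mdist m (f t) (g (\<tau> t)))))"

definition skorokhod_topology :: "real \<Rightarrow> 'a metric \<Rightarrow> (real \<Rightarrow> 'a) topology" where
  "skorokhod_topology T m = mtopology_of (metric (cadlag_space T m, skorokhod_dist T m))"

subsection \<open>The Skorokhod distance is a metric on paths over a fixed time interval\<close>

abbreviation (input) skor_size :: "real \<Rightarrow> 'a metric \<Rightarrow> (real \<Rightarrow> 'a) \<Rightarrow> (real \<Rightarrow> 'a) \<Rightarrow> (real \<Rightarrow> real) \<Rightarrow> ennreal" where
  "skor_size T m f g \<tau> \<equiv>
     max (SUP t\<in>{0..T}. ennreal \<bar>\<tau> t - t\<bar>) (SUP t\<in>{0..T}. ennreal (mdist m (f t) (g (\<tau> t))))"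

lemma skor_size_le_iff:
  assumes "0 \<le> r"
  shows "skor_size T m f g \<tau> \<le> ennreal r \<longleftrightarrow>
    (\<forall>t\<in>{0..T}. \<bar>\<tau> t - t\<bar> \<le> r \<and> mdist m (f t) (g (\<tau> t)) \<le> r)"
  using assms by (auto simp: SUP_le_iff ennreal_le_iff)

lemma id_time_changes: "(\<lambda>t. t) \<in> time_changes T"
  by (auto simp: time_changes_def strict_mono_on_def)

lemma time_changes_mem: "\<tau> \<in> time_changes T \<Longrightarrow> t \<in> {0..T} \<Longrightarrow> \<tau> t \<in> {0..T}"
  unfolding time_changes_def by blast

lemma time_changes_inv:
  assumes "\<tau> \<in> time_changes T"
  obtains \<sigma> where "\<sigma> \<in> time_changes T" "\<And>t. t \<in> {0..T} \<Longrightarrow> \<tau> (\<sigma> t) = t"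
proof
  let ?s = "inv_into {0..T} \<tau>"
  have im: "\<tau> ` {0..T} = {0..T}" and sm: "strict_mono_on {0..T} \<tau>"
    using assms by (auto simp: time_changes_def)
  show *: "\<tau> (?s t) = t" if "t \<in> {0..T}" for t
    using that im by (metis f_inv_into_f)
  have in1: "?s t \<in> {0..T}" if "t \<in> {0..T}" for t
    using that im by (metis inv_into_into)
  have "strict_mono_on {0..T} ?s"
  proof (rule strict_mono_onI)
    fix r s assume rs: "r \<in> {0..T}" "s \<in> {0..T}" "r < s"
    show "?s r < ?s s"
    proof (rule ccontr)
      assume "\<not> ?s r < ?s s"
      then have "\<tau> (?s s) \<le> \<tau> (?s r)"
        using sm in1[OF rs(1)] in1[OF rs(2)]
        by (metis linorder_le_less_linear order_le_less strict_mono_onD less_imp_le)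
      then show False using * rs by simp
    qed
  qed
  moreover have "?s ` {0..T} = {0..T}"
  proof
    show "?s ` {0..T} \<subseteq> {0..T}" using in1 by blast
    show "{0..T} \<subseteq> ?s ` {0..T}"
    proof
      fix t assume t: "t \<in> {0..T}"
      have "?s (\<tau> t) = t"
        using t sm by (simp add: strict_mono_on_imp_inj_on inv_into_f_f)
      then show "t \<in> ?s ` {0..T}" using time_changes_mem[OF assms t] by (metis imageI)
    qed
  qed
  ultimately show "?s \<in> time_changes T" by (simp add: time_changes_def)
qed

lemma time_changes_comp:
  assumes "\<sigma> \<in> time_changes T" "\<tau> \<in> time_changes T"
  shows "(\<lambda>t. \<tau> (\<sigma> t)) \<in> time_changes T"
proof -
  have "(\<lambda>t. \<tau> (\<sigma> t)) ` {0..T} = {0..T}"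
    using assms by (simp add: time_changes_def flip: image_image)
  moreover have "strict_mono_on {0..T} (\<lambda>t. \<tau> (\<sigma> t))"
  proof (rule strict_mono_onI)
    fix r s assume rs: "r \<in> {0..T}" "s \<in> {0..T}" "r < s"
    have "\<sigma> r < \<sigma> s" using assms(1) rs unfolding time_changes_def by (blast dest: strict_mono_onD)
    then show "\<tau> (\<sigma> r) < \<tau> (\<sigma> s)"
      using assms(2) time_changes_mem[OF assms(1) rs(1)] time_changes_mem[OF assms(1) rs(2)]
      unfolding time_changes_def by (blast dest: strict_mono_onD)
  qed
  ultimately show ?thesis by (simp add: time_changes_def)
qed

lemma cadlag_bounded:
  assumes f: "f \<in> cadlag_space T m" and p: "p \<in> mspace m"
  obtains B where "0 \<le> B" "\<And>t. t \<in> {0..T} \<Longrightarrow> mdist m p (f t) \<le> B"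
proof -
  interpret Metric_space "mspace m" "mdist m" by blast
  have ev: "\<exists>B. \<forall>\<^sub>F s in F. mdist m p (f s) \<le> B" if "limitin (mtopology_of m) f l F" for l F
  proof
    have l: "l \<in> mspace m" and "\<forall>\<^sub>F s in F. f s \<in> mspace m \<and> mdist m (f s) l < 1"
      using that limitin_metric[of f l F] by (auto simp: mtopology_of_def)
    then show "\<forall>\<^sub>F s in F. mdist m p (f s) \<le> mdist m p l + 1"
      by (rule_tac eventually_mono) (use triangle[OF p l] commute in \<open>fastforce\<close>)+
  qed
  have loc: "\<exists>U B. open U \<and> t \<in> U \<and> (\<forall>s\<in>U \<inter> {0..T}. mdist m p (f s) \<le> B)" if t: "t \<in> {0..T}" for t
  proof -
    have "\<exists>B e. e > t \<and> (\<forall>s\<in>{t<..<e} \<inter> {0..T}. mdist m p (f s) \<le> B)"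
    proof (cases "t < T")
      case True
      then have "limitin (mtopology_of m) f (f t) (at_right t)"
        using f t by (auto simp: cadlag_space_def)
      from ev[OF this] obtain B b where "b > t" "\<forall>s>t. s < b \<longrightarrow> mdist m p (f s) \<le> B"
        unfolding eventually_at_right_field by blast
      then show ?thesis by (intro exI[of _ B] exI[of _ b]) auto
    qed (intro exI[of _ 0] exI[of _ "t+1"], auto)
    then obtain B1 e where 1: "e > t" "\<And>s. s \<in> {t<..<e} \<inter> {0..T} \<Longrightarrow> mdist m p (f s) \<le> B1" by blast
    have "\<exists>B e. e < t \<and> (\<forall>s\<in>{e<..<t} \<inter> {0..T}. mdist m p (f s) \<le> B)"
    proof (cases "0 < t")
      case True
      then obtain l where "limitin (mtopology_of m) f l (at_left t)"
        using f t unfolding cadlag_space_def by force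
      from ev[OF this] obtain B b where "b < t" "\<forall>s>b. s < t \<longrightarrow> mdist m p (f s) \<le> B"
        unfolding eventually_at_left_field by blast
      then show ?thesis by (intro exI[of _ B] exI[of _ b]) auto
    qed (intro exI[of _ 0] exI[of _ "t-1"], auto)
    then obtain B2 e' where 2: "e' < t" "\<And>s. s \<in> {e'<..<t} \<inter> {0..T} \<Longrightarrow> mdist m p (f s) \<le> B2" by blast
    have "mdist m p (f s) \<le> max (mdist m p (f t)) (max B1 B2)" if s: "s \<in> {e'<..<e} \<inter> {0..T}" for s
    proof (cases s t rule: linorder_cases)
      case less
      then show ?thesis using 2(2)[of s] s by auto
    next
      case greater
      then show ?thesis using 1(2)[of s] s by auto
    qed auto
    with 1(1) 2(1) show ?thesis
      by (intro exI[of _ "{e'<..<e}"] exI[of _ "max (mdist m p (f t)) (max B1 B2)"]) auto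
  qed
  then obtain U B where U: "\<And>t. t \<in> {0..T} \<Longrightarrow> open (U t) \<and> t \<in> U t \<and> (\<forall>s\<in>U t \<inter> {0..T}. mdist m p (f s) \<le> B t)"
    by metis
  obtain C where C: "C \<subseteq> {0..T}" "finite C" "{0..T} \<subseteq> (\<Union>t\<in>C. U t)"
    by (rule compactE_image[of "{0..T}" "{0..T}" U]) (use U in auto)
  show thesis
  proof
    show "0 \<le> (\<Sum>t\<in>C. \<bar>B t\<bar>)" by (simp add: sum_nonneg)
    fix t assume t: "t \<in> {0..T}"
    then obtain c where c: "c \<in> C" "t \<in> U c" using C by blast
    then have "mdist m p (f t) \<le> \<bar>B c\<bar>" using U C t by force
    also have "\<dots> \<le> (\<Sum>t\<in>C. \<bar>B t\<bar>)" using c C by (intro member_le_sum) auto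
    finally show "mdist m p (f t) \<le> (\<Sum>t\<in>C. \<bar>B t\<bar>)" .
  qed
qed

lemma skor_size_finite:
  assumes T: "0 < T" and f: "f \<in> cadlag_space T m" and g: "g \<in> cadlag_space T m"
  shows "(INF \<tau>\<in>time_changes T. skor_size T m f g \<tau>) < \<infinity>"
proof -
  interpret Metric_space "mspace m" "mdist m" by blast
  have p: "f 0 \<in> mspace m" using f T by (auto simp: cadlag_space_def)
  obtain A where A: "0 \<le> A" "\<And>t. t \<in> {0..T} \<Longrightarrow> mdist m (f 0) (f t) \<le> A"
    using cadlag_bounded[OF f p] by blast
  obtain B where B: "0 \<le> B" "\<And>t. t \<in> {0..T} \<Longrightarrow> mdist m (f 0) (g t) \<le> B"
    using cadlag_bounded[OF g p] by blast
  have "mdist m (f t) (g t) \<le> A + B" if t: "t \<in> {0..T}" for t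
  proof -
    have "f t \<in> mspace m" "g t \<in> mspace m" using f g t by (auto simp: cadlag_space_def)
    then show ?thesis using triangle[of "f t" "f 0" "g t"] A(2)[OF t] B(2)[OF t] p commute[of "f 0" "f t"]
      by linarith
  qed
  then have "skor_size T m f g (\<lambda>t. t) \<le> ennreal (A + B)"
    by (subst skor_size_le_iff) (use A B in auto)
  then have "(INF \<tau>\<in>time_changes T. skor_size T m f g \<tau>) \<le> ennreal (A + B)"
    using id_time_changes by (intro INF_lower2[where i = "\<lambda>t. t"])
  also have "\<dots> < \<infinity>" by simp
  finally show ?thesis .
qed

lemma skorokhod_dist_less_iff:
  assumes T: "0 < T" and f: "f \<in> cadlag_space T m" and g: "g \<in> cadlag_space T m" and r: "0 < r"
  shows "skorokhod_dist T m f g < r \<longleftrightarrow> (\<exists>\<tau>\<in>time_changes T. \<exists>q<r.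
    \<forall>t\<in>{0..T}. \<bar>\<tau> t - t\<bar> \<le> q \<and> mdist m (f t) (g (\<tau> t)) \<le> q)"
proof -
  have "skorokhod_dist T m f g < r \<longleftrightarrow> (INF \<tau>\<in>time_changes T. skor_size T m f g \<tau>) < ennreal r"
    using skor_size_finite[OF T f g] r unfolding skorokhod_dist_def
    by (cases "INF \<tau>\<in>time_changes T. skor_size T m f g \<tau>") (auto simp: ennreal_less_iff)
  also have "\<dots> \<longleftrightarrow> (\<exists>\<tau>\<in>time_changes T. skor_size T m f g \<tau> < ennreal r)"
    by (simp only: INF_less_iff)
  also have "\<dots> \<longleftrightarrow> (\<exists>\<tau>\<in>time_changes T. \<exists>q<r. 0 \<le> q \<and> skor_size T m f g \<tau> \<le> ennreal q)"
  proof (intro bex_cong refl)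
    fix \<tau>
    have *: "(s < ennreal r) \<longleftrightarrow> (\<exists>q<r. 0 \<le> q \<and> s \<le> ennreal q)" for s
    proof (cases s)
      case (real a)
      then show ?thesis by (auto simp: ennreal_less_iff ennreal_le_iff intro: le_less_trans)
    qed (auto simp: top_unique)
    show "skor_size T m f g \<tau> < ennreal r \<longleftrightarrow> (\<exists>q<r. 0 \<le> q \<and> skor_size T m f g \<tau> \<le> ennreal q)"
      by (rule *)
  qed
  also have "\<dots> \<longleftrightarrow> (\<exists>\<tau>\<in>time_changes T. \<exists>q<r.
    \<forall>t\<in>{0..T}. \<bar>\<tau> t - t\<bar> \<le> q \<and> mdist m (f t) (g (\<tau> t)) \<le> q)"
  proof (intro bex_cong refl ex_cong conj_cong)
    fix \<tau> q
    show "(0 \<le> q \<and> skor_size T m f g \<tau> \<le> ennreal q) \<longleftrightarrow>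
      (\<forall>t\<in>{0..T}. \<bar>\<tau> t - t\<bar> \<le> q \<and> mdist m (f t) (g (\<tau> t)) \<le> q)"
    proof (cases "0 \<le> q")
      case False
      then show ?thesis using T by (auto intro!: bexI[of _ 0])
    qed (subst skor_size_le_iff, auto)
  qed
  finally show ?thesis .
qed

lemma Metric_space_skorokhod:
  assumes T: "0 < T"
  shows "Metric_space (cadlag_space T m) (skorokhod_dist T m)"
proof
  interpret Metric_space "mspace m" "mdist m" by blast
  fix f g h :: "real \<Rightarrow> 'a"
  show "0 \<le> skorokhod_dist T m f g" by (simp add: skorokhod_dist_def)
  have le: "(INF \<tau>\<in>time_changes T. skor_size T m f g \<tau>) \<le> (INF \<tau>\<in>time_changes T. skor_size T m g f \<tau>)"
    for f g :: "real \<Rightarrow> 'a"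
  proof (rule INF_greatest)
    fix \<tau> assume \<tau>: "\<tau> \<in> time_changes T"
    obtain \<sigma> where \<sigma>: "\<sigma> \<in> time_changes T" "\<And>t. t \<in> {0..T} \<Longrightarrow> \<tau> (\<sigma> t) = t"
      using time_changes_inv[OF \<tau>] by blast
    have "skor_size T m f g \<sigma> \<le> skor_size T m g f \<tau>"
    proof (rule max.mono; rule SUP_least)
      fix t assume t: "t \<in> {0..T}"
      show "ennreal \<bar>\<sigma> t - t\<bar> \<le> (SUP t\<in>{0..T}. ennreal \<bar>\<tau> t - t\<bar>)"
        using time_changes_mem[OF \<sigma>(1) t] \<sigma>(2)[OF t]
        by (intro SUP_upper2[where i = "\<sigma> t"]) (simp_all add: abs_minus_commute)
      show "ennreal (mdist m (f t) (g (\<sigma> t))) \<le> (SUP t\<in>{0..T}. ennreal (mdist m (g t) (f (\<tau> t))))"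
        using time_changes_mem[OF \<sigma>(1) t] \<sigma>(2)[OF t]
        by (intro SUP_upper2[where i = "\<sigma> t"]) (simp_all add: commute)
    qed
    then show "(INF \<tau>\<in>time_changes T. skor_size T m f g \<tau>) \<le> skor_size T m g f \<tau>"
      using \<sigma>(1) by (intro INF_lower2[where i = \<sigma>])
  qed
  show "skorokhod_dist T m f g = skorokhod_dist T m g f"
    unfolding skorokhod_dist_def using le[of f g] le[of g f] by (simp add: antisym)
  assume f: "f \<in> cadlag_space T m" and g: "g \<in> cadlag_space T m"
  note D = f[unfolded cadlag_space_def] g[unfolded cadlag_space_def]
  show "skorokhod_dist T m f g = 0 \<longleftrightarrow> f = g"
  proof
    assume "f = g"
    have "mdist m (f t) (g t) = 0" if "t \<in> {0..T}" for t
      using PiE_mem[of g "{0..T}" "\<lambda>_. mspace m" t] D(2) that \<open>f = g\<close> by simp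
    then have "skorokhod_dist T m f g < r" if "0 < r" for r
      using that by (subst skorokhod_dist_less_iff[OF T f g that])
        (auto intro!: bexI[OF _ id_time_changes] exI[of _ 0])
    then show "skorokhod_dist T m f g = 0"
      using \<open>0 \<le> skorokhod_dist T m f g\<close> by (metis less_irrefl order_le_less)
  next
    assume 0: "skorokhod_dist T m f g = 0"
    have app: "\<exists>\<tau>\<in>time_changes T. \<forall>t\<in>{0..T}. \<bar>\<tau> t - t\<bar> < r \<and> mdist m (f t) (g (\<tau> t)) < r"
      if r: "0 < r" for r
    proof -
      obtain \<tau> q where "\<tau> \<in> time_changes T" "q < r"
        "\<forall>t\<in>{0..T}. \<bar>\<tau> t - t\<bar> \<le> q \<and> mdist m (f t) (g (\<tau> t)) \<le> q"
        using skorokhod_dist_less_iff[OF T f g r] 0 r by auto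
      then show ?thesis by (intro bexI[of _ \<tau>]) force+
    qed
    have eqr: "f t = g t" if t: "t \<in> {0..<T}" for t
    proof (rule ccontr)
      assume ne: "f t \<noteq> g t"
      have ft: "f t \<in> mspace m" and gt: "g t \<in> mspace m" using D t by auto
      define e where "e = mdist m (f t) (g t)"
      have e: "e > 0" using ne mdist_nonneg[of m "f t" "g t"] zero[OF ft gt] unfolding e_def by linarith
      have lim1: "\<forall>\<^sub>F s in at_right t. mdist m (k s) (k t) < e/3" if "k \<in> cadlag_space T m" for k
      proof -
        have "limitin (mtopology_of m) k (k t) (at_right t)" using that t by (auto simp: cadlag_space_def)
        then have "\<forall>\<^sub>F s in at_right t. k s \<in> mspace m \<and> mdist m (k s) (k t) < e/3"
          using e limitin_metric[of k "k t" "at_right t"] unfolding mtopology_of_def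
          by (meson divide_pos_pos zero_less_numeral)
        then show ?thesis by (rule eventually_mono) simp
      qed
      have "\<forall>\<^sub>F s in at_right t. mdist m (f s) (f t) < e/3" "\<forall>\<^sub>F s in at_right t. mdist m (g s) (g t) < e/3"
        using lim1[of f] lim1[of g] f g by auto
      then have "\<forall>\<^sub>F s in at_right t. mdist m (f s) (f t) < e/3 \<and> mdist m (g s) (g t) < e/3"
        by (rule eventually_conj)
      then obtain b where b: "b > t" "\<And>s. t < s \<Longrightarrow> s < b \<Longrightarrow> mdist m (f s) (f t) < e/3 \<and> mdist m (g s) (g t) < e/3"
        by (auto simp: eventually_at_right_field)
      define c where "c = min b T"
      define s where "s = (t + c) / 2"
      have c: "t < c" "c \<le> b" "c \<le> T" using b t by (auto simp: c_def)
      have s: "t < s" "s < c" "s \<in> {0..T}" using c t by (auto simp: s_def field_simps)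
      have "0 < min (e/3) (min (s - t) (c - s))" using e s by auto
      from app[OF this] obtain \<tau> where \<tau>: "\<tau> \<in> time_changes T" "\<bar>\<tau> s - s\<bar> < min (e/3) (min (s - t) (c - s))"
        "mdist m (f s) (g (\<tau> s)) < min (e/3) (min (s - t) (c - s))" using s(3) by blast
      have u: "t < \<tau> s" "\<tau> s < b" using \<tau>(2) c by linarith+
      have us: "\<tau> s \<in> {0..T}" using time_changes_mem[OF \<tau>(1) s(3)] .
      have fs: "f s \<in> mspace m" "g (\<tau> s) \<in> mspace m" using D s us by auto
      have "e \<le> mdist m (f t) (f s) + (mdist m (f s) (g (\<tau> s)) + mdist m (g (\<tau> s)) (g t))"
        unfolding e_def using triangle[OF ft fs(1) gt] triangle[OF fs(1) fs(2) gt] by linarith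
      moreover have "mdist m (f t) (f s) < e/3" using b(2)[of s] s c commute[of "f s" "f t"] by simp
      moreover have "mdist m (g (\<tau> s)) (g t) < e/3" using b(2)[OF u] by simp
      ultimately show False using \<tau>(3) by linarith
    qed
    have "f T = g T"
    proof (rule ccontr)
      assume ne: "f T \<noteq> g T"
      have ft: "f T \<in> mspace m" and gt: "g T \<in> mspace m" using D T by auto
      have e: "mdist m (f T) (g T) > 0"
        using ne mdist_nonneg[of m "f T" "g T"] zero[OF ft gt] by linarith
      from app[OF e] obtain \<tau> where \<tau>: "\<tau> \<in> time_changes T" "mdist m (f T) (g (\<tau> T)) < mdist m (f T) (g T)"
        using T by (auto dest!: bspec[of _ _ T])
      obtain s where s: "s \<in> {0..T}" "\<tau> s = T"
      proof -
        have "T \<in> \<tau> ` {0..T}" using \<tau>(1) T by (simp add: time_changes_def)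
        then show ?thesis using that by auto
      qed
      have "\<tau> T \<in> {0..T}" using time_changes_mem[OF \<tau>(1)] T by auto
      have "s = T"
      proof (rule ccontr)
        assume "s \<noteq> T"
        then have "s < T" "T \<in> {0..T}" using s T by auto
        then have "\<tau> s < \<tau> T" using s(1) \<tau>(1) unfolding time_changes_def by (blast dest: strict_mono_onD)
        then show False using s \<open>\<tau> T \<in> {0..T}\<close> by auto
      qed
      then show False using s \<tau>(2) by simp
    qed
    then show "f = g"
    proof (intro PiE_ext[of f "{0..T}" "\<lambda>_. mspace m" g])
      show "f t = g t" if "t \<in> {0..T}" for t
        using eqr[of t] \<open>f T = g T\<close> that by (cases "t = T") auto
    qed (use D in auto)
  qed
  assume h: "h \<in> cadlag_space T m"
  note D = D h[unfolded cadlag_space_def]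
  show "skorokhod_dist T m f h \<le> skorokhod_dist T m f g + skorokhod_dist T m g h"
  proof (rule field_le_epsilon)
    fix e :: real assume "0 < e"
    let ?a = "skorokhod_dist T m f g + e/2" and ?b = "skorokhod_dist T m g h + e/2"
    have pos: "0 < ?a" "0 < ?b" using \<open>0 < e\<close> by (auto simp: skorokhod_dist_def add_nonneg_pos)
    obtain \<sigma> q where s: "\<sigma> \<in> time_changes T" "q < ?a"
      "\<forall>t\<in>{0..T}. \<bar>\<sigma> t - t\<bar> \<le> q \<and> mdist m (f t) (g (\<sigma> t)) \<le> q"
      using skorokhod_dist_less_iff[OF T f g pos(1)] \<open>0 < e\<close> by auto
    obtain \<tau> q' where t: "\<tau> \<in> time_changes T" "q' < ?b"
      "\<forall>t\<in>{0..T}. \<bar>\<tau> t - t\<bar> \<le> q' \<and> mdist m (g t) (h (\<tau> t)) \<le> q'"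
      using skorokhod_dist_less_iff[OF T g h pos(2)] \<open>0 < e\<close> by auto
    have "\<bar>\<tau> (\<sigma> u) - u\<bar> \<le> q + q' \<and> mdist m (f u) (h (\<tau> (\<sigma> u))) \<le> q + q'" if u: "u \<in> {0..T}" for u
    proof -
      note v = time_changes_mem[OF s(1) u]
      note w = time_changes_mem[OF t(1) v]
      have "f u \<in> mspace m" "g (\<sigma> u) \<in> mspace m" "h (\<tau> (\<sigma> u)) \<in> mspace m" using D u v w by auto
      from triangle[OF this] s(3) t(3) u v show ?thesis by fastforce
    qed
    moreover have "q + q' < ?a + ?b" using s t by linarith
    ultimately have "skorokhod_dist T m f h < ?a + ?b"
      using time_changes_comp[OF s(1) t(1)] pos
      by (subst skorokhod_dist_less_iff[OF T f h]) (auto intro!: bexI[of _ "\<lambda>u. \<tau> (\<sigma> u)"] exI[of _ "q + q'"])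
    then show "skorokhod_dist T m f h \<le> skorokhod_dist T m f g + skorokhod_dist T m g h + e" by linarith
  qed
qed

lemma topspace_skorokhod_topology: "0 < T \<Longrightarrow> topspace (skorokhod_topology T m) = cadlag_space T m"
  by (simp add: skorokhod_topology_def Metric_space.mtopology_of[OF Metric_space_skorokhod]
      Metric_space.topspace_mtopology[OF Metric_space_skorokhod])

text \<open>
  \<open>\<ell>\<^sub>1\<^sup>\<down> \<times> \<ell>\<^sub>1 \<times> \<real>\<^sup>\<infinity>\<close>.  The Skorokhod topology does not depend on the choice of metric for the product topology.
\<close>
definition state_metric :: "((nat \<Rightarrow> real) \<times> (nat \<Rightarrow> real) \<times> (nat \<Rightarrow> real)) metric" where
  "state_metric = prod_metric ell1_down_metric (prod_metric ell1_metric Rinf_metric)"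

section \<open>The space of controls\<close>

definition XX :: "real \<Rightarrow> (real \<times> real) set" where
  "XX t = {0..t} \<times> {0..1}"

text \<open>\<open>z log z - z + 1\<close>; the library convention \<open>ln 0 = 0\<close> yields \<open>ell 0 = 1\<close>.\<close>
definition ell :: "real \<Rightarrow> real" where
  "ell z = z * ln z - z + 1"

definition total_cost :: "real \<Rightarrow> (nat \<Rightarrow> real \<times> real \<Rightarrow> real) \<Rightarrow> ennreal" where
  "total_cost T h = (\<Sum>i. \<integral>\<^sup>+p. ennreal (ell (h i p)) \<partial>restrict_space lborel (XX T))"

text \<open>Families of measurable nonnegative functions on \<open>[0,T] \<times> [0,1]\<close>; values elsewhere are irrelevant.\<close>
definition control_functions :: "real \<Rightarrow> (nat \<Rightarrow> real \<times> real \<Rightarrow> real) set" where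
  "control_functions T = {h. \<forall>i. h i \<in> borel_measurable (restrict_space borel (XX T)) \<and> (\<forall>p\<in>XX T. 0 \<le> h i p)}"

definition S_space :: "real \<Rightarrow> real \<Rightarrow> (nat \<Rightarrow> real \<times> real \<Rightarrow> real) set" where
  "S_space T M = {h \<in> control_functions T. total_cost T h \<le> ennreal M}"

definition finite_measures_on :: "'a::topological_space set \<Rightarrow> 'a measure set" where
  "finite_measures_on E = {\<mu>. sets \<mu> = sets (restrict_space borel E) \<and> finite_measure \<mu>}"

definition weak_topology :: "'a::topological_space set \<Rightarrow> 'a measure topology" where
  "weak_topology E = topology_generated_by
     {{\<mu> \<in> finite_measures_on E. (LINT x|\<mu>. f x) \<in> U} | f U.
        continuous_on E f \<and> bounded (f ` E) \<and> open (U :: real set)}"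

definition control_measure :: "real \<Rightarrow> (real \<times> real \<Rightarrow> real) \<Rightarrow> (real \<times> real) measure" where
  "control_measure T h = density (restrict_space lborel (XX T)) (\<lambda>p. ennreal (h p))"

text \<open>
  The identification of functions with measures is expressed by pulling the topology back, so
  families that agree almost everywhere are topologically indistinguishable.
\<close>
definition S_topology :: "real \<Rightarrow> real \<Rightarrow> (nat \<Rightarrow> real \<times> real \<Rightarrow> real) topology" where
  "S_topology T M = pullback_topology (S_space T M) (\<lambda>h i. control_measure T (h i))
     (product_topology (\<lambda>_. weak_topology (XX T)) UNIV)"

section \<open>Convergence in distribution\<close>

text \<open>Random elements need only take values in the space almost surely.\<close>
definition random_element :: "'w measure \<Rightarrow> 'a topology \<Rightarrow> ('w \<Rightarrow> 'a) \<Rightarrow> bool" where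
  "random_element P X Z \<longleftrightarrow>
     (\<forall>U. openin X U \<longrightarrow> {w \<in> space P. Z w \<in> U} \<in> sets P) \<and> (AE w in P. Z w \<in> topspace X)"

definition converges_in_distribution ::
    "'w measure \<Rightarrow> 'a topology \<Rightarrow> (nat \<Rightarrow> 'w \<Rightarrow> 'a) \<Rightarrow> 'v measure \<Rightarrow> ('v \<Rightarrow> 'a) \<Rightarrow> bool" where
  "converges_in_distribution P X Z Q Z' \<longleftrightarrow>
     (\<forall>n. random_element P X (Z n)) \<and> random_element Q X Z' \<and>
     (\<forall>f. continuous_map X euclideanreal f \<and> bounded (f ` topspace X) \<longrightarrow>
        (\<lambda>n. LINT w|P. indicator (topspace X) (Z n w) * f (Z n w))
          \<longlonglongrightarrow> (LINT w|Q. indicator (topspace X) (Z' w) * f (Z' w)))"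

section \<open>Poisson random measures, filtration and controls\<close>

definition poisson_random_measure :: "'w measure \<Rightarrow> 'a measure \<Rightarrow> ('w \<Rightarrow> 'a measure) \<Rightarrow> bool" where
  "poisson_random_measure P \<nu> N \<longleftrightarrow>
     (\<forall>w\<in>space P. sets (N w) = sets \<nu>) \<and>
     (\<forall>A\<in>sets \<nu>. (\<lambda>w. emeasure (N w) A) \<in> borel_measurable P) \<and>
     (\<forall>A\<in>sets \<nu>. emeasure \<nu> A < \<infinity> \<longrightarrow> (\<forall>k::nat.
        measure P {w \<in> space P. emeasure (N w) A = of_nat k} =
          measure \<nu> A ^ k / fact k * exp (- measure \<nu> A))) \<and>
     (\<forall>A\<in>sets \<nu>. emeasure \<nu> A = \<infinity> \<longrightarrow> (AE w in P. emeasure (N w) A = \<infinity>)) \<and>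
     (\<forall>(A :: nat \<Rightarrow> 'a set) I. finite I \<and> A ` I \<subseteq> sets \<nu> \<and> disjoint_family_on A I \<longrightarrow>
        prob_space.indep_vars P (\<lambda>_. borel) (\<lambda>i w. emeasure (N w) (A i)) I)"

definition mark_space :: "real \<Rightarrow> (real \<times> real \<times> real) set" where
  "mark_space T = {0..T} \<times> {0..1} \<times> {0..}"

text \<open>
  Independence of the \<open>D i\<close> refers to the \<open>\<sigma>\<close>-field on measures generated by the evaluations at measurable sets.
  Identical distribution is automatic, the intensity being the same for every \<open>i\<close>.
\<close>
definition iid_poisson_random_measures ::
    "'w measure \<Rightarrow> real \<Rightarrow> (nat \<Rightarrow> 'w \<Rightarrow> (real \<times> real \<times> real) measure) \<Rightarrow> bool" where
  "iid_poisson_random_measures P T D \<longleftrightarrow>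
     (\<forall>i. poisson_random_measure P (restrict_space lborel (mark_space T)) (D i)) \<and>
     prob_space.indep_vars P (\<lambda>_. PiM (sets (restrict_space lborel (mark_space T))) (\<lambda>_. borel))
       (\<lambda>i w. \<lambda>A\<in>sets (restrict_space lborel (mark_space T)). emeasure (D i w) A) UNIV"

definition noise_filtration ::
    "'w measure \<Rightarrow> (nat \<Rightarrow> 'w \<Rightarrow> (real \<times> real \<times> real) measure) \<Rightarrow> real \<Rightarrow> 'w measure" where
  "noise_filtration P D t = sigma (space P)
     ({{w \<in> space P. emeasure (D i w) ({0<..s} \<times> H \<times> B) \<in> C} | i s H B C.
         s \<in> {0..t} \<and> H \<in> sets borel \<and> H \<subseteq> {0..1} \<and> B \<in> sets borel \<and> B \<subseteq> {0..} \<and> C \<in> sets borel}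
      \<union> null_sets P)"

definition predictable_sigma ::
    "'w measure \<Rightarrow> (nat \<Rightarrow> 'w \<Rightarrow> (real \<times> real \<times> real) measure) \<Rightarrow> real \<Rightarrow> ('w \<times> real) measure" where
  "predictable_sigma P D T = sigma (space P \<times> {0..T})
     ({A \<times> {0} | A. A \<in> sets (noise_filtration P D 0)} \<union>
      {A \<times> {s<..t} | A s t. 0 \<le> s \<and> s < t \<and> t \<le> T \<and> A \<in> sets (noise_filtration P D s)})"

definition A_plus ::
    "'w measure \<Rightarrow> (nat \<Rightarrow> 'w \<Rightarrow> (real \<times> real \<times> real) measure) \<Rightarrow> real \<Rightarrow> ('w \<Rightarrow> real \<times> real \<Rightarrow> real) set" where
  "A_plus P D T = {\<phi>.
     (\<lambda>((w, s), y). \<phi> w (s, y)) \<in>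
       borel_measurable (predictable_sigma P D T \<Otimes>\<^sub>M restrict_space borel {0..1}) \<and>
     (\<forall>w\<in>space P. \<forall>p\<in>XX T. 0 \<le> \<phi> w p)}"

definition A_bm ::
    "'w measure \<Rightarrow> (nat \<Rightarrow> 'w \<Rightarrow> (real \<times> real \<times> real) measure) \<Rightarrow> real \<Rightarrow> nat
      \<Rightarrow> ('w \<Rightarrow> nat \<Rightarrow> real \<times> real \<Rightarrow> real) set" where
  "A_bm P D T m = {\<phi>. (\<forall>i. (\<lambda>w. \<phi> w i) \<in> A_plus P D T) \<and>
     (\<forall>w\<in>space P. \<forall>p\<in>XX T.
        (\<forall>i\<le>m. 1 / real m \<le> \<phi> w i p \<and> \<phi> w i p \<le> real m) \<and> (\<forall>i>m. \<phi> w i p = 1))}"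

definition A_b ::
    "'w measure \<Rightarrow> (nat \<Rightarrow> 'w \<Rightarrow> (real \<times> real \<times> real) measure) \<Rightarrow> real
      \<Rightarrow> ('w \<Rightarrow> nat \<Rightarrow> real \<times> real \<Rightarrow> real) set" where
  "A_b P D T = (\<Union>m\<in>{1..}. A_bm P D T m)"

text \<open>The controlled random measure \<open>D\<^sup>\<psi>\<close> on \<open>[0,T] \<times> [0,1]\<close>, for one realisation \<open>N\<close> of \<open>D\<close>.\<close>
definition thinned ::
    "real \<Rightarrow> (real \<times> real \<times> real) measure \<Rightarrow> (real \<times> real \<Rightarrow> real) \<Rightarrow> (real \<times> real) measure" where
  "thinned T N \<psi> = distr (density N (\<lambda>(s, y, z). indicator {0..<\<psi> (s, y)} z))
     (restrict_space borel (XX T)) (\<lambda>(s, y, z). (s, y))"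

section \<open>The controlled processes\<close>

definition beta :: "nat \<Rightarrow> nat \<Rightarrow> real \<Rightarrow> real" where
  "beta d n x = (\<Prod>i<d. max 0 ((x - real i / real n) / (1 - real i / real n)))"

text \<open>Left limit \<open>f(s-)\<close>, with the convention \<open>f(0-) = f(0)\<close>.\<close>
definition left_lim :: "(real \<Rightarrow> real) \<Rightarrow> real \<Rightarrow> real" where
  "left_lim f s = (if s = 0 then f 0 else Lim (at_left s) f)"

text \<open>
  The defining equations for one realisation: \<open>N i\<close> is the realisation of the \<open>i\<close>-th Poisson random measure and
  \<open>\<phi> i\<close> that of the \<open>i\<close>-th control. The convention \<open>X\<^sub>0 = 1\<close> is not needed, as \<open>X\<^sub>0\<close> occurs in none of the equations.
\<close>
definition controlled_equations ::
    "real \<Rightarrow> nat \<Rightarrow> nat \<Rightarrow> real \<Rightarrow> (nat \<Rightarrow> real) \<Rightarrow> (nat \<Rightarrow> (real \<times> real \<times> real) measure)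
      \<Rightarrow> (nat \<Rightarrow> real \<times> real \<Rightarrow> real)
      \<Rightarrow> (real \<Rightarrow> nat \<Rightarrow> real) \<Rightarrow> (real \<Rightarrow> nat \<Rightarrow> real) \<Rightarrow> (real \<Rightarrow> nat \<Rightarrow> real) \<Rightarrow> bool" where
  "controlled_equations T n d lam x N \<phi> X Y \<eta> \<longleftrightarrow>
    (let D0 = thinned T (N 0) (\<lambda>p. real n * lam * \<phi> 0 p);
         D = (\<lambda>i. thinned T (N i) (\<lambda>p. real n * \<phi> i p));
         Xm = (\<lambda>s i. left_lim (\<lambda>u. X u i) s)
     in \<forall>t\<in>{0..T}.
       Y t 1 = x 1 + 1 / real n * (LINT p:XX t|D0. 1)
             - 1 / real n * (LINT (s, y):XX t|D 1. indicator {0..<Xm s 1 - Xm s 2} y) \<and>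
       (\<forall>i\<ge>2. Y t i = x i - 1 / real n * (LINT (s, y):XX t|D i. indicator {0..<Xm s i - Xm s (i + 1)} y)) \<and>
       \<eta> t 0 = 0 \<and>
       (\<forall>i\<ge>1. \<eta> t i = 1 / real n * (LINT (s, y):XX t|D0. indicator {0..<beta d n (Xm s i)} y)) \<and>
       (\<forall>i\<ge>1. X t i = Y t i + \<eta> t (i - 1) - \<eta> t i))"

section \<open>The limit\<close>

text \<open>
  Integrability is demanded explicitly because the Bochner integral of a non-integrable function is \<open>0\<close>
  by convention; for nonnegative integrands it means finiteness of the integrals.
\<close>
definition fluid_equations ::
    "real \<Rightarrow> real \<Rightarrow> (nat \<Rightarrow> real) \<Rightarrow> (nat \<Rightarrow> real \<times> real \<Rightarrow> real)
      \<Rightarrow> (real \<Rightarrow> nat \<Rightarrow> real) \<Rightarrow> (real \<Rightarrow> nat \<Rightarrow> real) \<Rightarrow> bool" where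
  "fluid_equations T lam x \<phi> X Y \<longleftrightarrow>
     (let served = (\<lambda>i (s, y). indicator {0..<X s i - X s (i + 1)} y * \<phi> i (s, y))
      in set_integrable lborel (XX T) (\<phi> 0) \<and>
         (\<forall>i\<ge>1. set_integrable lborel (XX T) (served i)) \<and>
         (\<forall>t\<in>{0..T}.
            Y t 1 = x 1 + lam * (LINT p:XX t|lborel. \<phi> 0 p) - (LINT p:XX t|lborel. served 1 p) \<and>
            (\<forall>i\<ge>2. Y t i = x i - (LINT p:XX t|lborel. served i p))))"

definition abs_continuous_on :: "real \<Rightarrow> real \<Rightarrow> (real \<Rightarrow> real) \<Rightarrow> bool" where
  "abs_continuous_on a b f \<longleftrightarrow>
     (\<forall>\<epsilon>>0. \<exists>\<delta>>0. \<forall>(n::nat) l r.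
        (\<forall>k<n. a \<le> l k \<and> l k \<le> r k \<and> r k \<le> b) \<and>
        disjoint_family_on (\<lambda>k. {l k<..<r k}) {..<n} \<and> (\<Sum>k<n. r k - l k) < \<delta> \<longrightarrow>
        (\<Sum>k<n. \<bar>f (r k) - f (l k)\<bar>) < \<epsilon>)"

text \<open>
  \<open>\<integral>\<^sub>0\<^sup>t g(s) F(ds)\<close> for nondecreasing right-continuous \<open>F\<close> on \<open>[0,T]\<close>; \<open>F\<close> is extended to the real line by
  constants, hence carries no mass at \<open>0\<close>.
\<close>
definition stieltjes_integral :: "real \<Rightarrow> real \<Rightarrow> (real \<Rightarrow> real) \<Rightarrow> (real \<Rightarrow> real) \<Rightarrow> real" where
  "stieltjes_integral T t g F = (LINT s:{0..t}|interval_measure (\<lambda>s. F (max 0 (min T s))). g s)"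

definition C_set :: "real \<Rightarrow> (nat \<Rightarrow> real) \<Rightarrow> ((real \<Rightarrow> nat \<Rightarrow> real) \<times> (real \<Rightarrow> nat \<Rightarrow> real)) set" where
  "C_set T x = {(\<zeta>, \<psi>).
     continuous_map (top_of_set {0..T}) (mtopology_of (prod_metric ell1_down_metric ell1_metric))
       (\<lambda>t. (\<zeta> t, \<psi> t)) \<and>
     \<zeta> 0 = x \<and> \<psi> 0 = x \<and>
     (\<forall>i\<ge>1. abs_continuous_on 0 T (\<lambda>t. \<zeta> t i) \<and> abs_continuous_on 0 T (\<lambda>t. \<psi> t i)) \<and>
     (\<exists>\<eta>. continuous_map (top_of_set {0..T}) (mtopology_of Rinf_metric) \<eta> \<and>
        (\<forall>i\<ge>1. (\<forall>t\<in>{0..T}. \<zeta> t i = \<psi> t i + \<eta> t (i - 1) - \<eta> t i) \<and>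
           \<eta> 0 i = 0 \<and> mono_on {0..T} (\<lambda>t. \<eta> t i) \<and>
           stieltjes_integral T T (\<lambda>s. 1 - \<zeta> s i) (\<lambda>s. \<eta> s i) = 0))}"

definition S_set ::
    "real \<Rightarrow> real \<Rightarrow> (nat \<Rightarrow> real) \<Rightarrow> (real \<Rightarrow> nat \<Rightarrow> real) \<Rightarrow> (real \<Rightarrow> nat \<Rightarrow> real)
      \<Rightarrow> (nat \<Rightarrow> real \<times> real \<Rightarrow> real) set" where
  "S_set T lam x \<zeta> \<psi> = {\<phi> \<in> control_functions T. fluid_equations T lam x \<phi> \<zeta> \<psi>}"

end

theory Submission
  imports Defs
begin

text \<open>
  The equations and constraints satisfied by the limit are gathered in one nonnegative functional \<open>viol\<close> of a path
  and a control, whose zeros are exactly the desired relations; the complementarity condition enters through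
  \<open>min (\<eta>\<^sub>i(t) - \<eta>\<^sub>i(s)) (INF u \<in> [s,t]. 1 - X\<^sub>i(u)) \<le> 0\<close>. For the prelimit processes \<open>viol\<close> is small:
  by the \<open>L\<^sup>2\<close> isometry for predictable sets, the rescaled thinned noise is close to its compensator on each box of a
  finite grid, the region below a path is a union of boxes up to the oscillation of that path, and the entropy bound
  makes the controls uniformly integrable, so small sets carry little mass. Moreover
  \<open>\<beta>\<^sub>n(x) \<le> (1 - \<epsilon>)\<^sup>d\<close> for \<open>x \<le> 1 - \<epsilon>\<close>, so that \<open>\<eta>\<^sub>i\<close> hardly increases while \<open>X\<^sub>i\<close> stays away from \<open>1\<close>.

  The estimates need no tightness of the paths, because their oscillation at resolution \<open>k\<close> is itself a continuous
  functional on Skorokhod space: subtracting a multiple of it from the supremum \<open>Phi\<close> of \<open>viol\<close> gives a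
  bounded continuous \<open>Psi\<close> with vanishing expectation in the limit. Hence \<open>Psi = 0\<close> almost surely for the limit, and
  letting the resolution parameter \<open>k\<close> and then the truncation level \<open>c\<close> tend to infinity yields \<open>viol = 0\<close>.
\<close>

section \<open>The isometry for predictable sets\<close>

text \<open>Two obstacles shape the argument. First, evaluation at a fixed time is not continuous
  for the Skorokhod topology, and the integrands are indicators of regions below random paths, to
  which weak convergence of the controls does not apply directly. A supremum over all pairs of times
  removes the first difficulty, because a time change only permutes the pairs; uniform absolute
  continuity removes the second, because slightly moved regions then have almost the same mass.
  Hence only expectations of one bounded continuous functional pass to the limit. No almost surely
  convergent copies of the processes are constructed, and the pathwise estimates are deterministic.

  Second, continuity of the limit in the l1 norm is not obtained from jump sizes. The functional
  also records that increments of \<eta>_i are dominated by \<lambda> times the increments of the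
  arrivals. This makes every coordinate of the limit absolutely continuous. A left limit in the
  state space exists by the cadlag property, and its coordinates must agree with the values, so the
  path is continuous in the full norm.\<close>

lemma kernel_section_measurable:
  fixes P :: "'w measure" and N :: "'w \<Rightarrow> 'z measure"
  assumes fin: "\<And>w. w \<in> space P \<Longrightarrow> finite_measure (N w)" "\<And>w. w \<in> space P \<Longrightarrow> space (N w) = Z"
    and G: "Int_stable G" "G \<subseteq> Pow (space P \<times> Z)" "space P \<times> Z \<in> G"
    and sec: "\<And>R w. R \<in> G \<Longrightarrow> w \<in> space P \<Longrightarrow> Pair w -` R \<in> sets (N w)"
    and meas: "\<And>R. R \<in> G \<Longrightarrow> (\<lambda>w. measure (N w) (Pair w -` R)) \<in> borel_measurable P"
    and S: "S \<in> sigma_sets (space P \<times> Z) G"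
  shows "(\<forall>w\<in>space P. Pair w -` S \<in> sets (N w)) \<and>
    (\<lambda>w. measure (N w) (Pair w -` S)) \<in> borel_measurable P"
  using G(1,2) S
proof (induction rule: sigma_sets_induct_disjoint)
  case (basic A)
  then show ?case using sec meas by blast
next
  case empty
  then show ?case by simp
next
  \<comment> \<open>Finiteness of the kernels turns the measure of a complement into a difference,
    which presupposes measurable sections. This is why both claims are carried through one
    induction.\<close>
  case (compl A)
  have eq: "Pair w -` (space P \<times> Z - A) = space (N w) - Pair w -` A" if "w \<in> space P" for w
    using that fin(2) by auto
  have m: "(\<lambda>w. measure (N w) (Pair w -` (space P \<times> Z)) - measure (N w) (Pair w -` A)) \<in> borel_measurable P"
    using compl meas[OF G(3)] by (intro borel_measurable_diff) auto
  have "measure (N w) (Pair w -` (space P \<times> Z - A)) =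
      measure (N w) (Pair w -` (space P \<times> Z)) - measure (N w) (Pair w -` A)" if w: "w \<in> space P" for w
  proof -
    interpret finite_measure "N w" by (rule fin(1)[OF w])
    have "Pair w -` (space P \<times> Z) = space (N w)" using w fin(2) by auto
    then show ?thesis using eq[OF w] compl w finite_measure_compl[of "Pair w -` A"] by simp
  qed
  then show ?case using eq compl m by (auto cong: measurable_cong)
next
  case (union A)
  have eq: "Pair w -` \<Union> (range A) = (\<Union>i. Pair w -` A i)" for w by auto
  have "measure (N w) (Pair w -` \<Union> (range A)) = (\<Sum>i. measure (N w) (Pair w -` A i))" if w: "w \<in> space P" for w
  proof -
    interpret finite_measure "N w" by (rule fin(1)[OF w])
    have "(\<lambda>i. measure (N w) (Pair w -` A i)) sums measure (N w) (\<Union>i. Pair w -` A i)"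
      using union w by (intro finite_measure_UNION) (auto simp: disjoint_family_on_def)
    then show ?thesis by (simp add: eq sums_iff)
  qed
  moreover have "(\<lambda>w. \<Sum>i. measure (N w) (Pair w -` A i)) \<in> borel_measurable P"
    using union by (intro borel_measurable_suminf) auto
  ultimately have "(\<lambda>w. measure (N w) (Pair w -` \<Union> (range A))) \<in> borel_measurable P"
    by (simp cong: measurable_cong)
  moreover have "Pair w -` \<Union> (range A) \<in> sets (N w)" if "w \<in> space P" for w
    unfolding eq using that union by auto
  ultimately show ?case by blast
qed

text \<open>
  A monotone class argument for signed combinations \<open>\<Sum>\<^sub>j K\<^sub>j Y\<^sub>j\<close> of kernels: the isometry is the statement that
  one such combination, itself depending on a predictable set, vanishes.
\<close>
lemma kernel_combination_zero:
  fixes P :: "'w measure" and K :: "'j \<Rightarrow> 'w \<Rightarrow> 'z measure" and Y :: "'j \<Rightarrow> 'w \<Rightarrow> real"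
  assumes J: "finite J"
    and fin: "\<And>j w. j \<in> J \<Longrightarrow> w \<in> space P \<Longrightarrow> finite_measure (K j w)"
      "\<And>j w. j \<in> J \<Longrightarrow> w \<in> space P \<Longrightarrow> space (K j w) = Z"
    and G: "Int_stable G" "G \<subseteq> Pow (space P \<times> Z)" "space P \<times> Z \<in> G"
    and sec: "\<And>j R w. j \<in> J \<Longrightarrow> R \<in> G \<Longrightarrow> w \<in> space P \<Longrightarrow> Pair w -` R \<in> sets (K j w)"
    and meas: "\<And>j R. j \<in> J \<Longrightarrow> R \<in> G \<Longrightarrow> (\<lambda>w. measure (K j w) (Pair w -` R)) \<in> borel_measurable P"
    and Y: "\<And>j. j \<in> J \<Longrightarrow> Y j \<in> borel_measurable P"
      "\<And>j. j \<in> J \<Longrightarrow> integrable P (\<lambda>w. measure (K j w) Z * Y j w)"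
    and zero: "\<And>R. R \<in> G \<Longrightarrow> (LINT w|P. (\<Sum>j\<in>J. measure (K j w) (Pair w -` R) * Y j w)) = 0"
    and S: "S \<in> sigma_sets (space P \<times> Z) G"
  shows "(LINT w|P. (\<Sum>j\<in>J. measure (K j w) (Pair w -` S) * Y j w)) = 0"
proof -
  note ksm = kernel_section_measurable[OF fin(1) fin(2) G sec meas]
  have le: "measure (K j w) U \<le> measure (K j w) Z" if "j \<in> J" "w \<in> space P" for j w U
    using finite_measure.bounded_measure[OF fin(1)[OF that], of U] fin(2)[OF that] by simp
  have int: "integrable P (\<lambda>w. measure (K j w) (Pair w -` S) * Y j w)"
    if "S \<in> sigma_sets (space P \<times> Z) G" "j \<in> J" for S j
  proof (rule Bochner_Integration.integrable_bound[OF Y(2)[OF that(2)]])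
    show "(\<lambda>w. measure (K j w) (Pair w -` S) * Y j w) \<in> borel_measurable P"
      using ksm[OF that(2) _ that(2) _ that(2) _ _ that(2) _ that(1)] Y(1)[OF that(2)] by auto
    show "AE w in P. norm (measure (K j w) (Pair w -` S) * Y j w) \<le> norm (measure (K j w) Z * Y j w)"
      using le[OF that(2)] by (auto simp: abs_mult intro!: AE_I2 mult_right_mono)
  qed
  show ?thesis
    using G(1,2) S
  proof (induction rule: sigma_sets_induct_disjoint)
    case (basic A)
    then show ?case by (rule zero)
  next
    case empty
    then show ?case by simp
  next
    case (compl A)
    have "measure (K j w) (Pair w -` (space P \<times> Z - A)) =
        measure (K j w) (Pair w -` (space P \<times> Z)) - measure (K j w) (Pair w -` A)"
      if w: "w \<in> space P" and j: "j \<in> J" for w j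
    proof -
      interpret finite_measure "K j w" by (rule fin(1)[OF j w])
      have "Pair w -` (space P \<times> Z) = space (K j w)"
        "Pair w -` (space P \<times> Z - A) = space (K j w) - Pair w -` A" using w fin(2)[OF j w] by auto
      moreover have "Pair w -` A \<in> sets (K j w)"
        using ksm[OF j _ j _ j _ _ j _ compl(1)] w by auto
      ultimately show ?thesis using finite_measure_compl[of "Pair w -` A"] by simp
    qed
    then have "(LINT w|P. (\<Sum>j\<in>J. measure (K j w) (Pair w -` (space P \<times> Z - A)) * Y j w)) =
      (LINT w|P. (\<Sum>j\<in>J. measure (K j w) (Pair w -` (space P \<times> Z)) * Y j w) -
         (\<Sum>j\<in>J. measure (K j w) (Pair w -` A) * Y j w))"
      by (intro Bochner_Integration.integral_cong) (auto simp: left_diff_distrib simp flip: sum_subtractf)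
    also have "\<dots> = 0"
      using zero[OF G(3)] compl int[OF compl(1)] int[OF sigma_sets.Basic[OF G(3)]]
      by (subst Bochner_Integration.integral_diff) auto
    finally show ?case .
  next
    case (union A)
    have A: "A i \<in> sigma_sets (space P \<times> Z) G" for i using union by auto
    let ?s = "\<lambda>m w. \<Sum>j\<in>J. (\<Sum>i<m. measure (K j w) (Pair w -` A i)) * Y j w"
    have sums: "(\<lambda>i. measure (K j w) (Pair w -` A i)) sums measure (K j w) (Pair w -` \<Union> (range A))"
      if w: "w \<in> space P" and j: "j \<in> J" for w j
    proof -
      interpret finite_measure "K j w" by (rule fin(1)[OF j w])
      have eq: "Pair w -` \<Union> (range A) = (\<Union>i. Pair w -` A i)" by auto
      show ?thesis unfolding eq
        using union(1) w ksm[OF j _ j _ j _ _ j _ A]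
        by (intro finite_measure_UNION) (auto simp: disjoint_family_on_def)
    qed
    have z: "(LINT w|P. ?s m w) = 0" for m
    proof -
      have "(LINT w|P. ?s m w) = (LINT w|P. (\<Sum>i<m. \<Sum>j\<in>J. measure (K j w) (Pair w -` A i) * Y j w))"
        by (simp add: sum_distrib_right sum.swap[of _ J])
      also have "\<dots> = (\<Sum>i<m. LINT w|P. (\<Sum>j\<in>J. measure (K j w) (Pair w -` A i) * Y j w))"
        by (intro Bochner_Integration.integral_sum Bochner_Integration.integrable_sum int A)
      finally show ?thesis using union(3) by simp
    qed
    \<comment> \<open>The partial sums are dominated by the total masses times the absolute weights.
      This is where integrability of \<open>measure (K j w) Z * Y j w\<close> enters.\<close>
    have lim: "(\<lambda>m. LINT w|P. ?s m w) \<longlonglongrightarrow>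
        (LINT w|P. (\<Sum>j\<in>J. measure (K j w) (Pair w -` \<Union> (range A)) * Y j w))"
    proof (rule integral_dominated_convergence[where w = "\<lambda>w. \<Sum>j\<in>J. \<bar>measure (K j w) Z * Y j w\<bar>"])
      have "\<Union> (range A) \<in> sigma_sets (space P \<times> Z) G" using A by (rule sigma_sets.Union)
      then show "(\<lambda>w. \<Sum>j\<in>J. measure (K j w) (Pair w -` \<Union> (range A)) * Y j w) \<in> borel_measurable P"
        using int by (intro borel_measurable_sum borel_measurable_integrable)
      show "?s m \<in> borel_measurable P" for m
        using int[OF A] by (auto simp: sum_distrib_right intro!: borel_measurable_sum borel_measurable_integrable)
      show "integrable P (\<lambda>w. \<Sum>j\<in>J. \<bar>measure (K j w) Z * Y j w\<bar>)" using Y(2) by auto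
      show "AE w in P. (\<lambda>m. ?s m w) \<longlonglongrightarrow> (\<Sum>j\<in>J. measure (K j w) (Pair w -` \<Union> (range A)) * Y j w)"
        using sums unfolding sums_def by (intro AE_I2 tendsto_sum tendsto_mult tendsto_const) auto
      have "norm (?s m w) \<le> (\<Sum>j\<in>J. \<bar>measure (K j w) Z * Y j w\<bar>)" if w: "w \<in> space P" for m w
      proof -
        have "norm (?s m w) \<le> (\<Sum>j\<in>J. \<bar>(\<Sum>i<m. measure (K j w) (Pair w -` A i)) * Y j w\<bar>)"
          by (simp add: sum_abs)
        also have "\<dots> \<le> (\<Sum>j\<in>J. \<bar>measure (K j w) Z * Y j w\<bar>)"
        proof (rule sum_mono)
          fix j assume j: "j \<in> J"
          have "(\<Sum>i<m. measure (K j w) (Pair w -` A i)) \<le> measure (K j w) (Pair w -` \<Union> (range A))"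
            using sums[OF w j] by (metis measure_nonneg sum_le_suminf sums_iff finite_lessThan)
          also have "\<dots> \<le> measure (K j w) Z" by (rule le[OF j w])
          finally show "\<bar>(\<Sum>i<m. measure (K j w) (Pair w -` A i)) * Y j w\<bar> \<le> \<bar>measure (K j w) Z * Y j w\<bar>"
            by (auto simp: abs_mult sum_nonneg intro!: mult_right_mono)
        qed
        finally show ?thesis .
      qed
      then show "AE w in P. norm (?s m w) \<le> (\<Sum>j\<in>J. \<bar>measure (K j w) Z * Y j w\<bar>)" for m by auto
    qed
    then show ?case using z by (simp add: LIMSEQ_const_iff)
  qed
qed

text \<open>The orthogonality relation is bilinear in the two sets, so it can be extended from the
  generator one argument at a time; the isometry is its diagonal. The square integrable total mass
  bounds all products that occur.\<close>

lemma kernel_isometry: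
  fixes P :: "'w measure" and N :: "'w \<Rightarrow> 'z measure" and \<nu> :: "'z measure"
  defines "M \<equiv> \<lambda>S w. measure (N w) (Pair w -` S) - measure \<nu> (Pair w -` S)"
  assumes P: "prob_space P" and nu: "finite_measure \<nu>"
    and fin: "\<And>w. w \<in> space P \<Longrightarrow> finite_measure (N w)" "\<And>w. w \<in> space P \<Longrightarrow> sets (N w) = sets \<nu>"
    and G: "Int_stable G" "G \<subseteq> Pow (space P \<times> space \<nu>)" "space P \<times> space \<nu> \<in> G"
    and sec: "\<And>R w. R \<in> G \<Longrightarrow> w \<in> space P \<Longrightarrow> Pair w -` R \<in> sets \<nu>"
    and meas: "\<And>R. R \<in> G \<Longrightarrow> (\<lambda>w. measure (N w) (Pair w -` R)) \<in> borel_measurable P"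
      "\<And>R. R \<in> G \<Longrightarrow> (\<lambda>w. measure \<nu> (Pair w -` R)) \<in> borel_measurable P"
    and sq: "integrable P (\<lambda>w. (measure (N w) (space \<nu>))\<^sup>2)"
    and orth: "\<And>R R'. R \<in> G \<Longrightarrow> R' \<in> G \<Longrightarrow>
      (LINT w|P. M R w * M R' w) = (LINT w|P. measure \<nu> (Pair w -` (R \<inter> R')))"
    and S: "S \<in> sigma_sets (space P \<times> space \<nu>) G"
  shows "integrable P (\<lambda>w. (M S w)\<^sup>2)" "(LINT w|P. (M S w)\<^sup>2) = (LINT w|P. measure \<nu> (Pair w -` S))"
    "\<forall>w\<in>space P. Pair w -` S \<in> sets \<nu>" "M S \<in> borel_measurable P"
proof -
  interpret P: prob_space P by (rule P)
  interpret nu: finite_measure \<nu> by (rule nu)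
  let ?\<Sigma> = "sigma_sets (space P \<times> space \<nu>) G"
  have sp: "space (N w) = space \<nu>" if "w \<in> space P" for w using sets_eq_imp_space_eq[OF fin(2)[OF that]] .
  have kN: "(\<lambda>w. measure (N w) (Pair w -` S)) \<in> borel_measurable P" if "S \<in> ?\<Sigma>" for S
    using kernel_section_measurable[OF fin(1) sp G _ meas(1) that] sec fin(2) by auto
  have knu: "(\<forall>w\<in>space P. Pair w -` S \<in> sets \<nu>) \<and> (\<lambda>w. measure \<nu> (Pair w -` S)) \<in> borel_measurable P"
    if "S \<in> ?\<Sigma>" for S
    using kernel_section_measurable[of P "\<lambda>_. \<nu>", OF nu refl G sec meas(2) that] by auto
  have Mm: "M S \<in> borel_measurable P" if "S \<in> ?\<Sigma>" for S
    unfolding M_def using kN[OF that] knu[OF that] by (intro borel_measurable_diff) auto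
  let ?B = "\<lambda>w. measure (N w) (space \<nu>) + measure \<nu> (space \<nu>)"
  have NZ: "(\<lambda>w. measure (N w) (space \<nu>)) \<in> borel_measurable P"
  proof -
    have "(\<lambda>w. measure (N w) (Pair w -` (space P \<times> space \<nu>))) \<in> borel_measurable P" by (rule meas(1)[OF G(3)])
    then show ?thesis by (rule measurable_cong[THEN iffD1, rotated]) (auto simp: vimage_def)
  qed
  have Nle: "measure (N w) U \<le> measure (N w) (space \<nu>)" if "w \<in> space P" for w U
    using finite_measure.bounded_measure[OF fin(1)[OF that], of U] sp[OF that] by simp
  have Mle: "\<bar>M S w\<bar> \<le> ?B w" if "w \<in> space P" for S w
    using Nle[OF that, of "Pair w -` S"] nu.bounded_measure[of "Pair w -` S"] unfolding M_def
    by (smt (verit) measure_nonneg)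
  have B2: "integrable P (\<lambda>w. (?B w)\<^sup>2)"
  proof (rule Bochner_Integration.integrable_bound)
    show "integrable P (\<lambda>w. 2 * (measure (N w) (space \<nu>))\<^sup>2 + 2 * (measure \<nu> (space \<nu>))\<^sup>2)" using sq by auto
    show "(\<lambda>w. (?B w)\<^sup>2) \<in> borel_measurable P" using NZ by auto
    have "(?B w)\<^sup>2 \<le> 2 * (measure (N w) (space \<nu>))\<^sup>2 + 2 * (measure \<nu> (space \<nu>))\<^sup>2" for w
      using sum_squares_bound[of "measure (N w) (space \<nu>)" "measure \<nu> (space \<nu>)"] by (simp add: power2_sum)
    then show "AE w in P. norm ((?B w)\<^sup>2) \<le> norm (2 * (measure (N w) (space \<nu>))\<^sup>2 + 2 * (measure \<nu> (space \<nu>))\<^sup>2)"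
      by (auto simp: abs_of_nonneg)
  qed
  have ib: "integrable P f" if f: "f \<in> borel_measurable P" "\<And>w. w \<in> space P \<Longrightarrow> \<bar>f w\<bar> \<le> (?B w)\<^sup>2" for f
    by (rule Bochner_Integration.integrable_bound[OF B2 f(1)]) (use f(2) in \<open>auto intro!: AE_I2\<close>)
  have bnu: "integrable P (\<lambda>w. measure \<nu> (Pair w -` S))" if "S \<in> ?\<Sigma>" for S
    by (rule P.integrable_const_bound[of _ "measure \<nu> (space \<nu>)"]) (use knu[OF that] nu.bounded_measure in auto)
  have ext: "(LINT w|P. M S w * M V w) = (LINT w|P. measure \<nu> (Pair w -` (S \<inter> V)))"
    if V: "V \<in> ?\<Sigma>" and hyp: "\<And>R. R \<in> G \<Longrightarrow> (LINT w|P. M R w * M V w) = (LINT w|P. measure \<nu> (Pair w -` (R \<inter> V)))"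
      and S: "S \<in> ?\<Sigma>" for V S
  proof -
    let ?Y = "M V"
    have Ym: "?Y \<in> borel_measurable P" by (rule Mm[OF V])
    \<comment> \<open>For fixed \<open>V\<close> the relation says that a combination of three
      kernels vanishes: the noise and its intensity with weights \<open>M V\<close> and
      \<open>- M V\<close>, and the intensity restricted to \<open>V\<close> with weight -1.\<close>
    define K where "K = (\<lambda>j::nat. \<lambda>w. if j = 0 then N w else if j = 1 then \<nu> else density \<nu> (indicator (Pair w -` V)))"
    define Y where "Y = (\<lambda>j::nat. \<lambda>w. if j = 0 then ?Y w else if j = 1 then - ?Y w else - 1)"
    have SV: "U \<inter> V \<in> ?\<Sigma>" if "U \<in> ?\<Sigma>" for U
    proof -
      interpret sigma_algebra "space P \<times> space \<nu>" ?\<Sigma> by (rule sigma_algebra_sigma_sets[OF G(2)])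
      show ?thesis using that V by auto
    qed
    have K2: "measure (density \<nu> (indicator (Pair w -` V))) (Pair w -` U) = measure \<nu> (Pair w -` (U \<inter> V))"
      if "U \<in> ?\<Sigma>" "w \<in> space P" for U w
      unfolding measure_def using knu[OF that(1)] knu[OF V] that(2)
      by (subst emeasure_restricted) (auto simp: Int_commute)
    have sum3: "(\<Sum>j\<in>{0,1,2::nat}. measure (K j w) (Pair w -` U) * Y j w) =
        M U w * ?Y w - measure \<nu> (Pair w -` (U \<inter> V))" if "U \<in> ?\<Sigma>" "w \<in> space P" for U w
      using K2[OF that] by (simp add: K_def Y_def M_def algebra_simps)
    have int1: "integrable P (\<lambda>w. M U w * ?Y w)" if "U \<in> ?\<Sigma>" for U
    proof (rule ib)
      show "(\<lambda>w. M U w * ?Y w) \<in> borel_measurable P" using Mm[OF that] Ym by auto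
      show "\<bar>M U w * ?Y w\<bar> \<le> (?B w)\<^sup>2" if w: "w \<in> space P" for w
        unfolding power2_eq_square abs_mult using Mle[OF w] by (intro mult_mono) (auto intro: order_trans[OF abs_ge_zero])
    qed
    have comb: "(LINT w|P. (\<Sum>j\<in>{0,1,2::nat}. measure (K j w) (Pair w -` U) * Y j w)) =
        (LINT w|P. M U w * ?Y w) - (LINT w|P. measure \<nu> (Pair w -` (U \<inter> V)))" if "U \<in> ?\<Sigma>" for U
      using int1[OF that] bnu[OF SV[OF that]] sum3[OF that]
      by (simp add: Bochner_Integration.integral_diff cong: Bochner_Integration.integral_cong del: sum.insert)
    have "(LINT w|P. (\<Sum>j\<in>{0,1,2::nat}. measure (K j w) (Pair w -` S) * Y j w)) = 0"
    proof (rule kernel_combination_zero[where Z = "space \<nu>" and G = G])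
      show "finite_measure (K j w)" if "w \<in> space P" for j w
        using fin(1)[OF that] nu nu.finite_measure_restricted[of "Pair w -` V"] knu[OF V] that by (auto simp: K_def)
      show "space (K j w) = space \<nu>" if "w \<in> space P" for j w using sp[OF that] by (auto simp: K_def)
      show "Pair w -` R \<in> sets (K j w)" if "R \<in> G" "w \<in> space P" for j R w
        using sec[OF that] fin(2)[OF that(2)] by (auto simp: K_def)
      show "(\<lambda>w. measure (K j w) (Pair w -` R)) \<in> borel_measurable P" if "R \<in> G" for j R
      proof -
        have R: "R \<in> ?\<Sigma>" using that by blast
        have "(\<lambda>w. measure (density \<nu> (indicator (Pair w -` V))) (Pair w -` R)) \<in> borel_measurable P"
          using knu[OF SV[OF R]] by (subst measurable_cong[OF K2[OF R]]) auto
        then show ?thesis using meas[OF that] by (cases "j = 0"; cases "j = 1"; simp add: K_def)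
      qed
      show "Y j \<in> borel_measurable P" for j using Ym by (auto simp: Y_def)
      show "integrable P (\<lambda>w. measure (K j w) (space \<nu>) * Y j w)" if j: "j \<in> {0,1,2}" for j
      proof (cases "j = 2")
        case False
        have "integrable P (\<lambda>w. measure (N w) (space \<nu>) * ?Y w)" "integrable P (\<lambda>w. measure \<nu> (space \<nu>) * ?Y w)"
          by (rule ib; use NZ Ym Mle in \<open>auto simp: power2_eq_square abs_mult intro!: mult_mono\<close>)+
        then show ?thesis using False j by (cases "j = 0") (auto simp: K_def Y_def)
      next
        case True
        have top: "space P \<times> space \<nu> \<in> ?\<Sigma>" using G(3) by blast
        have e: "measure (K j w) (space \<nu>) * Y j w = - measure \<nu> (Pair w -` ((space P \<times> space \<nu>) \<inter> V))"
          if w: "w \<in> space P" for w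
          using K2[OF top w] w True by (simp add: K_def Y_def vimage_def)
        have i: "integrable P (\<lambda>w. - measure \<nu> (Pair w -` ((space P \<times> space \<nu>) \<inter> V)))"
          by (intro Bochner_Integration.integrable_minus bnu[OF SV[OF top]])
        show ?thesis by (rule iffD2[OF Bochner_Integration.integrable_cong[OF refl e] i])
      qed
      show "(LINT w|P. (\<Sum>j\<in>{0,1,2}. measure (K j w) (Pair w -` R) * Y j w)) = 0" if "R \<in> G" for R
        using comb[of R] hyp[OF that] that by auto
    qed (use G S in auto)
    then show ?thesis using comb[OF S] by simp
  qed
  \<comment> \<open>With \<open>V\<close> in the generator the other set becomes arbitrary; by
    symmetry this is the hypothesis needed to take \<open>V\<close> equal to
    \<open>S\<close>.\<close>
  have 1: "(LINT w|P. M S w * M R w) = (LINT w|P. measure \<nu> (Pair w -` (S \<inter> R)))" if "R \<in> G" "S \<in> ?\<Sigma>" for R S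
    by (rule ext) (use that orth in auto)
  have 2: "(LINT w|P. M S w * M S w) = (LINT w|P. measure \<nu> (Pair w -` (S \<inter> S)))"
    by (rule ext[OF S _ S]) (use 1[OF _ S] in \<open>simp add: mult.commute Int_commute\<close>)
  then show "(LINT w|P. (M S w)\<^sup>2) = (LINT w|P. measure \<nu> (Pair w -` S))" by (simp add: power2_eq_square)
  show "integrable P (\<lambda>w. (M S w)\<^sup>2)"
  proof (rule ib)
    show "(\<lambda>w. (M S w)\<^sup>2) \<in> borel_measurable P" using Mm[OF S] by auto
    show "\<bar>(M S w)\<^sup>2\<bar> \<le> (?B w)\<^sup>2" if w: "w \<in> space P" for w
      using power_mono[OF Mle[OF w, of S], of 2] by simp
  qed
  show "\<forall>w\<in>space P. Pair w -` S \<in> sets \<nu>" "M S \<in> borel_measurable P" using knu[OF S] Mm[OF S] by auto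
qed

section \<open>Moments of Poisson counts\<close>

lemma sums_poisson_moments:
  fixes a :: real
  shows "(\<lambda>k. a ^ k / fact k * exp (- a)) sums 1"
    and "(\<lambda>k. real k * (a ^ k / fact k * exp (- a))) sums a"
    and "(\<lambda>k. (real k)\<^sup>2 * (a ^ k / fact k * exp (- a))) sums (a\<^sup>2 + a)"
proof -
  show 0: "(\<lambda>k. a ^ k / fact k * exp (- a)) sums 1"
    using sums_mult2[OF exp_converges[of a], of "exp (- a)"]
    by (simp add: field_simps scaleR_conv_of_real flip: exp_add)
  \<comment> \<open>With p_k the weight of k, (k + 1) p_(k+1) = a p_k. Since the term for k = 0
    vanishes, this shift reduces each moment to the preceding ones.\<close>
  have e: "real (Suc k) * (a ^ Suc k / fact (Suc k) * exp (- a)) = a * (a ^ k / fact k * exp (- a))" for k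
    by (simp add: divide_simps del: of_nat_Suc)
  show 1: "(\<lambda>k. real k * (a ^ k / fact k * exp (- a))) sums a"
    using sums_mult[OF 0, of a] sums_Suc_iff[of "\<lambda>k. real k * (a ^ k / fact k * exp (- a))" a] unfolding e by simp
  have e2: "(real (Suc k))\<^sup>2 * (a ^ Suc k / fact (Suc k) * exp (- a)) =
      a * (real k * (a ^ k / fact k * exp (- a))) + a * (a ^ k / fact k * exp (- a))" for k
  proof -
    have "(real (Suc k))\<^sup>2 * (a ^ Suc k / fact (Suc k) * exp (- a)) = real (Suc k) * (a * (a ^ k / fact k * exp (- a)))"
      unfolding power2_eq_square mult.assoc e ..
    moreover have "real (Suc k) * (a * X) = a * (real k * X) + a * X" for X by (simp add: algebra_simps)
    ultimately show ?thesis by (simp only:)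
  qed
  have "(\<lambda>k. a * (real k * (a ^ k / fact k * exp (- a))) + a * (a ^ k / fact k * exp (- a))) sums (a * a + a * 1)"
    by (intro sums_add sums_mult 0 1)
  then show "(\<lambda>k. (real k)\<^sup>2 * (a ^ k / fact k * exp (- a))) sums (a\<^sup>2 + a)"
    using sums_Suc_iff[of "\<lambda>k. (real k)\<^sup>2 * (a ^ k / fact k * exp (- a))" "a\<^sup>2 + a"]
    unfolding e2 by (simp add: power2_eq_square)
qed

text \<open>The prescribed point probabilities already sum to 1, so the count is almost surely a
  natural number and its integrals become series over the Poisson weights.\<close>

lemma prm_moments:
  assumes P: "prob_space P" and prm: "poisson_random_measure P \<nu> N"
    and A: "A \<in> sets \<nu>" "emeasure \<nu> A < \<infinity>"
  shows "AE w in P. emeasure (N w) A < \<infinity>"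
    "integrable P (\<lambda>w. measure (N w) A)" "(LINT w|P. measure (N w) A) = measure \<nu> A"
    "integrable P (\<lambda>w. (measure (N w) A)\<^sup>2)"
    "(LINT w|P. (measure (N w) A)\<^sup>2) = (measure \<nu> A)\<^sup>2 + measure \<nu> A"
proof -
  interpret P: prob_space P by (rule P)
  define a where "a = measure \<nu> A"
  have a: "0 \<le> a" by (simp add: a_def)
  let ?E = "\<lambda>k::nat. {w \<in> space P. emeasure (N w) A = of_nat k}"
  have m[measurable]: "(\<lambda>w. emeasure (N w) A) \<in> borel_measurable P"
    using prm A unfolding poisson_random_measure_def by blast
  have E: "?E k \<in> sets P" for k by measurable
  have pk: "measure P (?E k) = a ^ k / fact k * exp (- a)" for k
    using prm A unfolding poisson_random_measure_def a_def by blast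
  have disj: "disjoint_family ?E" by (auto simp: disjoint_family_on_def)
  have "measure P (\<Union>k. ?E k) = 1"
    using P.finite_measure_UNION[OF _ disj] E pk sums_poisson_moments(1)[of a] sums_unique2 by (simp add: image_subset_iff) blast
  then have AE_k: "AE w in P. w \<in> (\<Union>k. ?E k)" using E by (subst P.prob_eq_1[symmetric]) auto
  then show "AE w in P. emeasure (N w) A < \<infinity>" by (auto simp: of_nat_less_top)
  have mm: "(\<lambda>w. measure (N w) A) \<in> borel_measurable P" unfolding measure_def by measurable
  have nn: "(\<integral>\<^sup>+w. ennreal (f (measure (N w) A)) \<partial>P) = (\<Sum>k. ennreal (f (real k) * (a ^ k / fact k * exp (- a))))"
    if f: "\<And>x. 0 \<le> f x" "f \<in> borel_measurable borel" for f :: "real \<Rightarrow> real"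
  proof -
    have "(\<integral>\<^sup>+w. ennreal (f (measure (N w) A)) \<partial>P) = (\<integral>\<^sup>+w. (\<Sum>k. ennreal (f (real k)) * indicator (?E k) w) \<partial>P)"
    proof (rule nn_integral_cong_AE, use AE_k in eventually_elim)
      case (elim w)
      then obtain k where w: "w \<in> space P" and k: "emeasure (N w) A = of_nat k" by auto
      have "(\<Sum>j. ennreal (f (real j)) * indicator (?E j) w) = (\<Sum>j. if j = k then ennreal (f (real j)) else 0)"
        using w k by (intro suminf_cong) auto
      also have "\<dots> = ennreal (f (real k))" using sums_single[of k "\<lambda>j. ennreal (f (real j))"] by (simp add: sums_iff)
      finally show ?case using k by (simp add: measure_def enn2real_of_nat)
    qed
    also have "\<dots> = (\<Sum>k. ennreal (f (real k)) * emeasure P (?E k))"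
      using E by (subst nn_integral_suminf) (auto simp: nn_integral_cmult_indicator)
    also have "\<dots> = (\<Sum>k. ennreal (f (real k) * (a ^ k / fact k * exp (- a))))"
      unfolding P.emeasure_eq_measure pk using f(1) a by (intro suminf_cong) (simp flip: ennreal_mult)
    finally show ?thesis .
  qed
  have n1: "(\<integral>\<^sup>+w. ennreal (measure (N w) A) \<partial>P) = ennreal a"
  proof -
    have "(\<integral>\<^sup>+w. ennreal (measure (N w) A) \<partial>P) = (\<integral>\<^sup>+w. ennreal \<bar>measure (N w) A\<bar> \<partial>P)" by simp
    also have "\<dots> = (\<Sum>k. ennreal (real k * (a ^ k / fact k * exp (- a))))" by (subst nn) auto
    also have "\<dots> = ennreal a"
      using sums_poisson_moments(2)[of a] a by (subst suminf_ennreal2) (auto simp: sums_iff)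
    finally show ?thesis .
  qed
  have n2: "(\<integral>\<^sup>+w. ennreal ((measure (N w) A)\<^sup>2) \<partial>P) = ennreal (a\<^sup>2 + a)"
  proof -
    have "(\<integral>\<^sup>+w. ennreal ((measure (N w) A)\<^sup>2) \<partial>P) = (\<Sum>k. ennreal ((real k)\<^sup>2 * (a ^ k / fact k * exp (- a))))"
      by (subst nn[of "\<lambda>x. x\<^sup>2"]) auto
    also have "\<dots> = ennreal (a\<^sup>2 + a)"
      using sums_poisson_moments(3)[of a] a by (subst suminf_ennreal2) (auto simp: sums_iff)
    finally show ?thesis .
  qed
  show "integrable P (\<lambda>w. measure (N w) A)" using mm n1 by (intro integrableI_nonneg) auto
  show "(LINT w|P. measure (N w) A) = measure \<nu> A" using mm n1 a by (subst integral_eq_nn_integral) (auto simp: a_def)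
  show "integrable P (\<lambda>w. (measure (N w) A)\<^sup>2)" using mm n2 by (intro integrableI_nonneg) auto
  show "(LINT w|P. (measure (N w) A)\<^sup>2) = (measure \<nu> A)\<^sup>2 + measure \<nu> A"
  proof -
    have "(LINT w|P. (measure (N w) A)\<^sup>2) = enn2real (ennreal (a\<^sup>2 + a))"
      unfolding n2[symmetric] using mm by (intro integral_eq_nn_integral) auto
    then show ?thesis using a by (simp add: a_def del: ennreal_plus)
  qed
qed

section \<open>Independence of the noise from its past\<close>

abbreviation mark_measure :: "real \<Rightarrow> (real \<times> real \<times> real) measure" where
  "mark_measure T \<equiv> restrict_space lborel (mark_space T)"

lemma prm_sets: "poisson_random_measure P \<nu> N \<Longrightarrow> w \<in> space P \<Longrightarrow> sets (N w) = sets \<nu>"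
  and prm_measurable: "poisson_random_measure P \<nu> N \<Longrightarrow> A \<in> sets \<nu> \<Longrightarrow> (\<lambda>w. emeasure (N w) A) \<in> borel_measurable P"
  by (simp_all add: poisson_random_measure_def)

lemma iid_prm: "iid_poisson_random_measures P T D \<Longrightarrow> poisson_random_measure P (mark_measure T) (D i)"
  by (simp add: iid_poisson_random_measures_def)

text \<open>Complete randomness speaks of disjoint sets, while the members of \<open>\<U>\<close>
  may overlap. They are cut into the atoms they generate off \<open>R\<close>; each count is a sum
  of atom counts, hence a function of variables independent of the count on
  \<open>R\<close>.\<close>

lemma prm_finite_family_indep:
  assumes P: "prob_space P" and prm: "poisson_random_measure P \<nu> N"
    and U: "finite \<U>" "\<U> \<subseteq> sets \<nu>" and R: "R \<in> sets \<nu>" "\<And>U. U \<in> \<U> \<Longrightarrow> U \<inter> R = {}"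
    and C: "\<And>U. U \<in> \<U> \<Longrightarrow> C U \<in> sets borel" and B: "B \<in> sets borel"
  shows "measure P {w \<in> space P. (\<forall>U\<in>\<U>. emeasure (N w) U \<in> C U) \<and> emeasure (N w) R \<in> B} =
    measure P {w \<in> space P. \<forall>U\<in>\<U>. emeasure (N w) U \<in> C U} * measure P {w \<in> space P. emeasure (N w) R \<in> B}"
proof -
  interpret P: prob_space P by (rule P)
  define n where "n = card (Pow \<U>)"
  have "finite (Pow \<U>)" using U(1) by simp
  from ex_bij_betw_nat_finite[OF this] obtain h where h: "bij_betw h {..<n} (Pow \<U>)"
    unfolding atLeast0LessThan n_def by blast
  \<comment> \<open>\<open>W J\<close> is the atom of the points lying in exactly the members of
    \<open>J\<close>. In the enumeration \<open>F\<close> the indices below \<open>n\<close> are the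
    atoms and the index \<open>n\<close> is kept for \<open>R\<close>.\<close>
  define W where "W = (\<lambda>J. {z \<in> space \<nu> - R. (\<forall>U\<in>J. z \<in> U) \<and> (\<forall>U\<in>\<U> - J. z \<notin> U)})"
  define F where "F = (\<lambda>k. if k < n then W (h k) else R)"
  have Ws: "W J \<in> sets \<nu>" if "J \<subseteq> \<U>" for J
  proof -
    have "W J = (space \<nu> - R) \<inter> (space \<nu> \<inter> (\<Inter>U\<in>J. U)) - (\<Union>U\<in>\<U> - J. U)" by (auto simp: W_def)
    moreover have "(\<Union>U\<in>\<U> - J. U) \<in> sets \<nu>" using U by (intro sets.finite_UN) auto
    moreover have "space \<nu> \<inter> (\<Inter>U\<in>J. U) \<in> sets \<nu>"
    proof (cases "J = {}")
      case False
      have "finite J" using that U(1) by (rule finite_subset)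
      then have "(\<Inter>U\<in>J. U) \<in> sets \<nu>" using U that False by (intro sets.finite_INT) auto
      then show ?thesis by auto
    qed auto
    ultimately show ?thesis using R by auto
  qed
  have hk: "h k \<subseteq> \<U>" if "k < n" for k using bij_betwE[OF h] that by blast
  have Fs: "F k \<in> sets \<nu>" for k using Ws hk R by (auto simp: F_def)
  have disj: "disjoint_family_on F {..n}"
  proof (unfold disjoint_family_on_def, intro ballI impI)
    fix k l assume kl: "k \<in> {..n}" "l \<in> {..n}" "k \<noteq> l"
    have "W (h k) \<inter> W (h l) = {}" if "k < n" "l < n"
    proof -
      have "h k \<noteq> h l" using kl(3) that inj_onD[OF bij_betw_imp_inj_on[OF h], of k l] by blast
      then obtain U where "U \<in> h k \<and> U \<notin> h l \<or> U \<in> h l \<and> U \<notin> h k" by blast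
      moreover have "U \<in> \<U>" using calculation hk[OF that(1)] hk[OF that(2)] by blast
      ultimately show ?thesis unfolding W_def by blast
    qed
    moreover have "W J \<inter> R = {}" for J by (auto simp: W_def)
    ultimately show "F k \<inter> F l = {}" using kl by (auto simp: F_def)
  qed
  have iv: "P.indep_vars (\<lambda>_. borel) (\<lambda>k w. emeasure (N w) (F k)) {..n}"
  proof -
    have "\<forall>(A :: nat \<Rightarrow> _) I. finite I \<and> A ` I \<subseteq> sets \<nu> \<and> disjoint_family_on A I \<longrightarrow>
        P.indep_vars (\<lambda>_. borel) (\<lambda>i w. emeasure (N w) (A i)) I"
      using prm unfolding poisson_random_measure_def by (elim conjE)
    from this[THEN spec, THEN spec, THEN mp, of "{..n}" F] show ?thesis using disj Fs by auto
  qed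
  define Q where "Q = {f \<in> space (PiM {..<n} (\<lambda>_. borel :: ennreal measure)). \<forall>U\<in>\<U>. (\<Sum>k | k < n \<and> U \<in> h k. f k) \<in> C U}"
  have iv2: "P.indep_var (PiM {..<n} (\<lambda>_. borel)) (\<lambda>w. \<lambda>k\<in>{..<n}. emeasure (N w) (F k))
     (PiM {n} (\<lambda>_. borel)) (\<lambda>w. \<lambda>k\<in>{n}. emeasure (N w) (F k))"
    by (rule P.indep_var_restrict[OF iv]) auto
  have Q: "Q \<in> sets (PiM {..<n} (\<lambda>_. borel))"
    unfolding Q_def
  proof (intro sets.sets_Collect_finite_All)
    fix U assume "U \<in> \<U>"
    have "(\<lambda>f. \<Sum>k | k < n \<and> U \<in> h k. f k) \<in> borel_measurable (PiM {..<n} (\<lambda>_. borel :: ennreal measure))"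
      by (intro borel_measurable_sum measurable_component_singleton) auto
    from measurable_sets[OF this C[OF \<open>U \<in> \<U>\<close>]]
    show "{f \<in> space (PiM {..<n} (\<lambda>_. borel)). (\<Sum>k | k < n \<and> U \<in> h k. f k) \<in> C U} \<in> sets (PiM {..<n} (\<lambda>_. borel))"
      by (simp add: vimage_def Int_def conj_commute)
  qed (use U in auto)
  have B': "{f \<in> space (PiM {n} (\<lambda>_. borel)). f n \<in> B} \<in> sets (PiM {n} (\<lambda>_. borel))"
    using measurable_sets[OF measurable_component_singleton[of n "{n}" "\<lambda>_. borel"] B]
    by (simp add: vimage_def Int_def conj_commute)
  have sumU: "(\<Sum>k | k < n \<and> U \<in> h k. emeasure (N w) (F k)) = emeasure (N w) U" if w: "w \<in> space P" and U': "U \<in> \<U>" for w U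
  proof -
    have sN: "sets (N w) = sets \<nu>" by (rule prm_sets[OF prm w])
    have "(\<Sum>k | k < n \<and> U \<in> h k. emeasure (N w) (F k)) = emeasure (N w) (\<Union>k\<in>{k. k < n \<and> U \<in> h k}. F k)"
      using disj Fs sN by (intro sum_emeasure) (auto simp: disjoint_family_on_def)
    also have "(\<Union>k\<in>{k. k < n \<and> U \<in> h k}. F k) = U"
    proof
      show "(\<Union>k\<in>{k. k < n \<and> U \<in> h k}. F k) \<subseteq> U" by (auto simp: F_def W_def)
      show "U \<subseteq> (\<Union>k\<in>{k. k < n \<and> U \<in> h k}. F k)"
      proof
        fix z assume z: "z \<in> U"
        then have zs: "z \<in> space \<nu> - R" using U(2) U' R(2)[OF U'] sets.sets_into_space[of U \<nu>] by auto
        have "{V \<in> \<U>. z \<in> V} \<in> h ` {..<n}" unfolding bij_betw_imp_surj_on[OF h] by blast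
        then obtain k where k: "k < n" "h k = {V \<in> \<U>. z \<in> V}" by auto
        then have "z \<in> F k" using zs by (auto simp: F_def W_def)
        then show "z \<in> (\<Union>k\<in>{k. k < n \<and> U \<in> h k}. F k)" using k z U' by auto
      qed
    qed
    finally show ?thesis .
  qed
  have e1: "(\<lambda>w. \<lambda>k\<in>{..<n}. emeasure (N w) (F k)) -` Q \<inter> space P = {w \<in> space P. \<forall>U\<in>\<U>. emeasure (N w) U \<in> C U}"
    (is "?L = _")
  proof -
    have "(\<Sum>k | k < n \<and> U \<in> h k. (\<lambda>k\<in>{..<n}. emeasure (N w) (F k)) k) = emeasure (N w) U"
      if "w \<in> space P" "U \<in> \<U>" for w U
      using sumU[OF that] by (subst sum.cong[OF refl, of _ _ "\<lambda>k. emeasure (N w) (F k)"]) auto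
    then have "(\<lambda>k\<in>{..<n}. emeasure (N w) (F k)) \<in> Q \<longleftrightarrow> (\<forall>U\<in>\<U>. emeasure (N w) U \<in> C U)" if "w \<in> space P" for w
      using that unfolding Q_def by (simp add: space_PiM)
    then show ?thesis by blast
  qed
  have e2: "(\<lambda>w. \<lambda>k\<in>{n}. emeasure (N w) (F k)) -` {f \<in> space (PiM {n} (\<lambda>_. borel)). f n \<in> B} \<inter> space P
      = {w \<in> space P. emeasure (N w) R \<in> B}"
    by (auto simp: space_PiM F_def)
  have e3: "(\<lambda>w. (\<lambda>k\<in>{..<n}. emeasure (N w) (F k), \<lambda>k\<in>{n}. emeasure (N w) (F k))) -`
      (Q \<times> {f \<in> space (PiM {n} (\<lambda>_. borel)). f n \<in> B}) \<inter> space P =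
      {w \<in> space P. (\<forall>U\<in>\<U>. emeasure (N w) U \<in> C U) \<and> emeasure (N w) R \<in> B}"
  proof -
    have spl: "(\<lambda>w. (f w, g w)) -` (X \<times> Y) \<inter> space P = (f -` X \<inter> space P) \<inter> (g -` Y \<inter> space P)"
      for f :: "'a \<Rightarrow> nat \<Rightarrow> ennreal" and g :: "'a \<Rightarrow> nat \<Rightarrow> ennreal" and X Y by auto
    show ?thesis unfolding spl e1 e2 by blast
  qed
  show ?thesis using P.indep_varD[OF iv2 Q B'] unfolding e1 e2 e3 .
qed

text \<open>The factor of index \<open>i\<close> uses independence within one random measure, the
  remaining factors use independence of the family.\<close>

lemma past_cylinder_indep:
  assumes P: "prob_space P" and D: "iid_poisson_random_measures P T D"
    and K: "finite K" "\<And>j U. (j, U) \<in> K \<Longrightarrow> U \<in> sets (mark_measure T) \<and> U \<inter> R = {}"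
    and R: "R \<in> sets (mark_measure T)"
    and C: "\<And>p. p \<in> K \<Longrightarrow> C p \<in> sets borel" and B: "B \<in> sets borel"
  shows "measure P ({w \<in> space P. \<forall>(j, U)\<in>K. emeasure (D j w) U \<in> C (j, U)} \<inter> {w \<in> space P. emeasure (D i w) R \<in> B}) =
    measure P {w \<in> space P. \<forall>(j, U)\<in>K. emeasure (D j w) U \<in> C (j, U)} * measure P {w \<in> space P. emeasure (D i w) R \<in> B}"
proof -
  interpret P: prob_space P by (rule P)
  let ?S = "sets (mark_measure T)"
  let ?PM = "PiM ?S (\<lambda>_. borel :: ennreal measure)"
  define Z where "Z = (\<lambda>j w. \<lambda>A\<in>?S. emeasure (D j w) A)"
  have iv: "P.indep_vars (\<lambda>_. ?PM) Z UNIV" using D unfolding iid_poisson_random_measures_def Z_def by (rule conjunct2)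
  define J where "J = insert i (fst ` K)"
  define E where "E = (\<lambda>j. {f \<in> space ?PM. \<forall>U\<in>{U. (j, U) \<in> K}. f U \<in> C (j, U)})"
  define V where "V = {f \<in> space ?PM. f R \<in> B}"
  have fin: "finite {U. (j, U) \<in> K}" for j
  proof (rule finite_subset)
    show "{U. (j, U) \<in> K} \<subseteq> snd ` K" by force
  qed (use K(1) in auto)
  have comp: "{f \<in> space ?PM. f U \<in> X} \<in> sets ?PM" if "U \<in> ?S" "X \<in> sets borel" for U X
    using measurable_sets[OF measurable_component_singleton[OF that(1), of "\<lambda>_. borel"] that(2)]
    by (simp add: vimage_def Int_def conj_commute)
  have E: "E j \<in> sets ?PM" for j
    unfolding E_def using K C fin by (intro sets.sets_Collect_finite_All comp) auto
  have V: "V \<in> sets ?PM" unfolding V_def by (rule comp[OF R B])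
  have J: "finite J" "J \<noteq> {}" using K by (auto simp: J_def)
  have zE: "Z j -` E j \<inter> space P = {w \<in> space P. \<forall>U\<in>{U. (j, U) \<in> K}. emeasure (D j w) U \<in> C (j, U)}" for j
    using K(2) by (auto simp: Z_def E_def space_PiM)
  have zV: "Z i -` V \<inter> space P = {w \<in> space P. emeasure (D i w) R \<in> B}"
    using R by (auto simp: Z_def V_def space_PiM)
  have 1: "{w \<in> space P. \<forall>(j, U)\<in>K. emeasure (D j w) U \<in> C (j, U)} = (\<Inter>j\<in>J. Z j -` E j \<inter> space P)"
  proof (intro set_eqI iffI)
    fix w assume "w \<in> {w \<in> space P. \<forall>(j, U)\<in>K. emeasure (D j w) U \<in> C (j, U)}"
    then show "w \<in> (\<Inter>j\<in>J. Z j -` E j \<inter> space P)" unfolding zE by blast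
  next
    fix w assume w: "w \<in> (\<Inter>j\<in>J. Z j -` E j \<inter> space P)"
    then have "w \<in> space P" by (auto simp: J_def)
    moreover have "emeasure (D j w) U \<in> C (j, U)" if "(j, U) \<in> K" for j U
    proof -
      have "j \<in> J" using that by (force simp: J_def)
      then show ?thesis using w that unfolding zE by blast
    qed
    ultimately show "w \<in> {w \<in> space P. \<forall>(j, U)\<in>K. emeasure (D j w) U \<in> C (j, U)}" by blast
  qed
  have p1: "measure P (\<Inter>j\<in>J. Z j -` E j \<inter> space P) = (\<Prod>j\<in>J. measure P (Z j -` E j \<inter> space P))"
    by (rule P.indep_varsD[OF iv J(2,1)]) (use E in auto)
  \<comment> \<open>The event on \<open>R\<close> is absorbed in the factor of index
    \<open>i\<close>, so that both sides are products over the same \<open>J\<close>. Inserting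
    \<open>i\<close> in \<open>J\<close> covers the case that no set in \<open>K\<close> belongs to
    \<open>D i\<close>.\<close>
  define E' where "E' = (\<lambda>j. if j = i then E i \<inter> V else E j)"
  have 2: "(\<Inter>j\<in>J. Z j -` E' j \<inter> space P) = (\<Inter>j\<in>J. Z j -` E j \<inter> space P) \<inter> (Z i -` V \<inter> space P)"
    by (auto simp: E'_def J_def split: if_splits)
  have p2: "measure P (\<Inter>j\<in>J. Z j -` E' j \<inter> space P) = (\<Prod>j\<in>J. measure P (Z j -` E' j \<inter> space P))"
    by (rule P.indep_varsD[OF iv J(2,1)]) (use E V in \<open>auto simp: E'_def\<close>)
  note prm = iid_prm[OF D]
  have "measure P (Z i -` (E i \<inter> V) \<inter> space P) = measure P (Z i -` E i \<inter> space P) * measure P (Z i -` V \<inter> space P)"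
  proof -
    have "Z i -` (E i \<inter> V) \<inter> space P = {w \<in> space P. (\<forall>U\<in>{U. (i, U) \<in> K}. emeasure (D i w) U \<in> C (i, U)) \<and> emeasure (D i w) R \<in> B}"
      using zE[of i] zV by auto
    then show ?thesis unfolding zE zV
      by (simp only:) (rule prm_finite_family_indep[OF P prm fin _ R _ _ B], use K(2) C in auto)
  qed
  moreover have "(\<Prod>j\<in>J. measure P (Z j -` X j \<inter> space P)) = measure P (Z i -` X i \<inter> space P) *
      (\<Prod>j\<in>J - {i}. measure P (Z j -` X j \<inter> space P))" for X
    using J by (intro prod.remove) (auto simp: J_def)
  moreover have "(\<Prod>j\<in>J - {i}. measure P (Z j -` E' j \<inter> space P)) = (\<Prod>j\<in>J - {i}. measure P (Z j -` E j \<inter> space P))"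
    by (intro prod.cong) (auto simp: E'_def)
  ultimately have "measure P (\<Inter>j\<in>J. Z j -` E' j \<inter> space P) =
      measure P (\<Inter>j\<in>J. Z j -` E j \<inter> space P) * measure P (Z i -` V \<inter> space P)"
    unfolding p1 p2 by (simp add: E'_def)
  then show ?thesis unfolding 1 zV[symmetric] 2 .
qed

lemma noise_generators_Pow:
  "{{w \<in> space P. emeasure (D i w) ({0<..s} \<times> H \<times> B) \<in> C} | i s H B C.
         s \<in> {0..t} \<and> H \<in> sets borel \<and> H \<subseteq> {0..1} \<and> B \<in> sets borel \<and> B \<subseteq> {0..} \<and> C \<in> sets borel}
      \<union> null_sets P \<subseteq> Pow (space P)"
  by (auto dest: null_setsD2 sets.sets_into_space)

lemma sets_noise_filtration:
  "sets (noise_filtration P D t) = sigma_sets (space P)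
    ({{w \<in> space P. emeasure (D i w) ({0<..s} \<times> H \<times> B) \<in> C} | i s H B C.
         s \<in> {0..t} \<and> H \<in> sets borel \<and> H \<subseteq> {0..1} \<and> B \<in> sets borel \<and> B \<subseteq> {0..} \<and> C \<in> sets borel}
      \<union> null_sets P)"
  unfolding noise_filtration_def by (rule sets_measure_of[OF noise_generators_Pow])

lemma space_noise_filtration [simp]: "space (noise_filtration P D t) = space P"
  unfolding noise_filtration_def by (rule space_measure_of[OF noise_generators_Pow])

lemma mark_space_borel [measurable]: "mark_space T \<in> sets borel"
  unfolding mark_space_def by (intro borel_Times) auto

lemma mark_rectangle_sets:
  assumes "s \<in> sets borel" "s \<subseteq> {0..T}" "H \<in> sets borel" "H \<subseteq> {0..1}" "B \<in> sets borel" "B \<subseteq> {0..}"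
  shows "s \<times> H \<times> B \<in> sets (mark_measure T)"
proof -
  have "s \<times> H \<times> B \<in> sets borel" using assms by (intro borel_Times) auto
  moreover have "s \<times> H \<times> B \<subseteq> mark_space T" using assms unfolding mark_space_def by blast
  ultimately show ?thesis by (simp add: sets_restrict_space_iff)
qed

lemma noise_filtration_sets_mono:
  assumes "s \<le> t" shows "sets (noise_filtration P D s) \<subseteq> sets (noise_filtration P D t)"
  unfolding sets_noise_filtration 
proof (rule sigma_sets_mono', intro Un_mono Collect_mono subset_refl impI)
  fix x assume "\<exists>i s' H B C. x = {w \<in> space P. emeasure (D i w) ({0<..s'} \<times> H \<times> B) \<in> C} \<and> s' \<in> {0..s} \<and>
    H \<in> sets borel \<and> H \<subseteq> {0..1} \<and> B \<in> sets borel \<and> B \<subseteq> {0..} \<and> C \<in> sets borel"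
  then obtain i s' H B C where "x = {w \<in> space P. emeasure (D i w) ({0<..s'} \<times> H \<times> B) \<in> C}" "s' \<in> {0..s}"
    "H \<in> sets borel" "H \<subseteq> {0..1}" "B \<in> sets borel" "B \<subseteq> {0..}" "C \<in> sets borel" by (elim exE conjE)
  then show "\<exists>i s H B C. x = {w \<in> space P. emeasure (D i w) ({0<..s} \<times> H \<times> B) \<in> C} \<and> s \<in> {0..t} \<and>
    H \<in> sets borel \<and> H \<subseteq> {0..1} \<and> B \<in> sets borel \<and> B \<subseteq> {0..} \<and> C \<in> sets borel"
    using assms by (intro exI[of _ i] exI[of _ s'] exI[of _ H] exI[of _ B] exI[of _ C]) simp
qed

text \<open>The filtration contains the null sets, so its events are compared with the
  \<sigma>-algebra generated by counts on sets disjoint from \<open>R\<close>, from which they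
  differ by null sets only. For that \<sigma>-algebra the cylinders form an intersection-stable
  generator.\<close>

lemma noise_filtration_indep:
  assumes P: "prob_space P" and D: "iid_poisson_random_measures P T D"
    and u: "u \<le> T" and A: "A \<in> sets (noise_filtration P D u)"
    and R: "R \<in> sets (mark_measure T)" "R \<subseteq> {u<..} \<times> UNIV" and B: "B \<in> sets borel"
  shows "A \<in> sets P" "measure P (A \<inter> {w \<in> space P. emeasure (D i w) R \<in> B}) =
    measure P A * measure P {w \<in> space P. emeasure (D i w) R \<in> B}"
proof -
  interpret P: prob_space P by (rule P)
  let ?S = "sets (mark_measure T)"
  let ?Q = "{w \<in> space P. emeasure (D i w) R \<in> B}"
  note prm = iid_prm[OF D]
  have Dm: "(\<lambda>w. emeasure (D j w) U) \<in> borel_measurable P" if "U \<in> ?S" for j U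
    by (rule prm_measurable[OF prm that])
  have Q: "?Q \<in> sets P" using measurable_sets[OF Dm[OF R(1)] B] by (simp add: vimage_def Int_def conj_commute)
  define I where "I = (UNIV :: nat set) \<times> {U \<in> ?S. U \<inter> R = {}}"
  define W where "W = (\<lambda>w. \<lambda>p\<in>I. emeasure (D (fst p) w) (snd p))"
  have Wm: "W \<in> measurable P (PiM I (\<lambda>_. borel))"
    unfolding W_def by (rule measurable_restrict) (use Dm in \<open>auto simp: I_def\<close>)
  have W_emb: "W w \<in> prod_emb I (\<lambda>_. borel) K (\<Pi>\<^sub>E p\<in>K. C p) \<longleftrightarrow> (\<forall>p\<in>K. emeasure (D (fst p) w) (snd p) \<in> C p)"
    if "K \<subseteq> I" for w K C
    using subsetD[OF that] by (auto simp: prod_emb_iff W_def PiE_iff Int_absorb1[OF that])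
  define \<P> where "\<P> = {W -` E \<inter> space P | E. E \<in> prod_algebra I (\<lambda>_. borel)}"
  have stab: "Int_stable \<P>"
  proof (rule Int_stableI)
    fix a b assume "a \<in> \<P>" "b \<in> \<P>"
    then obtain E E' where "E \<in> prod_algebra I (\<lambda>_. borel)" "E' \<in> prod_algebra I (\<lambda>_. borel)"
      "a = W -` E \<inter> space P" "b = W -` E' \<inter> space P" unfolding \<P>_def by blast
    moreover have "E \<inter> E' \<in> prod_algebra I (\<lambda>_. borel)"
      using Int_stable_prod_algebra calculation(1,2) by (rule Int_stableD)
    ultimately show "a \<inter> b \<in> \<P>"
      unfolding \<P>_def by (intro CollectI exI[of _ "E \<inter> E'"]) auto
  qed
  have sub: "\<P> \<subseteq> sets P"
    using measurable_sets[OF Wm] unfolding \<P>_def sets_PiM by blast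
  have ind: "P.indep_set \<P> {?Q}"
  proof (rule P.indep_setI[OF sub])
    fix a b assume a: "a \<in> \<P>" and b: "b \<in> {?Q}"
    obtain E where E: "E \<in> prod_algebra I (\<lambda>_. borel)" "a = W -` E \<inter> space P" using a unfolding \<P>_def by blast
    obtain K C where K: "E = prod_emb I (\<lambda>_. borel) K (\<Pi>\<^sub>E p\<in>K. C p)" "finite K" "K \<subseteq> I"
      "\<And>p. p \<in> K \<Longrightarrow> C p \<in> sets (borel :: ennreal measure)"
      using E(1) by (elim prod_algebraE) auto
    have "a = {w \<in> space P. \<forall>(j, U)\<in>K. emeasure (D j w) U \<in> C (j, U)}"
      using W_emb[OF K(3), of _ C] by (simp add: E(2) K(1) case_prod_beta' set_eq_iff conj_commute)
    then show "measure P (a \<inter> b) = measure P a * measure P b"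
      using past_cylinder_indep[where C = C and i = i and K = K, OF P D K(2) _ R(1) K(4) B] b subsetD[OF K(3)]
      by (simp add: I_def) blast
  qed (use Q in auto)
  then have ind2: "P.indep_set (sigma_sets (space P) \<P>) (sigma_sets (space P) {?Q})"
    by (rule P.indep_set_sigma_sets[OF _ stab]) (auto simp: Int_stable_def)
  have prod: "measure P (A0 \<inter> ?Q) = measure P A0 * measure P ?Q" if "A0 \<in> sigma_sets (space P) \<P>" for A0
    using P.indep_setD[OF ind2 that] by blast
  have sub2: "sigma_sets (space P) \<P> \<subseteq> sets P" by (rule sets.sigma_sets_subset[OF sub])
  \<comment> \<open>Measurability in \<open>P\<close> has to be carried along, since null sets are
    sets of \<open>P\<close> and symmetric differences of unions must be measurable to be recognised
    as null.\<close>
  have "A \<in> sets P \<and> (\<exists>A0\<in>sigma_sets (space P) \<P>. sym_diff A A0 \<in> null_sets P)"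
    using A unfolding sets_noise_filtration
  proof (induction rule: sigma_sets.induct)
    case (Basic a)
    then consider "a \<in> null_sets P" | j s H B' C where "a = {w \<in> space P. emeasure (D j w) ({0<..s} \<times> H \<times> B') \<in> C}"
      "s \<in> {0..u}" "H \<in> sets borel" "H \<subseteq> {0..1}" "B' \<in> sets borel" "B' \<subseteq> {0..}" "C \<in> sets borel" by blast
    then show ?case
    proof cases
      case 1
      then show ?thesis by (intro conjI bexI[of _ "{}"] sigma_sets.Empty) auto
    next
      case 2
      let ?U = "{0<..s} \<times> H \<times> B'"
      have U: "(j, ?U) \<in> I" using 2 u R(2) by (auto simp: I_def intro!: mark_rectangle_sets)
      have "prod_emb I (\<lambda>_. borel) {(j, ?U)} (\<Pi>\<^sub>E p\<in>{(j, ?U)}. C) \<in> prod_algebra I (\<lambda>_. borel)"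
        using U 2 by (intro prod_algebraI) auto
      moreover have "a = W -` prod_emb I (\<lambda>_. borel) {(j, ?U)} (\<Pi>\<^sub>E p\<in>{(j, ?U)}. C) \<inter> space P"
        using W_emb[of "{(j, ?U)}" _ "\<lambda>_. C"] U 2(1) by auto
      ultimately have "a \<in> \<P>" unfolding \<P>_def by blast
      then show ?thesis using sub by (intro conjI bexI[of _ a]) auto
    qed
  next
    case Empty
    show ?case by (intro conjI bexI[of _ "{}"] sigma_sets.Empty) auto
  next
    case (Compl a)
    then obtain A0 where A0: "A0 \<in> sigma_sets (space P) \<P>" "sym_diff a A0 \<in> null_sets P" by blast
    have "sym_diff (space P - a) (space P - A0) = sym_diff a A0"
      using Compl sub2 A0(1) sets.sets_into_space[of _ P] by blast
    then show ?case using Compl A0 by (intro conjI bexI[of _ "space P - A0"] sigma_sets.Compl) auto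
  next
    case (Union a)
    then obtain A0 where A0: "\<And>k::nat. A0 k \<in> sigma_sets (space P) \<P>" "\<And>k. sym_diff (a k) (A0 k) \<in> null_sets P" by metis
    have m: "(\<Union>k. a k) \<in> sets P" "(\<Union>k. A0 k) \<in> sets P" using Union A0 sub2 by blast+
    have "sym_diff (\<Union>k. a k) (\<Union>k. A0 k) \<in> null_sets P"
    proof (rule null_sets_subset)
      show "(\<Union>k. sym_diff (a k) (A0 k)) \<in> null_sets P" using A0 by (intro null_sets_UN') auto
      show "sym_diff (\<Union>k. a k) (\<Union>k. A0 k) \<in> sets P" using m by auto
    qed auto
    then show ?case using m A0 by (intro conjI bexI[of _ "\<Union>k. A0 k"] sigma_sets.Union) auto
  qed
  then obtain A0 where A0: "A \<in> sets P" "A0 \<in> sigma_sets (space P) \<P>" "sym_diff A A0 \<in> null_sets P" by blast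
  have A0s: "A0 \<in> sets P" using A0 sub2 by blast
  have AE: "AE w in P. w \<in> A \<longleftrightarrow> w \<in> A0" using AE_not_in[OF A0(3)] by eventually_elim auto
  have "measure P A = measure P A0"
    by (rule P.finite_measure_eq_AE) (use AE A0 A0s in auto)
  moreover have "measure P (A \<inter> ?Q) = measure P (A0 \<inter> ?Q)"
    by (rule P.finite_measure_eq_AE) (use AE A0 A0s Q in auto)
  ultimately show "measure P (A \<inter> ?Q) = measure P A * measure P ?Q" using prod[OF A0(2)] by simp
  show "A \<in> sets P" by (rule A0(1))
qed

text \<open>An event of the real-valued count is an event of the extended count through
  \<open>enn2real\<close>, and preimages of Borel sets form intersection-stable generators.\<close>

lemma noise_indep_var:
  fixes g :: "'w \<Rightarrow> real"
  assumes P: "prob_space P" and D: "iid_poisson_random_measures P T D" and u: "u \<le> T"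
    and R: "R \<in> sets (mark_measure T)" "R \<subseteq> {u<..} \<times> UNIV"
    and g: "g \<in> borel_measurable (noise_filtration P D u)"
  shows "prob_space.indep_var P borel g borel (\<lambda>w. measure (D i w) R)"
proof -
  interpret P: prob_space P by (rule P)
  have sub: "sets (noise_filtration P D u) \<subseteq> sets P" using noise_filtration_indep(1)[OF P D u _ R, of _ UNIV] by auto
  have gs: "g -` C \<inter> space P \<in> sets (noise_filtration P D u)" if "C \<in> sets borel" for C
    using measurable_sets[OF g that] by simp
  have gm: "g \<in> borel_measurable P" by (rule measurableI) (use gs sub in auto)
  have [measurable]: "(\<lambda>w. emeasure (D i w) R) \<in> borel_measurable P" by (rule prm_measurable[OF iid_prm[OF D] R(1)])
  have Xm: "(\<lambda>w. measure (D i w) R) \<in> borel_measurable P" unfolding measure_def by measurable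
  have st: "Int_stable {f -` A \<inter> space P |A. A \<in> sets borel}" for f :: "'w \<Rightarrow> 'b :: topological_space"
  proof (rule Int_stableI)
    fix a b assume "a \<in> {f -` A \<inter> space P |A. A \<in> sets borel}" "b \<in> {f -` A \<inter> space P |A. A \<in> sets borel}"
    then obtain A B where "A \<in> sets borel" "B \<in> sets borel" "a = f -` A \<inter> space P" "b = f -` B \<inter> space P" by blast
    then show "a \<inter> b \<in> {f -` A \<inter> space P |A. A \<in> sets borel}" by (intro CollectI exI[of _ "A \<inter> B"]) auto
  qed
  have "P.indep_set {g -` A \<inter> space P |A. A \<in> sets borel} {(\<lambda>w. measure (D i w) R) -` A \<inter> space P |A. A \<in> sets borel}"
  proof (rule P.indep_setI)
    show "{g -` A \<inter> space P |A. A \<in> sets borel} \<subseteq> sets P" using measurable_sets[OF gm] by blast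
    show "{(\<lambda>w. measure (D i w) R) -` A \<inter> space P |A. A \<in> sets borel} \<subseteq> sets P" using measurable_sets[OF Xm] by blast
    fix a b assume a: "a \<in> {g -` A \<inter> space P |A. A \<in> sets borel}"
      and b: "b \<in> {(\<lambda>w. measure (D i w) R) -` A \<inter> space P |A. A \<in> sets borel}"
    from a gs have a': "a \<in> sets (noise_filtration P D u)" by auto
    from b obtain C where C: "C \<in> sets borel" "b = (\<lambda>w. measure (D i w) R) -` C \<inter> space P" by blast
    have "enn2real -` C \<in> sets borel" using measurable_sets[of enn2real borel borel C] C(1) by simp
    moreover have "b = {w \<in> space P. emeasure (D i w) R \<in> enn2real -` C}" using C(2) by (auto simp: measure_def)
    ultimately show "measure P (a \<inter> b) = measure P a * measure P b"
      using noise_filtration_indep(2)[OF P D u a' R, of "enn2real -` C" i] by simp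
  qed
  from P.indep_set_sigma_sets[OF this st st] show ?thesis
    unfolding P.indep_var_eq using gm Xm by simp
qed

section \<open>Compensated noise on a bounded box of marks\<close>

locale poisson_noise =
  fixes P :: "'w measure" and T :: real and D :: "nat \<Rightarrow> 'w \<Rightarrow> (real \<times> real \<times> real) measure"
    and i :: nat and L :: real
  assumes P: "prob_space P" and D: "iid_poisson_random_measures P T D" and T: "0 < T" and L: "0 \<le> L"
begin

sublocale P: prob_space P by (rule P)

text \<open>The height \<open>L\<close> will be a bound of the scaled control, so that the points
  counted by the thinned measure all lie in a set of finite intensity.\<close>

definition box :: "(real \<times> real \<times> real) set" where "box = {0..T} \<times> {0..1} \<times> {0..L}"

definition nu :: "(real \<times> real \<times> real) measure" where "nu = restrict_space lborel box"

text \<open>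
  Discarding the null event of infinite mass makes the kernel finite everywhere.
\<close>
definition NL :: "'w \<Rightarrow> (real \<times> real \<times> real) measure" where
  "NL w = (if emeasure (D i w) box < \<infinity> then restrict_space (D i w) box else null_measure nu)"

lemma box_sub: "box \<subseteq> mark_space T" and box_borel: "box \<in> sets borel"
  by (auto simp: box_def mark_space_def intro!: borel_Times)

lemma box_mark: "box \<in> sets (mark_measure T)"
  using box_sub box_borel by (simp add: sets_restrict_space_iff)

lemma space_nu [simp]: "space nu = box" by (simp add: nu_def space_restrict_space)

lemma sets_nu: "A \<in> sets nu \<longleftrightarrow> A \<in> sets borel \<and> A \<subseteq> box"
  unfolding nu_def using box_borel by (auto simp: sets_restrict_space_iff)

lemma sets_nu_mark: "A \<in> sets nu \<Longrightarrow> A \<in> sets (mark_measure T)"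
  using box_sub by (auto simp: sets_nu sets_restrict_space_iff)

lemma emeasure_nu: "A \<in> sets nu \<Longrightarrow> emeasure nu A = emeasure (mark_measure T) A"
  using box_sub box_borel unfolding nu_def
  by (subst (1 2) emeasure_restrict_space) (auto simp: sets_restrict_space_iff)

lemma finite_nu: "finite_measure nu"
proof
  have b: "bounded box" unfolding box_def by (intro bounded_Times) auto
  have "emeasure nu box = emeasure lborel box"
    unfolding nu_def using box_borel by (subst emeasure_restrict_space) auto
  then show "emeasure nu (space nu) \<noteq> \<infinity>" using emeasure_bounded_finite[OF b] by simp
qed

lemma sets_NL: "w \<in> space P \<Longrightarrow> sets (NL w) = sets nu"
proof -
  assume w: "w \<in> space P"
  have "sets (restrict_space (D i w) box) = sets (restrict_space (mark_measure T) box)"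
    by (rule sets_restrict_space_cong[OF prm_sets[OF iid_prm[OF D] w]])
  also have "\<dots> = sets nu"
    using box_sub box_borel by (subst restrict_restrict_space) (auto simp: nu_def Int_absorb1)
  finally show ?thesis by (simp add: NL_def)
qed

lemma space_NL: "w \<in> space P \<Longrightarrow> space (NL w) = box"
  using sets_eq_imp_space_eq[OF sets_NL] by simp

lemma measure_NL: "w \<in> space P \<Longrightarrow> A \<in> sets nu \<Longrightarrow>
  measure (NL w) A = (if emeasure (D i w) box < \<infinity> then measure (D i w) A else 0)"
proof -
  assume w: "w \<in> space P" and A: "A \<in> sets nu"
  have "box \<in> sets (D i w)" using box_mark prm_sets[OF iid_prm[OF D] w] by simp
  moreover have "A \<subseteq> box" using A by (simp add: sets_nu)
  ultimately show ?thesis unfolding NL_def by (simp add: measure_restrict_space)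
qed

lemma finite_NL: "w \<in> space P \<Longrightarrow> finite_measure (NL w)"
proof
  assume w: "w \<in> space P"
  have "box \<in> sets (D i w)" using box_mark prm_sets[OF iid_prm[OF D] w] by simp
  then have "emeasure (NL w) box \<noteq> \<infinity>" by (auto simp: NL_def emeasure_restrict_space)
  then show "emeasure (NL w) (space (NL w)) \<noteq> \<infinity>" by (simp add: space_NL[OF w])
qed

lemma NL_measurable: "A \<in> sets nu \<Longrightarrow> (\<lambda>w. measure (NL w) A) \<in> borel_measurable P"
proof -
  assume A: "A \<in> sets nu"
  have [measurable]: "(\<lambda>w. emeasure (D i w) box) \<in> borel_measurable P" "(\<lambda>w. emeasure (D i w) A) \<in> borel_measurable P"
    using prm_measurable[OF iid_prm[OF D]] box_mark sets_nu_mark[OF A] by auto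
  have "(\<lambda>w. if emeasure (D i w) box < \<infinity> then measure (D i w) A else 0) \<in> borel_measurable P"
    unfolding measure_def by measurable
  then show ?thesis using measure_NL[OF _ A] by (simp cong: measurable_cong)
qed

lemma nu_fin: "A \<in> sets nu \<Longrightarrow> emeasure (mark_measure T) A < \<infinity>"
  using emeasure_nu finite_measure.emeasure_finite[OF finite_nu, of A] by (simp add: top.not_eq_extremum)

lemma box_nu: "box \<in> sets nu" by (simp add: sets_nu box_borel)

lemma AE_box_finite: "AE w in P. emeasure (D i w) box < \<infinity>"
  by (rule prm_moments(1)[OF P iid_prm[OF D] box_mark nu_fin[OF box_nu]])

lemma AE_NL: "A \<in> sets nu \<Longrightarrow> AE w in P. measure (NL w) A = measure (D i w) A"
  using AE_box_finite AE_space by eventually_elim (simp add: measure_NL)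

lemma NL_moments:
  assumes A: "A \<in> sets nu"
  shows "integrable P (\<lambda>w. measure (NL w) A)" "(LINT w|P. measure (NL w) A) = measure nu A"
    "integrable P (\<lambda>w. (measure (NL w) A)\<^sup>2)"
    "(LINT w|P. (measure (NL w) A)\<^sup>2) = (measure nu A)\<^sup>2 + measure nu A"
proof -
  note m = prm_moments[OF P iid_prm[OF D] sets_nu_mark[OF A] nu_fin[OF A]]
  have e: "measure nu A = measure (mark_measure T) A" unfolding measure_def emeasure_nu[OF A] ..
  have nm: "(\<lambda>w. measure (D i w) A) \<in> borel_measurable P" using m(2) by (rule borel_measurable_integrable)
  show "integrable P (\<lambda>w. measure (NL w) A)"
    by (rule integrable_cong_AE_imp[OF m(2) NL_measurable[OF A]]) (use AE_NL[OF A] in auto)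
  show "(LINT w|P. measure (NL w) A) = measure nu A"
  proof -
    have "(LINT w|P. measure (NL w) A) = (LINT w|P. measure (D i w) A)"
      by (rule integral_cong_AE) (use AE_NL[OF A] NL_measurable[OF A] nm in auto)
    then show ?thesis using m(3) e by simp
  qed
  show "integrable P (\<lambda>w. (measure (NL w) A)\<^sup>2)"
    by (rule integrable_cong_AE_imp[OF m(4)]) (use AE_NL[OF A] NL_measurable[OF A] in auto)
  show "(LINT w|P. (measure (NL w) A)\<^sup>2) = (measure nu A)\<^sup>2 + measure nu A"
  proof -
    have "(LINT w|P. (measure (NL w) A)\<^sup>2) = (LINT w|P. (measure (D i w) A)\<^sup>2)"
      by (rule integral_cong_AE) (use AE_NL[OF A] NL_measurable[OF A] nm in auto)
    then show ?thesis using m(5) e by simp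
  qed
qed

definition compensated :: "(real \<times> real \<times> real) set \<Rightarrow> 'w \<Rightarrow> real" where
  "compensated A w = measure (NL w) A - measure nu A"

lemma compensated_measurable: "A \<in> sets nu \<Longrightarrow> compensated A \<in> borel_measurable P"
  unfolding compensated_def using NL_measurable by auto

lemma compensated_sq: "A \<in> sets nu \<Longrightarrow> integrable P (\<lambda>w. (compensated A w)\<^sup>2)"
  unfolding compensated_def power2_diff
  by (intro Bochner_Integration.integrable_add Bochner_Integration.integrable_diff NL_moments) 
     (use NL_moments(1) in auto)

lemma compensated_integrable: "A \<in> sets nu \<Longrightarrow> integrable P (compensated A)"
  unfolding compensated_def using NL_moments(1) by auto

lemma compensated_expectation: "A \<in> sets nu \<Longrightarrow> (LINT w|P. compensated A w) = 0"
  unfolding compensated_def using NL_moments(1,2) by (simp add: P.prob_space)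

lemma compensated_mult_integrable: "A \<in> sets nu \<Longrightarrow> B \<in> sets nu \<Longrightarrow> integrable P (\<lambda>w. compensated A w * compensated B w)"
proof (rule Bochner_Integration.integrable_bound)
  assume AB: "A \<in> sets nu" "B \<in> sets nu"
  show "integrable P (\<lambda>w. (compensated A w)\<^sup>2 + (compensated B w)\<^sup>2)" using compensated_sq AB by auto
  show "(\<lambda>w. compensated A w * compensated B w) \<in> borel_measurable P" using compensated_measurable AB by auto
  have "\<bar>a * b\<bar> \<le> a\<^sup>2 + b\<^sup>2" for a b :: real
  proof -
    have "2 * (\<bar>a\<bar> * \<bar>b\<bar>) \<le> a\<^sup>2 + b\<^sup>2"
      using sum_squares_bound[of "\<bar>a\<bar>" "\<bar>b\<bar>"] by (simp add: mult.assoc)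
    moreover have "0 \<le> \<bar>a\<bar> * \<bar>b\<bar>" by simp
    ultimately show ?thesis unfolding abs_mult by linarith
  qed
  then show "AE w in P. norm (compensated A w * compensated B w) \<le> norm ((compensated A w)\<^sup>2 + (compensated B w)\<^sup>2)" by (auto simp: abs_of_nonneg)
qed

lemma compensated_union: "A \<in> sets nu \<Longrightarrow> B \<in> sets nu \<Longrightarrow> A \<inter> B = {} \<Longrightarrow> w \<in> space P \<Longrightarrow> compensated (A \<union> B) w = compensated A w + compensated B w"
  unfolding compensated_def
  using finite_measure.finite_measure_Union[OF finite_NL, of w A B] finite_measure.finite_measure_Union[OF finite_nu, of A B]
  by (simp add: sets_NL)

text \<open>A nonnegative variable of expectation zero vanishes almost surely.\<close>

lemma compensated_null: "A \<in> sets nu \<Longrightarrow> measure nu A = 0 \<Longrightarrow> AE w in P. compensated A w = 0"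
  using NL_moments(1,2)[of A] integral_nonneg_eq_0_iff_AE[of P "\<lambda>w. measure (NL w) A"] by (simp add: compensated_def)

context
  fixes u :: real
  assumes u: "u \<le> T"
begin

abbreviation after :: "(real \<times> real \<times> real) set \<Rightarrow> bool" where
  "after A \<equiv> A \<in> sets nu \<and> A \<subseteq> {u<..} \<times> UNIV"

lemma filtration_sub: "sets (noise_filtration P D u) \<subseteq> sets P"
  using noise_filtration_indep(1)[OF P D u, of _ "{}" UNIV] by auto

lemma filtration_measurable: "g \<in> borel_measurable (noise_filtration P D u) \<Longrightarrow> g \<in> borel_measurable P"
  using filtration_sub by (auto simp: measurable_def)

text \<open>Independence is known for the count under \<open>D i\<close>; it passes to
  \<open>NL\<close> because the two agree outside the null event on which the box has infinite
  mass.\<close>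

lemma indep_product:
  fixes g :: "'w \<Rightarrow> real" and f :: "real \<Rightarrow> real"
  assumes A: "after A" and g: "g \<in> borel_measurable (noise_filtration P D u)" "integrable P g"
    and f: "f \<in> borel_measurable borel" "integrable P (\<lambda>w. f (measure (NL w) A))"
  shows "(LINT w|P. g w * f (measure (NL w) A)) = (LINT w|P. g w) * (LINT w|P. f (measure (NL w) A))"
proof -
  have "P.indep_var borel g borel (\<lambda>w. measure (D i w) A)"
    by (rule noise_indep_var[OF P D u _ _ g(1)]) (use A sets_nu_mark in auto)
  from P.indep_var_compose[OF this, of "\<lambda>x. x" borel f borel]
  have iv: "P.indep_var borel g borel (\<lambda>w. f (measure (D i w) A))"
    using f(1) by (simp add: comp_def)
  have AE: "AE w in P. f (measure (NL w) A) = f (measure (D i w) A)" using AE_NL[OF conjunct1[OF A]] by eventually_elim simp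
  have m: "(\<lambda>w. f (measure (D i w) A)) \<in> borel_measurable P"
    using P.indep_var_rv2[OF iv] .
  have m': "(\<lambda>w. f (measure (NL w) A)) \<in> borel_measurable P" using f(2) by (rule borel_measurable_integrable)
  have gm: "g \<in> borel_measurable P" by (rule filtration_measurable[OF g(1)])
  have i: "integrable P (\<lambda>w. f (measure (D i w) A))"
    by (rule integrable_cong_AE_imp[OF f(2) m]) (use AE in auto)
  have "(LINT w|P. g w * f (measure (NL w) A)) = (LINT w|P. g w * f (measure (D i w) A))"
    by (rule integral_cong_AE) (use AE m m' gm in auto)
  also have "\<dots> = (LINT w|P. g w) * (LINT w|P. f (measure (D i w) A))"
    by (rule P.indep_var_lebesgue_integral[OF iv g(2) i])
  also have "(LINT w|P. f (measure (D i w) A)) = (LINT w|P. f (measure (NL w) A))"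
    by (rule integral_cong_AE) (use AE m m' in auto)
  finally show ?thesis .
qed

lemma past_times_increment:
  assumes "after A" "g \<in> borel_measurable (noise_filtration P D u)" "integrable P g"
  shows "(LINT w|P. g w * compensated A w) = 0"
  using indep_product[OF assms, of "\<lambda>x. x - measure nu A"] compensated_integrable[of A] compensated_expectation[of A] assms(1)
  unfolding compensated_def by simp

lemma indicator_filtration: "E \<in> sets (noise_filtration P D u) \<Longrightarrow> (indicator E :: 'w \<Rightarrow> real) \<in> borel_measurable (noise_filtration P D u)"
  by simp

text \<open>The variance of a Poisson count equals its mean, and the event \<open>E\<close> is
  independent of the count.\<close>

lemma conditional_variance:
  assumes A: "after A" and E: "E \<in> sets (noise_filtration P D u)"
  shows "(LINT w|P. indicator E w * (compensated A w)\<^sup>2) = measure P E * measure nu A"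
proof -
  have E': "E \<in> sets P" using E filtration_sub by blast
  have s: "(LINT w|P. (compensated A w)\<^sup>2) = measure nu A"
  proof -
    have "(LINT w|P. (compensated A w)\<^sup>2) =
        (LINT w|P. (measure (NL w) A)\<^sup>2 - 2 * measure nu A * measure (NL w) A + (measure nu A)\<^sup>2)"
      by (simp add: compensated_def power2_diff algebra_simps)
    also have "\<dots> = measure nu A"
      using NL_moments[of A] A by (simp add: P.prob_space power2_eq_square)
    finally show ?thesis .
  qed
  have "(LINT w|P. indicator E w * (compensated A w)\<^sup>2) = (LINT w|P. indicator E w) * (LINT w|P. (compensated A w)\<^sup>2)"
    using indep_product[OF A indicator_filtration[OF E], of "\<lambda>x. (x - measure nu A)\<^sup>2"] compensated_sq[of A] A E'
    unfolding compensated_def by (simp add: P.emeasure_eq_measure)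
  then show ?thesis using s E' by simp
qed

text \<open>Polarisation: the conditional variances on \<open>A\<close>, \<open>B\<close> and their
  union determine the mixed term, and additivity of the intensity makes it zero.\<close>

lemma conditional_covariance_disjoint:
  assumes A: "after A" "after B" "A \<inter> B = {}" and E: "E \<in> sets (noise_filtration P D u)"
  shows "(LINT w|P. indicator E w * (compensated A w * compensated B w)) = 0"
proof -
  have E': "E \<in> sets P" using E filtration_sub by blast
  have AB: "after (A \<union> B)" using A by auto
  have i: "integrable P (\<lambda>w. indicator E w * (compensated C w)\<^sup>2)" if "after C" for C
    using compensated_sq[of C] that E' by (intro integrable_mult_indicator[where 'b = real, simplified]) auto
  have "(LINT w|P. indicator E w * (compensated A w * compensated B w)) =
      (LINT w|P. (indicator E w * (compensated (A \<union> B) w)\<^sup>2 - indicator E w * (compensated A w)\<^sup>2 - indicator E w * (compensated B w)\<^sup>2) / 2)"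
    using A compensated_union by (intro Bochner_Integration.integral_cong) (auto simp: power2_sum algebra_simps)
  also have "\<dots> = (measure P E * measure nu (A \<union> B) - measure P E * measure nu A - measure P E * measure nu B) / 2"
    using i[OF AB] i[OF A(1)] i[OF A(2)] conditional_variance[OF AB E] conditional_variance[OF A(1) E]
      conditional_variance[OF A(2) E] by simp
  also have "measure nu (A \<union> B) = measure nu A + measure nu B"
    using A by (intro finite_measure.finite_measure_Union[OF finite_nu]) auto
  finally show ?thesis by (simp add: algebra_simps)
qed

text \<open>Both sets are split along their intersection. Of the four products only the square of
  the common part survives.\<close>

lemma conditional_covariance:
  assumes A: "after A" "after B" and E: "E \<in> sets (noise_filtration P D u)"
  shows "(LINT w|P. indicator E w * (compensated A w * compensated B w)) = measure P E * measure nu (A \<inter> B)"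
proof -
  have E': "E \<in> sets P" using E filtration_sub by blast
  let ?U = "A - B" and ?V = "B - A" and ?W = "A \<inter> B"
  have a: "after ?U" "after ?V" "after ?W" using A by auto
  have i: "integrable P (\<lambda>w. indicator E w * (compensated C w * compensated C' w))" if "after C" "after C'" for C C'
    using compensated_mult_integrable[of C C'] that E' by (intro integrable_mult_indicator[where 'b = real, simplified]) auto
  have d: "A = ?U \<union> ?W" "B = ?V \<union> ?W" by auto
  have eq: "compensated A w = compensated ?U w + compensated ?W w" "compensated B w = compensated ?V w + compensated ?W w" if "w \<in> space P" for w
    using compensated_union[OF _ _ _ that, of ?U ?W] compensated_union[OF _ _ _ that, of ?V ?W] a unfolding d[symmetric] by blast+
  note ii = i[OF a(1,2)] i[OF a(1,3)] i[OF a(3,2)] i[OF a(3,3)]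
  have "(LINT w|P. indicator E w * (compensated A w * compensated B w)) =
      (LINT w|P. indicator E w * (compensated ?U w * compensated ?V w) + indicator E w * (compensated ?U w * compensated ?W w)
        + indicator E w * (compensated ?W w * compensated ?V w) + indicator E w * (compensated ?W w * compensated ?W w))"
    by (rule Bochner_Integration.integral_cong[OF refl]) (simp only: eq, simp add: algebra_simps)
  also have "\<dots> = (LINT w|P. indicator E w * (compensated ?U w * compensated ?V w)) + (LINT w|P. indicator E w * (compensated ?U w * compensated ?W w))
        + (LINT w|P. indicator E w * (compensated ?W w * compensated ?V w)) + (LINT w|P. indicator E w * (compensated ?W w * compensated ?W w))"
    using ii by (simp only: Bochner_Integration.integral_add Bochner_Integration.integrable_add)
  also have "(LINT w|P. indicator E w * (compensated ?U w * compensated ?V w)) = 0"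
    by (rule conditional_covariance_disjoint[OF a(1,2) _ E]) auto
  also have "(LINT w|P. indicator E w * (compensated ?U w * compensated ?W w)) = 0"
    by (rule conditional_covariance_disjoint[OF a(1,3) _ E]) auto
  also have "(LINT w|P. indicator E w * (compensated ?W w * compensated ?V w)) = 0"
    by (rule conditional_covariance_disjoint[OF a(3,2) _ E]) auto
  also have "(LINT w|P. indicator E w * (compensated ?W w * compensated ?W w)) = measure P E * measure nu ?W"
    using conditional_variance[OF a(3) E] by (simp add: power2_eq_square)
  finally show ?thesis by simp
qed

end

end

section \<open>Orthogonality of predictable rectangles\<close>

lemma null_slab: "emeasure lborel (({0} :: real set) \<times> (UNIV :: (real \<times> real) set)) = 0"
proof -
  have "emeasure (lborel \<Otimes>\<^sub>M lborel) (({0} :: real set) \<times> (UNIV :: (real \<times> real) set)) = emeasure lborel {0::real} * emeasure lborel (UNIV :: (real \<times> real) set)"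
    by (rule lborel.emeasure_pair_measure_Times) auto
  then show ?thesis by (simp add: lborel_prod)
qed

lemma noise_filtration_mono: "A \<in> sets (noise_filtration P D s) \<Longrightarrow> s \<le> t \<Longrightarrow> A \<in> sets (noise_filtration P D t)"
  using noise_filtration_sets_mono by blast

context poisson_noise
begin

definition cell :: "real \<Rightarrow> real \<Rightarrow> real set \<Rightarrow> real set \<Rightarrow> (real \<times> real \<times> real) set" where
  "cell s t H B = ({s<..t} \<inter> {0..T}) \<times> H \<times> B"

definition mark_set :: "real set \<Rightarrow> real set \<Rightarrow> bool" where
  "mark_set H B \<longleftrightarrow> H \<in> sets borel \<and> H \<subseteq> {0..1} \<and> B \<in> sets borel \<and> B \<subseteq> {0..L}"

text \<open>
  Rectangles with \<open>s < 0\<close> account for the time \<open>0\<close>, which no half-open interval starting in \<open>[0,T]\<close> contains.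
\<close>
definition rects :: "('w \<times> real \<times> real \<times> real) set set" where
  "rects = {A \<times> cell s t H B | A s t H B. s \<le> T \<and> A \<in> sets (noise_filtration P D (max 0 s)) \<and> mark_set H B}"

lemma times_nu: "J \<in> sets borel \<Longrightarrow> J \<subseteq> {0..T} \<Longrightarrow> mark_set H B \<Longrightarrow> J \<times> H \<times> B \<in> sets nu"
  unfolding sets_nu box_def mark_set_def by (auto intro!: borel_Times)

lemma cell_nu: "mark_set H B \<Longrightarrow> cell s t H B \<in> sets nu"
  unfolding cell_def by (rule times_nu) auto

text \<open>The filtration records counts over time intervals that exclude 0, so the mass at time 0
  cannot be treated as part of the past. It is discarded as a null contribution instead.\<close>

lemma nu_time0: "A \<in> sets nu \<Longrightarrow> A \<subseteq> {0} \<times> UNIV \<Longrightarrow> measure nu A = 0"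
proof -
  assume A: "A \<in> sets nu" "A \<subseteq> {0} \<times> UNIV"
  have "emeasure nu A = emeasure lborel A" 
    using A(1) box_borel unfolding nu_def by (subst emeasure_restrict_space) (auto simp: sets_restrict_space_iff)
  also have "\<dots> \<le> emeasure lborel (({0} :: real set) \<times> (UNIV :: (real \<times> real) set))"
    by (rule emeasure_mono[OF A(2)]) (auto intro!: borel_Times)
  finally show ?thesis by (simp add: null_slab measure_def)
qed

lemma past_count_measurable:
  assumes c: "0 \<le> c" "c \<le> u" and HB: "mark_set H B"
  shows "(\<lambda>w. measure (D i w) ({0<..c} \<times> H \<times> B)) \<in> borel_measurable (noise_filtration P D u)"
proof -
  have "(\<lambda>w. emeasure (D i w) ({0<..c} \<times> H \<times> B)) \<in> borel_measurable (noise_filtration P D u)"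
  proof (rule measurableI)
    fix C :: "ennreal set" assume C: "C \<in> sets borel"
    have "B \<subseteq> {0..}" using HB by (auto simp: mark_set_def)
    then have "{w \<in> space P. emeasure (D i w) ({0<..c} \<times> H \<times> B) \<in> C} \<in> sets (noise_filtration P D u)"
      unfolding sets_noise_filtration using c HB C unfolding mark_set_def
      by (intro sigma_sets.Basic UnI1 CollectI exI[of _ i] exI[of _ c] exI[of _ H] exI[of _ B] exI[of _ C]) auto
    moreover have "(\<lambda>w. emeasure (D i w) ({0<..c} \<times> H \<times> B)) -` C \<inter> space (noise_filtration P D u) =
        {w \<in> space P. emeasure (D i w) ({0<..c} \<times> H \<times> B) \<in> C}" by auto
    ultimately show "(\<lambda>w. emeasure (D i w) ({0<..c} \<times> H \<times> B)) -` C \<inter> space (noise_filtration P D u) \<in> sets (noise_filtration P D u)"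
      by simp
  qed simp
  then show ?thesis unfolding measure_def by measurable
qed

text \<open>The rectangle that starts earlier is cut at the start \<open>u\<close> of the later one.
  Its part before \<open>u\<close> is known at time \<open>u\<close>, hence uncorrelated with the
  later increment; the parts after \<open>u\<close> contribute the intensity of their intersection,
  conditionally on the two events.\<close>

lemma rect_orthogonal_le:
  assumes s: "s \<le> T" "A \<in> sets (noise_filtration P D (max 0 s))" "mark_set H B"
    and s': "s' \<le> T" "A' \<in> sets (noise_filtration P D (max 0 s'))" "mark_set H' B'"
    and le: "s \<le> s'"
  shows "(LINT w|P. (indicator A w * compensated (cell s t H B) w) * (indicator A' w * compensated (cell s' t' H' B') w)) =
    measure P (A \<inter> A') * measure nu (cell s t H B \<inter> cell s' t' H' B')"
proof -
  define u where "u = max 0 s'"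
  have u: "u \<le> T" "0 \<le> u" "s' \<le> u" using T s'(1) by (auto simp: u_def)
  \<comment> \<open>The part before \<open>u\<close> is written as a half-open interval from
    \<open>a\<close> to \<open>b\<close>. The outer \<open>max\<close> in \<open>b\<close> makes it
    empty, rather than reversed, when the rectangle ends before \<open>a\<close>.\<close>
  define a where "a = max 0 s"
  define b where "b = max a (min t u)"
  have ab: "0 \<le> a" "a \<le> b" "b \<le> u" using le u by (auto simp: a_def b_def u_def)
  let ?HB = "H \<times> B" and ?HB' = "H' \<times> B'"
  let ?r = "cell s t H B" and ?r' = "cell s' t' H' B'"
  define r0 where "r0 = ({s<..t} \<inter> {0}) \<times> ?HB"
  define r1 where "r1 = {a<..b} \<times> ?HB"
  define r2 where "r2 = ({s<..t} \<inter> {u<..T}) \<times> ?HB"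
  define q0 where "q0 = ({s'<..t'} \<inter> {0}) \<times> ?HB'"
  define q2 where "q2 = ({s'<..t'} \<inter> {u<..T}) \<times> ?HB'"
  have r_nu: "r0 \<in> sets nu" "r1 \<in> sets nu" "r2 \<in> sets nu" "q0 \<in> sets nu" "q2 \<in> sets nu"
    unfolding r0_def r1_def r2_def q0_def q2_def using s s' u ab by (auto intro!: times_nu)
  have r_eq: "?r = r0 \<union> (r1 \<union> r2)" "?r' = q0 \<union> q2"
    using ab u le by (auto simp: cell_def r0_def r1_def r2_def q0_def q2_def a_def b_def u_def)
  have r_disj: "r0 \<inter> (r1 \<union> r2) = {}" "r1 \<inter> r2 = {}" "q0 \<inter> q2 = {}"
    using ab u by (auto simp: r0_def r1_def r2_def q0_def q2_def)
  have AE0: "AE w in P. compensated r0 w = 0" "AE w in P. compensated q0 w = 0"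
    using r_nu by (intro compensated_null nu_time0; auto simp: r0_def q0_def)+
  have AE_r: "AE w in P. compensated ?r w = compensated r1 w + compensated r2 w"
    using AE0(1) AE_space unfolding r_eq(1)
    by eventually_elim (use r_nu r_disj in \<open>simp add: compensated_union sets.Un\<close>)
  have AE_r': "AE w in P. compensated ?r' w = compensated q2 w"
    using AE0(2) AE_space unfolding r_eq(2)
    by eventually_elim (use r_nu r_disj in \<open>simp add: compensated_union\<close>)
  let ?F = "noise_filtration P D u"
  have AA: "A \<inter> A' \<in> sets ?F"
    unfolding u_def by (intro sets.Int noise_filtration_mono[OF s(2)] noise_filtration_mono[OF s'(2)]) (use le in auto)
  have AAP: "A \<in> sets P" "A' \<in> sets P"
  proof -
    have "max 0 s \<le> T" "max 0 s' \<le> T" using s s' T by auto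
    then show "A \<in> sets P" "A' \<in> sets P" using s(2) s'(2) filtration_sub by blast+
  qed
  let ?d = "\<lambda>c w. measure (D i w) ({0<..c} \<times> ?HB)"
  have d_nu: "{0<..a} \<times> ?HB \<in> sets nu" "{0<..b} \<times> ?HB \<in> sets nu"
    using s(3) ab u by (auto intro!: times_nu)
  \<comment> \<open>A version of the past increment expressed through counts on (0,b] and (0,a], the
    only counts that generate the filtration. It agrees almost surely with the compensated mass of
    \<open>r1\<close> on the two events.\<close>
  define g where "g = (\<lambda>w. indicator (A \<inter> A') w * (?d b w - ?d a w - measure nu r1))"
  have gF: "g \<in> borel_measurable ?F"
  proof -
    have [measurable]: "?d a \<in> borel_measurable ?F" "?d b \<in> borel_measurable ?F"
      by (rule past_count_measurable; use ab s(3) in auto)+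
    have [measurable]: "A \<inter> A' \<in> sets ?F" by (rule AA)
    show ?thesis unfolding g_def by measurable
  qed
  have AE_g: "AE w in P. indicator (A \<inter> A') w * compensated r1 w = g w"
    using AE_NL[OF d_nu(1)] AE_NL[OF d_nu(2)] AE_space
  proof eventually_elim
    case (elim w)
    have "{0<..b} \<times> ?HB = ({0<..a} \<times> ?HB) \<union> r1" using ab by (auto simp: r1_def)
    moreover have dj: "({0<..a} \<times> ?HB) \<inter> r1 = {}" by (auto simp: r1_def)
    ultimately have "measure (NL w) ({0<..b} \<times> ?HB) = measure (NL w) ({0<..a} \<times> ?HB) + measure (NL w) r1"
      using finite_measure.finite_measure_Union[OF finite_NL[OF elim(3)], of "{0<..a} \<times> ?HB" r1] d_nu r_nu(2) elim(3)
        dj by (simp add: sets_NL)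
    then show ?case using elim by (simp add: g_def compensated_def)
  qed
  have gi: "integrable P g"
  proof (rule integrable_cong_AE_imp[OF _ filtration_measurable[OF u(1) gF]])
    show "integrable P (\<lambda>w. indicator (A \<inter> A') w * compensated r1 w)"
      using compensated_integrable[OF r_nu(2)] AAP by (intro integrable_mult_indicator[where 'b = real, simplified]) auto
    show "AE w in P. indicator (A \<inter> A') w * compensated r1 w = g w" by (rule AE_g)
  qed
  have aft: "after u r2" "after u q2" using r_nu by (auto simp: r2_def q2_def)
  have m: "compensated C \<in> borel_measurable P" if "C \<in> sets nu" for C using compensated_measurable[OF that] .
  have cm: "compensated ?r \<in> borel_measurable P" "compensated ?r' \<in> borel_measurable P" "compensated r1 \<in> borel_measurable P" "compensated r2 \<in> borel_measurable P" "compensated q2 \<in> borel_measurable P"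
    using cell_nu s(3) s'(3) r_nu m by auto
  have i2: "integrable P (\<lambda>w. indicator (A \<inter> A') w * (compensated r2 w * compensated q2 w))"
    using compensated_mult_integrable[OF r_nu(3) r_nu(5)] AAP by (intro integrable_mult_indicator[where 'b = real, simplified]) auto
  have i1: "integrable P (\<lambda>w. g w * compensated q2 w)"
  proof (rule integrable_cong_AE_imp)
    show "integrable P (\<lambda>w. indicator (A \<inter> A') w * (compensated r1 w * compensated q2 w))"
      using compensated_mult_integrable[OF r_nu(2) r_nu(5)] AAP by (intro integrable_mult_indicator[where 'b = real, simplified]) auto
    show "(\<lambda>w. g w * compensated q2 w) \<in> borel_measurable P" using filtration_measurable[OF u(1) gF] cm by auto
    show "AE w in P. indicator (A \<inter> A') w * (compensated r1 w * compensated q2 w) = g w * compensated q2 w"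
      using AE_g 
    proof eventually_elim
      case (elim w)
      show ?case unfolding elim[symmetric] by (simp add: mult.assoc)
    qed
  qed
  have "(LINT w|P. (indicator A w * compensated ?r w) * (indicator A' w * compensated ?r' w)) =
      (LINT w|P. g w * compensated q2 w + indicator (A \<inter> A') w * (compensated r2 w * compensated q2 w))"
  proof (rule integral_cong_AE)
    show "(\<lambda>w. (indicator A w * compensated ?r w) * (indicator A' w * compensated ?r' w)) \<in> borel_measurable P"
      using cm AAP by auto
    show "(\<lambda>w. g w * compensated q2 w + indicator (A \<inter> A') w * (compensated r2 w * compensated q2 w)) \<in> borel_measurable P"
      using cm AAP filtration_measurable[OF u(1) gF] by auto
    show "AE w in P. (indicator A w * compensated ?r w) * (indicator A' w * compensated ?r' w) =
        g w * compensated q2 w + indicator (A \<inter> A') w * (compensated r2 w * compensated q2 w)"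
      using AE_r AE_r' AE_g
    proof eventually_elim
      case (elim w)
      show ?case unfolding elim(1,2) elim(3)[symmetric] by (simp add: indicator_def algebra_simps)
    qed
  qed
  also have "\<dots> = (LINT w|P. g w * compensated q2 w) + (LINT w|P. indicator (A \<inter> A') w * (compensated r2 w * compensated q2 w))"
    using i1 i2 by (rule Bochner_Integration.integral_add)
  also have "\<dots> = measure P (A \<inter> A') * measure nu (r2 \<inter> q2)"
    using past_times_increment[OF u(1) aft(2) gF gi] conditional_covariance[OF u(1) aft AA] by simp
  \<comment> \<open>The intersection of the cells can exceed that of the later parts at time 0 only,
    where there is no intensity.\<close>
  also have "measure nu (r2 \<inter> q2) = measure nu (?r \<inter> ?r')"
  proof -
    let ?n = "?r \<inter> ?r' \<inter> ({0} \<times> UNIV)"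
    have z: "({0} :: real set) \<times> (UNIV :: (real \<times> real) set) \<in> sets borel" by (intro borel_Times) auto
    have n: "?n \<in> sets nu" using cell_nu[OF s(3), of s t] cell_nu[OF s'(3), of s' t'] z unfolding sets_nu by blast
    have e: "?r \<inter> ?r' = (r2 \<inter> q2) \<union> ?n"
      using u le by (auto simp: cell_def r2_def q2_def u_def)
    have "measure nu ((r2 \<inter> q2) \<union> ?n) = measure nu (r2 \<inter> q2) + measure nu ?n"
      using r_nu n u by (intro finite_measure.finite_measure_Union[OF finite_nu]) (auto simp: r2_def)
    also have "measure nu ?n = 0" using n by (rule nu_time0) auto
    finally show ?thesis using e by simp
  qed
  finally show ?thesis .
qed

lemma rect_orthogonal:
  assumes s: "s \<le> T" "A \<in> sets (noise_filtration P D (max 0 s))" "mark_set H B"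
    and s': "s' \<le> T" "A' \<in> sets (noise_filtration P D (max 0 s'))" "mark_set H' B'"
  shows "(LINT w|P. (indicator A w * compensated (cell s t H B) w) * (indicator A' w * compensated (cell s' t' H' B') w)) =
    measure P (A \<inter> A') * measure nu (cell s t H B \<inter> cell s' t' H' B')"
proof (cases "s \<le> s'")
  case True
  then show ?thesis by (rule rect_orthogonal_le[OF assms])
next
  case False
  then show ?thesis using rect_orthogonal_le[OF s' s, of t' t] by (simp add: mult.commute Int_commute)
qed

lemma rectsI: "s \<le> T \<Longrightarrow> A \<in> sets (noise_filtration P D (max 0 s)) \<Longrightarrow> mark_set H B \<Longrightarrow> A \<times> cell s t H B \<in> rects"
  unfolding rects_def by blast

lemma rects_Pow: "rects \<subseteq> Pow (space P \<times> box)"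
proof
  fix R assume "R \<in> rects"
  then obtain A s t H B where R: "R = A \<times> cell s t H B" "s \<le> T" "A \<in> sets (noise_filtration P D (max 0 s))" "mark_set H B"
    unfolding rects_def by blast
  show "R \<in> Pow (space P \<times> box)" using sets.sets_into_space[OF R(3)] cell_nu[OF R(4), of s t] R(1) by (auto simp: sets_nu)
qed

lemma rects_Int_stable: "Int_stable rects"
proof (rule Int_stableI)
  fix R R' assume "R \<in> rects" "R' \<in> rects"
  then obtain A s t H B A' s' t' H' B' where
    R: "R = A \<times> cell s t H B" "s \<le> T" "A \<in> sets (noise_filtration P D (max 0 s))" "mark_set H B" and
    R': "R' = A' \<times> cell s' t' H' B'" "s' \<le> T" "A' \<in> sets (noise_filtration P D (max 0 s'))" "mark_set H' B'"
    unfolding rects_def by blast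
  have eq: "R \<inter> R' = (A \<inter> A') \<times> cell (max s s') (min t t') (H \<inter> H') (B \<inter> B')"
    unfolding R R' cell_def by auto
  have "A \<inter> A' \<in> sets (noise_filtration P D (max 0 (max s s')))"
    by (intro sets.Int noise_filtration_mono[OF R(3)] noise_filtration_mono[OF R'(3)]) auto
  moreover have "mark_set (H \<inter> H') (B \<inter> B')" using R(4) R'(4) by (auto simp: mark_set_def)
  ultimately show "R \<inter> R' \<in> rects" unfolding eq using R(2) R'(2) by (intro rectsI) auto
qed

lemma space_noise_top: "space P \<in> sets (noise_filtration P D t)"
  using sets.top[of "noise_filtration P D t"] by simp

lemma mark_set_full: "mark_set {0..1} {0..L}" by (auto simp: mark_set_def)

lemma rects_top: "space P \<times> box \<in> rects"
proof -
  have "box = cell (-1) T {0..1} {0..L}" by (auto simp: box_def cell_def)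
  then show ?thesis using rectsI[of "-1" "space P" "{0..1}" "{0..L}" T] T mark_set_full space_noise_top by simp
qed

lemma predictable_isometry:
  assumes S: "S \<in> sigma_sets (space P \<times> box) rects"
  defines "M \<equiv> \<lambda>w. measure (NL w) (Pair w -` S) - measure nu (Pair w -` S)"
  shows "integrable P (\<lambda>w. (M w)\<^sup>2)" "(LINT w|P. (M w)\<^sup>2) = (LINT w|P. measure nu (Pair w -` S))"
    "\<forall>w\<in>space P. Pair w -` S \<in> sets nu" "M \<in> borel_measurable P"
proof -
  have rep: "\<exists>A s t H B. R = A \<times> cell s t H B \<and> s \<le> T \<and> A \<in> sets (noise_filtration P D (max 0 s)) \<and> mark_set H B \<and> A \<in> sets P"
    if RR: "R \<in> rects" for R
  proof -
    obtain A s t H B where R: "R = A \<times> cell s t H B" "s \<le> T" "A \<in> sets (noise_filtration P D (max 0 s))" "mark_set H B"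
      using RR unfolding rects_def by blast
    have "max 0 s \<le> T" using R(2) T by auto
    then have "A \<in> sets P" using R(3) filtration_sub by blast
    then show ?thesis using R by blast
  qed
  have sec: "Pair w -` R \<in> sets nu" if RR: "R \<in> rects" for R w
  proof -
    obtain A s t H B where R: "R = A \<times> cell s t H B" "mark_set H B" using rep[OF RR] by blast
    show ?thesis unfolding R(1) using cell_nu[OF R(2)] by (cases "w \<in> A") auto
  qed
  have mt: "measure K (Pair w -` (A \<times> r)) = indicator A w * measure K r" for K :: "(real \<times> real \<times> real) measure" and A :: "'w set" and r w
    by (cases "w \<in> A") auto
  have m1: "(\<lambda>w. measure (NL w) (Pair w -` R)) \<in> borel_measurable P" if RR: "R \<in> rects" for R
  proof -
    obtain A s t H B where R: "R = A \<times> cell s t H B" "mark_set H B" "A \<in> sets P" using rep[OF RR] by blast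
    show ?thesis unfolding R(1) mt using NL_measurable[OF cell_nu[OF R(2)]] R(3) by auto
  qed
  have m2: "(\<lambda>w. measure nu (Pair w -` R)) \<in> borel_measurable P" if RR: "R \<in> rects" for R
  proof -
    obtain A s t H B where R: "R = A \<times> cell s t H B" "mark_set H B" "A \<in> sets P" using rep[OF RR] by blast
    show ?thesis unfolding R(1) mt using R(3) by auto
  qed
  have orth: "(LINT w|P. (measure (NL w) (Pair w -` R) - measure nu (Pair w -` R)) *
      (measure (NL w) (Pair w -` R') - measure nu (Pair w -` R'))) = (LINT w|P. measure nu (Pair w -` (R \<inter> R')))"
    if RR: "R \<in> rects" "R' \<in> rects" for R R'
  proof -
    obtain A s t H B where R: "R = A \<times> cell s t H B" "s \<le> T" "A \<in> sets (noise_filtration P D (max 0 s))" "mark_set H B" "A \<in> sets P"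
      using rep[OF RR(1)] by blast
    obtain A' s' t' H' B' where R': "R' = A' \<times> cell s' t' H' B'" "s' \<le> T" "A' \<in> sets (noise_filtration P D (max 0 s'))" "mark_set H' B'" "A' \<in> sets P"
      using rep[OF RR(2)] by blast
    have "R \<inter> R' = (A \<inter> A') \<times> (cell s t H B \<inter> cell s' t' H' B')" unfolding R R' by blast
    then have "(LINT w|P. measure nu (Pair w -` (R \<inter> R'))) = measure P (A \<inter> A') * measure nu (cell s t H B \<inter> cell s' t' H' B')"
      using R(5) R'(5) by (simp only: mt) (simp add: P.emeasure_eq_measure)
    moreover have "(LINT w|P. (measure (NL w) (Pair w -` R) - measure nu (Pair w -` R)) *
      (measure (NL w) (Pair w -` R') - measure nu (Pair w -` R'))) =
      (LINT w|P. (indicator A w * compensated (cell s t H B) w) * (indicator A' w * compensated (cell s' t' H' B') w))"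
      unfolding R(1) R'(1) mt compensated_def by (simp add: right_diff_distrib)
    ultimately show ?thesis using rect_orthogonal[OF R(2-4) R'(2-4)] by simp
  qed
  note iso = kernel_isometry[OF P finite_nu finite_NL sets_NL rects_Int_stable, unfolded space_nu,
      OF _ _ rects_Pow rects_top sec m1 m2 NL_moments(3)[OF box_nu] orth S]
  show "integrable P (\<lambda>w. (M w)\<^sup>2)" "(LINT w|P. (M w)\<^sup>2) = (LINT w|P. measure nu (Pair w -` S))"
    "\<forall>w\<in>space P. Pair w -` S \<in> sets nu" "M \<in> borel_measurable P"
    unfolding M_def by (rule iso; simp)+
qed

end

section \<open>Controls as predictable sets, and the deviation of thinned noise\<close>

lemma predictable_generators_Pow:
  "{A \<times> {0} | A. A \<in> sets (noise_filtration P D 0)} \<union>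
   {A \<times> {s<..t} | A s t. 0 \<le> s \<and> s < t \<and> t \<le> T \<and> A \<in> sets (noise_filtration P D s)}
   \<subseteq> Pow (space P \<times> {0..T})" if "0 < T"
  using that by (auto dest!: sets.sets_into_space)

lemma measurable_predictableI:
  assumes T: "0 < T" and f: "f \<in> space M \<rightarrow> space P \<times> {0..T}"
    and 0: "\<And>A. A \<in> sets (noise_filtration P D 0) \<Longrightarrow> f -` (A \<times> {0}) \<inter> space M \<in> sets M"
    and st: "\<And>A s t. 0 \<le> s \<Longrightarrow> s < t \<Longrightarrow> t \<le> T \<Longrightarrow> A \<in> sets (noise_filtration P D s) \<Longrightarrow>
      f -` (A \<times> {s<..t}) \<inter> space M \<in> sets M"
  shows "f \<in> measurable M (predictable_sigma P D T)"
  unfolding predictable_sigma_def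
  by (rule measurable_measure_of[OF predictable_generators_Pow[OF T] f]) (use 0 st in blast)

lemma XX_borel [measurable]: "XX t \<in> sets borel"
  unfolding XX_def by (intro borel_Times) auto

text \<open>For a frozen sample point a predictable generator becomes either empty or a Borel set of
  times, so the control is an ordinary Borel function.\<close>

lemma A_plus_section:
  assumes T: "0 < T" and \<phi>: "\<phi> \<in> A_plus P D T" and w: "w \<in> space P"
  shows "\<phi> w \<in> borel_measurable (restrict_space borel (XX T))" "\<And>p. p \<in> XX T \<Longrightarrow> 0 \<le> \<phi> w p"
proof -
  let ?M = "restrict_space borel (XX T) :: (real \<times> real) measure"
  have spM: "space ?M = XX T" by (simp add: space_restrict_space)
  have spD: "fst p \<in> {0..T}" "snd p \<in> {0..1}" if "p \<in> space ?M" for p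
    using that unfolding spM by (auto simp: XX_def)
  have cl: "f -` C \<inter> XX T \<in> sets ?M" if "continuous_on UNIV f" "C \<in> sets borel" for f :: "real \<times> real \<Rightarrow> real" and C
    using measurable_sets[OF borel_measurable_continuous_onI[OF that(1)] that(2)]
    by (simp add: sets_restrict_space_iff sets.Int)
  have m1: "(\<lambda>p. (w, fst p)) \<in> measurable ?M (predictable_sigma P D T)"
  proof (rule measurable_predictableI[OF T])
    show "(\<lambda>p. (w, fst p)) \<in> space ?M \<rightarrow> space P \<times> {0..T}" using w spD by auto
    have *: "(\<lambda>p. (w, fst p)) -` (A \<times> J) \<inter> space ?M \<in> sets ?M" if J: "J \<in> sets borel" for A J
    proof -
      have "(\<lambda>p. (w, fst p)) -` (A \<times> J) \<inter> space ?M = (if w \<in> A then fst -` J \<inter> XX T else {})" by (auto simp: spM)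
      then show ?thesis using cl[of fst J] J by (simp add: continuous_intros)
    qed
    show "(\<lambda>p. (w, fst p)) -` (A \<times> {0}) \<inter> space ?M \<in> sets ?M" for A by (rule *) auto
    show "(\<lambda>p. (w, fst p)) -` (A \<times> {s<..t}) \<inter> space ?M \<in> sets ?M" for A s t by (rule *) auto
  qed
  have m2: "snd \<in> measurable ?M (restrict_space borel {0..1})"
    by (rule measurable_restrict_space2) (use spD in \<open>auto intro!: measurable_restrict_space1 borel_measurable_continuous_onI continuous_intros\<close>)
  have "(\<lambda>p. ((w, fst p), snd p)) \<in> measurable ?M (predictable_sigma P D T \<Otimes>\<^sub>M restrict_space borel {0..1})"
    using m1 m2 by (rule measurable_Pair)
  from measurable_compose[OF this, of "\<lambda>((w, s), y). \<phi> w (s, y)" borel]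
  show "\<phi> w \<in> borel_measurable ?M" using \<phi> by (simp add: A_plus_def)
  show "\<And>p. p \<in> XX T \<Longrightarrow> 0 \<le> \<phi> w p" using \<phi> w by (simp add: A_plus_def)
qed

text \<open>Integrating out the mark first leaves fibres of length \<open>f\<close>.\<close>

lemma emeasure_subgraph:
  fixes f :: "real \<times> real \<Rightarrow> real"
  assumes S: "{(s, y, z). (s, y) \<in> E \<and> 0 \<le> z \<and> z < f (s, y)} \<in> sets borel" and f: "\<And>p. p \<in> E \<Longrightarrow> 0 \<le> f p"
    and fm: "(\<lambda>p. ennreal (f p) * indicator E p) \<in> borel_measurable borel"
  shows "emeasure lborel {(s, y, z). (s, y) \<in> E \<and> 0 \<le> z \<and> z < f (s, y)} =
    (\<integral>\<^sup>+p. ennreal (f p) * indicator E p \<partial>lborel)"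
proof -
  let ?S = "{(s, y, z). (s, y) \<in> E \<and> 0 \<le> z \<and> z < f (s, y)}"
  have Sm: "indicator ?S \<in> borel_measurable (lborel \<Otimes>\<^sub>M (lborel \<Otimes>\<^sub>M (lborel :: real measure)) :: (real \<times> real \<times> real) measure)"
    using S by (simp add: lborel_prod)
  have fm': "(\<lambda>p. ennreal (f p) * indicator E p) \<in> borel_measurable (lborel \<Otimes>\<^sub>M lborel)"
    using fm by (simp add: lborel_prod)
  have "emeasure lborel ?S = (\<integral>\<^sup>+x. indicator ?S x \<partial>(lborel \<Otimes>\<^sub>M (lborel \<Otimes>\<^sub>M lborel)))"
    using S by (simp add: lborel_prod)
  also have "\<dots> = (\<integral>\<^sup>+s. \<integral>\<^sup>+q. indicator ?S (s, q) \<partial>(lborel \<Otimes>\<^sub>M lborel) \<partial>lborel)"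
    by (subst lborel_pair.P.nn_integral_fst[symmetric]) (use Sm in auto)
  also have "\<dots> = (\<integral>\<^sup>+s. \<integral>\<^sup>+y. \<integral>\<^sup>+z. indicator ?S (s, y, z) \<partial>lborel \<partial>lborel \<partial>lborel)"
  proof (intro nn_integral_cong)
    fix s :: real
    have "(\<lambda>q. indicator ?S (s, q) :: ennreal) \<in> borel_measurable (lborel \<Otimes>\<^sub>M lborel)"
      using Sm by (rule measurable_Pair2) simp
    then show "(\<integral>\<^sup>+q. indicator ?S (s, q) \<partial>(lborel \<Otimes>\<^sub>M lborel)) = (\<integral>\<^sup>+y. \<integral>\<^sup>+z. indicator ?S (s, y, z) \<partial>lborel \<partial>lborel)"
      by (subst lborel.nn_integral_fst[symmetric]) auto
  qed
  also have "\<dots> = (\<integral>\<^sup>+s. \<integral>\<^sup>+y. ennreal (f (s, y)) * indicator E (s, y) \<partial>lborel \<partial>lborel)"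
  proof (intro nn_integral_cong)
    fix s y :: real
    have "(\<integral>\<^sup>+z. indicator ?S (s, y, z) \<partial>lborel) = (\<integral>\<^sup>+z. indicator E (s, y) * indicator {0..<f (s, y)} z \<partial>lborel)"
      by (intro nn_integral_cong) (auto simp: indicator_def)
    also have "\<dots> = indicator E (s, y) * emeasure lborel {0..<f (s, y)}"
      by (subst nn_integral_cmult) auto
    also have "\<dots> = ennreal (f (s, y)) * indicator E (s, y)" using f[of "(s, y)"] by (cases "(s, y) \<in> E") auto
    finally show "(\<integral>\<^sup>+z. indicator ?S (s, y, z) \<partial>lborel) = ennreal (f (s, y)) * indicator E (s, y)" .
  qed
  also have "\<dots> = (\<integral>\<^sup>+p. ennreal (f p) * indicator E p \<partial>(lborel \<Otimes>\<^sub>M lborel))"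
    using lborel.nn_integral_fst[OF fm'] by simp
  finally show ?thesis by (simp add: lborel_prod)
qed

lemma emeasure_control_measure:
  assumes "h \<in> borel_measurable (restrict_space borel (XX T))" "E \<in> sets borel" "E \<subseteq> XX T"
  shows "emeasure (control_measure T h) E = (\<integral>\<^sup>+p. ennreal (h p) * indicator E p \<partial>lborel)"
proof -
  have E: "E \<in> sets (restrict_space lborel (XX T))" using assms by (simp add: sets_restrict_space_iff)
  have h: "h \<in> borel_measurable (restrict_space lborel (XX T))"
    using assms(1) by (simp cong: measurable_cong_sets add: sets_restrict_space_cong[of lborel borel])
  have "emeasure (control_measure T h) E = (\<integral>\<^sup>+p. ennreal (h p) * indicator E p \<partial>restrict_space lborel (XX T))"
    unfolding control_measure_def using E h by (subst emeasure_density) auto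
  also have "\<dots> = (\<integral>\<^sup>+p. ennreal (h p) * indicator E p * indicator (XX T) p \<partial>lborel)"
    by (rule nn_integral_restrict_space) simp
  also have "\<dots> = (\<integral>\<^sup>+p. ennreal (h p) * indicator E p \<partial>lborel)"
    using assms(3) by (intro nn_integral_cong) (auto simp: indicator_def)
  finally show ?thesis .
qed

lemma restricted_density_measurable:
  fixes h :: "real \<times> real \<Rightarrow> real"
  assumes "h \<in> borel_measurable (restrict_space borel (XX T))" "E \<in> sets borel" "E \<subseteq> XX T"
  shows "(\<lambda>p. ennreal (h p) * indicator E p) \<in> borel_measurable borel"
proof -
  have "(\<lambda>p. ennreal (h p) * indicator E p * indicator (XX T) p) \<in> borel_measurable borel"
  proof (subst borel_measurable_restrict_space_iff_ennreal[symmetric])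
    have i: "(indicator E :: _ \<Rightarrow> ennreal) \<in> borel_measurable (restrict_space borel (XX T))"
      by (rule measurable_restrict_space1) (use assms in auto)
    show "(\<lambda>p. ennreal (h p) * indicator E p) \<in> borel_measurable (restrict_space borel (XX T))"
      by (rule borel_measurable_times_ennreal[OF measurable_compose[OF assms(1) measurable_ennreal] i])
  qed simp
  moreover have "(\<lambda>p. ennreal (h p) * indicator E p * indicator (XX T) p) = (\<lambda>p. ennreal (h p) * indicator E p)"
    using assms(3) by (auto simp: indicator_def fun_eq_iff)
  ultimately show ?thesis by simp
qed

context poisson_noise
begin

text \<open>This is the set to which the isometry will be applied. The \<sigma>-algebra of the
  rectangles makes the three coordinates and the projection to the predictable \<sigma>-algebra
  measurable, hence also the comparison of the mark with the control.\<close>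

lemma graph_predictable:
  assumes \<phi>: "\<phi> \<in> A_plus P D T" and E: "E \<in> sets borel"
  shows "{(w, s, y, z). w \<in> space P \<and> (s, y, z) \<in> box \<and> (s, y) \<in> E \<and> z < c * \<phi> w (s, y)}
    \<in> sigma_sets (space P \<times> box) rects"
proof -
  define M where "M = sigma (space P \<times> box) rects"
  have sM: "sets M = sigma_sets (space P \<times> box) rects" "space M = space P \<times> box"
    unfolding M_def using rects_Pow by (auto intro: sets_measure_of space_measure_of)
  have rM: "R \<in> sets M" if "R \<in> rects" for R using that sM by auto
  have m1: "(\<lambda>(w, s, y, z). (w, s)) \<in> measurable M (predictable_sigma P D T)"
  proof (rule measurable_predictableI[OF T])
    show "(\<lambda>(w, s, y, z). (w, s)) \<in> space M \<rightarrow> space P \<times> {0..T}" by (auto simp: sM box_def)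
    fix A assume A: "A \<in> sets (noise_filtration P D 0)"
    \<comment> \<open>The instant 0 is a cell starting at -1; its event still has to belong to the
      filtration at time \<open>max 0 (-1) = 0\<close> only.\<close>
    have "(\<lambda>(w, s, y, z). (w, s)) -` (A \<times> {0}) \<inter> space M = A \<times> cell (-1) 0 {0..1} {0..L}"
      using T sets.sets_into_space[OF A] by (auto simp: sM box_def cell_def)
    then show "(\<lambda>(w, s, y, z). (w, s)) -` (A \<times> {0}) \<inter> space M \<in> sets M"
      using A T mark_set_full by (auto intro!: rM rectsI)
  next
    fix A s t assume st: "0 \<le> s" "s < t" "t \<le> T" and A: "A \<in> sets (noise_filtration P D s)"
    have "(\<lambda>(w, s, y, z). (w, s)) -` (A \<times> {s<..t}) \<inter> space M = A \<times> cell s t {0..1} {0..L}"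
      using st sets.sets_into_space[OF A] by (auto simp: sM box_def cell_def)
    then show "(\<lambda>(w, s, y, z). (w, s)) -` (A \<times> {s<..t}) \<inter> space M \<in> sets M"
      using A T st mark_set_full by (auto intro!: rM rectsI)
  qed
  have top: "space P \<times> cell (-1) t H B \<in> sets M" if "mark_set H B" for t H B
    using that T space_noise_top by (intro rM rectsI) auto
  have ms: "(\<lambda>(w, s, y, z). s) \<in> borel_measurable M"
  proof (rule borel_measurableI_le)
    fix a
    have "{x \<in> space M. (case x of (w, s, y, z) \<Rightarrow> s) \<le> a} = space P \<times> cell (-1) a {0..1} {0..L}"
      by (auto simp: sM box_def cell_def)
    then show "{x \<in> space M. (case x of (w, s, y, z) \<Rightarrow> s) \<le> a} \<in> sets M" using top mark_set_full by simp
  qed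
  have my: "(\<lambda>(w, s, y, z). y) \<in> borel_measurable M"
  proof (rule borel_measurableI_le)
    fix a
    have "{x \<in> space M. (case x of (w, s, y, z) \<Rightarrow> y) \<le> a} = space P \<times> cell (-1) T ({0..1} \<inter> {..a}) {0..L}"
      by (auto simp: sM box_def cell_def)
    then show "{x \<in> space M. (case x of (w, s, y, z) \<Rightarrow> y) \<le> a} \<in> sets M" using top by (simp add: mark_set_def)
  qed
  have mz: "(\<lambda>(w, s, y, z). z) \<in> borel_measurable M"
  proof (rule borel_measurableI_le)
    fix a
    have "{x \<in> space M. (case x of (w, s, y, z) \<Rightarrow> z) \<le> a} = space P \<times> cell (-1) T {0..1} ({0..L} \<inter> {..a})"
      by (auto simp: sM box_def cell_def)
    then show "{x \<in> space M. (case x of (w, s, y, z) \<Rightarrow> z) \<le> a} \<in> sets M" using top by (simp add: mark_set_def)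
  qed
  have my': "(\<lambda>(w, s, y, z). y) \<in> measurable M (restrict_space borel {0..1})"
    by (rule measurable_restrict_space2[OF _ my]) (auto simp: sM box_def)
  have mp: "(\<lambda>x. ((\<lambda>(w, s, y, z). (w, s)) x, (\<lambda>(w, s, y, z). y) x)) \<in>
      measurable M (predictable_sigma P D T \<Otimes>\<^sub>M restrict_space borel {0..1})"
    using m1 my' by (rule measurable_Pair)
  have mphi: "(\<lambda>(w, s, y, z). \<phi> w (s, y)) \<in> borel_measurable M"
    using measurable_compose[OF mp, of "\<lambda>((w, s), y). \<phi> w (s, y)" borel] \<phi> by (simp add: A_plus_def case_prod_beta')
  have mE: "{x \<in> space M. (case x of (w, s, y, z) \<Rightarrow> (s, y)) \<in> E} \<in> sets M"
  proof -
    have "(\<lambda>x. ((\<lambda>(w, s, y, z). s) x, (\<lambda>(w, s, y, z). y) x)) \<in> borel_measurable M"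
      using ms my by (rule borel_measurable_Pair)
    from measurable_sets[OF this E] show ?thesis by (simp add: vimage_def Int_def conj_commute case_prod_beta')
  qed
  have mlt: "{x \<in> space M. (\<lambda>(w, s, y, z). z) x < c * (\<lambda>(w, s, y, z). \<phi> w (s, y)) x} \<in> sets M"
    using mz mphi by (intro borel_measurable_less) auto
  have "{(w, s, y, z). w \<in> space P \<and> (s, y, z) \<in> box \<and> (s, y) \<in> E \<and> z < c * \<phi> w (s, y)} =
      {x \<in> space M. (case x of (w, s, y, z) \<Rightarrow> (s, y)) \<in> E} \<inter>
      {x \<in> space M. (\<lambda>(w, s, y, z). z) x < c * (\<lambda>(w, s, y, z). \<phi> w (s, y)) x}"
    by (auto simp: sM)
  then show ?thesis using mE mlt unfolding sM(1)[symmetric] by auto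
qed

end

text \<open>Thinning followed by projection counts the points below the graph of \<psi>. This turns
  the controlled random measure into the mass of a predictable set.\<close>

lemma emeasure_thinned:
  assumes N: "sets N = sets (mark_measure T)" and \<psi>: "\<psi> \<in> borel_measurable (restrict_space borel (XX T))"
    and E: "E \<in> sets borel" "E \<subseteq> XX T"
  shows "emeasure (thinned T N \<psi>) E = emeasure N {(s, y, z). (s, y) \<in> E \<and> 0 \<le> z \<and> z < \<psi> (s, y)}"
    "{(s, y, z). (s, y) \<in> E \<and> 0 \<le> z \<and> z < \<psi> (s, y)} \<in> sets N"
proof -
  let ?X = "restrict_space borel (XX T) :: (real \<times> real) measure"
  have spN: "space N = mark_space T" using sets_eq_imp_space_eq[OF N] by (simp add: space_restrict_space)
  have bN: "f \<in> borel_measurable N" if "continuous_on UNIV f" for f :: "real \<times> real \<times> real \<Rightarrow> 'c :: topological_space"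
    using borel_measurable_continuous_onI[OF that] N
    by (simp cong: measurable_cong_sets add: measurable_restrict_space1)
  have g: "(\<lambda>(s, y, z). (s, y)) \<in> measurable N ?X"
  proof (rule measurable_restrict_space2)
    show "(\<lambda>(s, y, z). (s, y)) \<in> space N \<rightarrow> XX T" by (auto simp: spN mark_space_def XX_def)
    show "(\<lambda>(s, y, z). (s, y)) \<in> borel_measurable N" unfolding case_prod_beta' by (intro bN continuous_intros)
  qed
  have pz: "(\<lambda>(s, y, z). z) \<in> borel_measurable N" unfolding case_prod_beta' by (intro bN continuous_intros)
  have pf: "(\<lambda>(s, y, z). \<psi> (s, y)) \<in> borel_measurable N"
    using measurable_compose[OF g \<psi>] by (simp add: case_prod_beta')
  define H where "H = {x \<in> space N. 0 \<le> (\<lambda>(s, y, z). z) x} \<inter> {x \<in> space N. (\<lambda>(s, y, z). z) x < (\<lambda>(s, y, z). \<psi> (s, y)) x}"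
  have H: "H \<in> sets N" unfolding H_def
    using pz pf by (intro sets.Int borel_measurable_less borel_measurable_le) auto
  have im: "(\<lambda>(s, y, z). indicator {0..<\<psi> (s, y)} z :: ennreal) \<in> borel_measurable N"
    by (rule measurable_cong[THEN iffD1, OF _ borel_measurable_indicator[OF H]]) (auto simp: H_def indicator_def)
  have EX: "E \<in> sets ?X" using E by (simp add: sets_restrict_space_iff)
  have gE: "(\<lambda>(s, y, z). (s, y)) -` E \<inter> space N \<in> sets N" by (rule measurable_sets[OF g EX])
  have eq: "{(s, y, z). (s, y) \<in> E \<and> 0 \<le> z \<and> z < \<psi> (s, y)} = ((\<lambda>(s, y, z). (s, y)) -` E \<inter> space N) \<inter> H"
    using E(2) by (auto simp: H_def spN mark_space_def XX_def)
  show "{(s, y, z). (s, y) \<in> E \<and> 0 \<le> z \<and> z < \<psi> (s, y)} \<in> sets N" unfolding eq using gE H by auto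
  have "emeasure (thinned T N \<psi>) E = emeasure (density N (\<lambda>(s, y, z). indicator {0..<\<psi> (s, y)} z)) ((\<lambda>(s, y, z). (s, y)) -` E \<inter> space N)"
    unfolding thinned_def using g EX by (subst emeasure_distr) auto
  also have "\<dots> = (\<integral>\<^sup>+x. (\<lambda>(s, y, z). indicator {0..<\<psi> (s, y)} z) x * indicator ((\<lambda>(s, y, z). (s, y)) -` E \<inter> space N) x \<partial>N)"
    using im gE by (rule emeasure_density)
  also have "\<dots> = (\<integral>\<^sup>+x. indicator (((\<lambda>(s, y, z). (s, y)) -` E \<inter> space N) \<inter> H) x \<partial>N)"
    by (intro nn_integral_cong) (auto simp: H_def indicator_def)
  also have "\<dots> = emeasure N (((\<lambda>(s, y, z). (s, y)) -` E \<inter> space N) \<inter> H)" using gE H by simp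
  finally show "emeasure (thinned T N \<psi>) E = emeasure N {(s, y, z). (s, y) \<in> E \<and> 0 \<le> z \<and> z < \<psi> (s, y)}"
    unfolding eq .
qed

text \<open>\<open>G\<close> is the compensated mass of the subgraph of the scaled control. By the
  isometry its variance is the mean compensator, of order \<open>c\<close>, so after division by
  \<open>c\<close> the error has variance of order 1/c. A measurable \<open>G\<close> is exported
  because the difference of masses is only identified with it off a null event.\<close>

lemma thinned_deviation:
  assumes P: "prob_space P" and D: "iid_poisson_random_measures P T D" and T: "0 < T"
    and \<phi>: "\<phi> \<in> A_plus P D T" and bd: "\<And>w p. w \<in> space P \<Longrightarrow> p \<in> XX T \<Longrightarrow> \<phi> w p \<le> m"
    and c: "0 \<le> c" and E: "E \<in> sets borel" "E \<subseteq> XX T"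
  obtains G where "G \<in> borel_measurable P" "integrable P (\<lambda>w. (G w)\<^sup>2)"
    "(LINT w|P. (G w)\<^sup>2) = (LINT w|P. c * measure (control_measure T (\<phi> w)) E)"
    "AE w in P. emeasure (thinned T (D i w) (\<lambda>p. c * \<phi> w p)) E < \<infinity> \<and>
      measure (thinned T (D i w) (\<lambda>p. c * \<phi> w p)) E - c * measure (control_measure T (\<phi> w)) E = G w"
proof -
  \<comment> \<open>This height dominates \<open>c * \<phi>\<close> on the whole of
    \<open>XX T\<close>, so the truncation to the box removes no point below the graph.\<close>
  define L where "L = c * max 0 m"
  interpret poisson_noise P T D i L
    by (rule poisson_noise.intro[OF P D T]) (use c in \<open>simp add: L_def\<close>)
  let ?S = "{(w, s, y, z). w \<in> space P \<and> (s, y, z) \<in> box \<and> (s, y) \<in> E \<and> z < c * \<phi> w (s, y)}"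
  let ?g = "\<lambda>w. {(s, y, z). (s, y) \<in> E \<and> 0 \<le> z \<and> z < c * \<phi> w (s, y)}"
  have S: "?S \<in> sigma_sets (space P \<times> box) rects" by (rule graph_predictable[OF \<phi> E(1)])
  have sec: "Pair w -` ?S = ?g w" if w: "w \<in> space P" for w
  proof -
    have "c * \<phi> w p \<le> L" if "p \<in> XX T" for p
      unfolding L_def using bd[OF w that] c by (intro mult_left_mono) auto
    note b = this
    have "(s, y, z) \<in> box" if g: "(s, y) \<in> E" "0 \<le> z" "z < c * \<phi> w (s, y)" for s y z
    proof -
      have p: "(s, y) \<in> XX T" using g(1) E(2) by blast
      show ?thesis using b[OF p] p g(2,3) by (simp add: box_def XX_def)
    qed
    moreover have "0 \<le> z" if "(s, y, z) \<in> box" for s y z using that by (simp add: box_def)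
    ultimately show ?thesis using w by blast
  qed
  note sect = A_plus_section[OF T \<phi>]
  have nu_eq: "measure nu (?g w) = c * measure (control_measure T (\<phi> w)) E" if w: "w \<in> space P" for w
  proof -
    have gs: "?g w \<in> sets nu" using predictable_isometry(3)[OF S] w sec[OF w] by auto
    have "emeasure nu (?g w) = emeasure lborel (?g w)"
      using gs box_borel unfolding nu_def by (subst emeasure_restrict_space) (auto simp: sets_restrict_space_iff)
    also have "\<dots> = (\<integral>\<^sup>+p. ennreal (c * \<phi> w p) * indicator E p \<partial>lborel)"
    proof (rule emeasure_subgraph)
      show "?g w \<in> sets borel" using gs by (simp add: sets_nu)
      show "0 \<le> c * \<phi> w p" if "p \<in> E" for p using sect(2)[OF w, of p] that E(2) c by auto
      show "(\<lambda>p. ennreal (c * \<phi> w p) * indicator E p) \<in> borel_measurable borel"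
        by (rule restricted_density_measurable[OF _ E]) (use sect(1)[OF w] in auto)
    qed
    also have "\<dots> = (\<integral>\<^sup>+p. ennreal c * (ennreal (\<phi> w p) * indicator E p) \<partial>lborel)"
      using sect(2)[OF w] E(2) c by (intro nn_integral_cong) (auto simp: indicator_def ennreal_mult)
    also have "\<dots> = ennreal c * (\<integral>\<^sup>+p. ennreal (\<phi> w p) * indicator E p \<partial>lborel)"
      using restricted_density_measurable[OF sect(1)[OF w] E] by (intro nn_integral_cmult) auto
    also have "\<dots> = ennreal c * emeasure (control_measure T (\<phi> w)) E"
      by (simp add: emeasure_control_measure[OF sect(1)[OF w] E])
    finally show ?thesis using c by (simp add: measure_def enn2real_mult)
  qed
  define G where "G = (\<lambda>w. measure (NL w) (Pair w -` ?S) - measure nu (Pair w -` ?S))"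
  note iso = predictable_isometry[OF S, folded G_def]
  have cong: "(LINT w|P. measure nu (Pair w -` ?S)) = (LINT w|P. c * measure (control_measure T (\<phi> w)) E)"
    by (rule Bochner_Integration.integral_cong[OF refl]) (use sec nu_eq in auto)
  have AE: "AE w in P. emeasure (thinned T (D i w) (\<lambda>p. c * \<phi> w p)) E < \<infinity> \<and>
      measure (thinned T (D i w) (\<lambda>p. c * \<phi> w p)) E - c * measure (control_measure T (\<phi> w)) E = G w"
    using AE_box_finite AE_space
  proof eventually_elim
    case (elim w)
    have gs: "?g w \<in> sets nu" using iso(3) elim sec by auto
    have "(\<lambda>p. c * \<phi> w p) \<in> borel_measurable (restrict_space borel (XX T))" using sect(1)[OF elim(2)] by auto
    from emeasure_thinned(1)[OF prm_sets[OF iid_prm[OF D, of i] elim(2)] this E]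
    have th: "emeasure (thinned T (D i w) (\<lambda>p. c * \<phi> w p)) E = emeasure (D i w) (?g w)" .
    have bs: "box \<in> sets (D i w)" using box_mark prm_sets[OF iid_prm[OF D] elim(2)] by simp
    have "emeasure (D i w) (?g w) \<le> emeasure (D i w) box" using gs bs by (intro emeasure_mono) (auto simp: sets_nu)
    then have "emeasure (D i w) (?g w) < \<infinity>" using elim(1) by (rule le_less_trans)
    moreover have "measure (NL w) (?g w) = measure (D i w) (?g w)" using measure_NL[OF elim(2) gs] elim(1) by simp
    ultimately show ?case using th nu_eq[OF elim(2)] sec[OF elim(2)] unfolding G_def by (simp add: measure_def)
  qed
  have "integrable P (\<lambda>w. (G w)\<^sup>2)" using iso(1) by (simp add: G_def)
  moreover have "(LINT w|P. (G w)\<^sup>2) = (LINT w|P. c * measure (control_measure T (\<phi> w)) E)"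
    using iso(2) cong by (simp add: G_def)
  ultimately show thesis using that[OF iso(4) _ _ AE] by blast
qed

section \<open>Controls of bounded cost\<close>

definition XX_sets :: "real \<Rightarrow> (real \<times> real) set set" where
  "XX_sets T = {E \<in> sets borel. E \<subseteq> XX T}"

lemma sets_restrict_XX: "sets (restrict_space borel (XX T)) = XX_sets T"
  by (auto simp: XX_sets_def sets_restrict_space_iff)

text \<open>A quantitative form of uniform absolute continuity. The family of bounds in
  \<open>c\<close> is kept, instead of a single modulus, because \<open>c\<close> is a parameter of
  the functional \<open>Psi\<close>.\<close>

definition ac_measure :: "real \<Rightarrow> real \<Rightarrow> (real \<times> real) measure \<Rightarrow> bool" where
  "ac_measure T M \<kappa> \<longleftrightarrow> sets \<kappa> = XX_sets T \<and> finite_measure \<kappa> \<and>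
     (\<forall>c>0. \<forall>E\<in>XX_sets T. measure \<kappa> E \<le> exp (1 + c) * measure lborel E + M / c)"

lemma ell_nonneg: "0 \<le> z \<Longrightarrow> 0 \<le> ell z"
proof (cases "z = 0")
  case False
  assume "0 \<le> z"
  then have z: "z > 0" using False by simp
  have "ln (1 / z) \<le> 1 / z - 1" using z by (intro ln_le_minus_one) simp
  then have "z * ln (1 / z) \<le> z * (1 / z - 1)" using z by (intro mult_left_mono) auto
  then show ?thesis using z by (simp add: ell_def ln_div algebra_simps)
qed (simp add: ell_def)

text \<open>
  The Fenchel-Young inequality behind the uniform integrability of controls of bounded cost.
\<close>
lemma le_exp_ell: assumes "0 \<le> z" "0 < c" shows "z \<le> exp (1 + c) + ell z / c"
proof (cases "z \<le> exp (1 + c)")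
  case True
  then show ?thesis using ell_nonneg[OF assms(1)] assms(2) by (smt (verit) divide_nonneg_pos)
next
  case False
  then have z: "z > exp (1 + c)" "z > 0" using less_trans[OF exp_gt_zero, of "1 + c" z] by auto
  have "1 + c \<le> ln z" using z by (simp add: ln_ge_iff)
  then have "z * (1 + c) \<le> z * ln z" using z by (intro mult_left_mono) auto
  then have "z * c \<le> ell z" by (simp add: ell_def algebra_simps)
  then have "z \<le> ell z / c" using assms(2) by (simp add: field_simps)
  then show ?thesis using exp_gt_zero[of "1 + c"] by linarith
qed

lemma XX_fmeasurable: "emeasure lborel (XX T) < \<infinity>"
  unfolding XX_def by (intro emeasure_bounded_finite bounded_Times) auto

lemma XX_sets_finite: "E \<in> XX_sets T \<Longrightarrow> emeasure lborel E < \<infinity>"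
  using emeasure_mono[of E "XX T" lborel] XX_fmeasurable[of T] by (auto simp: XX_sets_def intro: le_less_trans)

lemma measure_XX: "0 \<le> T \<Longrightarrow> measure lborel (XX T) = T"
proof -
  assume T: "0 \<le> T"
  have "emeasure (lborel \<Otimes>\<^sub>M lborel) ({0..T} \<times> {0..1::real}) = emeasure lborel {0..T} * emeasure lborel {0..1::real}"
    by (rule lborel.emeasure_pair_measure_Times) auto
  then show ?thesis using T by (simp add: XX_def lborel_prod measure_def)
qed

text \<open>Integrate \<open>le_exp_ell\<close> over \<open>E\<close>; the cost of one component is
  at most the total cost, as all terms of the series are nonnegative.\<close>

lemma control_ac:
  assumes h: "h \<in> S_space T M" and M: "0 \<le> M"
  shows "ac_measure T M (control_measure T (h i))"
proof -
  let ?\<kappa> = "control_measure T (h i)"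
  have hm: "h i \<in> borel_measurable (restrict_space borel (XX T))" and h0: "\<And>p. p \<in> XX T \<Longrightarrow> 0 \<le> h i p"
    using h by (auto simp: S_space_def control_functions_def)
  have hm': "h i \<in> borel_measurable (restrict_space lborel (XX T))"
    using hm by (simp cong: measurable_cong_sets add: sets_restrict_space_cong[of lborel borel])
  have cost: "(\<integral>\<^sup>+p. ennreal (ell (h i p)) \<partial>restrict_space lborel (XX T)) \<le> ennreal M"
  proof -
    have "(\<integral>\<^sup>+p. ennreal (ell (h i p)) \<partial>restrict_space lborel (XX T)) \<le> total_cost T h"
      unfolding total_cost_def
      using sum_le_suminf[of "\<lambda>i. \<integral>\<^sup>+p. ennreal (ell (h i p)) \<partial>restrict_space lborel (XX T)" "{i}"] by auto
    then show ?thesis using h by (auto simp: S_space_def)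
  qed
  have sets: "sets ?\<kappa> = XX_sets T"
    unfolding control_measure_def sets_density sets_restrict_XX[symmetric] by (rule sets_restrict_space_cong) simp
  have ell_m: "(\<lambda>p. ell (h i p)) \<in> borel_measurable (restrict_space lborel (XX T))"
    unfolding ell_def using hm' by measurable
  have bd: "emeasure ?\<kappa> E \<le> ennreal (exp (1 + c) * measure lborel E + M / c)" if E: "E \<in> XX_sets T" and c: "0 < c" for E c
  proof -
    have E': "E \<in> sets (restrict_space lborel (XX T))" using E by (auto simp: XX_sets_def sets_restrict_space_iff)
    have "emeasure ?\<kappa> E = (\<integral>\<^sup>+p. ennreal (h i p) * indicator E p \<partial>restrict_space lborel (XX T))"
      unfolding control_measure_def using E' hm' by (subst emeasure_density) auto
    also have "\<dots> \<le> (\<integral>\<^sup>+p. ennreal (exp (1 + c)) * indicator E p + ennreal (1 / c) * ennreal (ell (h i p)) \<partial>restrict_space lborel (XX T))"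
    proof (rule nn_integral_mono)
      fix p assume "p \<in> space (restrict_space lborel (XX T))"
      then have p: "p \<in> XX T" by (simp add: space_restrict_space)
      have "ennreal (h i p) \<le> ennreal (exp (1 + c) + 1 / c * ell (h i p))"
        using le_exp_ell[OF h0[OF p] c] by (intro ennreal_leI) simp
      also have "\<dots> = ennreal (exp (1 + c)) + ennreal (1 / c) * ennreal (ell (h i p))"
      proof -
        have a: "0 \<le> exp (1 + c)" "0 \<le> 1 / c" "0 \<le> ell (h i p)" using c ell_nonneg[OF h0[OF p]] by auto
        show ?thesis unfolding ennreal_plus[OF a(1) mult_nonneg_nonneg[OF a(2,3)]] ennreal_mult[OF a(2,3)] ..
      qed
      finally show "ennreal (h i p) * indicator E p \<le> ennreal (exp (1 + c)) * indicator E p + ennreal (1 / c) * ennreal (ell (h i p))"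
        by (auto simp: indicator_def)
    qed
    also have "\<dots> = ennreal (exp (1 + c)) * emeasure (restrict_space lborel (XX T)) E
        + ennreal (1 / c) * (\<integral>\<^sup>+p. ennreal (ell (h i p)) \<partial>restrict_space lborel (XX T))"
      using E' ell_m by (subst nn_integral_add) (auto simp: nn_integral_cmult)
    also have "emeasure (restrict_space lborel (XX T)) E = emeasure lborel E"
      using E by (subst emeasure_restrict_space) (auto simp: XX_sets_def)
    also have "emeasure lborel E = ennreal (measure lborel E)"
      using XX_sets_finite[OF E] by (intro emeasure_eq_ennreal_measure) auto
    also have "ennreal (exp (1 + c)) * ennreal (measure lborel E) + ennreal (1 / c) * (\<integral>\<^sup>+p. ennreal (ell (h i p)) \<partial>restrict_space lborel (XX T))
        \<le> ennreal (exp (1 + c)) * ennreal (measure lborel E) + ennreal (1 / c) * ennreal M"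
      by (intro add_left_mono mult_left_mono cost) auto
    also have "\<dots> = ennreal (exp (1 + c) * measure lborel E + M / c)"
      using c M by (simp flip: ennreal_mult ennreal_plus)
    finally show ?thesis .
  qed
  have spk: "space ?\<kappa> = XX T" by (simp add: control_measure_def space_restrict_space)
  have top: "XX T \<in> XX_sets T" by (auto simp: XX_sets_def)
  have "finite_measure ?\<kappa>"
  proof
    have "emeasure ?\<kappa> (XX T) < \<infinity>" using bd[OF top, of 1] by (rule le_less_trans) auto
    then show "emeasure ?\<kappa> (space ?\<kappa>) \<noteq> \<infinity>" by (simp add: spk)
  qed
  moreover have "measure ?\<kappa> E \<le> exp (1 + c) * measure lborel E + M / c" if E: "E \<in> XX_sets T" and c: "0 < c" for E c
    unfolding measure_def[of ?\<kappa>] using bd[OF that] c M by (intro enn2real_leI) (auto intro!: add_nonneg_nonneg mult_nonneg_nonneg)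
  ultimately show ?thesis unfolding ac_measure_def using sets by blast
qed

lemma ac_measureD:
  assumes "ac_measure T M \<kappa>"
  shows "sets \<kappa> = XX_sets T" "finite_measure \<kappa>" "space \<kappa> = XX T"
    "\<And>c E. 0 < c \<Longrightarrow> E \<in> XX_sets T \<Longrightarrow> measure \<kappa> E \<le> exp (1 + c) * measure lborel E + M / c"
proof -
  show 1: "sets \<kappa> = XX_sets T" "finite_measure \<kappa>"
    "\<And>c E. 0 < c \<Longrightarrow> E \<in> XX_sets T \<Longrightarrow> measure \<kappa> E \<le> exp (1 + c) * measure lborel E + M / c"
    using assms by (auto simp: ac_measure_def)
  show "space \<kappa> = XX T"
    using sets_eq_imp_space_eq[of \<kappa> "restrict_space borel (XX T)"] 1(1) by (simp add: sets_restrict_XX space_restrict_space)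
qed

lemma ac_modulus:
  assumes M: "0 \<le> M" and e: "0 < \<epsilon>"
  obtains \<delta> where "0 < \<delta>" "\<And>\<kappa> E. ac_measure T M \<kappa> \<Longrightarrow> E \<in> XX_sets T \<Longrightarrow> measure lborel E \<le> \<delta> \<Longrightarrow> measure \<kappa> E < \<epsilon>"
proof -
  \<comment> \<open>This makes \<open>M / c\<close> less than half of \<epsilon>. The factor
    \<open>exp (1 + c)\<close> is then absorbed by \<delta>, which is thus common to all measures of
    the class.\<close>
  define c where "c = 2 * M / \<epsilon> + 1"
  have c: "0 < c" using M e by (auto simp: c_def intro!: add_nonneg_pos divide_nonneg_pos)
  have "M / c < \<epsilon> / 2" using M e c by (simp add: c_def field_simps)
  then have "measure \<kappa> E < \<epsilon>" if \<kappa>: "ac_measure T M \<kappa>" "E \<in> XX_sets T" "measure lborel E \<le> \<epsilon> / (2 * exp (1 + c))" for \<kappa> E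
  proof -
    have "exp (1 + c) * measure lborel E \<le> \<epsilon> / 2" using mult_left_mono[OF \<kappa>(3), of "exp (1 + c)"] by simp
    then show ?thesis using ac_measureD(4)[OF \<kappa>(1) c \<kappa>(2)] \<open>M / c < \<epsilon> / 2\<close> by linarith
  qed
  then show thesis using e by (intro that[of "\<epsilon> / (2 * exp (1 + c))"]) auto
qed

lemma ac_null:
  assumes M: "0 \<le> M" and \<kappa>: "ac_measure T M \<kappa>" "E \<in> XX_sets T" "measure lborel E = 0"
  shows "measure \<kappa> E = 0"
proof (rule ccontr)
  assume "measure \<kappa> E \<noteq> 0"
  then have "0 < measure \<kappa> E" by (simp add: zero_less_measure_iff)
  from ac_modulus[OF M this] obtain \<delta> where "0 < \<delta>"
    "\<And>\<kappa>' E'. ac_measure T M \<kappa>' \<Longrightarrow> E' \<in> XX_sets T \<Longrightarrow> measure lborel E' \<le> \<delta> \<Longrightarrow> measure \<kappa>' E' < measure \<kappa> E" by blast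
  from this(2)[OF \<kappa>(1,2)] this(1) \<kappa>(3) show False by simp
qed

section \<open>Comparison of measures on a finite grid\<close>

definition grid_box :: "real \<Rightarrow> nat \<Rightarrow> nat \<times> nat \<Rightarrow> (real \<times> real) set" where
  "grid_box T K p = {q \<in> XX T. \<lfloor>fst q * real K / T\<rfloor> = int (fst p) \<and> \<lfloor>snd q * real K\<rfloor> = int (snd p)}"

text \<open>The indices run up to \<open>K\<close> inclusive because the floors equal
  \<open>K\<close> at the endpoints, time \<open>T\<close> and height 1.\<close>

definition grid_index :: "nat \<Rightarrow> (nat \<times> nat) set" where "grid_index K = {..K} \<times> {..K}"

definition grid_dev :: "real \<Rightarrow> nat \<Rightarrow> (real \<times> real) measure \<Rightarrow> (real \<times> real) measure \<Rightarrow> real" where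
  "grid_dev T K \<mu> \<kappa> = (\<Sum>p\<in>grid_index K. \<bar>measure \<mu> (grid_box T K p) - measure \<kappa> (grid_box T K p)\<bar>)"

lemma grid_dev_nonneg: "0 \<le> grid_dev T K \<mu> \<kappa>"
  unfolding grid_dev_def by (rule sum_nonneg) simp

lemma finite_grid_index: "finite (grid_index K)" by (simp add: grid_index_def)

lemma grid_box_sets: "grid_box T K p \<in> XX_sets T"
proof -
  have "{q. \<lfloor>f q\<rfloor> = j} \<in> sets borel" if "f \<in> borel_measurable borel" for f :: "real \<times> real \<Rightarrow> real" and j :: int
  proof -
    have "{q. \<lfloor>f q\<rfloor> = j} = f -` {real_of_int j..<real_of_int j + 1} \<inter> space borel" by (auto simp: floor_eq_iff)
    then show ?thesis using measurable_sets[OF that, of "{real_of_int j..<real_of_int j + 1}"] by simp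
  qed
  note m = this
  have "{q :: real \<times> real. \<lfloor>fst q * real K / T\<rfloor> = int (fst p)} \<in> sets borel"
    unfolding divide_inverse by (intro m borel_measurable_continuous_onI continuous_intros)
  moreover have "{q :: real \<times> real. \<lfloor>snd q * real K\<rfloor> = int (snd p)} \<in> sets borel"
    by (intro m borel_measurable_continuous_onI continuous_intros)
  ultimately have "XX T \<inter> {q. \<lfloor>fst q * real K / T\<rfloor> = int (fst p)} \<inter> {q :: real \<times> real. \<lfloor>snd q * real K\<rfloor> = int (snd p)} \<in> sets borel"
    by auto
  moreover have "grid_box T K p = XX T \<inter> {q. \<lfloor>fst q * real K / T\<rfloor> = int (fst p)} \<inter> {q :: real \<times> real. \<lfloor>snd q * real K\<rfloor> = int (snd p)}"
    by (auto simp: grid_box_def)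
  ultimately show ?thesis by (auto simp: XX_sets_def)
qed

lemma grid_box_disjoint: "disjoint_family_on (grid_box T K) I"
  by (auto simp: disjoint_family_on_def grid_box_def prod_eq_iff)

lemma grid_box_cover:
  assumes T: "0 < T" and q: "q \<in> XX T"
  obtains p where "p \<in> grid_index K" "q \<in> grid_box T K p"
proof -
  define p where "p = (nat \<lfloor>fst q * real K / T\<rfloor>, nat \<lfloor>snd q * real K\<rfloor>)"
  have q': "0 \<le> fst q" "fst q \<le> T" "0 \<le> snd q" "snd q \<le> 1" using q by (auto simp: XX_def)
  have "fst q * real K / T \<le> real K" using T q' mult_right_mono[OF q'(2), of "real K"] by (simp add: field_simps)
  moreover have "0 \<le> fst q * real K / T" "0 \<le> snd q * real K" using T q' by auto
  moreover have "snd q * real K \<le> real K" using q' mult_right_mono[OF q'(4), of "real K"] by simp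
  ultimately have "p \<in> grid_index K" "q \<in> grid_box T K p"
    using q by (auto simp: p_def grid_index_def grid_box_def nat_le_iff floor_le_iff)
  then show thesis by (rule that)
qed

lemma grid_box_diam:
  assumes T: "0 < T" and K: "0 < K" and q: "q \<in> grid_box T K p" "q' \<in> grid_box T K p"
  shows "\<bar>fst q - fst q'\<bar> \<le> T / real K" "\<bar>snd q - snd q'\<bar> \<le> 1 / real K"
proof -
  have fl: "\<bar>x - y\<bar> \<le> 1" if "\<lfloor>x\<rfloor> = \<lfloor>y\<rfloor>" for x y :: real using that by linarith
  have "\<bar>fst q * real K / T - fst q' * real K / T\<bar> \<le> 1" using q by (intro fl) (simp add: grid_box_def)
  moreover have "fst q * real K / T - fst q' * real K / T = (fst q - fst q') * (real K / T)"
    by (simp add: left_diff_distrib diff_divide_distrib)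
  ultimately have "\<bar>fst q - fst q'\<bar> * (real K / T) \<le> 1" using T K by (simp add: abs_mult)
  then show "\<bar>fst q - fst q'\<bar> \<le> T / real K" using T K by (simp add: field_simps)
  have "\<bar>snd q * real K - snd q' * real K\<bar> \<le> 1" using q by (intro fl) (simp add: grid_box_def)
  then have "\<bar>snd q - snd q'\<bar> * real K \<le> 1" by (simp add: abs_mult flip: left_diff_distrib)
  then show "\<bar>snd q - snd q'\<bar> \<le> 1 / real K" using K by (simp add: field_simps)
qed

text \<open>Boxes inside \<open>A\<close> contribute at most their deviation; those that meet both
  \<open>A\<close> and its complement are covered by \<open>B\<close>. Only \<kappa> has to be small
  on \<open>B\<close>, which matters because \<mu> will be an atomic random measure.\<close>

lemma grid_deviation:
  assumes T: "0 < T" and \<mu>: "finite_measure \<mu>" "sets \<mu> = XX_sets T" and \<kappa>: "finite_measure \<kappa>" "sets \<kappa> = XX_sets T"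
    and A: "A \<in> XX_sets T" and B: "B \<in> XX_sets T"
    and bdry: "\<And>p q q'. q \<in> grid_box T K p \<Longrightarrow> q' \<in> grid_box T K p \<Longrightarrow> q \<in> A \<Longrightarrow> q' \<notin> A \<Longrightarrow> grid_box T K p \<subseteq> B"
  shows "\<bar>measure \<mu> A - measure \<kappa> A\<bar> \<le> grid_dev T K \<mu> \<kappa> + measure \<kappa> B"
proof -
  let ?b = "grid_box T K"
  define I where "I = {p \<in> grid_index K. ?b p \<subseteq> A}"
  define J where "J = {p \<in> grid_index K. ?b p \<inter> A \<noteq> {} \<and> \<not> ?b p \<subseteq> A}"
  have fin: "finite I" "finite J" and IJ: "I \<inter> J = {}" "I \<union> J \<subseteq> grid_index K"
    using finite_grid_index by (auto simp: I_def J_def)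
  define U where "U = (\<Union>p\<in>J. ?b p)"
  have Us: "U \<in> XX_sets T" unfolding U_def
    using grid_box_sets[of T K] fin by (auto simp: XX_sets_def)
  have UB: "U \<subseteq> B" using bdry by (fastforce simp: U_def J_def)
  have A_eq: "A = (\<Union>p\<in>I. ?b p) \<union> (A \<inter> U)"
  proof
    show "A \<subseteq> (\<Union>p\<in>I. ?b p) \<union> (A \<inter> U)"
    proof
      fix q assume q: "q \<in> A"
      then have "q \<in> XX T" using A by (auto simp: XX_sets_def)
      then obtain p where "p \<in> grid_index K" "q \<in> ?b p" using grid_box_cover[OF T] by blast
      then show "q \<in> (\<Union>p\<in>I. ?b p) \<union> (A \<inter> U)" 
        using q unfolding I_def J_def U_def by (cases "?b p \<subseteq> A") blast+
    qed
  qed (auto simp: I_def)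
  have AU: "A \<inter> U \<in> XX_sets T" using A Us by (auto simp: XX_sets_def)
  have Is: "(\<Union>p\<in>I. ?b p) \<in> XX_sets T" using grid_box_sets[of T K] fin by (auto simp: XX_sets_def)
  have disj: "(\<Union>p\<in>I. ?b p) \<inter> (A \<inter> U) = {}"
  proof -
    have "?b p \<inter> ?b p' = {}" if "p \<in> I" "p' \<in> J" for p p'
    proof -
      have "p \<noteq> p'" using that IJ(1) by blast
      then show ?thesis by (rule disjoint_family_onD[OF grid_box_disjoint UNIV_I UNIV_I])
    qed
    then show ?thesis unfolding U_def by blast
  qed
  have m: "measure m A = (\<Sum>p\<in>I. measure m (?b p)) + measure m (A \<inter> U)"
    "measure m (A \<inter> U) \<le> (\<Sum>p\<in>J. measure m (?b p))" "measure m U = (\<Sum>p\<in>J. measure m (?b p))"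
    if m: "finite_measure m" "sets m = XX_sets T" for m
  proof -
    interpret finite_measure m by (rule m(1))
    have "measure m A = measure m (\<Union>p\<in>I. ?b p) + measure m (A \<inter> U)"
      using finite_measure_Union[of "\<Union>p\<in>I. ?b p" "A \<inter> U"] Is AU disj A_eq m(2) by simp
    also have "measure m (\<Union>p\<in>I. ?b p) = (\<Sum>p\<in>I. measure m (?b p))"
      using fin grid_box_sets m(2) by (intro finite_measure_finite_Union grid_box_disjoint) auto
    finally show "measure m A = (\<Sum>p\<in>I. measure m (?b p)) + measure m (A \<inter> U)" .
    show 3: "measure m U = (\<Sum>p\<in>J. measure m (?b p))"
      unfolding U_def using fin grid_box_sets m(2) by (intro finite_measure_finite_Union grid_box_disjoint) auto
    show "measure m (A \<inter> U) \<le> (\<Sum>p\<in>J. measure m (?b p))"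
      unfolding 3[symmetric] using Us m(2) by (intro finite_measure_mono) auto
  qed
  let ?d = "\<lambda>p. \<bar>measure \<mu> (?b p) - measure \<kappa> (?b p)\<bar>"
  have s1: "\<bar>(\<Sum>p\<in>I. measure \<mu> (?b p)) - (\<Sum>p\<in>I. measure \<kappa> (?b p))\<bar> \<le> (\<Sum>p\<in>I. ?d p)"
    unfolding sum_subtractf[symmetric] by (rule sum_abs)
  have s2: "\<bar>(\<Sum>p\<in>J. measure \<mu> (?b p)) - (\<Sum>p\<in>J. measure \<kappa> (?b p))\<bar> \<le> (\<Sum>p\<in>J. ?d p)"
    unfolding sum_subtractf[symmetric] by (rule sum_abs)
  have s3: "(\<Sum>p\<in>I. ?d p) + (\<Sum>p\<in>J. ?d p) \<le> grid_dev T K \<mu> \<kappa>"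
    unfolding grid_dev_def using IJ finite_grid_index fin by (subst sum.union_disjoint[symmetric]) (auto intro!: sum_mono2)
  have UBm: "measure \<kappa> U \<le> measure \<kappa> B"
    using UB B \<kappa> by (intro finite_measure.finite_measure_mono) auto
  have a0: "0 \<le> measure \<mu> (A \<inter> U)" "0 \<le> measure \<kappa> (A \<inter> U)" by simp_all
  note mu = m[OF \<mu>] and ka = m[OF \<kappa>]
  \<comment> \<open>On the boundary boxes the mass of \<mu> is at most that of \<kappa> plus the
    deviation, so no bound on \<mu> of \<open>B\<close> is used.\<close>
  have "\<bar>measure \<mu> (A \<inter> U) - measure \<kappa> (A \<inter> U)\<bar> \<le> (\<Sum>p\<in>J. ?d p) + measure \<kappa> U"
  proof -
    have "0 \<le> (\<Sum>p\<in>J. ?d p)" by (rule sum_nonneg) simp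
    then show ?thesis using mu(2,3) ka(2,3) s2 a0 unfolding abs_le_iff by linarith
  qed
  then show ?thesis using mu(1) ka(1) s1 s3 UBm by linarith
qed

section \<open>Oscillation of paths\<close>

text \<open>
  Upper and lower \<open>k\<close>-Lipschitz envelopes. Unlike the path itself they depend continuously on it
  under Skorokhod time changes, and they squeeze it in the mean as \<open>k \<rightarrow> \<infinity>\<close>.
\<close>
definition upc :: "real \<Rightarrow> real \<Rightarrow> (real \<Rightarrow> real) \<Rightarrow> real \<Rightarrow> real" where
  "upc T k a s = (SUP r\<in>{0..T}. a r - k * \<bar>r - s\<bar>)"

definition lowc :: "real \<Rightarrow> real \<Rightarrow> (real \<Rightarrow> real) \<Rightarrow> real \<Rightarrow> real" where
  "lowc T k a s = - upc T k (\<lambda>r. - a r) s"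

definition osc :: "real \<Rightarrow> real \<Rightarrow> (real \<Rightarrow> real) \<Rightarrow> real" where
  "osc T k a = (LINT s:{0..T}|lborel. upc T k a s - lowc T k a s)"

definition bounded_path :: "real \<Rightarrow> (real \<Rightarrow> real) \<Rightarrow> bool" where
  "bounded_path T a \<longleftrightarrow> (\<exists>B. \<forall>s\<in>{0..T}. \<bar>a s\<bar> \<le> B)"

lemma bounded_pathE:
  assumes "bounded_path T a" obtains B where "\<And>s. s \<in> {0..T} \<Longrightarrow> \<bar>a s\<bar> \<le> B"
  using assms unfolding bounded_path_def by blast

lemma bounded_path_minus: "bounded_path T a \<Longrightarrow> bounded_path T (\<lambda>r. - a r)"
  by (simp add: bounded_path_def)

lemma upc_bdd: assumes "bounded_path T a" "0 \<le> k" shows "bdd_above ((\<lambda>r. a r - k * \<bar>r - s\<bar>) ` {0..T})"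
proof -
  obtain B where B: "\<And>s. s \<in> {0..T} \<Longrightarrow> \<bar>a s\<bar> \<le> B" using bounded_pathE[OF assms(1)] by blast
  have "a r - k * \<bar>r - s\<bar> \<le> B" if "r \<in> {0..T}" for r
    using B[OF that] mult_nonneg_nonneg[OF assms(2), of "\<bar>r - s\<bar>"] by linarith
  then show ?thesis by (intro bdd_aboveI2[of _ _ B])
qed

lemma upc_ge: "bounded_path T a \<Longrightarrow> 0 \<le> k \<Longrightarrow> r \<in> {0..T} \<Longrightarrow> a r - k * \<bar>r - s\<bar> \<le> upc T k a s"
  unfolding upc_def by (rule cSUP_upper[OF _ upc_bdd])

lemma upc_least: "0 \<le> T \<Longrightarrow> (\<And>r. r \<in> {0..T} \<Longrightarrow> a r - k * \<bar>r - s\<bar> \<le> c) \<Longrightarrow> upc T k a s \<le> c"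
  unfolding upc_def by (rule cSUP_least) auto

lemma upc_bound: "bounded_path T a \<Longrightarrow> 0 \<le> k \<Longrightarrow> s \<in> {0..T} \<Longrightarrow> a s \<le> upc T k a s"
  using upc_ge[of T a k s s] by simp

lemma upc_lipschitz_le:
  assumes "0 \<le> T" "bounded_path T a" "0 \<le> k" shows "upc T k a s \<le> upc T k a s' + k * \<bar>s - s'\<bar>"
proof (rule upc_least[OF assms(1)])
  fix r assume r: "r \<in> {0..T}"
  have "k * \<bar>r - s'\<bar> \<le> k * (\<bar>r - s\<bar> + \<bar>s - s'\<bar>)" using assms(3) by (intro mult_left_mono) auto
  then show "a r - k * \<bar>r - s\<bar> \<le> upc T k a s' + k * \<bar>s - s'\<bar>"
    using upc_ge[OF assms(2,3) r, of s'] by (simp add: distrib_left)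
qed

lemma upc_continuous: assumes "0 \<le> T" "bounded_path T a" "0 \<le> k" shows "continuous_on S (upc T k a)"
proof (rule continuous_on_subset[OF _ subset_UNIV], rule lipschitz_on_continuous_on, rule lipschitz_onI)
  show "dist (upc T k a x) (upc T k a y) \<le> k * dist x y" for x y
    using upc_lipschitz_le[OF assms, of x y] upc_lipschitz_le[OF assms, of y x] by (simp add: dist_real_def abs_minus_commute abs_le_iff)
qed (use assms in auto)

lemma lowc_continuous: assumes "0 \<le> T" "bounded_path T a" "0 \<le> k" shows "continuous_on S (lowc T k a)"
  unfolding lowc_def using upc_continuous[OF assms(1) bounded_path_minus[OF assms(2)] assms(3)]
  by (intro continuous_intros)

lemma lowc_le_upc: assumes "bounded_path T a" "0 \<le> k" "s \<in> {0..T}" shows "lowc T k a s \<le> upc T k a s"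
  using upc_bound[OF assms] upc_bound[OF bounded_path_minus[OF assms(1)] assms(2,3)] by (simp add: lowc_def)

lemma bracket:
  assumes "bounded_path T a" "0 \<le> k" "s \<in> {0..T}"
  shows "a s \<le> upc T k a \<sigma> + k * \<bar>s - \<sigma>\<bar>" "lowc T k a \<sigma> - k * \<bar>s - \<sigma>\<bar> \<le> a s"
  using upc_ge[OF assms, of \<sigma>] upc_ge[OF bounded_path_minus[OF assms(1)] assms(2,3), of \<sigma>] by (simp_all add: lowc_def)

text \<open>The time change moves the value by at most \<open>q\<close> and the argument by at most
  \<open>q\<close>, and the penalty has slope \<open>k\<close>; together this costs (1 + k)
  q.\<close>

lemma upc_time_change_le:
  assumes T: "0 \<le> T" and a': "bounded_path T a'" and k: "0 \<le> k"
    and \<tau>: "\<And>r. r \<in> {0..T} \<Longrightarrow> \<tau> r \<in> {0..T} \<and> \<bar>\<tau> r - r\<bar> \<le> q \<and> a r \<le> a' (\<tau> r) + q"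
  shows "upc T k a s \<le> upc T k a' s + (1 + k) * q"
proof (rule upc_least[OF T])
  fix r assume r: "r \<in> {0..T}"
  have "k * \<bar>\<tau> r - s\<bar> \<le> k * (\<bar>r - s\<bar> + q)" using \<tau>[OF r] k by (intro mult_left_mono) auto
  then show "a r - k * \<bar>r - s\<bar> \<le> upc T k a' s + (1 + k) * q"
    using upc_ge[OF a' k, of "\<tau> r" s] \<tau>[OF r] by (simp add: algebra_simps)
qed

lemma upc_time_change:
  assumes T: "0 \<le> T" and a: "bounded_path T a" "bounded_path T a'" and k: "0 \<le> k"
    and \<tau>: "\<tau> \<in> time_changes T" "\<And>r. r \<in> {0..T} \<Longrightarrow> \<bar>\<tau> r - r\<bar> \<le> q \<and> \<bar>a r - a' (\<tau> r)\<bar> \<le> q"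
  shows "\<bar>upc T k a s - upc T k a' s\<bar> \<le> (1 + k) * q"
proof -
  obtain \<sigma> where \<sigma>: "\<sigma> \<in> time_changes T" "\<And>t. t \<in> {0..T} \<Longrightarrow> \<tau> (\<sigma> t) = t" using time_changes_inv[OF \<tau>(1)] by blast
  have "upc T k a s \<le> upc T k a' s + (1 + k) * q"
  proof (rule upc_time_change_le[OF T a(2) k])
    fix r assume r: "r \<in> {0..T}"
    show "\<tau> r \<in> {0..T} \<and> \<bar>\<tau> r - r\<bar> \<le> q \<and> a r \<le> a' (\<tau> r) + q"
      using time_changes_mem[OF \<tau>(1) r] \<tau>(2)[OF r] unfolding abs_le_iff by linarith
  qed
  moreover have "upc T k a' s \<le> upc T k a s + (1 + k) * q"
  proof (rule upc_time_change_le[OF T a(1) k])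
    fix r assume r: "r \<in> {0..T}"
    show "\<sigma> r \<in> {0..T} \<and> \<bar>\<sigma> r - r\<bar> \<le> q \<and> a' r \<le> a (\<sigma> r) + q"
      using time_changes_mem[OF \<sigma>(1) r] \<tau>(2)[of "\<sigma> r"] \<sigma>(2)[OF r] by (auto simp: abs_le_iff)
  qed
  ultimately show ?thesis by (simp add: abs_le_iff)
qed

lemma lowc_time_change:
  assumes T: "0 \<le> T" and a: "bounded_path T a" "bounded_path T a'" and k: "0 \<le> k"
    and \<tau>: "\<tau> \<in> time_changes T" "\<And>r. r \<in> {0..T} \<Longrightarrow> \<bar>\<tau> r - r\<bar> \<le> q \<and> \<bar>a r - a' (\<tau> r)\<bar> \<le> q"
  shows "\<bar>lowc T k a s - lowc T k a' s\<bar> \<le> (1 + k) * q"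
proof -
  have "\<bar>upc T k (\<lambda>r. - a r) s - upc T k (\<lambda>r. - a' r) s\<bar> \<le> (1 + k) * q"
  proof (rule upc_time_change[OF T bounded_path_minus[OF a(1)] bounded_path_minus[OF a(2)] k \<tau>(1)])
    fix r assume "r \<in> {0..T}"
    from \<tau>(2)[OF this] show "\<bar>\<tau> r - r\<bar> \<le> q \<and> \<bar>- a r - - a' (\<tau> r)\<bar> \<le> q" by linarith
  qed
  then show ?thesis unfolding lowc_def by linarith
qed

lemma osc_integrable:
  assumes "0 \<le> T" "bounded_path T a" "0 \<le> k"
  shows "set_integrable lborel {0..T} (\<lambda>s. upc T k a s - lowc T k a s)"
  by (intro borel_integrable_atLeastAtMost' continuous_on_diff upc_continuous lowc_continuous assms)

lemma osc_nonneg: assumes "0 \<le> T" "bounded_path T a" "0 \<le> k" shows "0 \<le> osc T k a"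
  unfolding osc_def set_lebesgue_integral_def
  by (rule integral_nonneg_AE) (use lowc_le_upc[OF assms(2,3)] in \<open>auto simp: indicator_def intro!: AE_I2\<close>)

text \<open>Each of the two envelopes moves by at most (1 + k) q, uniformly on an interval of length
  \<open>T\<close>.\<close>

lemma osc_time_change:
  assumes T: "0 \<le> T" and a: "bounded_path T a" "bounded_path T a'" and k: "0 \<le> k"
    and \<tau>: "\<tau> \<in> time_changes T" "\<And>r. r \<in> {0..T} \<Longrightarrow> \<bar>\<tau> r - r\<bar> \<le> q \<and> \<bar>a r - a' (\<tau> r)\<bar> \<le> q"
  shows "\<bar>osc T k a - osc T k a'\<bar> \<le> 2 * T * ((1 + k) * q)"
proof -
  have ic: "set_integrable lborel {0..T} (\<lambda>_. 2 * ((1 + k) * q))"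
    by (rule borel_integrable_atLeastAtMost') auto
  have c1: "osc T k a - osc T k a' = (LINT s:{0..T}|lborel. (upc T k a s - lowc T k a s) - (upc T k a' s - lowc T k a' s))"
    unfolding osc_def using osc_integrable[OF T a(1) k] osc_integrable[OF T a(2) k] by (simp add: set_integral_diff)
  have c2: "\<bar>LINT s:{0..T}|lborel. (upc T k a s - lowc T k a s) - (upc T k a' s - lowc T k a' s)\<bar> \<le> (LINT s:{0..T}|lborel. 2 * ((1 + k) * q))"
    unfolding set_lebesgue_integral_def
  proof (rule integral_abs_bound_integral)
    show "integrable lborel (\<lambda>x. indicat_real {0..T} x *\<^sub>R (upc T k a x - lowc T k a x - (upc T k a' x - lowc T k a' x)))"
      using set_integral_diff(1)[OF osc_integrable[OF T a(1) k] osc_integrable[OF T a(2) k]] by (simp add: set_integrable_def)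
    show "integrable lborel (\<lambda>x. indicat_real {0..T} x *\<^sub>R (2 * ((1 + k) * q)))" using ic by (simp add: set_integrable_def)
    fix x
    show "\<bar>indicat_real {0..T} x *\<^sub>R (upc T k a x - lowc T k a x - (upc T k a' x - lowc T k a' x))\<bar> \<le> indicat_real {0..T} x *\<^sub>R (2 * ((1 + k) * q))"
      using upc_time_change[OF T a k \<tau>, of x] lowc_time_change[OF T a k \<tau>, of x]
      by (auto simp: indicator_def)
  qed
  have c3: "(LINT s:{0..T}|lborel. 2 * ((1 + k) * q)) = 2 * T * ((1 + k) * q)"
    using T by (simp add: set_lebesgue_integral_def measure_def)
  show ?thesis using c2 unfolding c1 c3 .
qed

section \<open>Regulated paths and their discontinuities\<close>

definition regulated :: "real \<Rightarrow> (real \<Rightarrow> real) \<Rightarrow> bool" where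
  "regulated T a \<longleftrightarrow> (\<forall>t\<in>{0..<T}. \<exists>L. (a \<longlongrightarrow> L) (at_right t)) \<and> (\<forall>t\<in>{0<..T}. \<exists>L. (a \<longlongrightarrow> L) (at_left t))"

definition jumps :: "real \<Rightarrow> (real \<Rightarrow> real) \<Rightarrow> real set" where
  "jumps T a = {t \<in> {0..T}. \<not> (\<forall>e>0. \<exists>d>0. \<forall>r\<in>{0..T}. \<bar>r - t\<bar> < d \<longrightarrow> \<bar>a r - a t\<bar> < e)}"

lemma regulatedD:
  assumes "regulated T a"
  shows "t \<in> {0..<T} \<Longrightarrow> \<exists>L. (a \<longlongrightarrow> L) (at_right t)" "t \<in> {0<..T} \<Longrightarrow> \<exists>L. (a \<longlongrightarrow> L) (at_left t)"
  using assms unfolding regulated_def by blast+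

text \<open>Near any point the one-sided limits keep the oscillation on either side small, so the
  discontinuities of size at least 1/(n+1) do not accumulate in the compact interval and are finite
  in number.\<close>

lemma countable_jumps:
  assumes "regulated T a" shows "countable (jumps T a)"
proof -
  define J where "J n = {t \<in> {0..T}. \<forall>d>0. \<exists>r\<in>{0..T}. \<bar>r - t\<bar> < d \<and> \<bar>a r - a t\<bar> \<ge> inverse (real (Suc n))}" for n
  have "jumps T a \<subseteq> (\<Union>n. J n)"
  proof
    fix t assume t: "t \<in> jumps T a"
    then obtain e where e: "0 < e" "\<forall>d>0. \<exists>r\<in>{0..T}. \<bar>r - t\<bar> < d \<and> \<not> \<bar>a r - a t\<bar> < e" by (auto simp: jumps_def)
    obtain n where "inverse (real (Suc n)) < e" using reals_Archimedean[OF e(1)] by blast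
    then have "t \<in> J n" using e(2) t unfolding J_def jumps_def
      by clarsimp (meson less_le_trans not_less order_less_imp_le)
    then show "t \<in> (\<Union>n. J n)" by blast
  qed
  moreover have "countable (J n)" for n
  proof -
    let ?e = "inverse (real (Suc n))"
    have key: "x \<notin> J n" if x: "z1 < x" "x < z2"
      and osc: "\<And>r r'. r \<in> {z1<..<z2} \<inter> {0..T} \<Longrightarrow> r' \<in> {z1<..<z2} \<inter> {0..T} \<Longrightarrow> \<bar>a r - a r'\<bar> < ?e" for z1 z2 x
    proof
      assume J: "x \<in> J n"
      then have "0 < min (x - z1) (z2 - x)" "x \<in> {0..T}" using x by (auto simp: J_def)
      then obtain r where "r \<in> {0..T}" "\<bar>r - x\<bar> < min (x - z1) (z2 - x)" "\<bar>a r - a x\<bar> \<ge> ?e"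
        using J unfolding J_def by blast
      moreover have "r \<in> {z1<..<z2}" using calculation(2) by (auto simp: abs_less_iff)
      ultimately show False using osc[of r x] x \<open>x \<in> {0..T}\<close> by simp
    qed
    have lim: "\<bar>u - v\<bar> < ?e" if "\<bar>u - L\<bar> < ?e / 2" "\<bar>v - L\<bar> < ?e / 2" for u v L :: real using that by linarith
    have "\<not> z islimpt J n" if z: "z \<in> {0..T}" for z
    proof -
      have "\<exists>b>z. \<forall>x. z < x \<and> x < b \<longrightarrow> x \<notin> J n"
      proof (cases "z < T")
        case True
        then obtain L where "(a \<longlongrightarrow> L) (at_right z)" using regulatedD(1)[OF assms, of z] z by auto
        then have "\<forall>\<^sub>F r in at_right z. dist (a r) L < ?e / 2" by (rule tendstoD) simp
        then have "\<forall>\<^sub>F r in at_right z. \<bar>a r - L\<bar> < ?e / 2" unfolding dist_real_def .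
        then obtain b where b: "b > z" "\<And>r. z < r \<Longrightarrow> r < b \<Longrightarrow> \<bar>a r - L\<bar> < ?e / 2"
          unfolding eventually_at_right_field by blast
        have "x \<notin> J n" if "z < x" "x < b" for x
          by (rule key[OF that], rule lim) (use b(2) in auto)
        then show ?thesis using b(1) by blast
      next
        case False
        then show ?thesis using z by (intro exI[of _ "z + 1"]) (auto simp: J_def)
      qed
      then obtain b where b: "b > z" "\<And>x. z < x \<Longrightarrow> x < b \<Longrightarrow> x \<notin> J n" by blast
      have "\<exists>b<z. \<forall>x. b < x \<and> x < z \<longrightarrow> x \<notin> J n"
      proof (cases "0 < z")
        case True
        then obtain L where "(a \<longlongrightarrow> L) (at_left z)" using regulatedD(2)[OF assms, of z] z by auto
        then have "\<forall>\<^sub>F r in at_left z. dist (a r) L < ?e / 2" by (rule tendstoD) simp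
        then have "\<forall>\<^sub>F r in at_left z. \<bar>a r - L\<bar> < ?e / 2" unfolding dist_real_def .
        then obtain b where b: "b < z" "\<And>r. b < r \<Longrightarrow> r < z \<Longrightarrow> \<bar>a r - L\<bar> < ?e / 2"
          unfolding eventually_at_left_field by blast
        have "x \<notin> J n" if "b < x" "x < z" for x
          by (rule key[OF that], rule lim) (use b(2) in auto)
        then show ?thesis using b(1) by blast
      next
        case False
        then show ?thesis using z by (intro exI[of _ "z - 1"]) (auto simp: J_def)
      qed
      then obtain b' where b': "b' < z" "\<And>x. b' < x \<Longrightarrow> x < z \<Longrightarrow> x \<notin> J n" by blast
      show ?thesis
      proof
        assume "z islimpt J n"
        then obtain y where "y \<in> J n" "y \<in> {b'<..<b}" "y \<noteq> z"
          using b(1) b'(1) by (elim islimptE[of z _ "{b'<..<b}"]) auto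
        then show False using b(2)[of y] b'(2)[of y] by (cases "y < z") auto
      qed
    qed
    then have "finite ({0..T} \<inter> J n)" by (intro finite_not_islimpt_in_compact) auto
    moreover have "{0..T} \<inter> J n = J n" by (auto simp: J_def)
    ultimately show ?thesis by (simp add: countable_finite)
  qed
  ultimately show ?thesis by (meson countable_UN countable_subset countableI_type)
qed

lemma not_jump: "t \<in> {0..T} \<Longrightarrow> t \<notin> jumps T a \<Longrightarrow> 0 < e \<Longrightarrow> \<exists>d>0. \<forall>r\<in>{0..T}. \<bar>r - t\<bar> < d \<longrightarrow> \<bar>a r - a t\<bar> < e"
  by (auto simp: jumps_def)

text \<open>Within distance \<open>d\<close> of \<open>s\<close> the path exceeds its value at
  \<open>s\<close> by less than \<open>e\<close>. Beyond it, the penalty k d outweighs the largest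
  possible difference 2 B as soon as k is at least 2 B / d.\<close>

lemma upc_at_continuity_point:
  assumes T: "0 \<le> T" and a: "bounded_path T a" and s: "s \<in> {0..T}" "s \<notin> jumps T a" and e: "0 < e"
  shows "\<forall>\<^sub>F k in sequentially. upc T (real k) a s \<le> a s + e"
proof -
  obtain d where d: "0 < d" "\<And>r. r \<in> {0..T} \<Longrightarrow> \<bar>r - s\<bar> < d \<Longrightarrow> \<bar>a r - a s\<bar> < e"
    using not_jump[OF s e] by blast
  obtain B where B: "\<And>s. s \<in> {0..T} \<Longrightarrow> \<bar>a s\<bar> \<le> B" using bounded_pathE[OF a] by blast
  obtain N where N: "2 * B / d \<le> real N" using real_arch_simple by blast
  have "upc T (real k) a s \<le> a s + e" if k: "N \<le> k" for k
  proof (rule upc_least[OF T])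
    fix r assume r: "r \<in> {0..T}"
    show "a r - real k * \<bar>r - s\<bar> \<le> a s + e"
    proof (cases "\<bar>r - s\<bar> < d")
      case True
      have "0 \<le> real k * \<bar>r - s\<bar>" by simp
      then show ?thesis using d(2)[OF r True] by linarith
    next
      case False
      have "2 * B / d \<le> real k" using N k by linarith
      then have "2 * B \<le> real k * d" using d(1) by (simp add: field_simps)
      also have "\<dots> \<le> real k * \<bar>r - s\<bar>" using False by (intro mult_left_mono) auto
      finally show ?thesis using B[OF r] B[OF s(1)] e by linarith
    qed
  qed
  then show ?thesis by (auto simp: eventually_sequentially)
qed

lemma jumps_minus: "jumps T (\<lambda>r. - a r) = jumps T a"
proof -
  have "\<bar>- a r - - a t\<bar> = \<bar>a r - a t\<bar>" for r t by linarith
  then show ?thesis unfolding jumps_def by simp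
qed

text \<open>The two envelopes meet in the limit at every continuity point, hence almost everywhere,
  and the bound of the path dominates them uniformly in \<open>k\<close>.\<close>

lemma osc_tendsto:
  assumes T: "0 \<le> T" and a: "bounded_path T a" "regulated T a"
  shows "(\<lambda>k. osc T (real k) a) \<longlonglongrightarrow> 0"
proof -
  obtain B where B: "\<And>s. s \<in> {0..T} \<Longrightarrow> \<bar>a s\<bar> \<le> B" using bounded_pathE[OF a(1)] by blast
  have ub: "\<bar>upc T (real k) a s\<bar> \<le> B" if "s \<in> {0..T}" "\<And>s. s \<in> {0..T} \<Longrightarrow> \<bar>a s\<bar> \<le> B" "bounded_path T a" for k s a
  proof -
    have "a r - real k * \<bar>r - s\<bar> \<le> B" if r: "r \<in> {0..T}" for r
    proof -
      have "0 \<le> real k * \<bar>r - s\<bar>" by simp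
      then show ?thesis using \<open>\<And>s. s \<in> {0..T} \<Longrightarrow> \<bar>a s\<bar> \<le> B\<close>[OF r] by linarith
    qed
    then have "upc T (real k) a s \<le> B" by (rule upc_least[OF T])
    then show ?thesis using upc_bound[OF that(3) _ that(1), of "real k"] that(2)[OF that(1)] by (simp add: abs_le_iff)
  qed
  have "(\<lambda>k. LINT s|lborel. indicator {0..T} s *\<^sub>R (upc T (real k) a s - lowc T (real k) a s)) \<longlonglongrightarrow> (LINT s|(lborel :: real measure). (0 :: real))"
  proof (rule integral_dominated_convergence[of "\<lambda>_. 0" lborel
        "\<lambda>k s. indicator {0..T} s *\<^sub>R (upc T (real k) a s - lowc T (real k) a s)" "\<lambda>s. indicator {0..T} s * (2 * B)"])
    show "(\<lambda>s. indicator {0..T} s *\<^sub>R (upc T (real k) a s - lowc T (real k) a s)) \<in> borel_measurable lborel" for k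
      using osc_integrable[OF T a(1), of "real k"] unfolding set_integrable_def by (rule borel_measurable_integrable) simp
    show "integrable lborel (\<lambda>s. indicator {0..T} s * (2 * B))"
      using borel_integrable_atLeastAtMost'[of 0 T "\<lambda>_. 2 * B"] by (simp add: set_integrable_def)
    have "AE s in lborel. s \<notin> jumps T a"
      by (rule AE_discrete_difference[OF countable_jumps[OF a(2)]]) auto
    then show "AE s in lborel. (\<lambda>k. indicator {0..T} s *\<^sub>R (upc T (real k) a s - lowc T (real k) a s)) \<longlonglongrightarrow> 0"
    proof eventually_elim
      case (elim s)
      show ?case
      proof (cases "s \<in> {0..T}")
        case True
        have "(\<lambda>k. upc T (real k) a s - lowc T (real k) a s) \<longlonglongrightarrow> 0"
        proof (rule tendstoI)
          fix e :: real assume e: "0 < e"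
          have "\<forall>\<^sub>F k in sequentially. upc T (real k) a s \<le> a s + e / 3"
            by (rule upc_at_continuity_point[OF T a(1) True elim]) (use e in simp)
          moreover have "\<forall>\<^sub>F k in sequentially. upc T (real k) (\<lambda>r. - a r) s \<le> - a s + e / 3"
            by (rule upc_at_continuity_point[OF T bounded_path_minus[OF a(1)] True]) (use e elim in \<open>simp_all add: jumps_minus\<close>)
          ultimately show "\<forall>\<^sub>F k in sequentially. dist (upc T (real k) a s - lowc T (real k) a s) 0 < e"
          proof eventually_elim
            case (elim k)
            then show ?case using lowc_le_upc[OF a(1) _ True, of "real k"] e by (simp add: lowc_def dist_real_def)
          qed
        qed
        then show ?thesis using True by simp
      qed simp
    qed
    show "AE s in lborel. norm (indicator {0..T} s *\<^sub>R (upc T (real k) a s - lowc T (real k) a s)) \<le> indicator {0..T} s * (2 * B)" for k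
    proof (rule AE_I2)
      fix s
      show "norm (indicator {0..T} s *\<^sub>R (upc T (real k) a s - lowc T (real k) a s)) \<le> indicator {0..T} s * (2 * B)"
        using ub[OF _ B a(1), of s k] ub[OF _ _ bounded_path_minus[OF a(1)], of s k] B
        by (auto simp: indicator_def lowc_def abs_le_iff)
    qed
  qed simp
  then show ?thesis by (simp add: osc_def set_lebesgue_integral_def)
qed

lemma osc_const: "0 \<le> T \<Longrightarrow> 0 \<le> k \<Longrightarrow> osc T k (\<lambda>_. c) = 0"
proof -
  assume T: "0 \<le> T" and k: "0 \<le> k"
  have b: "bounded_path T (\<lambda>_. c)" for c by (auto simp: bounded_path_def)
  have "upc T k (\<lambda>_. c) s = c" if s: "s \<in> {0..T}" for s c
  proof (rule antisym)
    show "upc T k (\<lambda>_. c) s \<le> c" by (rule upc_least[OF T]) (use k in simp)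
    show "c \<le> upc T k (\<lambda>_. c) s" using upc_bound[OF b k s] .
  qed
  then show ?thesis unfolding osc_def set_lebesgue_integral_def lowc_def
    by (intro integral_eq_zero_AE AE_I2) (auto simp: indicator_def)
qed

section \<open>Mass below a path\<close>

definition strip :: "real \<Rightarrow> (real \<Rightarrow> real) \<Rightarrow> (real \<Rightarrow> real) \<Rightarrow> (real \<times> real) set" where
  "strip T lo hi = {q \<in> XX T. lo (fst q) \<le> snd q \<and> snd q \<le> hi (fst q)}"

text \<open>The set whose indicator is the integrand 1_[0,a(s))(y) of the equations, up to time
  \<open>t\<close>; the lower bound on y comes from \<open>XX T\<close>.\<close>

definition region :: "real \<Rightarrow> (real \<Rightarrow> real) \<Rightarrow> real \<Rightarrow> (real \<times> real) set" where
  "region T a t = {q \<in> XX T. fst q \<le> t \<and> snd q < a (fst q)}"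

lemma strip_measure:
  assumes c: "continuous_on {0..T} lo" "continuous_on {0..T} hi" and le: "\<And>s. s \<in> {0..T} \<Longrightarrow> lo s \<le> hi s"
  shows "strip T lo hi \<in> XX_sets T" "measure lborel (strip T lo hi) \<le> (LINT s:{0..T}|lborel. hi s - lo s)"
proof -
  have sub: "fst ` XX T \<subseteq> {0..T}" by (auto simp: XX_def)
  have cX: "closed (XX T)" unfolding XX_def by (intro closed_Times) auto
  have c1: "continuous_on (XX T) (\<lambda>q. lo (fst q))" "continuous_on (XX T) (\<lambda>q. hi (fst q))"
    by (rule continuous_on_compose2[OF c(1) continuous_on_fst[OF continuous_on_id] sub],
        rule continuous_on_compose2[OF c(2) continuous_on_fst[OF continuous_on_id] sub])
  have "strip T lo hi = {q \<in> XX T. lo (fst q) \<le> snd q} \<inter> {q \<in> XX T. snd q \<le> hi (fst q)}" by (auto simp: strip_def)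
  moreover have "closed {q \<in> XX T. lo (fst q) \<le> snd q}" "closed {q \<in> XX T. snd q \<le> hi (fst q)}"
    by (intro continuous_on_closed_Collect_le c1 cX continuous_intros)+
  ultimately have "closed (strip T lo hi)" by (simp add: closed_Int)
  then have sb: "strip T lo hi \<in> sets borel" by simp
  then show "strip T lo hi \<in> XX_sets T" by (auto simp: XX_sets_def strip_def)
  have int: "set_integrable lborel {0..T} (\<lambda>s. hi s - lo s)"
    by (intro borel_integrable_atLeastAtMost' continuous_on_diff c)
  have "emeasure lborel (strip T lo hi) = (\<integral>\<^sup>+s. emeasure lborel (Pair s -` strip T lo hi) \<partial>lborel)"
  proof -
    have "strip T lo hi \<in> sets (lborel \<Otimes>\<^sub>M lborel)" unfolding lborel_prod using sb by simp
    from lborel.emeasure_pair_measure_alt[OF this] show ?thesis unfolding lborel_prod .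
  qed
  also have "\<dots> \<le> (\<integral>\<^sup>+s. ennreal (indicator {0..T} s *\<^sub>R (hi s - lo s)) \<partial>lborel)"
  proof (rule nn_integral_mono)
    fix s :: real
    show "emeasure lborel (Pair s -` strip T lo hi) \<le> ennreal (indicator {0..T} s *\<^sub>R (hi s - lo s))"
    proof (cases "s \<in> {0..T}")
      case True
      have "emeasure lborel (Pair s -` strip T lo hi) \<le> emeasure lborel {lo s..hi s}"
      proof (rule emeasure_mono)
        show "Pair s -` strip T lo hi \<subseteq> {lo s..hi s}" unfolding strip_def subset_eq by simp
        show "{lo s..hi s} \<in> sets lborel" by simp
      qed
      also have "emeasure lborel {lo s..hi s} = ennreal (hi s - lo s)" using le[OF True] by simp
      also have "hi s - lo s = indicator {0..T} s *\<^sub>R (hi s - lo s)" using True by simp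
      finally show ?thesis .
    next
      case False
      then have "Pair s -` strip T lo hi = {}" unfolding strip_def XX_def by auto
      then show ?thesis by simp
    qed
  qed
  also have "\<dots> = ennreal (LINT s:{0..T}|lborel. hi s - lo s)"
    unfolding set_lebesgue_integral_def using int le
    by (intro nn_integral_eq_integral) (auto simp: set_integrable_def indicator_def intro!: AE_I2)
  finally have "emeasure lborel (strip T lo hi) \<le> ennreal (LINT s:{0..T}|lborel. hi s - lo s)" .
  moreover have "0 \<le> (LINT s:{0..T}|lborel. hi s - lo s)"
    unfolding set_lebesgue_integral_def by (rule integral_nonneg_AE) (use le in \<open>auto simp: indicator_def intro!: AE_I2\<close>)
  ultimately show "measure lborel (strip T lo hi) \<le> (LINT s:{0..T}|lborel. hi s - lo s)"
    unfolding measure_def by (intro enn2real_leI)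
qed

text \<open>This strip contains every point at which the region below \<open>a\<close> can be
  misjudged. The margin \<open>e\<close> will absorb either the diameter of a grid box or the effect
  of a time change.\<close>

lemma osc_strip:
  assumes T: "0 \<le> T" and a: "bounded_path T a" and k: "0 \<le> k" and e: "0 \<le> e"
  defines "S \<equiv> strip T (\<lambda>s. lowc T k a s - e) (\<lambda>s. upc T k a s + e)"
  shows "S \<in> XX_sets T" "measure lborel S \<le> osc T k a + 2 * T * e"
proof -
  have c: "continuous_on {0..T} (\<lambda>s. lowc T k a s - e)" "continuous_on {0..T} (\<lambda>s. upc T k a s + e)"
    by (intro continuous_intros lowc_continuous upc_continuous T a k)+
  have le: "lowc T k a s - e \<le> upc T k a s + e" if "s \<in> {0..T}" for s using lowc_le_upc[OF a k that] e by simp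
  show "S \<in> XX_sets T" unfolding S_def by (rule strip_measure(1)[OF c le])
  have i: "set_integrable lborel {0..T} (\<lambda>_. 2 * e)" by (rule borel_integrable_atLeastAtMost') auto
  have "measure lborel S \<le> (LINT s:{0..T}|lborel. (upc T k a s + e) - (lowc T k a s - e))"
    unfolding S_def by (rule strip_measure(2)[OF c le])
  also have "\<dots> = (LINT s:{0..T}|lborel. (upc T k a s - lowc T k a s) + 2 * e)"
    by (simp add: algebra_simps)
  also have "\<dots> = osc T k a + (LINT s:{0..T}|lborel. 2 * e)"
    unfolding osc_def by (rule set_integral_add(2)[OF osc_integrable[OF T a k] i])
  also have "(LINT s:{0..T}|lborel. 2 * e) = 2 * T * e"
    using T by (simp add: set_lebesgue_integral_def measure_def)
  finally show "measure lborel S \<le> osc T k a + 2 * T * e" .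
qed

lemma vertical_strip:
  assumes "0 \<le> T" "lo \<le> hi"
  shows "{q \<in> XX T. lo \<le> fst q \<and> fst q \<le> hi} \<in> XX_sets T" "measure lborel {q \<in> XX T. lo \<le> fst q \<and> fst q \<le> hi} \<le> hi - lo"
proof -
  have eq: "{q \<in> XX T. lo \<le> fst q \<and> fst q \<le> hi} = ({0..T} \<inter> {lo..hi}) \<times> {0..1}" by (auto simp: XX_def)
  have sb: "{q \<in> XX T. lo \<le> fst q \<and> fst q \<le> hi} \<in> sets borel" unfolding eq by (intro borel_Times) auto
  then show "{q \<in> XX T. lo \<le> fst q \<and> fst q \<le> hi} \<in> XX_sets T" by (auto simp: XX_sets_def)
  have "emeasure lborel (({0..T} \<inter> {lo..hi}) \<times> {0..1::real}) = emeasure lborel ({0..T} \<inter> {lo..hi}) * emeasure lborel {0..1::real}"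
    unfolding lborel_prod[symmetric] by (rule lborel.emeasure_pair_measure_Times) auto
  also have "\<dots> \<le> emeasure lborel {lo..hi}" by (simp, intro emeasure_mono) auto
  also have "\<dots> = ennreal (hi - lo)" using assms by simp
  finally show "measure lborel {q \<in> XX T. lo \<le> fst q \<and> fst q \<le> hi} \<le> hi - lo"
    unfolding eq measure_def using assms by (intro enn2real_leI) auto
qed

lemma left_lim_tendsto:
  assumes "regulated T a" "s \<in> {0<..T}" shows "(a \<longlongrightarrow> left_lim a s) (at_left s)"
proof -
  obtain L where L: "(a \<longlongrightarrow> L) (at_left s)" using regulatedD(2)[OF assms] by blast
  have "Lim (at_left s) a = L" by (rule tendsto_Lim[OF _ L]) simp
  then show ?thesis using L assms(2) by (simp add: left_lim_def)
qed

text \<open>The bounds of \<open>bracket\<close> are continuous in \<open>s\<close>, so they pass to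
  left limits. Regions defined with left limits, as in the prelimit equations, therefore obey the
  same strip estimate.\<close>

lemma left_lim_bracket:
  assumes a: "bounded_path T a" "regulated T a" and k: "0 \<le> k" and s: "s \<in> {0..T}"
  shows "left_lim a s \<le> upc T k a \<sigma> + k * \<bar>s - \<sigma>\<bar>" "lowc T k a \<sigma> - k * \<bar>s - \<sigma>\<bar> \<le> left_lim a s"
proof -
  have "left_lim a s \<le> upc T k a \<sigma> + k * \<bar>s - \<sigma>\<bar> \<and> lowc T k a \<sigma> - k * \<bar>s - \<sigma>\<bar> \<le> left_lim a s"
  proof (cases "s = 0")
    case True
    then show ?thesis using bracket[OF a(1) k s, of \<sigma>] by (simp add: left_lim_def)
  next
    case False
    then have s': "0 < s" "s \<in> {0<..T}" using s by auto
    note L = left_lim_tendsto[OF a(2) s'(2)]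
    have ev: "\<forall>\<^sub>F r in at_left s. r \<in> {0..T}"
      using eventually_at_left_real[OF s'(1)] by eventually_elim (use s in auto)
    have "((\<lambda>r. upc T k a \<sigma> + k * \<bar>r - \<sigma>\<bar>) \<longlongrightarrow> upc T k a \<sigma> + k * \<bar>s - \<sigma>\<bar>) (at_left s)"
      "((\<lambda>r. lowc T k a \<sigma> - k * \<bar>r - \<sigma>\<bar>) \<longlongrightarrow> lowc T k a \<sigma> - k * \<bar>s - \<sigma>\<bar>) (at_left s)"
      by (intro tendsto_intros)+
    then show ?thesis
      using tendsto_le[OF _ _ L, of "\<lambda>r. upc T k a \<sigma> + k * \<bar>r - \<sigma>\<bar>" "upc T k a \<sigma> + k * \<bar>s - \<sigma>\<bar>"]
        tendsto_le[OF _ L, of "\<lambda>r. lowc T k a \<sigma> - k * \<bar>r - \<sigma>\<bar>" "lowc T k a \<sigma> - k * \<bar>s - \<sigma>\<bar>"]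
        eventually_mono[OF ev bracket(1)[OF a(1) k]] eventually_mono[OF ev bracket(2)[OF a(1) k]]
      by simp
  qed
  then show "left_lim a s \<le> upc T k a \<sigma> + k * \<bar>s - \<sigma>\<bar>" "lowc T k a \<sigma> - k * \<bar>s - \<sigma>\<bar> \<le> left_lim a s" by auto
qed

lemma left_lim_eq:
  assumes a: "regulated T a" and s: "s \<in> {0..T}" "s \<notin> jumps T a"
  shows "left_lim a s = a s"
proof (cases "s = 0")
  case False
  then have s': "0 < s" "s \<in> {0<..T}" using s by auto
  have "(a \<longlongrightarrow> a s) (at_left s)"
  proof (rule tendstoI)
    fix e :: real assume "0 < e"
    from not_jump[OF s this] obtain d where d: "0 < d" "\<And>r. r \<in> {0..T} \<Longrightarrow> \<bar>r - s\<bar> < d \<Longrightarrow> \<bar>a r - a s\<bar> < e" by blast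
    have "max 0 (s - d) < s" using s' d by auto
    from eventually_at_left_real[OF this] show "\<forall>\<^sub>F r in at_left s. dist (a r) (a s) < e"
      by eventually_elim (use d(2) s in \<open>auto simp: dist_real_def\<close>)
  qed
  with left_lim_tendsto[OF a s'(2)] show ?thesis by (rule tendsto_unique[rotated]) simp
qed (simp add: left_lim_def)

text \<open>The function is continuous off a countable set; the endpoints join the exceptional set
  because the indicator may jump there.\<close>

lemma regulated_measurable:
  assumes a: "regulated T a" shows "(\<lambda>s. indicator {0..T} s * a s) \<in> borel_measurable borel"
proof (rule borel_measurable_continuous_countable_exceptions[where X = "insert 0 (insert T (jumps T a))"])
  show "countable (insert 0 (insert T (jumps T a)))" using countable_jumps[OF a] by simp
  show "continuous_on (- insert 0 (insert T (jumps T a))) (\<lambda>s. indicator {0..T} s * a s)"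
  proof (intro continuous_at_imp_continuous_on ballI)
    fix s assume s: "s \<in> - insert 0 (insert T (jumps T a))"
    show "isCont (\<lambda>s. indicator {0..T} s * a s) s"
      unfolding continuous_at_eps_delta
    proof (intro allI impI)
      fix e :: real assume e: "0 < e"
      consider "s < 0" | "T < s" | "0 < s" "s < T" using s by force
      then show "\<exists>d>0. \<forall>x'. dist x' s < d \<longrightarrow> dist (indicator {0..T} x' * a x') (indicator {0..T} s * a s) < e"
      proof cases
        case 1
        then show ?thesis using e by (intro exI[of _ "- s"]) (auto simp: dist_real_def indicator_def)
      next
        case 2
        then show ?thesis using e by (intro exI[of _ "s - T"]) (auto simp: dist_real_def indicator_def)
      next
        case 3
        then obtain d where d: "0 < d" "\<And>r. r \<in> {0..T} \<Longrightarrow> \<bar>r - s\<bar> < d \<Longrightarrow> \<bar>a r - a s\<bar> < e"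
          using not_jump[of s T a e] s e by auto
        have "\<bar>indicator {0..T} x * a x - indicator {0..T} s * a s\<bar> < e" if "\<bar>x - s\<bar> < min d (min s (T - s))" for x
        proof -
          have "x \<in> {0..T}" using that by auto
          then show ?thesis using d(2)[of x] that 3 by simp
        qed
        then show ?thesis using d(1) 3 by (intro exI[of _ "min d (min s (T - s))"]) (auto simp: dist_real_def)
      qed
    qed
  qed
qed

lemma left_lim_measurable:
  assumes a: "regulated T a" shows "(\<lambda>s. indicator {0..T} s * left_lim a s) \<in> borel_measurable borel"
  by (rule measurable_discrete_difference[OF regulated_measurable[OF a] countable_jumps[OF a]])
     (auto simp: indicator_def left_lim_eq[OF a])

lemma region_sets:
  assumes "(\<lambda>s. indicator {0..T} s * a s) \<in> borel_measurable borel" shows "region T a t \<in> XX_sets T"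
proof -
  have f: "fst \<in> borel_measurable (borel :: (real \<times> real) measure)" "snd \<in> borel_measurable (borel :: (real \<times> real) measure)"
    by (intro borel_measurable_continuous_onI continuous_intros)+
  have "{q \<in> space borel. snd q < (\<lambda>s. indicator {0..T} s * a s) (fst q)} \<in> sets (borel :: (real \<times> real) measure)"
    by (rule borel_measurable_less[OF f(2) measurable_compose[OF f(1) assms]])
  moreover have "{q \<in> space borel. fst q \<le> t} \<in> sets (borel :: (real \<times> real) measure)"
    by (rule borel_measurable_le[OF f(1)]) simp
  moreover have "region T a t = XX T \<inter> {q \<in> space borel. fst q \<le> t} \<inter> {q \<in> space borel. snd q < (\<lambda>s. indicator {0..T} s * a s) (fst q)}"
    by (auto simp: region_def XX_def)
  ultimately show ?thesis by (auto simp: XX_sets_def)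
qed

lemma countable_lines_null:
  assumes J: "countable J"
  shows "XX T \<inter> (J \<times> UNIV) \<in> XX_sets T" "measure lborel (XX T \<inter> (J \<times> UNIV)) = 0"
proof -
  have Jb: "J \<in> sets borel" using J by (rule sets.countable[rotated]) simp
  then have "J \<times> (UNIV :: real set) \<in> sets borel" by (intro borel_Times) auto
  then show "XX T \<inter> (J \<times> UNIV) \<in> XX_sets T" by (auto simp: XX_sets_def)
  have "emeasure lborel (XX T \<inter> (J \<times> UNIV)) \<le> emeasure lborel (J \<times> (UNIV :: real set))"
    using \<open>J \<times> (UNIV :: real set) \<in> sets borel\<close> by (intro emeasure_mono) auto
  also have "\<dots> = emeasure lborel J * emeasure lborel (UNIV :: real set)"
    unfolding lborel_prod[symmetric] by (rule lborel.emeasure_pair_measure_Times) (use Jb in auto)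
  also have "emeasure lborel J = 0" using J by (rule emeasure_lborel_countable)
  finally show "measure lborel (XX T \<inter> (J \<times> UNIV)) = 0" by (simp add: measure_def)
qed

lemma measure_diff_le:
  assumes \<kappa>: "finite_measure \<kappa>" and A: "A \<in> sets \<kappa>" "A' \<in> sets \<kappa>" "B \<in> sets \<kappa>" and sub: "A \<subseteq> A' \<union> B" "A' \<subseteq> A \<union> B"
  shows "\<bar>measure \<kappa> A - measure \<kappa> A'\<bar> \<le> measure \<kappa> B"
proof -
  interpret finite_measure \<kappa> by (rule \<kappa>)
  have "measure \<kappa> A \<le> measure \<kappa> (A' \<union> B)" "measure \<kappa> A' \<le> measure \<kappa> (A \<union> B)"
    using A sub by (intro finite_measure_mono; auto)+
  moreover have "measure \<kappa> (A' \<union> B) \<le> measure \<kappa> A' + measure \<kappa> B" "measure \<kappa> (A \<union> B) \<le> measure \<kappa> A + measure \<kappa> B"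
    using A by (intro measure_Un_le; auto simp: fmeasurable_eq_sets)+
  ultimately show ?thesis by linarith
qed

text \<open>The two regions differ on countably many vertical lines, which are null for an
  absolutely continuous measure. The atomic thinned measure has no such property, so left limits
  disappear only on the side of the compensator.\<close>

lemma region_left_lim:
  assumes M: "0 \<le> M" and \<kappa>: "ac_measure T M \<kappa>" and a: "regulated T a"
  shows "measure \<kappa> (region T (left_lim a) t) = measure \<kappa> (region T a t)"
proof -
  let ?B = "XX T \<inter> (jumps T a \<times> UNIV)"
  note B = countable_lines_null[OF countable_jumps[OF a], of T]
  have eq: "left_lim a (fst q) = a (fst q)" if "q \<in> XX T" "q \<notin> ?B" for q
    using that left_lim_eq[OF a, of "fst q"] by (cases q) (auto simp: XX_def)
  have "\<bar>measure \<kappa> (region T (left_lim a) t) - measure \<kappa> (region T a t)\<bar> \<le> measure \<kappa> ?B"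
    using B(1) ac_measureD(1)[OF \<kappa>] region_sets[OF left_lim_measurable[OF a]] region_sets[OF regulated_measurable[OF a]] eq
    by (intro measure_diff_le[OF ac_measureD(2)[OF \<kappa>]]) (auto simp: region_def)
  then show ?thesis using ac_null[OF M \<kappa> B] by simp
qed

lemma measure_lborel_Un:
  assumes "A \<in> XX_sets T" "B \<in> XX_sets T"
  shows "A \<union> B \<in> XX_sets T" "measure lborel (A \<union> B) \<le> measure lborel A + measure lborel B"
proof -
  show "A \<union> B \<in> XX_sets T" using assms by (auto simp: XX_sets_def)
  have "A \<in> fmeasurable lborel" "B \<in> fmeasurable lborel"
    using assms XX_sets_finite[OF assms(1)] XX_sets_finite[OF assms(2)] by (auto simp: XX_sets_def fmeasurable_def)
  then show "measure lborel (A \<union> B) \<le> measure lborel A + measure lborel B"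
    by (intro measure_Un_le) auto
qed

text \<open>The condition on \<open>b\<close> is the common property of \<open>a\<close> itself and
  of its left limits; both will be substituted for \<open>b\<close>. The error is the mass of a
  vertical strip around time \<open>t\<close> and of the strip between the envelopes of
  \<open>a\<close>.\<close>

lemma region_deviation:
  assumes T: "0 < T" and K: "0 < K" and c: "0 < c" and k: "0 \<le> k"
    and \<mu>: "finite_measure \<mu>" "sets \<mu> = XX_sets T" and \<kappa>: "ac_measure T M \<kappa>"
    and a: "bounded_path T a" and b: "region T b t \<in> XX_sets T"
    and br: "\<And>s \<sigma>. s \<in> {0..T} \<Longrightarrow> b s \<le> upc T k a \<sigma> + k * \<bar>s - \<sigma>\<bar> \<and> lowc T k a \<sigma> - k * \<bar>s - \<sigma>\<bar> \<le> b s"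
  shows "\<bar>measure \<mu> (region T b t) - measure \<kappa> (region T b t)\<bar> \<le> grid_dev T K \<mu> \<kappa> +
    (exp (1 + c) * (2 * T / real K + (osc T k a + 2 * T * ((k * T + 1) / real K))) + M / c)"
proof -
  \<comment> \<open>Within a box, times differ by at most T/K, which moves the envelopes by k T/K,
    and heights by at most 1/K.\<close>
  define e where "e = (k * T + 1) / real K"
  have e: "0 \<le> e" using k T K by (simp add: e_def)
  let ?V = "{q \<in> XX T. t - T / real K \<le> fst q \<and> fst q \<le> t + T / real K}"
  let ?S = "strip T (\<lambda>s. lowc T k a s - e) (\<lambda>s. upc T k a s + e)"
  have V: "?V \<in> XX_sets T" "measure lborel ?V \<le> 2 * T / real K"
    using vertical_strip[of T "t - T / real K" "t + T / real K"] T K by auto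
  have T0: "0 \<le> T" using T by simp
  note S = osc_strip[OF T0 a k e]
  note VS = measure_lborel_Un[OF V(1) S(1)]
  \<comment> \<open>A point of the box can leave the region for two reasons: its time exceeds
    \<open>t\<close>, which puts the box near the line at \<open>t\<close>, or its height is above
    the path, which puts the box between the enlarged envelopes.\<close>
  have bdry: "grid_box T K p \<subseteq> ?V \<union> ?S"
    if q: "q \<in> grid_box T K p" "q' \<in> grid_box T K p" "q \<in> region T b t" "q' \<notin> region T b t" for p q q'
  proof
    fix z assume z: "z \<in> grid_box T K p"
    have X: "z \<in> XX T" "q \<in> XX T" "q' \<in> XX T" using z q by (auto simp: grid_box_def)
    note d = grid_box_diam[OF T K z q(1)] grid_box_diam[OF T K z q(2)]
    have st: "fst q \<in> {0..T}" "fst q' \<in> {0..T}" using X by (auto simp: XX_def)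
    show "z \<in> ?V \<union> ?S"
    proof (cases "fst q' \<le> t")
      case False
      then show ?thesis using X d q(3) by (auto simp: region_def abs_le_iff)
    next
      case True
      have q1: "snd q < b (fst q)" "b (fst q') \<le> snd q'" using q True X by (auto simp: region_def)
      have k1: "k * \<bar>fst q - fst z\<bar> \<le> k * (T / real K)" "k * \<bar>fst q' - fst z\<bar> \<le> k * (T / real K)"
        using d k by (intro mult_left_mono; simp add: abs_minus_commute)+
      have e_eq: "e = k * (T / real K) + 1 / real K" by (simp add: e_def add_divide_distrib)
      have "snd z \<le> upc T k a (fst z) + e"
        using br[OF st(1), of "fst z"] q1 k1 d unfolding e_eq abs_le_iff by linarith
      moreover have "lowc T k a (fst z) - e \<le> snd z"
        using br[OF st(2), of "fst z"] q1 k1 d unfolding e_eq abs_le_iff by linarith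
      ultimately show ?thesis using X by (simp add: strip_def)
    qed
  qed
  have "\<bar>measure \<mu> (region T b t) - measure \<kappa> (region T b t)\<bar> \<le> grid_dev T K \<mu> \<kappa> + measure \<kappa> (?V \<union> ?S)"
    by (rule grid_deviation[OF T \<mu> ac_measureD(2,1)[OF \<kappa>] b VS(1) bdry])
  also have "measure \<kappa> (?V \<union> ?S) \<le> exp (1 + c) * measure lborel (?V \<union> ?S) + M / c"
    by (rule ac_measureD(4)[OF \<kappa> c VS(1)])
  also have "exp (1 + c) * measure lborel (?V \<union> ?S) \<le> exp (1 + c) * (2 * T / real K + (osc T k a + 2 * T * e))"
    using VS(2) V(2) S(2) by (intro mult_left_mono) auto
  finally show ?thesis by (simp add: e_def)
qed

lemma region_time_shift:
  assumes T: "0 \<le> T" and c: "0 < c" and \<kappa>: "ac_measure T M \<kappa>" and a: "regulated T a" and tt: "\<bar>t - t'\<bar> \<le> q"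
  shows "\<bar>measure \<kappa> (region T a t) - measure \<kappa> (region T a t')\<bar> \<le> exp (1 + c) * (2 * q) + M / c"
proof -
  let ?V = "{p \<in> XX T. t - q \<le> fst p \<and> fst p \<le> t + q}"
  have V: "?V \<in> XX_sets T" "measure lborel ?V \<le> 2 * q" using vertical_strip[OF T, of "t - q" "t + q"] tt by auto
  have "\<bar>measure \<kappa> (region T a t) - measure \<kappa> (region T a t')\<bar> \<le> measure \<kappa> ?V"
    using V(1) ac_measureD(1)[OF \<kappa>] region_sets[OF regulated_measurable[OF a]] tt
    by (intro measure_diff_le[OF ac_measureD(2)[OF \<kappa>]]) (auto simp: region_def abs_le_iff)
  also have "\<dots> \<le> exp (1 + c) * measure lborel ?V + M / c" by (rule ac_measureD(4)[OF \<kappa> c V(1)])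
  also have "exp (1 + c) * measure lborel ?V \<le> exp (1 + c) * (2 * q)" using V(2) by simp
  finally show ?thesis by simp
qed

text \<open>Both paths run inside the strip around the envelopes of \<open>a\<close> alone, since
  the envelopes of \<open>a'\<close> are within (1 + k) q of them. Hence the bound contains only the
  oscillation of \<open>a\<close>, which is the fixed path in the continuity argument.\<close>

lemma region_path_change:
  assumes T: "0 \<le> T" and c: "0 < c" and k: "0 \<le> k" and q: "0 \<le> q" and \<kappa>: "ac_measure T M \<kappa>"
    and a: "bounded_path T a" "bounded_path T a'" "regulated T a" "regulated T a'"
    and \<tau>: "\<tau> \<in> time_changes T" "\<And>r. r \<in> {0..T} \<Longrightarrow> \<bar>\<tau> r - r\<bar> \<le> q \<and> \<bar>a r - a' (\<tau> r)\<bar> \<le> q"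
  shows "\<bar>measure \<kappa> (region T a t) - measure \<kappa> (region T a' t)\<bar> \<le>
    exp (1 + c) * (osc T k a + 2 * T * ((1 + k) * q)) + M / c"
proof -
  have e: "0 \<le> (1 + k) * q" using k q by simp
  let ?S = "strip T (\<lambda>s. lowc T k a s - (1 + k) * q) (\<lambda>s. upc T k a s + (1 + k) * q)"
  note S = osc_strip[OF T a(1) k e]
  have br: "lowc T k a s - (1 + k) * q \<le> a s \<and> a s \<le> upc T k a s + (1 + k) * q \<and>
      lowc T k a s - (1 + k) * q \<le> a' s \<and> a' s \<le> upc T k a s + (1 + k) * q" if s: "s \<in> {0..T}" for s
    using bracket[OF a(1) k s, of s] bracket[OF a(2) k s, of s] e
      upc_time_change[OF T a(1,2) k \<tau>, of s] lowc_time_change[OF T a(1,2) k \<tau>, of s] by (simp add: abs_le_iff)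
  have fs: "fst p \<in> {0..T}" if "p \<in> XX T" for p using that by (auto simp: XX_def)
  have "\<bar>measure \<kappa> (region T a t) - measure \<kappa> (region T a' t)\<bar> \<le> measure \<kappa> ?S"
  proof (rule measure_diff_le[OF ac_measureD(2)[OF \<kappa>]])
    show "region T a t \<subseteq> region T a' t \<union> ?S"
    proof
      fix p assume p: "p \<in> region T a t"
      then have "p \<in> XX T" by (simp add: region_def)
      from br[OF fs[OF this]] p show "p \<in> region T a' t \<union> ?S" by (auto simp: region_def strip_def)
    qed
    show "region T a' t \<subseteq> region T a t \<union> ?S"
    proof
      fix p assume p: "p \<in> region T a' t"
      then have "p \<in> XX T" by (simp add: region_def)
      from br[OF fs[OF this]] p show "p \<in> region T a t \<union> ?S" by (auto simp: region_def strip_def)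
    qed
  qed (use S(1) ac_measureD(1)[OF \<kappa>] region_sets[OF regulated_measurable[OF a(3)]] region_sets[OF regulated_measurable[OF a(4)]] in auto)
  also have "\<dots> \<le> exp (1 + c) * measure lborel ?S + M / c" by (rule ac_measureD(4)[OF \<kappa> c S(1)])
  also have "exp (1 + c) * measure lborel ?S \<le> exp (1 + c) * (osc T k a + 2 * T * ((1 + k) * q))" using S(2) by simp
  finally show ?thesis by simp
qed

section \<open>Continuity of the violation functional\<close>

lemma continuous_map_realI:
  fixes f :: "'a \<Rightarrow> real"
  assumes "\<And>x e. x \<in> topspace X \<Longrightarrow> 0 < e \<Longrightarrow> \<exists>U. openin X U \<and> x \<in> U \<and> (\<forall>y\<in>U. \<bar>f y - f x\<bar> < e)"
  shows "continuous_map X euclideanreal f"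
  unfolding continuous_map_def
proof (intro conjI allI impI)
  fix V :: "real set" assume "openin euclideanreal V"
  then have V: "open V" by simp
  show "openin X {x \<in> topspace X. f x \<in> V}"
  proof (subst openin_subopen, intro ballI)
    fix x assume x: "x \<in> {x \<in> topspace X. f x \<in> V}"
    then obtain e where e: "0 < e" "\<And>r. \<bar>r - f x\<bar> < e \<Longrightarrow> r \<in> V"
      using V unfolding open_dist dist_real_def by auto
    obtain U where U: "openin X U" "x \<in> U" "\<And>y. y \<in> U \<Longrightarrow> \<bar>f y - f x\<bar> < e"
      using assms[of x e] x e(1) by blast
    then show "\<exists>U. openin X U \<and> x \<in> U \<and> U \<subseteq> {x \<in> topspace X. f x \<in> V}"
      using e(2) openin_subset[OF U(1)] by (intro exI[of _ U]) auto
  qed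
qed auto

lemma continuous_map_realD:
  fixes f :: "'a \<Rightarrow> real"
  assumes f: "continuous_map X euclideanreal f" and x: "x \<in> topspace X" and e: "0 < e"
  shows "\<exists>U. openin X U \<and> x \<in> U \<and> (\<forall>y\<in>U. \<bar>f y - f x\<bar> < e)"
proof -
  have "openin X {y \<in> topspace X. f y \<in> ball (f x) e}"
    using f by (rule openin_continuous_map_preimage) simp
  then show ?thesis using x e
    by (intro exI[of _ "{y \<in> topspace X. f y \<in> ball (f x) e}"]) (auto simp: dist_real_def abs_minus_commute)
qed

lemma weak_topology_integral_continuous:
  fixes f :: "'a :: topological_space \<Rightarrow> real"
  assumes f: "continuous_on E f" "bounded (f ` E)"
  shows "continuous_map (weak_topology E) euclideanreal (\<lambda>\<mu>. LINT x|\<mu>. f x)"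
proof -
  let ?S = "{{\<mu> \<in> finite_measures_on E. (LINT x|\<mu>. f x) \<in> U} | f U.
        continuous_on E f \<and> bounded (f ` E) \<and> open (U :: real set)}"
  have top: "topspace (weak_topology E) \<subseteq> finite_measures_on E"
    unfolding weak_topology_def topology_generated_by_topspace by auto
  have op: "openin (weak_topology E) {\<mu> \<in> finite_measures_on E. (LINT x|\<mu>. f x) \<in> U}" if "open U" for U
    unfolding weak_topology_def by (rule topology_generated_by_Basis) (use f that in blast)
  show ?thesis unfolding continuous_map_def
  proof (intro conjI allI impI)
    fix U :: "real set" assume "openin euclideanreal U"
    then have "openin (weak_topology E) (topspace (weak_topology E) \<inter> {\<mu> \<in> finite_measures_on E. (LINT x|\<mu>. f x) \<in> U})"
      using op by (intro openin_Int) auto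
    moreover have "topspace (weak_topology E) \<inter> {\<mu> \<in> finite_measures_on E. (LINT x|\<mu>. f x) \<in> U} =
        {\<mu> \<in> topspace (weak_topology E). (LINT x|\<mu>. f x) \<in> U}" using top by auto
    ultimately show "openin (weak_topology E) {\<mu> \<in> topspace (weak_topology E). (LINT x|\<mu>. f x) \<in> U}" by simp
  qed auto
qed

lemma S_integral_continuous:
  assumes "continuous_on (XX T) f" "bounded (f ` XX T)"
  shows "continuous_map (S_topology T M) euclideanreal (\<lambda>\<phi>. LINT x|control_measure T (\<phi> i). f x)"
proof -
  have "continuous_map (product_topology (\<lambda>_. weak_topology (XX T)) UNIV) (weak_topology (XX T)) (\<lambda>m. m i)"
    by (rule continuous_map_product_projection) simp
  from continuous_map_compose[OF this weak_topology_integral_continuous[OF assms]]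
  have "continuous_map (product_topology (\<lambda>_. weak_topology (XX T)) UNIV) euclideanreal (\<lambda>m. LINT x|m i. f x)"
    by (simp add: comp_def)
  from continuous_map_pullback[OF this, of "S_space T M" "\<lambda>h i. control_measure T (h i)"]
  show ?thesis unfolding S_topology_def by (simp add: comp_def)
qed

lemma topspace_S: "topspace (S_topology T M) \<subseteq> S_space T M"
  unfolding S_topology_def topspace_pullback_topology by auto

text \<open>
  Weak convergence only tests continuous functions; uniform integrability lets it test indicators of all Borel sets.
\<close>
lemma lusin_indicator:
  assumes E: "E \<in> XX_sets T" and d: "0 < \<delta>"
  obtains f B where "continuous_on UNIV f" "\<And>q. 0 \<le> f q \<and> f q \<le> (1 :: real)" "B \<in> XX_sets T" "measure lborel B \<le> \<delta>"
    "\<And>q. q \<in> XX T \<Longrightarrow> q \<notin> B \<Longrightarrow> f q = indicator E q"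
proof -
  have Eb: "E \<in> sets borel" "E \<subseteq> XX T" using E by (auto simp: XX_sets_def)
  then have El: "E \<in> sets lebesgue" by simp
  have d2: "0 < \<delta> / 2" using d by simp
  obtain C where C: "closed C" "C \<subseteq> E" "E - C \<in> lmeasurable" "emeasure lebesgue (E - C) < ennreal (\<delta> / 2)"
    by (rule sets_lebesgue_inner_closed[OF El d2])
  obtain O' where O': "open O'" "E \<subseteq> O'" "O' - E \<in> lmeasurable" "emeasure lebesgue (O' - E) < ennreal (\<delta> / 2)"
    by (rule sets_lebesgue_outer_open[OF El d2])
  \<comment> \<open>A Urysohn function equal to 1 on \<open>C\<close> and to 0 off \<open>O'\<close>
    can differ from the indicator of \<open>E\<close> only between the two sets.\<close>
  define B where "B = (E - C) \<union> ((O' - E) \<inter> XX T)"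
  have b: "E - C \<in> XX_sets T" "(O' - E) \<inter> XX T \<in> XX_sets T" using Eb C(1) O'(1) by (auto simp: XX_sets_def)
  have "emeasure lborel (E - C) \<le> ennreal (\<delta> / 2)"
    using C(4) b(1) by (simp add: XX_sets_def emeasure_completion)
  moreover have "emeasure lborel ((O' - E) \<inter> XX T) \<le> ennreal (\<delta> / 2)"
  proof -
    have "emeasure lborel ((O' - E) \<inter> XX T) \<le> emeasure lborel (O' - E)" using O' Eb by (intro emeasure_mono) auto
    also have "\<dots> = emeasure lebesgue (O' - E)" using O' Eb by (simp add: emeasure_completion)
    finally show ?thesis using O'(4) by simp
  qed
  moreover have "measure lborel X \<le> \<delta> / 2" if "emeasure lborel X \<le> ennreal (\<delta> / 2)" for X :: "(real \<times> real) set"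
    unfolding measure_def by (rule enn2real_leI[OF _ that]) (use d2 in simp)
  ultimately have "measure lborel (E - C) \<le> \<delta> / 2" "measure lborel ((O' - E) \<inter> XX T) \<le> \<delta> / 2" by blast+
  then have Bm: "B \<in> XX_sets T" "measure lborel B \<le> \<delta>"
    using measure_lborel_Un[OF b] unfolding B_def by auto
  have u: "closedin (top_of_set UNIV) C" "closedin (top_of_set UNIV) (- O')" "C \<inter> - O' = {}"
    using C(1,2) O'(1,2) by auto
  have "\<exists>f. continuous_on UNIV f \<and> (\<forall>x. f x \<in> closed_segment (1 :: real) 0) \<and> (\<forall>x\<in>C. f x = 1) \<and> (\<forall>x\<in>- O'. f x = 0)"
    by (rule Urysohn_local[OF u, of "1 :: real" 0]) blast
  then obtain f where f: "continuous_on UNIV f" "\<And>x. f x \<in> closed_segment (1 :: real) 0"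
    "\<And>x. x \<in> C \<Longrightarrow> f x = 1" "\<And>x. x \<in> - O' \<Longrightarrow> f x = 0" by blast
  show thesis
  proof (rule that[OF f(1) _ Bm])
    show "0 \<le> f q \<and> f q \<le> 1" for q using f(2)[of q] by (simp add: closed_segment_eq_real_ivl)
    show "f q = indicator E q" if q: "q \<in> XX T" "q \<notin> B" for q
      using q f(3)[of q] f(4)[of q] C(2) by (auto simp: B_def indicator_def)
  qed
qed

text \<open>The exceptional set of the continuous approximation is chosen by Lebesgue measure alone,
  so by \<open>ac_modulus\<close> it has small mass for all controls of the space simultaneously. A
  third of \<open>e\<close> goes to each of the three comparisons.\<close>

lemma S_measure_continuous:
  assumes M: "0 \<le> M" and E: "E \<in> XX_sets T"
  shows "continuous_map (S_topology T M) euclideanreal (\<lambda>\<phi>. measure (control_measure T (\<phi> i)) E)"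
proof (rule continuous_map_realI)
  fix \<phi>0 and e :: real assume \<phi>0: "\<phi>0 \<in> topspace (S_topology T M)" and e: "0 < e"
  have e3: "0 < e / 3" using e by simp
  obtain \<delta> where \<delta>: "0 < \<delta>" "\<And>\<kappa> E. ac_measure T M \<kappa> \<Longrightarrow> E \<in> XX_sets T \<Longrightarrow> measure lborel E \<le> \<delta> \<Longrightarrow> measure \<kappa> E < e / 3"
    using ac_modulus[OF M e3] by blast
  obtain f B where f: "continuous_on UNIV f" "\<And>q. 0 \<le> f q \<and> f q \<le> (1 :: real)" "B \<in> XX_sets T" "measure lborel B \<le> \<delta>"
    "\<And>q. q \<in> XX T \<Longrightarrow> q \<notin> B \<Longrightarrow> f q = indicator E q" using lusin_indicator[OF E \<delta>(1)] by blast
  have close: "\<bar>(LINT x|control_measure T (\<phi> i). f x) - measure (control_measure T (\<phi> i)) E\<bar> < e / 3"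
    if "\<phi> \<in> topspace (S_topology T M)" for \<phi>
  proof -
    let ?\<kappa> = "control_measure T (\<phi> i)"
    have ac: "ac_measure T M ?\<kappa>" using that topspace_S by (intro control_ac[OF _ M]) auto
    interpret finite_measure ?\<kappa> by (rule ac_measureD(2)[OF ac])
    have fm: "f \<in> borel_measurable ?\<kappa>"
    proof -
      have "f \<in> borel_measurable (restrict_space borel (XX T))"
        by (intro measurable_restrict_space1 borel_measurable_continuous_onI f(1))
      moreover have "sets ?\<kappa> = sets (restrict_space borel (XX T))" using ac_measureD(1)[OF ac] by (simp add: sets_restrict_XX)
      ultimately show ?thesis using measurable_cong_sets[of ?\<kappa> "restrict_space borel (XX T)" borel borel] by blast
    qed
    have Es: "E \<in> sets ?\<kappa>" "B \<in> sets ?\<kappa>" using E f(3) ac_measureD(1)[OF ac] by auto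
    have fi: "integrable ?\<kappa> f" by (rule integrable_const_bound[of _ 1]) (use f(2) fm in \<open>auto simp: abs_le_iff intro: order_trans\<close>)
    have Ei: "integrable ?\<kappa> (indicator E :: _ \<Rightarrow> real)" "integrable ?\<kappa> (indicator B :: _ \<Rightarrow> real)"
      using Es by (auto simp: less_top[symmetric])
    have "(LINT x|?\<kappa>. f x) - measure ?\<kappa> E = (LINT x|?\<kappa>. f x - indicator E x)"
      using fi Ei Es by simp
    also have "\<bar>\<dots>\<bar> \<le> (LINT x|?\<kappa>. indicator B x)"
    proof (rule integral_abs_bound_integral)
      show "\<bar>f x - indicator E x\<bar> \<le> indicator B x" if "x \<in> space ?\<kappa>" for x
      proof (cases "x \<in> B")
        case True
        then show ?thesis using f(2)[of x] by (auto simp: indicator_def)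
      next
        case False
        then show ?thesis using f(5)[of x] that ac_measureD(3)[OF ac] by simp
      qed
    qed (use fi Ei in auto)
    also have "\<dots> = measure ?\<kappa> B" using Es by simp
    also have "\<dots> < e / 3" by (rule \<delta>(2)[OF ac f(3,4)])
    finally show ?thesis .
  qed
  have "bounded (f ` XX T)" unfolding bounded_iff using f(2) by (intro exI[of _ 1]) auto
  then have "continuous_map (S_topology T M) euclideanreal (\<lambda>\<phi>. LINT x|control_measure T (\<phi> i). f x)"
    using f(1) by (intro S_integral_continuous) (auto intro: continuous_on_subset)
  from continuous_map_realD[OF this \<phi>0 e3] obtain U where U: "openin (S_topology T M) U" "\<phi>0 \<in> U"
    "\<And>\<phi>. \<phi> \<in> U \<Longrightarrow> \<bar>(LINT x|control_measure T (\<phi> i). f x) - (LINT x|control_measure T (\<phi>0 i). f x)\<bar> < e / 3" by blast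
  have "\<bar>measure (control_measure T (\<phi> i)) E - measure (control_measure T (\<phi>0 i)) E\<bar> < e" if "\<phi> \<in> U" for \<phi>
  proof -
    have "\<phi> \<in> topspace (S_topology T M)" using that openin_subset[OF U(1)] by blast
    then show ?thesis using U(3)[OF that] close[OF \<phi>0] close[of \<phi>] by linarith
  qed
  then show "\<exists>U. openin (S_topology T M) U \<and> \<phi>0 \<in> U \<and> (\<forall>\<phi>\<in>U. \<bar>measure (control_measure T (\<phi> i)) E - measure (control_measure T (\<phi>0 i)) E\<bar> < e)"
    using U by blast
qed

section \<open>Coordinates of the state space\<close>

lemma mspace_state: "mspace state_metric = ell1_down \<times> ell1 \<times> {x. x 0 = 0}"
  by (simp add: state_metric_def Rinf_metric_def)

lemma abs_le_ell1_norm: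
  assumes "x \<in> ell1" "y \<in> ell1" shows "\<bar>x i - y i\<bar> \<le> ell1_norm (\<lambda>i. x i - y i)"
proof -
  have s: "(\<lambda>i. \<bar>x i - y i\<bar>) summable_on UNIV"
    by (rule summable_on_comparison_test[OF summable_on_add[of "\<lambda>i. \<bar>x i\<bar>" UNIV "\<lambda>i. \<bar>y i\<bar>"]])
       (use assms in \<open>auto simp: ell1_def abs_triangle_ineq4\<close>)
  have "(\<Sum>\<^sub>\<infinity>j\<in>{i}. \<bar>x j - y j\<bar>) \<le> (\<Sum>\<^sub>\<infinity>j. \<bar>x j - y j\<bar>)"
    by (rule infsum_mono_neutral) (use s in auto)
  then show ?thesis by (simp add: ell1_norm_def)
qed

lemma state_mdist_ge:
  assumes "p \<in> mspace state_metric" "p' \<in> mspace state_metric"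
  shows "ell1_norm (\<lambda>i. fst p i - fst p' i) \<le> mdist state_metric p p'"
    "ell1_norm (\<lambda>i. fst (snd p) i - fst (snd p') i) \<le> mdist state_metric p p'"
    "dist (snd (snd p)) (snd (snd p')) \<le> mdist state_metric p p'"
proof -
  obtain x y e x' y' e' where p: "p = (x, y, e)" "p' = (x', y', e')" by (metis prod_cases3)
  have eq: "mdist state_metric p p' = sqrt ((ell1_norm (\<lambda>i. x i - x' i))\<^sup>2 + (sqrt ((ell1_norm (\<lambda>i. y i - y' i))\<^sup>2 + (dist e e')\<^sup>2))\<^sup>2)"
    unfolding p state_metric_def Rinf_metric_def ell1_down_metric_def by (simp add: prod_dist_def)
  let ?a = "ell1_norm (\<lambda>i. x i - x' i)" and ?b = "ell1_norm (\<lambda>i. y i - y' i)" and ?c = "dist e e'"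
  have m: "mdist state_metric p p' = sqrt (?a\<^sup>2 + (?b\<^sup>2 + ?c\<^sup>2))" unfolding eq by (simp add: add_nonneg_nonneg)
  have le: "r \<le> sqrt (?a\<^sup>2 + (?b\<^sup>2 + ?c\<^sup>2))" if "r\<^sup>2 \<le> ?a\<^sup>2 + (?b\<^sup>2 + ?c\<^sup>2)" for r
    using that by (rule real_le_rsqrt)
  show "ell1_norm (\<lambda>i. fst p i - fst p' i) \<le> mdist state_metric p p'" unfolding m using le[of ?a] by (simp add: p)
  show "ell1_norm (\<lambda>i. fst (snd p) i - fst (snd p') i) \<le> mdist state_metric p p'" unfolding m using le[of ?b] by (simp add: p)
  show "dist (snd (snd p)) (snd (snd p')) \<le> mdist state_metric p p'" unfolding m using le[of ?c] by (simp add: p)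
qed

text \<open>Uniform continuity is required, since closeness in the Skorokhod distance has to give
  closeness of the coordinate at all times of the interval at once.\<close>

definition uc_coord :: "((nat \<Rightarrow> real) \<times> (nat \<Rightarrow> real) \<times> (nat \<Rightarrow> real) \<Rightarrow> real) \<Rightarrow> bool" where
  "uc_coord F \<longleftrightarrow> (\<forall>e>0. \<exists>d>0. \<forall>p\<in>mspace state_metric. \<forall>p'\<in>mspace state_metric.
     mdist state_metric p p' < d \<longrightarrow> \<bar>F p - F p'\<bar> < e)"

lemma uc_coord_X: "uc_coord (\<lambda>p. fst p i)"
  unfolding uc_coord_def
proof (intro allI impI)
  fix e :: real assume e: "0 < e"
  have "\<bar>fst p i - fst p' i\<bar> < e" if "p \<in> mspace state_metric" "p' \<in> mspace state_metric" "mdist state_metric p p' < e" for p p'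
    using abs_le_ell1_norm[of "fst p" "fst p'" i] state_mdist_ge(1)[OF that(1,2)] that by (auto simp: mspace_state ell1_down_def)
  then show "\<exists>d>0. \<forall>p\<in>mspace state_metric. \<forall>p'\<in>mspace state_metric. mdist state_metric p p' < d \<longrightarrow> \<bar>fst p i - fst p' i\<bar> < e"
    using e by blast
qed

lemma uc_coord_Y: "uc_coord (\<lambda>p. fst (snd p) i)"
  unfolding uc_coord_def
proof (intro allI impI)
  fix e :: real assume e: "0 < e"
  have "\<bar>fst (snd p) i - fst (snd p') i\<bar> < e" if "p \<in> mspace state_metric" "p' \<in> mspace state_metric" "mdist state_metric p p' < e" for p p'
    using abs_le_ell1_norm[of "fst (snd p)" "fst (snd p')" i] state_mdist_ge(2)[OF that(1,2)] that by (auto simp: mspace_state)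
  then show "\<exists>d>0. \<forall>p\<in>mspace state_metric. \<forall>p'\<in>mspace state_metric. mdist state_metric p p' < d \<longrightarrow> \<bar>fst (snd p) i - fst (snd p') i\<bar> < e"
    using e by blast
qed

lemma uc_coord_eta: "uc_coord (\<lambda>p. snd (snd p) i)"
  unfolding uc_coord_def
proof (intro allI impI)
  fix e :: real assume e: "0 < e"
  \<comment> \<open>The product metric weights coordinate \<open>i\<close> by (1/2)^(to_nat i) and
    cuts its distance off at 1; hence the factor and the \<open>min\<close>.\<close>
  define d where "d = (1/2) ^ to_nat i * min e 1"
  have d: "0 < d" using e by (simp add: d_def)
  have "\<bar>snd (snd p) i - snd (snd p') i\<bar> < e" if "p \<in> mspace state_metric" "p' \<in> mspace state_metric" "mdist state_metric p p' < d" for p p'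
  proof -
    let ?x = "snd (snd p)" and ?y = "snd (snd p')"
    have sm: "summable (\<lambda>n. (1/2) ^ n * min (dist (?x (from_nat n)) (?y (from_nat n))) 1 :: real)"
      by (rule summable_comparison_test'[of "\<lambda>n. (1/2) ^ n :: real" 0]) (auto simp: summable_geometric mult_left_le)
    have "(\<Sum>n\<in>{to_nat i}. (1/2) ^ n * min (dist (?x (from_nat n)) (?y (from_nat n))) 1) \<le>
        (\<Sum>n. (1/2) ^ n * min (dist (?x (from_nat n)) (?y (from_nat n))) 1)"
      by (rule sum_le_suminf[OF sm]) auto
    then have "(1/2) ^ to_nat i * min \<bar>?x i - ?y i\<bar> 1 \<le> dist ?x ?y"
      unfolding dist_fun_def by (simp add: dist_real_def)
    also have "\<dots> < d" using state_mdist_ge(3)[OF that(1,2)] that(3) by simp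
    finally have "min \<bar>?x i - ?y i\<bar> 1 < min e 1" unfolding d_def by simp
    then show ?thesis by linarith
  qed
  then show "\<exists>d>0. \<forall>p\<in>mspace state_metric. \<forall>p'\<in>mspace state_metric. mdist state_metric p p' < d \<longrightarrow> \<bar>snd (snd p) i - snd (snd p') i\<bar> < e"
    using d by blast
qed

lemma uc_coord_diff: assumes "uc_coord F" "uc_coord G" shows "uc_coord (\<lambda>p. F p - G p)"
  unfolding uc_coord_def
proof (intro allI impI)
  fix e :: real assume e: "0 < e"
  then have e2: "0 < e / 2" by simp
  obtain d1 where d1: "0 < d1" "\<And>p p'. p \<in> mspace state_metric \<Longrightarrow> p' \<in> mspace state_metric \<Longrightarrow> mdist state_metric p p' < d1 \<Longrightarrow> \<bar>F p - F p'\<bar> < e / 2"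
    using assms(1) e2 unfolding uc_coord_def by meson
  obtain d2 where d2: "0 < d2" "\<And>p p'. p \<in> mspace state_metric \<Longrightarrow> p' \<in> mspace state_metric \<Longrightarrow> mdist state_metric p p' < d2 \<Longrightarrow> \<bar>G p - G p'\<bar> < e / 2"
    using assms(2) e2 unfolding uc_coord_def by meson
  have "\<bar>F p - G p - (F p' - G p')\<bar> < e" if "p \<in> mspace state_metric" "p' \<in> mspace state_metric" "mdist state_metric p p' < min d1 d2" for p p'
  proof -
    have "\<bar>F p - F p'\<bar> < e / 2" "\<bar>G p - G p'\<bar> < e / 2" using d1(2)[OF that(1,2)] d2(2)[OF that(1,2)] that(3) by auto
    then show ?thesis by linarith
  qed
  then show "\<exists>d>0. \<forall>p\<in>mspace state_metric. \<forall>p'\<in>mspace state_metric. mdist state_metric p p' < d \<longrightarrow> \<bar>F p - G p - (F p' - G p')\<bar> < e"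
    using d1(1) d2(1) by (intro exI[of _ "min d1 d2"]) auto
qed

lemma coord_tendsto:
  assumes F: "uc_coord F" and l: "limitin (mtopology_of state_metric) f l \<F>"
  shows "((\<lambda>s. F (f s)) \<longlongrightarrow> F l) \<F>"
proof (rule tendstoI)
  fix e :: real assume "0 < e"
  then obtain d where d: "0 < d" "\<And>p p'. p \<in> mspace state_metric \<Longrightarrow> p' \<in> mspace state_metric \<Longrightarrow> mdist state_metric p p' < d \<Longrightarrow> \<bar>F p - F p'\<bar> < e"
    using F unfolding uc_coord_def by meson
  interpret Metric_space "mspace state_metric" "mdist state_metric" by blast
  have "l \<in> mspace state_metric" "\<forall>\<^sub>F s in \<F>. f s \<in> mspace state_metric \<and> mdist state_metric (f s) l < d"
    using l d(1) limitin_metric[of f l \<F>] unfolding mtopology_of_def by auto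
  then show "\<forall>\<^sub>F s in \<F>. dist (F (f s)) (F l) < e"
    by (auto elim!: eventually_mono simp: dist_real_def d(2))
qed

lemma coord_cadlag:
  assumes F: "uc_coord F" and p: "p \<in> cadlag_space T state_metric"
  shows "regulated T (\<lambda>s. F (p s))" "\<And>t. t \<in> {0..<T} \<Longrightarrow> ((\<lambda>s. F (p s)) \<longlongrightarrow> F (p t)) (at_right t)"
proof -
  show r: "((\<lambda>s. F (p s)) \<longlongrightarrow> F (p t)) (at_right t)" if "t \<in> {0..<T}" for t
    using p that by (intro coord_tendsto[OF F]) (auto simp: cadlag_space_def)
  have l: "\<exists>L. ((\<lambda>s. F (p s)) \<longlongrightarrow> L) (at_left t)" if "t \<in> {0<..T}" for t
  proof -
    have "\<exists>l. limitin (mtopology_of state_metric) p l (at_left t)"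
    proof -
      have "\<forall>t\<in>{0<..T}. \<exists>l. limitin (mtopology_of state_metric) p l (at_left t)"
        using p by (simp add: cadlag_space_def)
      then show ?thesis using that by blast
    qed
    then show ?thesis using coord_tendsto[OF F] by blast
  qed
  show "regulated T (\<lambda>s. F (p s))" unfolding regulated_def using r l by blast
qed

section \<open>The violation functional\<close>

type_synonym state = "(nat \<Rightarrow> real) \<times> (nat \<Rightarrow> real) \<times> (nat \<Rightarrow> real)"

definition cX :: "(real \<Rightarrow> state) \<Rightarrow> nat \<Rightarrow> real \<Rightarrow> real" where "cX p i s = fst (p s) i"
definition cY :: "(real \<Rightarrow> state) \<Rightarrow> nat \<Rightarrow> real \<Rightarrow> real" where "cY p i s = fst (snd (p s)) i"
definition cE :: "(real \<Rightarrow> state) \<Rightarrow> nat \<Rightarrow> real \<Rightarrow> real" where "cE p i s = snd (snd (p s)) i"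
definition gap :: "(real \<Rightarrow> state) \<Rightarrow> nat \<Rightarrow> real \<Rightarrow> real" where "gap p i s = fst (p s) i - fst (p s) (i + 1)"

text \<open>
  The height \<open>2\<close> exceeds every mark, so that the region is the whole of \<open>[0,t] \<times> [0,1]\<close>.
\<close>
definition arrivals :: "real \<Rightarrow> (nat \<Rightarrow> real \<times> real \<Rightarrow> real) \<Rightarrow> real \<Rightarrow> real" where
  "arrivals T \<phi> t = measure (control_measure T (\<phi> 0)) (region T (\<lambda>_. 2) t)"

definition services :: "real \<Rightarrow> (real \<Rightarrow> state) \<Rightarrow> (nat \<Rightarrow> real \<times> real \<Rightarrow> real) \<Rightarrow> nat \<Rightarrow> real \<Rightarrow> real" where
  "services T p \<phi> i t = measure (control_measure T (\<phi> i)) (region T (gap p i) t)"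

text \<open>All summands are nonnegative, so a zero satisfies each relation separately. The
  domination of increments of \<open>cE\<close> by those of the arrivals is an auxiliary relation:
  it makes the limit of \<eta> absolutely continuous.\<close>

definition viol :: "real \<Rightarrow> real \<Rightarrow> (nat \<Rightarrow> real) \<Rightarrow> nat \<Rightarrow> (real \<Rightarrow> state) \<times> (nat \<Rightarrow> real \<times> real \<Rightarrow> real) \<Rightarrow> real \<Rightarrow> real \<Rightarrow> real" where
  "viol T lam x i z s t = (case z of (p, \<phi>) \<Rightarrow>
     \<bar>cY p i t - x i - (if i = 1 then lam * arrivals T \<phi> t else 0) + services T p \<phi> i t\<bar>
   + \<bar>cX p i t - cY p i t - cE p (i - 1) t + cE p i t\<bar>
   + max 0 (cE p i s - cE p i t)
   + max 0 (cE p i t - cE p i s - lam * (arrivals T \<phi> t - arrivals T \<phi> s))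
   + max 0 (min (cE p i t - cE p i s) (INF u\<in>{s..t}. 1 - cX p i u))
   + \<bar>cE p i 0\<bar>)"

definition time_pairs :: "real \<Rightarrow> (real \<times> real) set" where
  "time_pairs T = {(s, t). 0 \<le> s \<and> s \<le> t \<and> t \<le> T}"

text \<open>A time change maps ordered pairs of times onto ordered pairs, so the supremum survives
  it although the value at a fixed pair does not. The cut at 1 makes it bounded.\<close>

definition Phi :: "real \<Rightarrow> real \<Rightarrow> (nat \<Rightarrow> real) \<Rightarrow> nat \<Rightarrow> (real \<Rightarrow> state) \<times> (nat \<Rightarrow> real \<times> real \<Rightarrow> real) \<Rightarrow> real" where
  "Phi T lam x i z = (SUP (s, t)\<in>time_pairs T. min 1 (viol T lam x i z s t))"

text \<open>The subtracted terms are the errors that remain in the prelimit when the grid becomes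
  fine. There the coefficient of \<open>M / c\<close> is 5 q + 1 with q tending to
  \<open>lam\<close>; since q is eventually below 3/2 \<open>lam\<close>, it is at most 8
  \<open>lam\<close> + 1.\<close>

definition Psi :: "real \<Rightarrow> real \<Rightarrow> (nat \<Rightarrow> real) \<Rightarrow> real \<Rightarrow> real \<Rightarrow> real \<Rightarrow> nat \<Rightarrow> (real \<Rightarrow> state) \<times> (nat \<Rightarrow> real \<times> real \<Rightarrow> real) \<Rightarrow> real" where
  "Psi T lam x M c k i z = max 0 (Phi T lam x i z - exp (1 + c) * osc T k (gap (fst z) i) - (8 * lam + 1) * (M / c))"

lemma cadlag_mem: "p \<in> cadlag_space T state_metric \<Longrightarrow> s \<in> {0..T} \<Longrightarrow> p s \<in> mspace state_metric"
  by (auto simp: cadlag_space_def)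

lemma cX_range: "p \<in> cadlag_space T state_metric \<Longrightarrow> s \<in> {0..T} \<Longrightarrow> 1 \<le> i \<Longrightarrow> 0 \<le> cX p i s \<and> cX p i s \<le> 1"
  using cadlag_mem[of p T s] by (auto simp: mspace_state ell1_down_def cX_def)

lemma gap_bounded: "p \<in> cadlag_space T state_metric \<Longrightarrow> 1 \<le> i \<Longrightarrow> bounded_path T (gap p i)"
  unfolding bounded_path_def
proof (intro exI[of _ 1] ballI)
  fix s assume p: "p \<in> cadlag_space T state_metric" "1 \<le> i" "s \<in> {0..T}"
  show "\<bar>gap p i s\<bar> \<le> 1"
    using cX_range[OF p(1,3), of i] cX_range[OF p(1,3), of "i + 1"] p(2) by (auto simp: gap_def cX_def)
qed

lemma uc_coord_gap: "uc_coord (\<lambda>q. fst q i - fst q (i + 1))"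
  by (rule uc_coord_diff[OF uc_coord_X uc_coord_X])

lemma gap_regulated: "p \<in> cadlag_space T state_metric \<Longrightarrow> regulated T (gap p i)"
  using coord_cadlag(1)[OF uc_coord_gap, of p T i] unfolding gap_def .

lemma const_regulated: "regulated T (\<lambda>_. c)" by (auto simp: regulated_def)

lemma const_bounded: "bounded_path T (\<lambda>_. c)" by (auto simp: bounded_path_def)

lemma grid_dev_continuous:
  assumes M: "0 \<le> M"
  shows "continuous_map (S_topology T M) euclideanreal (\<lambda>\<phi>. grid_dev T K (control_measure T (\<phi> i)) \<kappa>)"
  unfolding grid_dev_def
  by (intro continuous_map_sum finite_grid_index continuous_map_real_abs continuous_map_diff
      S_measure_continuous[OF M grid_box_sets]) auto

text \<open>Time, measure and path are changed one after the other. The neighbourhood is uniform in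
  \<open>t\<close> and in the perturbed path, because it restricts the control only through finitely
  many grid masses.\<close>

lemma region_neighbourhood:
  assumes T: "0 < T" and M: "0 \<le> M" and a0: "bounded_path T a0" "regulated T a0" and \<phi>0: "\<phi>0 \<in> topspace (S_topology T M)"
    and e: "0 < e"
  obtains q V where "0 < q" "openin (S_topology T M) V" "\<phi>0 \<in> V"
    "\<And>\<phi> a \<tau> t. \<phi> \<in> V \<Longrightarrow> bounded_path T a \<Longrightarrow> regulated T a \<Longrightarrow> \<tau> \<in> time_changes T \<Longrightarrow>
      (\<And>r. r \<in> {0..T} \<Longrightarrow> \<bar>\<tau> r - r\<bar> \<le> q \<and> \<bar>a0 r - a (\<tau> r)\<bar> \<le> q) \<Longrightarrow> t \<in> {0..T} \<Longrightarrow>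
      \<bar>measure (control_measure T (\<phi>0 i)) (region T a0 t) - measure (control_measure T (\<phi> i)) (region T a (\<tau> t))\<bar> < e"
proof -
  have T0: "0 \<le> T" using T by simp
  \<comment> \<open>The parameters are fixed in the order \<open>c\<close>, \<open>k\<close>,
    \<open>K\<close>, \<open>q\<close>, each allowed to depend on the earlier ones. Every elementary
    error is kept to e/20, and nine of them occur in the end.\<close>
  define c where "c = 20 * M / e + 1"
  have c: "0 < c" using M e by (auto simp: c_def intro!: add_nonneg_pos divide_nonneg_pos)
  have Mc: "M / c < e / 20" using M e c by (simp add: c_def field_simps)
  define A where "A = exp (1 + c)"
  have A: "0 < A" by (simp add: A_def)
  have ea: "0 < e / (20 * A)" using e A by simp
  obtain k where k: "osc T (real k) a0 < e / (20 * A)"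
    using order_tendstoD(2)[OF osc_tendsto[OF T0 a0] ea] unfolding eventually_sequentially by blast
  have k': "A * osc T (real k) a0 < e / 20" using k A by (simp add: field_simps)
  obtain K :: nat where K: "20 * A * (2 * T + 2 * T * (real k * T + 1)) / e < real K" using reals_Archimedean2 by blast
  have Kpos: "0 < K"
  proof -
    have "0 \<le> 20 * A * (2 * T + 2 * T * (real k * T + 1)) / e" using T A e by (intro divide_nonneg_pos mult_nonneg_nonneg add_nonneg_nonneg) auto
    then show ?thesis using K by (metis le_less_trans of_nat_0_less_iff)
  qed
  have K': "A * (2 * T / real K + 2 * T * ((real k * T + 1) / real K)) < e / 20"
  proof -
    have "20 * A * (2 * T + 2 * T * (real k * T + 1)) < real K * e" using K e by (simp add: field_simps)
    then have "A * (2 * T + 2 * T * (real k * T + 1)) / real K < e / 20" using Kpos by (simp add: field_simps)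
    moreover have "A * (2 * T / real K + 2 * T * ((real k * T + 1) / real K)) = A * (2 * T + 2 * T * (real k * T + 1)) / real K"
      by (simp add: add_divide_distrib distrib_left)
    ultimately show ?thesis by simp
  qed
  define q where "q = min (e / (40 * A)) (e / (40 * A * T * (1 + real k)))"
  have den: "0 < 40 * A * T * (1 + real k)" using A T by simp
  have q: "0 < q" unfolding q_def using e A den by simp
  have q1: "A * (2 * q) \<le> e / 20"
  proof -
    have "q \<le> e / (40 * A)" by (simp add: q_def)
    then have "q * (40 * A) \<le> e" using A by (simp add: field_simps)
    then show ?thesis by (simp add: algebra_simps)
  qed
  have q2: "A * (2 * T * ((1 + real k) * q)) \<le> e / 20"
  proof -
    have "q \<le> e / (40 * A * T * (1 + real k))" by (simp add: q_def)
    then have "q * (40 * A * T * (1 + real k)) \<le> e" using den by (simp only: pos_le_divide_eq)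
    then show ?thesis by (simp add: algebra_simps)
  qed
  let ?kz = "control_measure T (\<phi>0 i)"
  have acS: "ac_measure T M (control_measure T (\<phi> i))" if "\<phi> \<in> topspace (S_topology T M)" for \<phi>
    using that topspace_S by (intro control_ac[OF _ M]) auto
  have dev0: "grid_dev T K ?kz ?kz = 0" by (simp add: grid_dev_def)
  have e20: "0 < e / 20" using e by simp
  obtain V where V: "openin (S_topology T M) V" "\<phi>0 \<in> V"
    "\<forall>\<phi>\<in>V. \<bar>grid_dev T K (control_measure T (\<phi> i)) ?kz - 0\<bar> < e / 20"
    using continuous_map_realD[OF grid_dev_continuous[OF M, of T K i ?kz] \<phi>0 e20] unfolding dev0 by blast
  show thesis
  proof (rule that[OF q V(1,2)])
    fix \<phi> a \<tau> t
    assume as: "\<phi> \<in> V" "bounded_path T a" "regulated T a" "\<tau> \<in> time_changes T"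
      "\<And>r. r \<in> {0..T} \<Longrightarrow> \<bar>\<tau> r - r\<bar> \<le> q \<and> \<bar>a0 r - a (\<tau> r)\<bar> \<le> q" "t \<in> {0..T}"
    let ?k = "control_measure T (\<phi> i)"
    have \<phi>t: "\<phi> \<in> topspace (S_topology T M)" using as(1) openin_subset[OF V(1)] by blast
    note ac0 = acS[OF \<phi>0] and ac = acS[OF \<phi>t]
    have k0: "0 \<le> real k" by simp
    \<comment> \<open>The comparison passes from time t to \<tau> t, then from \<phi>0 to \<phi>
      with path and time fixed, then from \<open>a0\<close> to \<open>a\<close> under the new
      control.\<close>
    have s1: "\<bar>measure ?kz (region T a0 t) - measure ?kz (region T a0 (\<tau> t))\<bar> \<le> A * (2 * q) + M / c"
    proof -
      have tt: "\<bar>t - \<tau> t\<bar> \<le> q" using as(5)[OF as(6)] by (simp add: abs_minus_commute)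
      from region_time_shift[OF T0 c ac0 a0(2) tt] show ?thesis unfolding A_def .
    qed
    have s2: "\<bar>measure ?k (region T a0 (\<tau> t)) - measure ?kz (region T a0 (\<tau> t))\<bar> \<le> grid_dev T K ?k ?kz +
        (A * (2 * T / real K + (osc T (real k) a0 + 2 * T * ((real k * T + 1) / real K))) + M / c)"
      unfolding A_def
      by (rule region_deviation[OF T Kpos c k0 ac_measureD(2,1)[OF ac] ac0 a0(1) region_sets[OF regulated_measurable[OF a0(2)]]])
         (use bracket[OF a0(1) k0] in auto)
    have s3: "\<bar>measure ?k (region T a0 (\<tau> t)) - measure ?k (region T a (\<tau> t))\<bar> \<le>
        A * (osc T (real k) a0 + 2 * T * ((1 + real k) * q)) + M / c"
      unfolding A_def by (rule region_path_change[OF T0 c k0 less_imp_le[OF q] ac a0(1) as(2) a0(2) as(3,4,5)])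
    have s2': "A * (2 * T / real K + (osc T (real k) a0 + 2 * T * ((real k * T + 1) / real K))) =
        A * (2 * T / real K + 2 * T * ((real k * T + 1) / real K)) + A * osc T (real k) a0"
      by (simp add: distrib_left)
    have s3': "A * (osc T (real k) a0 + 2 * T * ((1 + real k) * q)) = A * osc T (real k) a0 + A * (2 * T * ((1 + real k) * q))"
      by (simp only: distrib_left)
    show "\<bar>measure ?kz (region T a0 t) - measure ?k (region T a (\<tau> t))\<bar> < e"
      using bspec[OF V(3) as(1)] s1 s2[unfolded s2'] s3[unfolded s3'] q1 q2 K' k' Mc e by linarith
  qed
qed

lemma skorokhod_ball:
  assumes T: "0 < T" and p0: "p0 \<in> cadlag_space T m" and r: "0 < r"
  shows "openin (skorokhod_topology T m) {p \<in> cadlag_space T m. skorokhod_dist T m p0 p < r}"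
    "p0 \<in> {p \<in> cadlag_space T m. skorokhod_dist T m p0 p < r}"
proof -
  interpret Metric_space "cadlag_space T m" "skorokhod_dist T m" by (rule Metric_space_skorokhod[OF T])
  have "{p \<in> cadlag_space T m. skorokhod_dist T m p0 p < r} = mball p0 r" using p0 by (auto simp: mball_def)
  then show "openin (skorokhod_topology T m) {p \<in> cadlag_space T m. skorokhod_dist T m p0 p < r}"
    unfolding skorokhod_topology_def mtopology_of by simp
  show "p0 \<in> {p \<in> cadlag_space T m. skorokhod_dist T m p0 p < r}" using p0 r by simp
qed

text \<open>One time change must serve all quantities, since \<open>viol\<close> combines them at
  the same times. It comes from the Skorokhod ball; the controls enter through two neighbourhoods,
  one for the region below the gap and one for the constant path 2 of the arrivals.\<close>

lemma path_neighbourhood: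
  assumes T: "0 < T" and M: "0 \<le> M" and p0: "p0 \<in> cadlag_space T state_metric"
    and \<phi>0: "\<phi>0 \<in> topspace (S_topology T M)" and i: "1 \<le> i" and e: "0 < e" and k: "0 \<le> k"
  obtains U where "openin (prod_topology (skorokhod_topology T state_metric) (S_topology T M)) U" "(p0, \<phi>0) \<in> U"
    "\<And>p \<phi>. (p, \<phi>) \<in> U \<Longrightarrow> p \<in> cadlag_space T state_metric \<and> \<bar>osc T k (gap p0 i) - osc T k (gap p i)\<bar> \<le> e \<and>
      (\<exists>\<tau>\<in>time_changes T. \<forall>t\<in>{0..T}. \<bar>cX p0 i t - cX p i (\<tau> t)\<bar> \<le> e \<and> \<bar>cY p0 i t - cY p i (\<tau> t)\<bar> \<le> e \<and>
        \<bar>cE p0 i t - cE p i (\<tau> t)\<bar> \<le> e \<and> \<bar>cE p0 (i - 1) t - cE p (i - 1) (\<tau> t)\<bar> \<le> e \<and>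
        \<bar>arrivals T \<phi>0 t - arrivals T \<phi> (\<tau> t)\<bar> \<le> e \<and> \<bar>services T p0 \<phi>0 i t - services T p \<phi> i (\<tau> t)\<bar> \<le> e)"
proof -
  have T0: "0 \<le> T" using T by simp
  note g0 = gap_bounded[OF p0 i] gap_regulated[OF p0]
  obtain q1 V1 where 1: "0 < q1" "openin (S_topology T M) V1" "\<phi>0 \<in> V1"
    "\<And>\<phi> a \<tau> t. \<phi> \<in> V1 \<Longrightarrow> bounded_path T a \<Longrightarrow> regulated T a \<Longrightarrow> \<tau> \<in> time_changes T \<Longrightarrow>
      (\<And>r. r \<in> {0..T} \<Longrightarrow> \<bar>\<tau> r - r\<bar> \<le> q1 \<and> \<bar>gap p0 i r - a (\<tau> r)\<bar> \<le> q1) \<Longrightarrow> t \<in> {0..T} \<Longrightarrow>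
      \<bar>measure (control_measure T (\<phi>0 i)) (region T (gap p0 i) t) - measure (control_measure T (\<phi> i)) (region T a (\<tau> t))\<bar> < e"
    using region_neighbourhood[OF T M g0 \<phi>0 e] by blast
  obtain q2 V2 where 2: "0 < q2" "openin (S_topology T M) V2" "\<phi>0 \<in> V2"
    "\<And>\<phi> a \<tau> t. \<phi> \<in> V2 \<Longrightarrow> bounded_path T a \<Longrightarrow> regulated T a \<Longrightarrow> \<tau> \<in> time_changes T \<Longrightarrow>
      (\<And>r. r \<in> {0..T} \<Longrightarrow> \<bar>\<tau> r - r\<bar> \<le> q2 \<and> \<bar>2 - a (\<tau> r)\<bar> \<le> q2) \<Longrightarrow> t \<in> {0..T} \<Longrightarrow>
      \<bar>measure (control_measure T (\<phi>0 0)) (region T (\<lambda>_. 2) t) - measure (control_measure T (\<phi> 0)) (region T a (\<tau> t))\<bar> < e"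
    using region_neighbourhood[OF T M const_bounded const_regulated \<phi>0 e] by blast
  define q where "q = min (min q1 q2) (e / (2 * T * (1 + k) + 1))"
  have den: "0 < 2 * T * (1 + k) + 1" using T k by (intro add_nonneg_pos mult_nonneg_nonneg) auto
  have q: "0 < q" "q \<le> q1" "q \<le> q2" unfolding q_def using 1 2 e den by auto
  have q3: "2 * T * ((1 + k) * q) \<le> e"
  proof -
    have "q \<le> e / (2 * T * (1 + k) + 1)" by (simp add: q_def)
    then have "q * (2 * T * (1 + k) + 1) \<le> e" using den by (simp only: pos_le_divide_eq)
    moreover have "q * (2 * T * (1 + k) + 1) = 2 * T * ((1 + k) * q) + q" by (simp add: algebra_simps)
    ultimately show ?thesis using q(1) by linarith
  qed
  have ucd: "\<exists>d>0. \<forall>p\<in>mspace state_metric. \<forall>p'\<in>mspace state_metric. mdist state_metric p p' < d \<longrightarrow> \<bar>F p - F p'\<bar> < e'"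
    if "uc_coord F" "0 < e'" for F e' using that unfolding uc_coord_def by blast
  obtain d1 where d1: "0 < d1" "\<And>p p'. p \<in> mspace state_metric \<Longrightarrow> p' \<in> mspace state_metric \<Longrightarrow> mdist state_metric p p' < d1 \<Longrightarrow> \<bar>fst p i - fst p' i\<bar> < e"
    using ucd[OF uc_coord_X[of i] e] by blast
  obtain d2 where d2: "0 < d2" "\<And>p p'. p \<in> mspace state_metric \<Longrightarrow> p' \<in> mspace state_metric \<Longrightarrow> mdist state_metric p p' < d2 \<Longrightarrow> \<bar>fst (snd p) i - fst (snd p') i\<bar> < e"
    using ucd[OF uc_coord_Y[of i] e] by blast
  obtain d3 where d3: "0 < d3" "\<And>p p'. p \<in> mspace state_metric \<Longrightarrow> p' \<in> mspace state_metric \<Longrightarrow> mdist state_metric p p' < d3 \<Longrightarrow> \<bar>snd (snd p) i - snd (snd p') i\<bar> < e"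
    using ucd[OF uc_coord_eta[of i] e] by blast
  obtain d4 where d4: "0 < d4" "\<And>p p'. p \<in> mspace state_metric \<Longrightarrow> p' \<in> mspace state_metric \<Longrightarrow> mdist state_metric p p' < d4 \<Longrightarrow> \<bar>snd (snd p) (i - 1) - snd (snd p') (i - 1)\<bar> < e"
    using ucd[OF uc_coord_eta[of "i - 1"] e] by blast
  obtain d5 where d5: "0 < d5" "\<And>p p'. p \<in> mspace state_metric \<Longrightarrow> p' \<in> mspace state_metric \<Longrightarrow> mdist state_metric p p' < d5 \<Longrightarrow>
      \<bar>(fst p i - fst p (i + 1)) - (fst p' i - fst p' (i + 1))\<bar> < q"
    using ucd[OF uc_coord_gap[of i] q(1)] by blast
  define r where "r = min q (min (min d1 d2) (min d3 (min d4 d5)))"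
  have r: "0 < r" "r \<le> q" "r \<le> d1" "r \<le> d2" "r \<le> d3" "r \<le> d4" "r \<le> d5" unfolding r_def using q d1 d2 d3 d4 d5 by auto
  let ?B = "{p \<in> cadlag_space T state_metric. skorokhod_dist T state_metric p0 p < r}"
  note B = skorokhod_ball[OF T p0 r(1)]
  show thesis
  proof (rule that[of "?B \<times> (V1 \<inter> V2)"])
    show "openin (prod_topology (skorokhod_topology T state_metric) (S_topology T M)) (?B \<times> (V1 \<inter> V2))"
      using B(1) 1(2) 2(2) by (auto simp: openin_prod_Times_iff)
    show "(p0, \<phi>0) \<in> ?B \<times> (V1 \<inter> V2)" using B(2) 1(3) 2(3) by blast
    fix p \<phi> assume "(p, \<phi>) \<in> ?B \<times> (V1 \<inter> V2)"
    then have p: "p \<in> cadlag_space T state_metric" "skorokhod_dist T state_metric p0 p < r" and \<phi>: "\<phi> \<in> V1" "\<phi> \<in> V2" by auto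
    obtain \<tau> q' where \<tau>: "\<tau> \<in> time_changes T" "q' < r"
      "\<And>t. t \<in> {0..T} \<Longrightarrow> \<bar>\<tau> t - t\<bar> \<le> q' \<and> mdist state_metric (p0 t) (p (\<tau> t)) \<le> q'"
      using skorokhod_dist_less_iff[OF T p0 p(1) r(1)] p(2) by blast
    note gp = gap_bounded[OF p(1) i] gap_regulated[OF p(1)]
    have m: "p0 t \<in> mspace state_metric" "p (\<tau> t) \<in> mspace state_metric" "mdist state_metric (p0 t) (p (\<tau> t)) < r" if t: "t \<in> {0..T}" for t
      using cadlag_mem[OF p0 t] cadlag_mem[OF p(1) time_changes_mem[OF \<tau>(1) t]] \<tau>(3)[OF t] \<tau>(2) by auto
    have gq: "\<bar>\<tau> t - t\<bar> \<le> q \<and> \<bar>gap p0 i t - gap p i (\<tau> t)\<bar> \<le> q" if t: "t \<in> {0..T}" for t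
      using \<tau>(3)[OF t] \<tau>(2) d5(2)[OF m(1)[OF t] m(2)[OF t]] m(3)[OF t] r unfolding gap_def by auto
    have os: "\<bar>osc T k (gap p0 i) - osc T k (gap p i)\<bar> \<le> e"
      using osc_time_change[OF T0 g0(1) gp(1) k \<tau>(1) gq] q3 by linarith
    have gq1: "\<bar>\<tau> t - t\<bar> \<le> q1 \<and> \<bar>gap p0 i t - gap p i (\<tau> t)\<bar> \<le> q1" if t: "t \<in> {0..T}" for t using gq[OF t] q by auto
    have gq2: "\<bar>\<tau> t - t\<bar> \<le> q2 \<and> \<bar>2 - (2 :: real)\<bar> \<le> q2" if t: "t \<in> {0..T}" for t using gq[OF t] q by auto
    have "\<bar>cX p0 i t - cX p i (\<tau> t)\<bar> \<le> e \<and> \<bar>cY p0 i t - cY p i (\<tau> t)\<bar> \<le> e \<and>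
        \<bar>cE p0 i t - cE p i (\<tau> t)\<bar> \<le> e \<and> \<bar>cE p0 (i - 1) t - cE p (i - 1) (\<tau> t)\<bar> \<le> e \<and>
        \<bar>arrivals T \<phi>0 t - arrivals T \<phi> (\<tau> t)\<bar> \<le> e \<and> \<bar>services T p0 \<phi>0 i t - services T p \<phi> i (\<tau> t)\<bar> \<le> e"
      if t: "t \<in> {0..T}" for t
    proof (intro conjI less_imp_le)
      note mm = m(1)[OF t] m(2)[OF t] and m3 = m(3)[OF t]
      show "\<bar>cX p0 i t - cX p i (\<tau> t)\<bar> < e" unfolding cX_def by (rule d1(2)[OF mm]) (use m3 r in simp)
      show "\<bar>cY p0 i t - cY p i (\<tau> t)\<bar> < e" unfolding cY_def by (rule d2(2)[OF mm]) (use m3 r in simp)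
      show "\<bar>cE p0 i t - cE p i (\<tau> t)\<bar> < e" unfolding cE_def by (rule d3(2)[OF mm]) (use m3 r in simp)
      show "\<bar>cE p0 (i - 1) t - cE p (i - 1) (\<tau> t)\<bar> < e" unfolding cE_def by (rule d4(2)[OF mm]) (use m3 r in simp)
      show "\<bar>arrivals T \<phi>0 t - arrivals T \<phi> (\<tau> t)\<bar> < e"
        unfolding arrivals_def by (rule 2(4)[OF \<phi>(2) const_bounded const_regulated \<tau>(1) gq2 t])
      show "\<bar>services T p0 \<phi>0 i t - services T p \<phi> i (\<tau> t)\<bar> < e"
        unfolding services_def by (rule 1(4)[OF \<phi>(1) gp \<tau>(1) gq1 t])
    qed
    then show "p \<in> cadlag_space T state_metric \<and> \<bar>osc T k (gap p0 i) - osc T k (gap p i)\<bar> \<le> e \<and>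
      (\<exists>\<tau>\<in>time_changes T. \<forall>t\<in>{0..T}. \<bar>cX p0 i t - cX p i (\<tau> t)\<bar> \<le> e \<and> \<bar>cY p0 i t - cY p i (\<tau> t)\<bar> \<le> e \<and>
        \<bar>cE p0 i t - cE p i (\<tau> t)\<bar> \<le> e \<and> \<bar>cE p0 (i - 1) t - cE p (i - 1) (\<tau> t)\<bar> \<le> e \<and>
        \<bar>arrivals T \<phi>0 t - arrivals T \<phi> (\<tau> t)\<bar> \<le> e \<and> \<bar>services T p0 \<phi>0 i t - services T p \<phi> i (\<tau> t)\<bar> \<le> e)"
      using p(1) os \<tau>(1) by blast
  qed
qed

lemma time_changes_mono: "\<tau> \<in> time_changes T \<Longrightarrow> s \<in> {0..T} \<Longrightarrow> t \<in> {0..T} \<Longrightarrow> s \<le> t \<Longrightarrow> \<tau> s \<le> \<tau> t"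
  unfolding time_changes_def using strict_mono_onD[of "{0..T}" \<tau> s t] by (cases "s = t") auto

text \<open>This turns the infimum over an interval in \<open>viol\<close> into an infimum over the
  image of an interval, where values can be compared pointwise.\<close>

lemma time_changes_image:
  assumes \<tau>: "\<tau> \<in> time_changes T" and st: "0 \<le> s" "s \<le> t" "t \<le> T"
  shows "\<tau> ` {s..t} = {\<tau> s..\<tau> t}"
proof
  show "\<tau> ` {s..t} \<subseteq> {\<tau> s..\<tau> t}" using st by (auto intro!: time_changes_mono[OF \<tau>])
  show "{\<tau> s..\<tau> t} \<subseteq> \<tau> ` {s..t}"
  proof
    fix v assume v: "v \<in> {\<tau> s..\<tau> t}"
    have "\<tau> s \<in> {0..T}" "\<tau> t \<in> {0..T}" using time_changes_mem[OF \<tau>] st by auto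
    then have "v \<in> \<tau> ` {0..T}" using v \<tau> by (auto simp: time_changes_def)
    then obtain u where u: "u \<in> {0..T}" "v = \<tau> u" by auto
    have sm: "strict_mono_on {0..T} \<tau>" using \<tau> by (simp add: time_changes_def)
    have "s \<le> u" using strict_mono_onD[OF sm u(1), of s] v u st by (metis atLeastAtMost_iff leD linorder_not_le order.trans)
    moreover have "u \<le> t" using strict_mono_onD[OF sm _ u(1), of t] v u st by (metis atLeastAtMost_iff leD linorder_not_le order.trans)
    ultimately show "v \<in> \<tau> ` {s..t}" using u by auto
  qed
qed

lemma INF_close:
  fixes f g :: "real \<Rightarrow> real"
  assumes "S \<noteq> {}" "\<And>u. u \<in> S \<Longrightarrow> \<bar>f u - g (\<tau> u)\<bar> \<le> e" "\<And>u. u \<in> S \<Longrightarrow> 0 \<le> f u" "\<And>u. u \<in> S \<Longrightarrow> 0 \<le> g (\<tau> u)"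
  shows "\<bar>(INF u\<in>S. f u) - (INF v\<in>\<tau> ` S. g v)\<bar> \<le> e"
proof -
  have im: "(INF v\<in>\<tau> ` S. g v) = (INF u\<in>S. g (\<tau> u))" by (simp add: image_image)
  have b: "bdd_below (f ` S)" "bdd_below ((\<lambda>u. g (\<tau> u)) ` S)" using assms(3,4) by (auto intro!: bdd_belowI2[where m = 0])
  have "(INF u\<in>S. f u) - e \<le> (INF u\<in>S. g (\<tau> u))"
  proof (rule cINF_greatest[OF assms(1)])
    fix u assume u: "u \<in> S"
    show "(INF u\<in>S. f u) - e \<le> g (\<tau> u)" using cINF_lower[OF b(1) u] assms(2)[OF u] by linarith
  qed
  moreover have "(INF u\<in>S. g (\<tau> u)) - e \<le> (INF u\<in>S. f u)"
  proof (rule cINF_greatest[OF assms(1)])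
    fix u assume u: "u \<in> S"
    show "(INF u\<in>S. g (\<tau> u)) - e \<le> f u" using cINF_lower[OF b(2) u] assms(2)[OF u] by linarith
  qed
  ultimately show ?thesis unfolding im by linarith
qed

lemma viol_nonneg: "0 \<le> viol T lam x i z s t"
  unfolding viol_def by (auto split: prod.splits intro!: add_nonneg_nonneg)

lemma time_pairs_ne: "0 \<le> T \<Longrightarrow> time_pairs T \<noteq> {}"
  by (auto simp: time_pairs_def intro!: exI[of _ 0])

lemma Phi_bdd: "bdd_above ((\<lambda>(s, t). min 1 (viol T lam x i z s t)) ` time_pairs T)"
  by (rule bdd_aboveI[of _ 1]) auto

lemma viol_le_Phi:
  assumes "0 \<le> s" "s \<le> t" "t \<le> T" shows "min 1 (viol T lam x i z s t) \<le> Phi T lam x i z"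
proof -
  have "(s, t) \<in> time_pairs T" using assms by (simp add: time_pairs_def)
  from cSUP_upper[OF this Phi_bdd] show ?thesis unfolding Phi_def by simp
qed

lemma Phi_least:
  assumes "0 \<le> T" "\<And>s t. 0 \<le> s \<Longrightarrow> s \<le> t \<Longrightarrow> t \<le> T \<Longrightarrow> min 1 (viol T lam x i z s t) \<le> b"
  shows "Phi T lam x i z \<le> b"
  unfolding Phi_def by (rule cSUP_least[OF time_pairs_ne[OF assms(1)]]) (use assms(2) in \<open>auto simp: time_pairs_def\<close>)

lemma time_changes_0: "\<tau> \<in> time_changes T \<Longrightarrow> 0 \<le> T \<Longrightarrow> \<tau> 0 = 0"
proof -
  assume \<tau>: "\<tau> \<in> time_changes T" and T: "0 \<le> T"
  have "0 \<in> \<tau> ` {0..T}" using \<tau> T by (simp add: time_changes_def)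
  then obtain u where u: "u \<in> {0..T}" "\<tau> u = 0" by auto
  have "\<tau> 0 \<le> \<tau> u" using time_changes_mono[OF \<tau> _ u(1), of 0] u T by simp
  moreover have "0 \<le> \<tau> 0" using time_changes_mem[OF \<tau>, of 0] T by simp
  ultimately show ?thesis using u by simp
qed

text \<open>Every summand is a Lipschitz function of the coordinates. The six errors add up to 14 e
  + 3 |lam| e; the constant of the statement is a round upper bound.\<close>

lemma viol_close:
  assumes T: "0 \<le> T" and p: "p0 \<in> cadlag_space T state_metric" "p \<in> cadlag_space T state_metric" and i: "1 \<le> i"
    and \<tau>: "\<tau> \<in> time_changes T"
    and cl: "\<And>t. t \<in> {0..T} \<Longrightarrow> \<bar>cX p0 i t - cX p i (\<tau> t)\<bar> \<le> e \<and> \<bar>cY p0 i t - cY p i (\<tau> t)\<bar> \<le> e \<and>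
        \<bar>cE p0 i t - cE p i (\<tau> t)\<bar> \<le> e \<and> \<bar>cE p0 (i - 1) t - cE p (i - 1) (\<tau> t)\<bar> \<le> e \<and>
        \<bar>arrivals T \<phi>0 t - arrivals T \<phi> (\<tau> t)\<bar> \<le> e \<and> \<bar>services T p0 \<phi>0 i t - services T p \<phi> i (\<tau> t)\<bar> \<le> e"
    and st: "0 \<le> s" "s \<le> t" "t \<le> T"
  shows "\<bar>viol T lam x i (p0, \<phi>0) s t - viol T lam x i (p, \<phi>) (\<tau> s) (\<tau> t)\<bar> \<le> (20 + 10 * \<bar>lam\<bar>) * e"
proof -
  have sT: "s \<in> {0..T}" "t \<in> {0..T}" "0 \<in> {0..T}" using st by auto
  note cs = cl[OF sT(1)] and ct = cl[OF sT(2)] and c0 = cl[OF sT(3)]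
  have e: "0 \<le> e" using c0 by linarith
  have la: "\<bar>lam * arrivals T \<phi>0 u - lam * arrivals T \<phi> (\<tau> u)\<bar> \<le> \<bar>lam\<bar> * e" if "u \<in> {0..T}" for u
    using cl[OF that] by (simp add: abs_mult mult_left_mono flip: right_diff_distrib)
  define A where "A = (if i = 1 then lam * arrivals T \<phi>0 t else 0)"
  define A' where "A' = (if i = 1 then lam * arrivals T \<phi> (\<tau> t) else 0)"
  have le: "0 \<le> \<bar>lam\<bar> * e" using e by simp
  have AA: "\<bar>A - A'\<bar> \<le> \<bar>lam\<bar> * e" using la[OF sT(2)] le unfolding A_def A'_def by auto
  let ?I = "INF u\<in>{s..t}. 1 - cX p0 i u" and ?J = "INF u\<in>{\<tau> s..\<tau> t}. 1 - cX p i u"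
  have I: "\<bar>?I - ?J\<bar> \<le> e"
    unfolding time_changes_image[OF \<tau> st, symmetric]
  proof (rule INF_close)
    show "{s..t} \<noteq> {}" using st by simp
    fix u assume "u \<in> {s..t}"
    then have u: "u \<in> {0..T}" using st by auto
    show "\<bar>1 - cX p0 i u - (1 - cX p i (\<tau> u))\<bar> \<le> e" using cl[OF u] by linarith
    show "0 \<le> 1 - cX p0 i u" using cX_range[OF p(1) u i] by simp
    show "0 \<le> 1 - cX p i (\<tau> u)" using cX_range[OF p(2) time_changes_mem[OF \<tau> u] i] by simp
  qed
  have cX: "\<bar>cX p0 i t - cX p i (\<tau> t)\<bar> \<le> e" and cY: "\<bar>cY p0 i t - cY p i (\<tau> t)\<bar> \<le> e"
    and cE: "\<bar>cE p0 i t - cE p i (\<tau> t)\<bar> \<le> e" and cE': "\<bar>cE p0 (i - 1) t - cE p (i - 1) (\<tau> t)\<bar> \<le> e"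
    and cS: "\<bar>services T p0 \<phi>0 i t - services T p \<phi> i (\<tau> t)\<bar> \<le> e"
    and cEs: "\<bar>cE p0 i s - cE p i (\<tau> s)\<bar> \<le> e" and cE0: "\<bar>cE p0 i 0 - cE p i (\<tau> 0)\<bar> \<le> e"
    using ct cs c0 by simp_all
  note D = cX[THEN abs_le_D1] cX[THEN abs_le_D2] cY[THEN abs_le_D1] cY[THEN abs_le_D2] cE[THEN abs_le_D1] cE[THEN abs_le_D2]
    cE'[THEN abs_le_D1] cE'[THEN abs_le_D2] cS[THEN abs_le_D1] cS[THEN abs_le_D2] cEs[THEN abs_le_D1] cEs[THEN abs_le_D2]
    AA[THEN abs_le_D1] AA[THEN abs_le_D2] I[THEN abs_le_D1] I[THEN abs_le_D2]
    la[OF sT(1), THEN abs_le_D1] la[OF sT(1), THEN abs_le_D2] la[OF sT(2), THEN abs_le_D1] la[OF sT(2), THEN abs_le_D2]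
  have mx: "\<bar>max 0 a - max 0 b\<bar> \<le> c" if "\<bar>a - b\<bar> \<le> c" for a b c :: real using that by linarith
  have mn: "\<bar>min a b - min a' b'\<bar> \<le> c + d" if "\<bar>a - a'\<bar> \<le> c" "\<bar>b - b'\<bar> \<le> d" for a b a' b' c d :: real
    using that by linarith
  have ab: "\<bar>\<bar>a\<bar> - \<bar>b\<bar>\<bar> \<le> c" if "\<bar>a - b\<bar> \<le> c" for a b c :: real using that by linarith
  have dl: "lam * (a - b) = lam * a - lam * b" for a b by (simp add: right_diff_distrib)
  have t1: "\<bar>\<bar>cY p0 i t - x i - A + services T p0 \<phi>0 i t\<bar> - \<bar>cY p i (\<tau> t) - x i - A' + services T p \<phi> i (\<tau> t)\<bar>\<bar> \<le> 2 * e + \<bar>lam\<bar> * e"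
    by (rule ab, rule abs_leI) (use D in linarith)+
  have t2: "\<bar>\<bar>cX p0 i t - cY p0 i t - cE p0 (i - 1) t + cE p0 i t\<bar> - \<bar>cX p i (\<tau> t) - cY p i (\<tau> t) - cE p (i - 1) (\<tau> t) + cE p i (\<tau> t)\<bar>\<bar> \<le> 4 * e"
    by (rule ab, rule abs_leI) (use D in linarith)+
  have t3: "\<bar>max 0 (cE p0 i s - cE p0 i t) - max 0 (cE p i (\<tau> s) - cE p i (\<tau> t))\<bar> \<le> 2 * e"
    by (rule mx, rule abs_leI) (use D in linarith)+
  have t4: "\<bar>max 0 (cE p0 i t - cE p0 i s - lam * (arrivals T \<phi>0 t - arrivals T \<phi>0 s)) -
      max 0 (cE p i (\<tau> t) - cE p i (\<tau> s) - lam * (arrivals T \<phi> (\<tau> t) - arrivals T \<phi> (\<tau> s)))\<bar> \<le> 2 * e + 2 * (\<bar>lam\<bar> * e)"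
    unfolding dl by (rule mx, rule abs_leI) (use D in linarith)+
  have d5: "\<bar>cE p0 i t - cE p0 i s - (cE p i (\<tau> t) - cE p i (\<tau> s))\<bar> \<le> 2 * e"
    by (rule abs_leI) (use D in linarith)+
  have t5: "\<bar>max 0 (min (cE p0 i t - cE p0 i s) ?I) - max 0 (min (cE p i (\<tau> t) - cE p i (\<tau> s)) ?J)\<bar> \<le> 2 * e + e"
    by (rule mx, rule mn[OF d5 I])
  have t6: "\<bar>\<bar>cE p0 i 0\<bar> - \<bar>cE p i 0\<bar>\<bar> \<le> e" by (rule ab) (use cE0 time_changes_0[OF \<tau> T] in simp)
  have k: "(20 + 10 * \<bar>lam\<bar>) * e = 20 * e + 10 * (\<bar>lam\<bar> * e)" by (simp add: algebra_simps)
  note F = t1[THEN abs_le_D1] t1[THEN abs_le_D2] t2[THEN abs_le_D1] t2[THEN abs_le_D2] t3[THEN abs_le_D1] t3[THEN abs_le_D2]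
    t4[THEN abs_le_D1] t4[THEN abs_le_D2] t5[THEN abs_le_D1] t5[THEN abs_le_D2] t6[THEN abs_le_D1] t6[THEN abs_le_D2]
  have su: "(a1 + a2 + a3 + a4 + a5 + a6) - (b1 + b2 + b3 + b4 + b5 + b6) \<le> c1 + c2 + c3 + c4 + c5 + c6"
    if "a1 - b1 \<le> c1" "a2 - b2 \<le> c2" "a3 - b3 \<le> c3" "a4 - b4 \<le> c4" "a5 - b5 \<le> c5" "a6 - b6 \<le> c6"
    for a1 a2 a3 a4 a5 a6 b1 b2 b3 b4 b5 b6 c1 c2 c3 c4 c5 c6 :: real using that by linarith
  have su': "- ((a1 + a2 + a3 + a4 + a5 + a6) - (b1 + b2 + b3 + b4 + b5 + b6)) \<le> c1 + c2 + c3 + c4 + c5 + c6"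
    if "- (a1 - b1) \<le> c1" "- (a2 - b2) \<le> c2" "- (a3 - b3) \<le> c3" "- (a4 - b4) \<le> c4" "- (a5 - b5) \<le> c5" "- (a6 - b6) \<le> c6"
    for a1 a2 a3 a4 a5 a6 b1 b2 b3 b4 b5 b6 c1 c2 c3 c4 c5 c6 :: real using that by linarith
  have tot: "2 * e + \<bar>lam\<bar> * e + 4 * e + 2 * e + (2 * e + 2 * (\<bar>lam\<bar> * e)) + (2 * e + e) + e \<le> (20 + 10 * \<bar>lam\<bar>) * e"
    unfolding k using e le by linarith
  show ?thesis
    unfolding viol_def prod.case A_def[symmetric] A'_def[symmetric]
    by (rule abs_leI; rule order_trans[OF _ tot]; (rule su[OF F(1,3,5,7,9,11)] | rule su'[OF F(2,4,6,8,10,12)]))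
qed

lemma Phi_close_le:
  assumes T: "0 \<le> T"
    and cl: "\<And>s t. 0 \<le> s \<Longrightarrow> s \<le> t \<Longrightarrow> t \<le> T \<Longrightarrow> \<exists>s' t'. 0 \<le> s' \<and> s' \<le> t' \<and> t' \<le> T \<and>
      viol T lam x i z s t \<le> viol T lam x i z' s' t' + b" and b: "0 \<le> b"
  shows "Phi T lam x i z \<le> Phi T lam x i z' + b"
proof (rule Phi_least[OF T])
  fix s t assume "0 \<le> s" "s \<le> t" "t \<le> T"
  from cl[OF this] obtain s' t' where "0 \<le> s'" "s' \<le> t'" "t' \<le> T" "viol T lam x i z s t \<le> viol T lam x i z' s' t' + b" by blast
  then show "min 1 (viol T lam x i z s t) \<le> Phi T lam x i z' + b"
    using viol_le_Phi[of s' t' T lam x i z'] b by linarith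
qed

text \<open>The time change transports each pair of times of one path to a pair of the other, and
  its inverse transports them back, so the two suprema differ by at most the error of a single
  pair.\<close>

lemma Psi_continuous:
  assumes T: "0 < T" and M: "0 \<le> M" and i: "1 \<le> i" and k: "0 \<le> k"
  shows "continuous_map (prod_topology (skorokhod_topology T state_metric) (S_topology T M)) euclideanreal (Psi T lam x M' c k i)"
proof (rule continuous_map_realI)
  fix z :: "(real \<Rightarrow> state) \<times> (nat \<Rightarrow> real \<times> real \<Rightarrow> real)" and e :: real
  assume z: "z \<in> topspace (prod_topology (skorokhod_topology T state_metric) (S_topology T M))" and e: "0 < e"
  obtain p0 \<phi>0 where zp: "z = (p0, \<phi>0)" by (cases z)
  have p0: "p0 \<in> cadlag_space T state_metric" and \<phi>0: "\<phi>0 \<in> topspace (S_topology T M)"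
    using z by (auto simp: zp topspace_skorokhod_topology[OF T])
  have T0: "0 \<le> T" using T by simp
  \<comment> \<open>The first two terms are the constant of \<open>viol_close\<close>, the last one
    is the coefficient of the oscillation in \<open>Psi\<close>.\<close>
  define C where "C = 20 + 10 * \<bar>lam\<bar> + exp (1 + c)"
  have C: "0 < C" unfolding C_def by (intro add_nonneg_pos) auto
  define e' where "e' = e / (2 * C)"
  have e': "0 < e'" "C * e' < e" using e C by (auto simp: e'_def)
  obtain U where U: "openin (prod_topology (skorokhod_topology T state_metric) (S_topology T M)) U" "(p0, \<phi>0) \<in> U"
    "\<And>p \<phi>. (p, \<phi>) \<in> U \<Longrightarrow> p \<in> cadlag_space T state_metric \<and> \<bar>osc T k (gap p0 i) - osc T k (gap p i)\<bar> \<le> e' \<and>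
      (\<exists>\<tau>\<in>time_changes T. \<forall>t\<in>{0..T}. \<bar>cX p0 i t - cX p i (\<tau> t)\<bar> \<le> e' \<and> \<bar>cY p0 i t - cY p i (\<tau> t)\<bar> \<le> e' \<and>
        \<bar>cE p0 i t - cE p i (\<tau> t)\<bar> \<le> e' \<and> \<bar>cE p0 (i - 1) t - cE p (i - 1) (\<tau> t)\<bar> \<le> e' \<and>
        \<bar>arrivals T \<phi>0 t - arrivals T \<phi> (\<tau> t)\<bar> \<le> e' \<and> \<bar>services T p0 \<phi>0 i t - services T p \<phi> i (\<tau> t)\<bar> \<le> e')"
    using path_neighbourhood[OF T M p0 \<phi>0 i e'(1) k] by blast
  have "\<bar>Psi T lam x M' c k i y - Psi T lam x M' c k i z\<bar> < e" if "y \<in> U" for y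
  proof -
    obtain p \<phi> where y: "y = (p, \<phi>)" by (cases y)
    from U(3)[of p \<phi>] that obtain \<tau> where p: "p \<in> cadlag_space T state_metric" and os: "\<bar>osc T k (gap p0 i) - osc T k (gap p i)\<bar> \<le> e'"
      and \<tau>: "\<tau> \<in> time_changes T"
      and cl: "\<And>t. t \<in> {0..T} \<Longrightarrow> \<bar>cX p0 i t - cX p i (\<tau> t)\<bar> \<le> e' \<and> \<bar>cY p0 i t - cY p i (\<tau> t)\<bar> \<le> e' \<and>
        \<bar>cE p0 i t - cE p i (\<tau> t)\<bar> \<le> e' \<and> \<bar>cE p0 (i - 1) t - cE p (i - 1) (\<tau> t)\<bar> \<le> e' \<and>
        \<bar>arrivals T \<phi>0 t - arrivals T \<phi> (\<tau> t)\<bar> \<le> e' \<and> \<bar>services T p0 \<phi>0 i t - services T p \<phi> i (\<tau> t)\<bar> \<le> e'"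
      unfolding y by blast
    let ?b = "(20 + 10 * \<bar>lam\<bar>) * e'"
    have b: "0 \<le> ?b" using e' by simp
    have vc: "\<bar>viol T lam x i (p0, \<phi>0) s t - viol T lam x i (p, \<phi>) (\<tau> s) (\<tau> t)\<bar> \<le> ?b"
      if "0 \<le> s" "s \<le> t" "t \<le> T" for s t by (rule viol_close[OF T0 p0 p i \<tau> _ that]) (rule cl)
    have 1: "Phi T lam x i z \<le> Phi T lam x i y + ?b"
    proof (rule Phi_close_le[OF T0 _ b])
      fix s t assume st: "0 \<le> s" "s \<le> t" "t \<le> T"
      have "\<tau> s \<in> {0..T}" "\<tau> t \<in> {0..T}" using time_changes_mem[OF \<tau>] st by auto
      moreover have "\<tau> s \<le> \<tau> t" using time_changes_mono[OF \<tau>, of s t] st by auto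
      ultimately show "\<exists>s' t'. 0 \<le> s' \<and> s' \<le> t' \<and> t' \<le> T \<and> viol T lam x i z s t \<le> viol T lam x i y s' t' + ?b"
        using vc[OF st] unfolding zp y by (intro exI[of _ "\<tau> s"] exI[of _ "\<tau> t"]) auto
    qed
    obtain \<sigma> where \<sigma>: "\<sigma> \<in> time_changes T" "\<And>t. t \<in> {0..T} \<Longrightarrow> \<tau> (\<sigma> t) = t" using time_changes_inv[OF \<tau>] by blast
    have 2: "Phi T lam x i y \<le> Phi T lam x i z + ?b"
    proof (rule Phi_close_le[OF T0 _ b])
      fix s t assume st: "0 \<le> s" "s \<le> t" "t \<le> T"
      have "\<sigma> s \<in> {0..T}" "\<sigma> t \<in> {0..T}" using time_changes_mem[OF \<sigma>(1)] st by auto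
      then have st': "0 \<le> \<sigma> s" "\<sigma> t \<le> T" by auto
      have le: "\<sigma> s \<le> \<sigma> t" using time_changes_mono[OF \<sigma>(1), of s t] st by auto
      have "\<tau> (\<sigma> s) = s" "\<tau> (\<sigma> t) = t" using \<sigma>(2) st by auto
      then show "\<exists>s' t'. 0 \<le> s' \<and> s' \<le> t' \<and> t' \<le> T \<and> viol T lam x i y s t \<le> viol T lam x i z s' t' + ?b"
        using vc[OF st'(1) le st'(2)] st' le unfolding zp y by (intro exI[of _ "\<sigma> s"] exI[of _ "\<sigma> t"]) auto
    qed
    have eo: "\<bar>exp (1 + c) * osc T k (gap p0 i) - exp (1 + c) * osc T k (gap p i)\<bar> \<le> exp (1 + c) * e'"
      using os by (simp add: abs_mult mult_left_mono flip: right_diff_distrib)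
    have "C * e' = ?b + exp (1 + c) * e'" by (simp add: C_def algebra_simps)
    moreover have "\<bar>max 0 (A - B - K) - max 0 (A' - B' - K)\<bar> \<le> b + d" if "A' \<le> A + b" "A \<le> A' + b" "\<bar>B' - B\<bar> \<le> d"
      for A B A' B' K b d :: real using that by linarith
    from this[OF 1 2 eo] have "\<bar>Psi T lam x M' c k i y - Psi T lam x M' c k i z\<bar> \<le> ?b + exp (1 + c) * e'"
      unfolding Psi_def zp y fst_conv .
    ultimately show ?thesis using e'(2) by linarith
  qed
  then show "\<exists>U. openin (prod_topology (skorokhod_topology T state_metric) (S_topology T M)) U \<and> z \<in> U \<and>
      (\<forall>y\<in>U. \<bar>Psi T lam x M' c k i y - Psi T lam x M' c k i z\<bar> < e)"
    using U(1,2) zp by blast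
qed

section \<open>The controlled processes nearly satisfy the limit equations\<close>

text \<open>The normalisation makes the control measure itself the compensator, for the arrivals
  with q the arrival rate and for the services with q = 1.\<close>

definition scaled_thinned :: "real \<Rightarrow> nat \<Rightarrow> real \<Rightarrow> (real \<times> real \<times> real) measure \<Rightarrow> (real \<times> real \<Rightarrow> real) \<Rightarrow> (real \<times> real) measure" where
  "scaled_thinned T n q N \<phi> = scale_measure (ennreal (1 / (real n * q))) (thinned T N (\<lambda>p. real n * q * \<phi> p))"

lemma sets_thinned: "sets (thinned T N \<psi>) = XX_sets T"
  by (simp add: thinned_def sets_restrict_XX)

lemma space_thinned: "space (thinned T N \<psi>) = XX T"
  by (simp add: thinned_def space_restrict_space)

lemma sets_scaled_thinned: "sets (scaled_thinned T n q N \<phi>) = XX_sets T"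
  by (simp add: scaled_thinned_def sets_thinned)

lemma finite_scaled_thinned:
  assumes "emeasure (thinned T N (\<lambda>p. real n * q * \<phi> p)) (XX T) < \<infinity>"
  shows "finite_measure (scaled_thinned T n q N \<phi>)"
proof
  have "emeasure (scaled_thinned T n q N \<phi>) (XX T) < \<infinity>"
    unfolding scaled_thinned_def using assms by (simp add: ennreal_mult_less_top)
  moreover have "space (scaled_thinned T n q N \<phi>) = XX T" by (simp add: scaled_thinned_def space_scale_measure space_thinned)
  ultimately show "emeasure (scaled_thinned T n q N \<phi>) (space (scaled_thinned T n q N \<phi>)) \<noteq> \<infinity>" by simp
qed

lemma measure_scaled_thinned:
  assumes "0 < n" "0 < q"
  shows "1 / real n * measure (thinned T N (\<lambda>p. real n * q * \<phi> p)) A = q * measure (scaled_thinned T n q N \<phi>) A"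
  unfolding scaled_thinned_def using assms by (simp add: measure_scale_measure)

lemma XX_sub: "t \<le> T \<Longrightarrow> XX t \<subseteq> XX T" by (auto simp: XX_def)

lemma XX_region: "t \<le> T \<Longrightarrow> XX t = region T (\<lambda>_. 2) t" by (auto simp: region_def XX_def)

lemma region_cong: "(\<And>s. s \<in> {0..T} \<Longrightarrow> a s = b s) \<Longrightarrow> region T a t = region T b t"
  by (auto simp: region_def XX_def)

lemma set_integral_thinned_one:
  assumes "t \<le> T" shows "(LINT p:XX t|thinned T N \<psi>. 1) = measure (thinned T N \<psi>) (region T (\<lambda>_. 2) t)"
proof -
  have "(LINT p:XX t|thinned T N \<psi>. 1) = measure (thinned T N \<psi>) (XX t \<inter> space (thinned T N \<psi>))"
    unfolding set_lebesgue_integral_def by simp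
  also have "XX t \<inter> space (thinned T N \<psi>) = region T (\<lambda>_. 2) t"
    using XX_sub[OF assms] XX_region[OF assms] by (auto simp: space_thinned)
  finally show ?thesis .
qed

lemma set_integral_thinned_strip:
  assumes "t \<le> T"
  shows "(LINT (s, y):XX t|thinned T N \<psi>. indicator {0..<b s} y) = measure (thinned T N \<psi>) (region T b t)"
proof -
  have "(LINT (s, y):XX t|thinned T N \<psi>. indicator {0..<b s} y) = (LINT q|thinned T N \<psi>. indicator (region T b t) q)"
    unfolding set_lebesgue_integral_def
    by (rule Bochner_Integration.integral_cong[OF refl])
       (use assms in \<open>auto simp: space_thinned indicator_def region_def XX_def\<close>)
  also have "\<dots> = measure (thinned T N \<psi>) (region T b t \<inter> space (thinned T N \<psi>))" by simp
  also have "region T b t \<inter> space (thinned T N \<psi>) = region T b t" by (auto simp: space_thinned region_def)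
  finally show ?thesis .
qed

text \<open>The processes agree with the cadlag path on [0,T] only, the latter being undefined
  elsewhere. For a positive time of the interval a left neighbourhood lies inside [0,T].\<close>

lemma left_lim_cong:
  assumes f: "regulated T f" and fg: "\<And>u. u \<in> {0..T} \<Longrightarrow> g u = f u" and s: "s \<in> {0..T}"
  shows "left_lim g s = left_lim f s"
proof (cases "s = 0")
  case True
  then show ?thesis using fg[OF s] by (simp add: left_lim_def)
next
  case False
  then have s': "0 < s" "s \<in> {0<..T}" using s by auto
  have "\<forall>\<^sub>F u in at_left s. f u = g u"
    using eventually_at_left_real[OF s'(1)] by eventually_elim (use s fg in auto)
  then have "(g \<longlongrightarrow> left_lim f s) (at_left s)"
    by (rule Lim_transform_eventually[OF left_lim_tendsto[OF f s'(2)]])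
  then have "Lim (at_left s) g = left_lim f s" by (intro tendsto_Lim) auto
  then show ?thesis using False by (simp add: left_lim_def)
qed

lemma left_lim_diff:
  assumes f: "regulated T f" "regulated T g" and h: "regulated T h" "\<And>u. h u = f u - g u" and s: "s \<in> {0..T}"
  shows "left_lim f s - left_lim g s = left_lim h s"
proof (cases "s = 0")
  case False
  then have s': "s \<in> {0<..T}" using s by auto
  have "(h \<longlongrightarrow> left_lim f s - left_lim g s) (at_left s)"
    unfolding h(2) by (intro tendsto_diff left_lim_tendsto[OF f(1) s'] left_lim_tendsto[OF f(2) s'])
  with left_lim_tendsto[OF h(1) s'] show ?thesis by (metis tendsto_unique trivial_limit_at_left_real)
qed (simp add: left_lim_def h)

text \<open>Each factor is at most y: for a = i/n < 1 one has x - a \<le> y - a y = y (1 - a). There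
  are d factors.\<close>

lemma beta_le_power:
  assumes d: "d \<le> n" and n: "1 \<le> n" and x: "x \<le> y" "0 \<le> y" "y \<le> 1"
  shows "beta d n x \<le> y ^ d"
proof -
  have "beta d n x \<le> (\<Prod>i<d. y)" unfolding beta_def
  proof (rule prod_mono, intro conjI)
    fix i assume "i \<in> {..<d}"
    then have i: "real i / real n < 1" "0 \<le> real i / real n" using d n by (auto simp: divide_less_eq)
    let ?a = "real i / real n"
    have "?a * y \<le> ?a * 1" using i x by (intro mult_left_mono) auto
    then have "x - ?a \<le> y * (1 - ?a)" using x by (simp add: algebra_simps)
    then have "(x - ?a) / (1 - ?a) \<le> y" using i by (simp add: pos_divide_le_eq)
    then show "max 0 ((x - ?a) / (1 - ?a)) \<le> y" using x by simp
  qed simp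
  then show ?thesis by simp
qed

lemma beta_measurable [measurable]: "beta d n \<in> borel_measurable borel"
  unfolding beta_def by measurable

text \<open>An estimate for a single realisation. The arrival error \<open>W\<close> occurs three
  times, once in the equation for Y and twice in the increment bound; complementarity and the
  initial value add one more multiple of q each, whence 5 q. The additional 1 comes from the
  services.\<close>

lemma prelimit_violation:
  fixes X Y \<eta> :: "real \<Rightarrow> nat \<Rightarrow> real"
  assumes T: "0 < T" and M: "0 \<le> M" and c: "0 < c" and k: "0 \<le> k" and K: "0 < K" and n: "1 \<le> n"
    and d: "d \<in> {1..n}" and q: "0 < q" and i: "1 \<le> i"
    and \<phi>: "\<phi> \<in> S_space T M"
    and p: "p \<in> cadlag_space T state_metric" and p_eq: "\<And>t. t \<in> {0..T} \<Longrightarrow> p t = (X t, Y t, \<eta> t)"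
    and eqs: "controlled_equations T n d q xn N \<phi> X Y \<eta>"
    and fin: "emeasure (thinned T (N 0) (\<lambda>p. real n * q * \<phi> 0 p)) (XX T) < \<infinity>"
      "emeasure (thinned T (N i) (\<lambda>p. real n * 1 * \<phi> i p)) (XX T) < \<infinity>"
    and bd: "(1 - 1 / real K) ^ d \<le> 1 / real K"
    and st: "0 \<le> s" "s \<le> t" "t \<le> T"
  defines "\<mu>0 \<equiv> scaled_thinned T n q (N 0) (\<phi> 0)" and "\<mu>1 \<equiv> scaled_thinned T n 1 (N i) (\<phi> i)"
    and "\<kappa>0 \<equiv> control_measure T (\<phi> 0)" and "\<kappa>1 \<equiv> control_measure T (\<phi> i)"
    and "\<rho> \<equiv> exp (1 + c) * (2 * T / real K + 2 * T * ((k * T + 1) / real K))"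
  shows "viol T lam x i (p, \<phi>) s t \<le> exp (1 + c) * osc T k (gap p i) + (5 * q + 1) * (M / c) +
     (\<bar>xn i - x i\<bar> + 3 * \<bar>q - lam\<bar> * (exp 2 * T + M) + 1 / real K + (4 * q + 1) * \<rho> + q * (exp (1 + c) * (T / real K))
      + 5 * q * grid_dev T K \<mu>0 \<kappa>0 + grid_dev T K \<mu>1 \<kappa>1)"
proof -
  have T0: "0 \<le> T" using T by simp
  have n0: "0 < n" using n by simp
  have ac: "ac_measure T M \<kappa>0" "ac_measure T M \<kappa>1"
    unfolding \<kappa>0_def \<kappa>1_def by (rule control_ac[OF \<phi> M])+
  have \<mu>: "finite_measure \<mu>0" "sets \<mu>0 = XX_sets T" "finite_measure \<mu>1" "sets \<mu>1 = XX_sets T"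
    unfolding \<mu>0_def \<mu>1_def using fin by (auto intro: finite_scaled_thinned simp: sets_scaled_thinned)
  define m where "m = M / c"
  define A where "A = exp (1 + c)"
  define B0 where "B0 = grid_dev T K \<mu>0 \<kappa>0"
  define B1 where "B1 = grid_dev T K \<mu>1 \<kappa>1"
  define R where "R u = region T (\<lambda>_. 2) u" for u
  let ?g = "gap p i"
  note gb = gap_bounded[OF p i] and gr = gap_regulated[OF p, of i]
  have cXr: "regulated T (cX p j)" for j
    using coord_cadlag(1)[OF uc_coord_X p] unfolding cX_def .
  have Rs: "R u \<in> XX_sets T" for u unfolding R_def by (rule region_sets[OF regulated_measurable[OF const_regulated]])
  have br2: "(2 :: real) \<le> upc T k (\<lambda>_. 2) \<sigma> + k * \<bar>r - \<sigma>\<bar> \<and> lowc T k (\<lambda>_. 2) \<sigma> - k * \<bar>r - \<sigma>\<bar> \<le> 2" if "r \<in> {0..T}" for r \<sigma>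
    using bracket[OF const_bounded k that, of 2 \<sigma>] by simp
  have dev0: "\<bar>measure \<mu>0 (R u) - measure \<kappa>0 (R u)\<bar> \<le> B0 + \<rho> + m" for u
    using region_deviation[OF T K c k \<mu>(1,2) ac(1) const_bounded Rs[unfolded R_def] br2, of u] osc_const[OF T0 k, of 2]
    unfolding R_def B0_def \<rho>_def m_def by simp
  have ll: "left_lim ?g r \<le> upc T k ?g \<sigma> + k * \<bar>r - \<sigma>\<bar> \<and> lowc T k ?g \<sigma> - k * \<bar>r - \<sigma>\<bar> \<le> left_lim ?g r" if "r \<in> {0..T}" for r \<sigma>
    using left_lim_bracket[OF gb gr k that, of \<sigma>] by simp
  \<comment> \<open>The thinned measure is compared with its compensator on the region of left
    limits, and only then are the left limits removed under the compensator.\<close>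
  have dev1: "\<bar>measure \<mu>1 (region T (left_lim ?g) t) - measure \<kappa>1 (region T ?g t)\<bar> \<le> B1 + \<rho> + A * osc T k ?g + m"
  proof -
    have "\<bar>measure \<mu>1 (region T (left_lim ?g) t) - measure \<kappa>1 (region T (left_lim ?g) t)\<bar> \<le> grid_dev T K \<mu>1 \<kappa>1 +
      (exp (1 + c) * (2 * T / real K + (osc T k ?g + 2 * T * ((k * T + 1) / real K))) + M / c)"
      by (rule region_deviation[OF T K c k \<mu>(3,4) ac(2) gb region_sets[OF left_lim_measurable[OF gr]] ll])
    moreover have "exp (1 + c) * (2 * T / real K + (osc T k ?g + 2 * T * ((k * T + 1) / real K))) = \<rho> + A * osc T k ?g"
      by (simp add: \<rho>_def A_def algebra_simps)
    ultimately show ?thesis unfolding region_left_lim[OF M ac(2) gr] B1_def m_def by simp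
  qed
  have eq: "(Y t 1 = xn 1 + 1 / real n * (LINT p:XX t|thinned T (N 0) (\<lambda>p. real n * q * \<phi> 0 p). 1)
             - 1 / real n * (LINT (s, y):XX t|thinned T (N 1) (\<lambda>p. real n * \<phi> 1 p). indicator {0..<left_lim (\<lambda>u. X u 1) s - left_lim (\<lambda>u. X u 2) s} y)) \<and>
       (\<forall>i\<ge>2. Y t i = xn i - 1 / real n * (LINT (s, y):XX t|thinned T (N i) (\<lambda>p. real n * \<phi> i p). indicator {0..<left_lim (\<lambda>u. X u i) s - left_lim (\<lambda>u. X u (i + 1)) s} y)) \<and>
       (\<forall>i\<ge>1. \<eta> t i = 1 / real n * (LINT (s, y):XX t|thinned T (N 0) (\<lambda>p. real n * q * \<phi> 0 p). indicator {0..<beta d n (left_lim (\<lambda>u. X u i) s)} y)) \<and>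
       (\<forall>i\<ge>1. X t i = Y t i + \<eta> t (i - 1) - \<eta> t i)" if "t \<in> {0..T}" for t
    using bspec[OF eqs[unfolded controlled_equations_def Let_def] that] by simp
  have Xll: "left_lim (\<lambda>u. X u j) r = left_lim (cX p j) r" if "r \<in> {0..T}" for j r
    by (rule left_lim_cong[OF cXr _ that]) (simp add: cX_def p_eq)
  have gapll: "left_lim (\<lambda>u. X u i) r - left_lim (\<lambda>u. X u (i + 1)) r = left_lim ?g r" if "r \<in> {0..T}" for r
    unfolding Xll[OF that] by (rule left_lim_diff[OF cXr cXr gr _ that]) (simp add: gap_def cX_def)
  define b where "b r = beta d n (left_lim (cX p i) r)" for r
  have bm: "(\<lambda>s. indicator {0..T} s * b s) \<in> borel_measurable borel"
  proof -
    have [measurable]: "(\<lambda>s. indicator {0..T} s * left_lim (cX p i) s) \<in> borel_measurable borel"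
      by (rule left_lim_measurable[OF cXr])
    have "(\<lambda>s. indicator {0..T} s * beta d n (indicator {0..T} s * left_lim (cX p i) s)) \<in> borel_measurable borel" by measurable
    moreover have "(\<lambda>s. indicator {0..T} s * beta d n (indicator {0..T} s * left_lim (cX p i) s)) = (\<lambda>s. indicator {0..T} s * b s)"
      by (auto simp: b_def indicator_def fun_eq_iff)
    ultimately show ?thesis by simp
  qed
  have bs: "region T b u \<in> XX_sets T" for u by (rule region_sets[OF bm])
  have E: "cE p i u = q * measure \<mu>0 (region T b u)" if u: "u \<in> {0..T}" for u
  proof -
    have "cE p i u = 1 / real n * (LINT (s, y):XX u|thinned T (N 0) (\<lambda>p. real n * q * \<phi> 0 p). indicator {0..<beta d n (left_lim (\<lambda>u. X u i) s)} y)"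
      using eq[OF u] i p_eq[OF u] by (simp add: cE_def)
    also have "(LINT (s, y):XX u|thinned T (N 0) (\<lambda>p. real n * q * \<phi> 0 p). indicator {0..<beta d n (left_lim (\<lambda>u. X u i) s)} y) =
        measure (thinned T (N 0) (\<lambda>p. real n * q * \<phi> 0 p)) (region T (\<lambda>s. beta d n (left_lim (\<lambda>u. X u i) s)) u)"
      using u by (intro set_integral_thinned_strip) simp
    also have "region T (\<lambda>s. beta d n (left_lim (\<lambda>u. X u i) s)) u = region T b u"
      by (rule region_cong) (simp add: b_def Xll)
    finally show ?thesis unfolding \<mu>0_def measure_scaled_thinned[OF n0 q] .
  qed
  have one: "1 / real n * measure (thinned T (N i) (\<lambda>p. real n * \<phi> i p)) S = measure \<mu>1 S" for S
    unfolding \<mu>1_def using measure_scaled_thinned[OF n0, of 1 T "N i" "\<phi> i" S] by simp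
  have gS: "(LINT (s, y):XX t|thinned T (N i) (\<lambda>p. real n * \<phi> i p). indicator {0..<left_lim (\<lambda>u. X u i) s - left_lim (\<lambda>u. X u (i + 1)) s} y) =
      measure (thinned T (N i) (\<lambda>p. real n * \<phi> i p)) (region T (left_lim ?g) t)"
    unfolding set_integral_thinned_strip[OF st(3)] by (rule arg_cong[OF region_cong]) (rule gapll)
  have tT: "t \<in> {0..T}" "s \<in> {0..T}" "0 \<in> {0..T}" using st T by auto
  have Yt: "cY p i t = xn i + (if i = 1 then q * measure \<mu>0 (R t) else 0) - measure \<mu>1 (region T (left_lim ?g) t)"
  proof (cases "i = 1")
    case True
    have "cY p i t = xn 1 + 1 / real n * (LINT p:XX t|thinned T (N 0) (\<lambda>p. real n * q * \<phi> 0 p). 1) -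
        1 / real n * measure (thinned T (N i) (\<lambda>p. real n * \<phi> i p)) (region T (left_lim ?g) t)"
      using eq[OF tT(1)] gS unfolding True by (simp add: cY_def p_eq[OF tT(1)] numeral_2_eq_2)
    then show ?thesis
      unfolding one set_integral_thinned_one[OF st(3)] measure_scaled_thinned[OF n0 q] using True
      by (simp add: \<mu>0_def R_def)
  next
    case False
    then have "2 \<le> i" using i by simp
    then have "cY p i t = xn i - 1 / real n * measure (thinned T (N i) (\<lambda>p. real n * \<phi> i p)) (region T (left_lim ?g) t)"
      using eq[OF tT(1)] gS by (simp add: cY_def p_eq[OF tT(1)])
    then show ?thesis unfolding one using False by simp
  qed
  have lin: "cX p i t - cY p i t - cE p (i - 1) t + cE p i t = 0"
    using eq[OF tT(1)] i by (simp add: cX_def cY_def cE_def p_eq[OF tT(1)])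
  interpret m0: finite_measure \<mu>0 by (rule \<mu>(1))
  have mono: "cE p i s \<le> cE p i t"
    unfolding E[OF tT(1)] E[OF tT(2)] using q bs \<mu>(2) st
    by (intro mult_left_mono m0.finite_measure_mono) (auto simp: region_def)
  have diff: "cE p i t - cE p i s \<le> q * (measure \<mu>0 (R t) - measure \<mu>0 (R s))"
  proof -
    have sub: "region T b s \<subseteq> region T b t" "R s \<subseteq> R t" using st by (auto simp: region_def R_def)
    have "measure \<mu>0 (region T b t) - measure \<mu>0 (region T b s) = measure \<mu>0 (region T b t - region T b s)"
      using bs \<mu>(2) sub by (simp add: m0.finite_measure_Diff)
    also have "\<dots> \<le> measure \<mu>0 (R t - R s)"
    proof (rule m0.finite_measure_mono)
      show "region T b t - region T b s \<subseteq> R t - R s" by (auto simp: region_def R_def XX_def)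
      show "R t - R s \<in> sets \<mu>0" using sets.Diff[of "R t" \<mu>0 "R s"] Rs \<mu>(2) by simp
    qed
    also have "\<dots> = measure \<mu>0 (R t) - measure \<mu>0 (R s)"
      using Rs \<mu>(2) sub by (simp add: m0.finite_measure_Diff)
    finally show ?thesis unfolding E[OF tT(1)] E[OF tT(2)] using q by (simp flip: right_diff_distrib)
  qed
  \<comment> \<open>The bound of \<open>ac_measure\<close> on the whole strip with c = 1, the
    Lebesgue measure of \<open>XX T\<close> being T.\<close>
  define kT where "kT = exp 2 * T + M"
  have kR: "measure \<kappa>0 (R u) \<le> kT" for u
  proof -
    interpret k0: finite_measure \<kappa>0 by (rule ac_measureD(2)[OF ac(1)])
    have top: "XX T \<in> XX_sets T" by (auto simp: XX_sets_def)
    have "measure \<kappa>0 (R u) \<le> measure \<kappa>0 (XX T)"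
      using top ac_measureD(1)[OF ac(1)] by (intro k0.finite_measure_mono) (auto simp: R_def region_def)
    also have "\<dots> \<le> kT" using ac_measureD(4)[OF ac(1) _ top, of 1] measure_XX[OF T0] by (simp add: kT_def)
    finally show ?thesis .
  qed
  \<comment> \<open>The error of replacing rate and arrival measure: the first summand is the
    deviation of the noise at rate \<open>q\<close>, the second the error of the rate
    itself.\<close>
  define W where "W = q * (B0 + \<rho> + m) + \<bar>q - lam\<bar> * kT"
  have arr: "\<bar>q * measure \<mu>0 (R u) - lam * measure \<kappa>0 (R u)\<bar> \<le> W" for u
  proof -
    have "q * measure \<mu>0 (R u) - lam * measure \<kappa>0 (R u) = q * (measure \<mu>0 (R u) - measure \<kappa>0 (R u)) + (q - lam) * measure \<kappa>0 (R u)"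
      by (simp add: algebra_simps)
    also have "\<bar>\<dots>\<bar> \<le> q * \<bar>measure \<mu>0 (R u) - measure \<kappa>0 (R u)\<bar> + \<bar>q - lam\<bar> * measure \<kappa>0 (R u)"
      using q by (intro order_trans[OF abs_triangle_ineq]) (simp add: abs_mult)
    also have "\<dots> \<le> W" unfolding W_def using dev0[of u] kR[of u] q by (intro add_mono mult_left_mono) auto
    finally show ?thesis .
  qed
  have W0: "0 \<le> W" using arr[of 0] by linarith
  have v1: "\<bar>cY p i t - x i - (if i = 1 then lam * arrivals T \<phi> t else 0) + services T p \<phi> i t\<bar> \<le>
      \<bar>xn i - x i\<bar> + W + (B1 + \<rho> + A * osc T k ?g + m)"
  proof -
    have a: "arrivals T \<phi> t = measure \<kappa>0 (R t)" "services T p \<phi> i t = measure \<kappa>1 (region T ?g t)"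
      by (simp_all add: arrivals_def services_def \<kappa>0_def \<kappa>1_def R_def)
    have tri: "\<bar>(xx + a' - b') - x' - a'' + b''\<bar> \<le> \<bar>xx - x'\<bar> + w + v" if "\<bar>a' - a''\<bar> \<le> w" "\<bar>b' - b''\<bar> \<le> v" for xx a' b' x' a'' b'' w v :: real
      using that by linarith
    show ?thesis unfolding Yt a by (rule tri[OF _ dev1]) (use arr[of t] W0 in auto)
  qed
  have v4: "max 0 (cE p i t - cE p i s - lam * (arrivals T \<phi> t - arrivals T \<phi> s)) \<le> 2 * W"
  proof -
    have "q * (measure \<mu>0 (R t) - measure \<mu>0 (R s)) - lam * (measure \<kappa>0 (R t) - measure \<kappa>0 (R s)) \<le> 2 * W"
      unfolding right_diff_distrib using arr[of t] arr[of s] by linarith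
    then show ?thesis using diff W0 unfolding arrivals_def \<kappa>0_def[symmetric] R_def[symmetric] by simp
  qed
  \<comment> \<open>The lowest row of the grid. As a union of grid boxes it has no boundary boxes,
    so \<open>grid_deviation\<close> applies with an empty exceptional set.\<close>
  define L where "L = {z \<in> XX T. snd z < 1 / real K}"
  have Ls: "L \<in> XX_sets T" "measure lborel L \<le> T / real K"
  proof -
    have eqL: "L = {0..T} \<times> ({0..1} \<inter> {..<1 / real K})" by (auto simp: L_def XX_def)
    have "L \<in> sets borel" unfolding eqL by (intro borel_Times) auto
    then show "L \<in> XX_sets T" by (auto simp: XX_sets_def L_def)
    have "emeasure lborel L = emeasure lborel {0..T} * emeasure lborel ({0..1} \<inter> {..<1 / real K})"
      unfolding eqL lborel_prod[symmetric] by (rule lborel.emeasure_pair_measure_Times) auto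
    also have "\<dots> \<le> ennreal T * emeasure lborel {0..1 / real K}"
      using T0 by (intro mult_mono emeasure_mono) auto
    also have "\<dots> = ennreal (T / real K)" using T0 by (simp flip: ennreal_mult)
    finally show "measure lborel L \<le> T / real K" unfolding measure_def using T0 by (intro enn2real_leI) auto
  qed
  have L\<mu>: "measure \<mu>0 L \<le> B0 + A * (T / real K) + m"
  proof -
    have emp: "{} \<in> XX_sets T" by (simp add: XX_sets_def)
    have "\<bar>measure \<mu>0 L - measure \<kappa>0 L\<bar> \<le> grid_dev T K \<mu>0 \<kappa>0 + measure \<kappa>0 {}"
    proof (rule grid_deviation[OF T \<mu>(1,2) ac_measureD(2,1)[OF ac(1)] Ls(1) emp])
      fix p' z z' assume z: "z \<in> grid_box T K p'" "z' \<in> grid_box T K p'" "z \<in> L" "z' \<notin> L"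
      have X: "z \<in> XX T" "z' \<in> XX T" using z by (auto simp: grid_box_def)
      have "\<lfloor>snd z * real K\<rfloor> = 0" using z(3) X(1) K by (auto simp: L_def XX_def floor_eq_iff field_simps)
      then have "\<lfloor>snd z' * real K\<rfloor> = 0" using z(1,2) by (simp add: grid_box_def)
      then have "snd z' < 1 / real K" using K by (simp add: floor_eq_iff field_simps)
      then show "grid_box T K p' \<subseteq> {}" using z(4) X(2) by (simp add: L_def)
    qed
    moreover have "measure \<kappa>0 L \<le> A * measure lborel L + m" unfolding A_def m_def by (rule ac_measureD(4)[OF ac(1) c Ls(1)])
    moreover have "A * measure lborel L \<le> A * (T / real K)" using Ls(2) by (intro mult_left_mono) (auto simp: A_def)
    ultimately show ?thesis unfolding B0_def by simp
  qed
  \<comment> \<open>Either the infimum is at most 1/K, or the path stays below 1 - 1/K on the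
    interval. In the latter case \<open>beta\<close> is at most 1/K there, and the increment of
    \<eta> is produced by points of the lowest row alone.\<close>
  have v5: "max 0 (min (cE p i t - cE p i s) (INF u\<in>{s..t}. 1 - cX p i u)) \<le> 1 / real K + q * (B0 + A * (T / real K) + m)"
  proof (cases "(INF u\<in>{s..t}. 1 - cX p i u) \<le> 1 / real K")
    case True
    have "0 \<le> q * (B0 + A * (T / real K) + m)" using L\<mu> q measure_nonneg[of \<mu>0 L] by (intro mult_nonneg_nonneg) linarith+
    moreover have "0 \<le> 1 / real K" by simp
    ultimately show ?thesis using True by linarith
  next
    case False
    have bb: "bdd_below ((\<lambda>u. 1 - cX p i u) ` {s..t})"
      using cX_range[OF p _ i] st by (intro bdd_belowI2[where m = 0]) auto
    have Xle: "cX p i u \<le> 1 - 1 / real K" if u: "u \<in> {s..t}" for u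
      using cINF_lower[OF bb u] False by linarith
    have K1: "0 \<le> 1 - 1 / real K" "1 - 1 / real K \<le> 1" using K by auto
    \<comment> \<open>The inequality s < r is strict because the left limit at \<open>s\<close>
      itself would involve times before \<open>s\<close>. The increment only concerns times after
      \<open>s\<close>.\<close>
    have ble: "b r \<le> 1 / real K" if r: "s < r" "r \<le> t" for r
    proof -
      have r': "r \<in> {0<..T}" "0 < r" using r st by auto
      have cXr': "(cX p i \<longlongrightarrow> left_lim (cX p i) r) (at_left r)" by (rule left_lim_tendsto[OF cXr r'(1)])
      have "\<forall>\<^sub>F u in at_left r. cX p i u \<le> 1 - 1 / real K"
        using eventually_at_left_real[OF r(1)] by eventually_elim (use r Xle in auto)
      then have "left_lim (cX p i) r \<le> 1 - 1 / real K"
        by (intro tendsto_upperbound[OF cXr']) auto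
      then have "b r \<le> (1 - 1 / real K) ^ d" unfolding b_def using d n K1 by (intro beta_le_power) auto
      then show ?thesis using bd by linarith
    qed
    have "region T b t - region T b s \<subseteq> L"
    proof
      fix z assume z: "z \<in> region T b t - region T b s"
      then have "s < fst z" "fst z \<le> t" "snd z < b (fst z)" "z \<in> XX T" by (auto simp: region_def)
      then show "z \<in> L" using ble[of "fst z"] by (simp add: L_def)
    qed
    then have "measure \<mu>0 (region T b t - region T b s) \<le> measure \<mu>0 L"
      using Ls(1) \<mu>(2) by (intro m0.finite_measure_mono) auto
    moreover have "measure \<mu>0 (region T b t) - measure \<mu>0 (region T b s) = measure \<mu>0 (region T b t - region T b s)"
      using bs \<mu>(2) st by (subst m0.finite_measure_Diff) (auto simp: region_def)
    ultimately have "cE p i t - cE p i s \<le> q * measure \<mu>0 L"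
      unfolding E[OF tT(1)] E[OF tT(2)] using q by (simp flip: right_diff_distrib)
    also have "\<dots> \<le> q * (B0 + A * (T / real K) + m)" using L\<mu> q by (intro mult_left_mono) auto
    finally have "cE p i t - cE p i s \<le> q * (B0 + A * (T / real K) + m)" .
    moreover have "0 \<le> 1 / real K" by simp
    ultimately show ?thesis using mono by linarith
  qed
  have v6: "\<bar>cE p i 0\<bar> \<le> q * (B0 + \<rho> + m)"
  proof -
    \<comment> \<open>The thinned measure may charge time 0, but its compensator does not; the value
      of \<eta> at 0 is therefore bounded by the deviation.\<close>
    have z: "measure \<kappa>0 (R 0) = 0"
    proof (rule ac_null[OF M ac(1) Rs])
      have "R 0 = {z \<in> XX T. 0 \<le> fst z \<and> fst z \<le> 0}" by (auto simp: R_def region_def XX_def)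
      then have "measure lborel (R 0) \<le> 0" using vertical_strip(2)[OF T0, of 0 0] by simp
      then show "measure lborel (R 0) = 0" using measure_nonneg by (rule antisym)
    qed
    have sub: "region T b 0 \<subseteq> R 0" by (auto simp: R_def region_def XX_def)
    have "measure \<mu>0 (region T b 0) \<le> measure \<mu>0 (R 0)" using sub Rs \<mu>(2) by (intro m0.finite_measure_mono) auto
    also have "\<dots> \<le> B0 + \<rho> + m" using dev0[of 0] z by simp
    finally show ?thesis unfolding E[OF tT(3)] using q by (simp add: abs_mult mult_left_mono)
  qed
  have "viol T lam x i (p, \<phi>) s t \<le> (\<bar>xn i - x i\<bar> + W + (B1 + \<rho> + A * osc T k ?g + m)) + 0 + 0 + 2 * W +
      (1 / real K + q * (B0 + A * (T / real K) + m)) + q * (B0 + \<rho> + m)"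
    unfolding viol_def prod.case
    by (intro add_mono v1 v4 v5 v6) (use lin mono in auto)
  also have "\<dots> = A * osc T k ?g + (5 * q + 1) * m + (\<bar>xn i - x i\<bar> + 3 * \<bar>q - lam\<bar> * kT + 1 / real K + (4 * q + 1) * \<rho>
      + q * (A * (T / real K)) + 5 * q * B0 + B1)"
    unfolding W_def by (simp add: algebra_simps)
  finally show ?thesis unfolding A_def m_def kT_def B0_def B1_def .
qed

section \<open>Passage to the limit\<close>

text \<open>Where \<open>Z\<close> leaves the space the indicator forces the value 0, so the
  preimage of a set containing 0 acquires an additional measurable part.\<close>

lemma random_element_measurable:
  assumes Z: "random_element Q Xt Z" and f: "continuous_map Xt euclideanreal f"
  shows "(\<lambda>w. indicator (topspace Xt) (Z w) * f (Z w)) \<in> borel_measurable Q"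
proof (rule borel_measurableI)
  fix S :: "real set" assume S: "open S"
  have op: "{w \<in> space Q. Z w \<in> U} \<in> sets Q" if "openin Xt U" for U
    using Z that by (simp add: random_element_def)
  have 1: "{w \<in> space Q. Z w \<in> {z \<in> topspace Xt. f z \<in> S}} \<in> sets Q"
    using f S by (intro op openin_continuous_map_preimage[of Xt euclideanreal]) auto
  have "{w \<in> space Q. Z w \<in> topspace Xt} \<in> sets Q" by (rule op) simp
  then have 2: "space Q - {w \<in> space Q. Z w \<in> topspace Xt} \<in> sets Q" by auto
  have "(\<lambda>w. indicator (topspace Xt) (Z w) * f (Z w)) -` S \<inter> space Q =
      {w \<in> space Q. Z w \<in> {z \<in> topspace Xt. f z \<in> S}} \<union> (if 0 \<in> S then space Q - {w \<in> space Q. Z w \<in> topspace Xt} else {})"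
    (is "?A = ?B")
  proof (rule set_eqI)
    fix w show "w \<in> ?A \<longleftrightarrow> w \<in> ?B" by (cases "Z w \<in> topspace Xt") auto
  qed
  then show "(\<lambda>w. indicator (topspace Xt) (Z w) * f (Z w)) -` S \<inter> space Q \<in> sets Q" using 1 2 by auto
qed

lemma A_b_A_plus: "\<phi> \<in> A_b P D T \<Longrightarrow> (\<lambda>w. \<phi> w i) \<in> A_plus P D T"
  by (auto simp: A_b_def A_bm_def)

lemma A_b_bounded:
  assumes "\<phi> \<in> A_b P D T"
  shows "\<exists>m. \<forall>i. \<forall>w\<in>space P. \<forall>p\<in>XX T. \<phi> w i p \<le> m"
proof -
  obtain m where m: "1 \<le> m" "\<phi> \<in> A_bm P D T m" using assms by (auto simp: A_b_def)
  have "\<phi> w i p \<le> real m" if "w \<in> space P" "p \<in> XX T" for i w p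
    using m that unfolding A_bm_def by (cases "i \<le> m") auto
  then show ?thesis by (intro exI[of _ "real m"]) simp
qed

text \<open>There are (K + 1)^2 boxes, and the normalised variance on each is at most C / (n q). The
  free parameter \<theta> converts the square into a first moment. The majorant is built from the
  measurable versions \<open>G\<close>, so that its expectation is meaningful.\<close>

lemma grid_dev_expectation:
  assumes P: "prob_space P" and D: "iid_poisson_random_measures P T D" and T: "0 < T"
    and \<phi>: "\<phi> \<in> A_plus P D T" and bd: "\<And>w p. w \<in> space P \<Longrightarrow> p \<in> XX T \<Longrightarrow> \<phi> w p \<le> m"
    and n: "0 < n" and q: "0 < q" and \<theta>: "0 < \<theta>"
    and tot: "AE w in P. finite_measure (control_measure T (\<phi> w)) \<and> sets (control_measure T (\<phi> w)) = XX_sets T \<and>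
      measure (control_measure T (\<phi> w)) (XX T) \<le> C"
    and C: "0 \<le> C"
  obtains H where "integrable P H" "(LINT w|P. H w) \<le> (real K + 1)\<^sup>2 * (C / (real n * q * \<theta>) + \<theta>)"
    "AE w in P. grid_dev T K (scaled_thinned T n q (D i w) (\<phi> w)) (control_measure T (\<phi> w)) \<le> H w"
    "AE w in P. emeasure (thinned T (D i w) (\<lambda>p. real n * q * \<phi> w p)) (XX T) < \<infinity>"
proof -
  interpret P: prob_space P by (rule P)
  let ?N = "real n * q"
  have N: "0 < ?N" using n q by simp
  have box: "grid_box T K b \<in> sets borel" "grid_box T K b \<subseteq> XX T" for b
    using grid_box_sets[of T K b] by (auto simp: XX_sets_def)
  have "\<exists>G. G \<in> borel_measurable P \<and> integrable P (\<lambda>w. (G w)\<^sup>2) \<and>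
    (LINT w|P. (G w)\<^sup>2) = (LINT w|P. ?N * measure (control_measure T (\<phi> w)) (grid_box T K b)) \<and>
    (AE w in P. measure (thinned T (D i w) (\<lambda>p. ?N * \<phi> w p)) (grid_box T K b) - ?N * measure (control_measure T (\<phi> w)) (grid_box T K b) = G w)" for b
  proof (rule thinned_deviation[OF P D T \<phi> bd less_imp_le[OF N] box[of b], of i])
    fix G assume G: "G \<in> borel_measurable P" "integrable P (\<lambda>w. (G w)\<^sup>2)"
      "(LINT w|P. (G w)\<^sup>2) = (LINT w|P. ?N * measure (control_measure T (\<phi> w)) (grid_box T K b))"
      and ae: "AE w in P. emeasure (thinned T (D i w) (\<lambda>p. ?N * \<phi> w p)) (grid_box T K b) < \<infinity> \<and>
        measure (thinned T (D i w) (\<lambda>p. ?N * \<phi> w p)) (grid_box T K b) - ?N * measure (control_measure T (\<phi> w)) (grid_box T K b) = G w"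
    have "AE w in P. measure (thinned T (D i w) (\<lambda>p. ?N * \<phi> w p)) (grid_box T K b) - ?N * measure (control_measure T (\<phi> w)) (grid_box T K b) = G w"
      using ae by eventually_elim (erule conjunct2)
    with G show ?thesis by (intro exI[of _ G] conjI)
  qed
  then have "\<exists>G. \<forall>b. G b \<in> borel_measurable P \<and> integrable P (\<lambda>w. (G b w)\<^sup>2) \<and>
    (LINT w|P. (G b w)\<^sup>2) = (LINT w|P. ?N * measure (control_measure T (\<phi> w)) (grid_box T K b)) \<and>
    (AE w in P. measure (thinned T (D i w) (\<lambda>p. ?N * \<phi> w p)) (grid_box T K b) - ?N * measure (control_measure T (\<phi> w)) (grid_box T K b) = G b w)"
    by (intro choice allI)
  then obtain G where G: "\<forall>b. G b \<in> borel_measurable P \<and> integrable P (\<lambda>w. (G b w)\<^sup>2) \<and>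
    (LINT w|P. (G b w)\<^sup>2) = (LINT w|P. ?N * measure (control_measure T (\<phi> w)) (grid_box T K b)) \<and>
    (AE w in P. measure (thinned T (D i w) (\<lambda>p. ?N * \<phi> w p)) (grid_box T K b) - ?N * measure (control_measure T (\<phi> w)) (grid_box T K b) = G b w)"
    by (rule exE)
  note G_sq = G[THEN spec, THEN conjunct2, THEN conjunct1] and G_eq = G[THEN spec, THEN conjunct2, THEN conjunct2, THEN conjunct1]
    and G_AE = G[THEN spec, THEN conjunct2, THEN conjunct2, THEN conjunct2]
  define H where "H = (\<lambda>w. \<Sum>b\<in>grid_index K. (G b w)\<^sup>2 / (?N\<^sup>2 * \<theta>) + \<theta>)"
  have G2: "(LINT w|P. (G b w)\<^sup>2) \<le> ?N * C" for b
  proof -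
    have "(LINT w|P. ?N * measure (control_measure T (\<phi> w)) (grid_box T K b)) \<le> (LINT w|P. ?N * C)"
    proof (rule integral_mono_AE')
      show "AE w in P. ?N * measure (control_measure T (\<phi> w)) (grid_box T K b) \<le> ?N * C"
        using tot
      proof eventually_elim
        case (elim w)
        then have "measure (control_measure T (\<phi> w)) (grid_box T K b) \<le> measure (control_measure T (\<phi> w)) (XX T)"
          using box(2)[of b] by (intro finite_measure.finite_measure_mono) (auto simp: XX_sets_def)
        then show ?case using elim N by (intro mult_left_mono) auto
      qed
      show "AE w in P. 0 \<le> ?N * C" using N C by simp
    qed (rule P.integrable_const)
    then show ?thesis unfolding G_eq using P.prob_space by simp
  qed
  have cg: "real (card (grid_index K)) = (real K + 1)\<^sup>2" by (simp add: grid_index_def power2_eq_square algebra_simps)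
  have i1: "integrable P (\<lambda>w. (G b w)\<^sup>2 / (?N\<^sup>2 * \<theta>))" for b using G_sq[of b] by (rule integrable_divide)
  have i2: "integrable P (\<lambda>w. (G b w)\<^sup>2 / (?N\<^sup>2 * \<theta>) + \<theta>)" for b
    by (rule Bochner_Integration.integrable_add[OF i1 P.integrable_const])
  have Hi: "integrable P H" unfolding H_def by (intro Bochner_Integration.integrable_sum i2)
  have e1: "(LINT w|P. (G b w)\<^sup>2 / (?N\<^sup>2 * \<theta>) + \<theta>) = (LINT w|P. (G b w)\<^sup>2) / (?N\<^sup>2 * \<theta>) + \<theta>" for b
    unfolding Bochner_Integration.integral_add[OF i1[of b] P.integrable_const] by (simp only: integral_divide_zero lebesgue_integral_const P.prob_space) simp
  have "(LINT w|P. H w) = (\<Sum>b\<in>grid_index K. (LINT w|P. (G b w)\<^sup>2) / (?N\<^sup>2 * \<theta>) + \<theta>)"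
    unfolding H_def Bochner_Integration.integral_sum[OF i2] e1 ..
  also have "\<dots> \<le> (\<Sum>b\<in>grid_index K. C / (?N * \<theta>) + \<theta>)"
  proof (intro sum_mono add_right_mono)
    fix b
    have "(LINT w|P. (G b w)\<^sup>2) / (?N\<^sup>2 * \<theta>) \<le> (?N * C) / (?N\<^sup>2 * \<theta>)" using G2 \<theta> by (intro divide_right_mono) auto
    also have "\<dots> = C / (?N * \<theta>)" using N by (simp add: power2_eq_square)
    finally show "(LINT w|P. (G b w)\<^sup>2) / (?N\<^sup>2 * \<theta>) \<le> C / (?N * \<theta>)" .
  qed
  also have "\<dots> = (real K + 1)\<^sup>2 * (C / (?N * \<theta>) + \<theta>)" unfolding sum_constant cg ..
  finally have EH: "(LINT w|P. H w) \<le> (real K + 1)\<^sup>2 * (C / (?N * \<theta>) + \<theta>)" .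
  have "AE w in P. \<forall>b\<in>grid_index K. measure (thinned T (D i w) (\<lambda>p. ?N * \<phi> w p)) (grid_box T K b) - ?N * measure (control_measure T (\<phi> w)) (grid_box T K b) = G b w"
    using G_AE finite_grid_index by (intro AE_finite_allI) auto
  then have dev: "AE w in P. grid_dev T K (scaled_thinned T n q (D i w) (\<phi> w)) (control_measure T (\<phi> w)) \<le> H w"
  proof eventually_elim
    case (elim w)
    show ?case unfolding grid_dev_def H_def
    proof (rule sum_mono)
      fix b assume b: "b \<in> grid_index K"
      let ?a = "measure (scaled_thinned T n q (D i w) (\<phi> w)) (grid_box T K b)"
        and ?t = "measure (thinned T (D i w) (\<lambda>p. ?N * \<phi> w p)) (grid_box T K b)"
        and ?m = "measure (control_measure T (\<phi> w)) (grid_box T K b)"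
      \<comment> \<open>Multiplied by \<theta>, this is half of 2 |g| \<theta> \<le> g^2 +
        \<theta>^2, up to a generous constant.\<close>
      have young: "\<bar>g\<bar> \<le> g\<^sup>2 / \<theta> + \<theta>" for g :: real
      proof -
        have "2 * \<bar>g\<bar> * \<theta> \<le> g\<^sup>2 + \<theta>\<^sup>2" using sum_squares_bound[of "\<bar>g\<bar>" \<theta>] by simp
        moreover have "0 \<le> \<bar>g\<bar> * \<theta>" using \<theta> by simp
        ultimately have "\<bar>g\<bar> * \<theta> \<le> g\<^sup>2 + \<theta>\<^sup>2" by linarith
        then show ?thesis using \<theta> by (simp add: field_simps power2_eq_square)
      qed
      have "1 / real n * ?t = q * ?a" by (rule measure_scaled_thinned[OF n q])
      then have "?t = ?N * ?a" using n by (simp add: field_simps)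
      then have "?N * (?a - ?m) = G b w" using bspec[OF elim b] by (simp only: right_diff_distrib)
      then have "?a - ?m = G b w / ?N" using N by (metis less_irrefl nonzero_mult_div_cancel_left)
      then show "\<bar>?a - ?m\<bar> \<le> (G b w)\<^sup>2 / (?N\<^sup>2 * \<theta>) + \<theta>" using young[of "?a - ?m"] by (simp only: power_divide divide_divide_eq_left)
    qed
  qed
  have fin: "AE w in P. emeasure (thinned T (D i w) (\<lambda>p. ?N * \<phi> w p)) (XX T) < \<infinity>"
  proof (rule thinned_deviation[OF P D T \<phi> bd less_imp_le[OF N], of "XX T" i])
    fix G assume "AE w in P. emeasure (thinned T (D i w) (\<lambda>p. ?N * \<phi> w p)) (XX T) < \<infinity> \<and>
      measure (thinned T (D i w) (\<lambda>p. ?N * \<phi> w p)) (XX T) - ?N * measure (control_measure T (\<phi> w)) (XX T) = G w"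
    then show ?thesis by eventually_elim simp
  qed auto
  show thesis by (rule that[OF Hi EH dev fin])
qed

section \<open>The violation functional vanishes for the limit\<close>

locale controlled_limit =
  fixes T lam M0 :: real
    and d :: "nat \<Rightarrow> nat" and lamn :: "nat \<Rightarrow> real"
    and x :: "nat \<Rightarrow> real" and xn :: "nat \<Rightarrow> nat \<Rightarrow> real"
    and P :: "'w measure" and Q :: "'v measure"
    and D :: "nat \<Rightarrow> 'w \<Rightarrow> (real \<times> real \<times> real) measure"
    and \<phi>n :: "nat \<Rightarrow> 'w \<Rightarrow> nat \<Rightarrow> real \<times> real \<Rightarrow> real"
    and Xn Yn \<eta>n :: "nat \<Rightarrow> 'w \<Rightarrow> real \<Rightarrow> nat \<Rightarrow> real"
    and \<phi> :: "'v \<Rightarrow> nat \<Rightarrow> real \<times> real \<Rightarrow> real"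
    and X Y \<eta> :: "'v \<Rightarrow> real \<Rightarrow> nat \<Rightarrow> real"
    and r :: "nat \<Rightarrow> nat"
  assumes T: "0 < T"
    and d: "\<And>n. 1 \<le> n \<Longrightarrow> d n \<in> {1..n}" "filterlim d at_top sequentially"
    and lam: "lamn \<longlonglongrightarrow> lam" "0 < lam"
    and x: "x \<in> ell1_down" "\<And>n. 1 \<le> n \<Longrightarrow> xn n \<in> ell1_down"
      "(\<lambda>n. ell1_norm (\<lambda>i. xn n i - x i)) \<longlonglongrightarrow> 0"
    and P: "prob_space P"
    and D: "iid_poisson_random_measures P T D"
    and controls: "\<And>n. 1 \<le> n \<Longrightarrow> \<phi>n n \<in> A_b P D T"
    and M0: "0 < M0" "AE w in P. \<forall>n\<ge>1. total_cost T (\<phi>n n w) \<le> ennreal M0"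
    and controlled: "\<And>n. 1 \<le> n \<Longrightarrow> AE w in P.
      controlled_equations T n (d n) (lamn n) (xn n) (\<lambda>i. D i w) (\<phi>n n w) (Xn n w) (Yn n w) (\<eta>n n w)"
    and Q: "prob_space Q"
    and r: "strict_mono r" "1 \<le> r 0"
    and conv: "converges_in_distribution P
      (prod_topology (skorokhod_topology T state_metric) (S_topology T M0))
      (\<lambda>k w. (\<lambda>t\<in>{0..T}. (Xn (r k) w t, Yn (r k) w t, \<eta>n (r k) w t), \<phi>n (r k) w))
      Q (\<lambda>w. (\<lambda>t\<in>{0..T}. (X w t, Y w t, \<eta> w t), \<phi> w))"
begin

abbreviation "path_space \<equiv> prod_topology (skorokhod_topology T state_metric) (S_topology T M0)"

definition Zn :: "nat \<Rightarrow> 'w \<Rightarrow> (real \<Rightarrow> state) \<times> (nat \<Rightarrow> real \<times> real \<Rightarrow> real)" where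
  "Zn k w = (\<lambda>t\<in>{0..T}. (Xn (r k) w t, Yn (r k) w t, \<eta>n (r k) w t), \<phi>n (r k) w)"

definition Z :: "'v \<Rightarrow> (real \<Rightarrow> state) \<times> (nat \<Rightarrow> real \<times> real \<Rightarrow> real)" where
  "Z w = (\<lambda>t\<in>{0..T}. (X w t, Y w t, \<eta> w t), \<phi> w)"

lemma topspace_path: "z \<in> topspace path_space \<Longrightarrow> fst z \<in> cadlag_space T state_metric \<and> snd z \<in> topspace (S_topology T M0)"
  by (auto simp: topspace_skorokhod_topology[OF T])

lemma conv_Z: "converges_in_distribution P path_space Zn Q Z"
  unfolding Zn_def[abs_def] Z_def[abs_def] by (rule conv)

lemma random_element_Zn: "random_element P path_space (Zn j)"
  using conv_Z[unfolded converges_in_distribution_def, THEN conjunct1] by (rule spec)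

lemma random_element_Z: "random_element Q path_space Z"
  by (rule conv_Z[unfolded converges_in_distribution_def, THEN conjunct2, THEN conjunct1])

lemma Psi_bounds:
  assumes "z \<in> topspace path_space" "1 \<le> i" "0 \<le> k" "0 < c"
  shows "0 \<le> Psi T lam x M0 c k i z" "Psi T lam x M0 c k i z \<le> 1"
proof -
  have T0: "0 \<le> T" using T by simp
  have "0 \<le> osc T k (gap (fst z) i)"
    using topspace_path[OF assms(1)] assms by (intro osc_nonneg[OF T0 gap_bounded]) auto
  then have "0 \<le> exp (1 + c) * osc T k (gap (fst z) i)" by simp
  moreover have "0 \<le> (8 * lam + 1) * (M0 / c)" using lam M0 assms by simp
  moreover have "Phi T lam x i z \<le> 1" by (rule Phi_least[OF T0]) simp
  ultimately show "Psi T lam x M0 c k i z \<le> 1" "0 \<le> Psi T lam x M0 c k i z" unfolding Psi_def by auto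
qed

lemma rk_ge: "1 \<le> r k" using r by (metis le0 le_trans strict_mono_less_eq)

lemma control_in_S: "1 \<le> n \<Longrightarrow> AE w in P. \<phi>n n w \<in> S_space T M0"
proof -
  assume n: "1 \<le> n"
  have m: "(\<lambda>w. \<phi>n n w i) \<in> A_plus P D T" for i by (rule A_b_A_plus[OF controls[OF n]])
  show ?thesis using M0(2) AE_space
  proof eventually_elim
    case (elim w)
    then show ?case using A_plus_section[OF T m elim(2)] n by (auto simp: S_space_def control_functions_def)
  qed
qed

text \<open>With \<open>c\<close> and \<open>k\<close> fixed, the limits are taken in the order n to
  infinity, \<theta> to 0, K to infinity. The variance of the noise disappears in the first limit,
  the price \<theta> per box in the second, and the grid errors in the third.\<close>

lemma limit_Psi_integral:
  assumes i: "1 \<le> i" and k: "0 \<le> k" and c: "0 < c"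
  shows "(LINT w|Q. indicator (topspace path_space) (Z w) * Psi T lam x M0 c k i (Z w)) \<le> 0"
proof -
  interpret P: prob_space P by (rule P)
  have T0: "0 \<le> T" and M: "0 \<le> M0" using T M0 by auto
  define L where "L = (LINT w|Q. indicator (topspace path_space) (Z w) * Psi T lam x M0 c k i (Z w))"
  define a where "a j = (LINT w|P. indicator (topspace path_space) (Zn j w) * Psi T lam x M0 c k i (Zn j w))" for j
  have cont: "continuous_map path_space euclideanreal (Psi T lam x M0 c k i)" by (rule Psi_continuous[OF T M i k])
  have bdd: "bounded (Psi T lam x M0 c k i ` topspace path_space)"
    unfolding bounded_iff
  proof (intro exI[of _ 1] ballI)
    fix y assume "y \<in> Psi T lam x M0 c k i ` topspace path_space"
    then obtain z where "z \<in> topspace path_space" "y = Psi T lam x M0 c k i z" by (elim imageE)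
    then show "norm y \<le> 1" using Psi_bounds[OF _ i k c] by simp
  qed
  have aL: "a \<longlonglongrightarrow> L"
    unfolding a_def L_def
    by (rule mp[OF conv_Z[unfolded converges_in_distribution_def, THEN conjunct2, THEN conjunct2, THEN spec] conjI[OF cont bdd]])
  note rZ = random_element_Zn
  define kT where "kT = exp 2 * T + M0"
  have kT: "0 \<le> kT" using T0 M by (simp add: kT_def)
  define \<rho> where "\<rho> K = exp (1 + c) * (2 * T / real K + 2 * T * ((k * T + 1) / real K))" for K :: nat
  \<comment> \<open>The bound of \<open>prelimit_violation\<close>, with the two grid deviations
    replaced by their expected majorants and the terms subtracted in \<open>Psi\<close>
    removed.\<close>
  define u where "u K \<theta> j = \<bar>xn (r j) i - x i\<bar> + 3 * \<bar>lamn (r j) - lam\<bar> * kT + 1 / real K + (4 * lamn (r j) + 1) * \<rho> K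
     + lamn (r j) * (exp (1 + c) * (T / real K))
     + 5 * lamn (r j) * ((real K + 1)\<^sup>2 * (kT / (real (r j) * lamn (r j) * \<theta>) + \<theta>))
     + (real K + 1)\<^sup>2 * (kT / (real (r j) * 1 * \<theta>) + \<theta>)" for K :: nat and \<theta> j
  have rtop: "filterlim r at_top sequentially" using r(1) by (rule filterlim_subseq)
  have lamr: "(\<lambda>j. lamn (r j)) \<longlonglongrightarrow> lam" using LIMSEQ_subseq_LIMSEQ[OF lam(1) r(1)] by (simp add: comp_def)
  \<comment> \<open>The factor 3/2 gives 5 q + 1 \<le> 8 lam + 1, which matches the constant in
    \<open>Psi\<close>.\<close>
  have evl: "\<forall>\<^sub>F j in sequentially. 0 < lamn (r j) \<and> lamn (r j) < 3 / 2 * lam"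
    using order_tendstoD(1)[OF lamr lam(2)] order_tendstoD(2)[OF lamr, of "3 / 2 * lam"] lam(2)
    by (auto intro: eventually_conj)
  have evd: "\<forall>\<^sub>F j in sequentially. (1 - 1 / real K) ^ d (r j) \<le> 1 / real K" if K: "0 < K" for K :: nat
  proof -
    have "(\<lambda>n. (1 - 1 / real K) ^ n) \<longlonglongrightarrow> 0" using K by (intro LIMSEQ_realpow_zero) auto
    then have "(\<lambda>j. (1 - 1 / real K) ^ d (r j)) \<longlonglongrightarrow> 0"
      by (rule filterlim_compose) (rule filterlim_compose[OF d(2) rtop])
    from order_tendstoD(2)[OF this, of "1 / real K"] K show ?thesis by (auto elim: eventually_mono)
  qed
  have bound: "a j \<le> u K \<theta> j" if K: "0 < K" and \<theta>: "0 < \<theta>" and q: "0 < lamn (r j)" "lamn (r j) < 3 / 2 * lam"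
    and dj: "(1 - 1 / real K) ^ d (r j) \<le> 1 / real K" for K \<theta> j
  proof -
    let ?n = "r j" and ?q = "lamn (r j)"
    have n: "1 \<le> ?n" "0 < ?n" using rk_ge[of j] by auto
    have m1: "(\<lambda>w. \<phi>n ?n w l) \<in> A_plus P D T" for l by (rule A_b_A_plus[OF controls[OF n(1)]])
    obtain m where "\<forall>l. \<forall>w\<in>space P. \<forall>p\<in>XX T. \<phi>n ?n w l p \<le> m" using A_b_bounded[OF controls[OF n(1)]] by (elim exE)
    then have m2: "\<phi>n ?n w l p \<le> m" if "w \<in> space P" "p \<in> XX T" for l w p using that by simp
    have tot: "AE w in P. finite_measure (control_measure T (\<phi>n ?n w l)) \<and> sets (control_measure T (\<phi>n ?n w l)) = XX_sets T \<and>
      measure (control_measure T (\<phi>n ?n w l)) (XX T) \<le> kT" for l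
      using control_in_S[OF n(1)]
    proof eventually_elim
      case (elim w)
      note ac = control_ac[OF elim M, of l]
      have top: "XX T \<in> XX_sets T" by (auto simp: XX_sets_def)
      show ?case using ac_measureD(1,2)[OF ac] ac_measureD(4)[OF ac _ top, of 1] measure_XX[OF T0] by (simp add: kT_def)
    qed
    obtain H0 where H0: "integrable P H0" "(LINT w|P. H0 w) \<le> (real K + 1)\<^sup>2 * (kT / (real ?n * ?q * \<theta>) + \<theta>)"
      "AE w in P. grid_dev T K (scaled_thinned T ?n ?q (D 0 w) (\<phi>n ?n w 0)) (control_measure T (\<phi>n ?n w 0)) \<le> H0 w"
      "AE w in P. emeasure (thinned T (D 0 w) (\<lambda>p. real ?n * ?q * \<phi>n ?n w 0 p)) (XX T) < \<infinity>"
      by (rule grid_dev_expectation[OF P D T m1 m2 n(2) q(1) \<theta> tot kT])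
    have one: "(0 :: real) < 1" by simp
    obtain H1 where H1: "integrable P H1" "(LINT w|P. H1 w) \<le> (real K + 1)\<^sup>2 * (kT / (real ?n * 1 * \<theta>) + \<theta>)"
      "AE w in P. grid_dev T K (scaled_thinned T ?n 1 (D i w) (\<phi>n ?n w i)) (control_measure T (\<phi>n ?n w i)) \<le> H1 w"
      "AE w in P. emeasure (thinned T (D i w) (\<lambda>p. real ?n * 1 * \<phi>n ?n w i p)) (XX T) < \<infinity>"
      by (rule grid_dev_expectation[OF P D T m1 m2 n(2) one \<theta> tot kT])
    define b where "b = \<bar>xn ?n i - x i\<bar> + 3 * \<bar>?q - lam\<bar> * kT + 1 / real K + (4 * ?q + 1) * \<rho> K + ?q * (exp (1 + c) * (T / real K))"
    have \<rho>0: "0 \<le> \<rho> K" unfolding \<rho>_def using T0 k by (intro mult_nonneg_nonneg add_nonneg_nonneg divide_nonneg_nonneg) auto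
    have b0: "0 \<le> b" unfolding b_def using kT \<rho>0 q(1) T0 by (intro add_nonneg_nonneg mult_nonneg_nonneg) auto
    have AEtop: "AE w in P. Zn j w \<in> topspace path_space" using rZ[of j] by (simp add: random_element_def)
    have AEb: "AE w in P. indicator (topspace path_space) (Zn j w) * Psi T lam x M0 c k i (Zn j w) \<le> b + 5 * ?q * H0 w + H1 w"
      using AEtop controlled[OF n(1)] control_in_S[OF n(1)] H0(3,4) H1(3,4)
    proof eventually_elim
      case (elim w)
      define p where "p = fst (Zn j w)"
      have zp: "Zn j w = (p, \<phi>n ?n w)" by (simp add: p_def Zn_def)
      have pc: "p \<in> cadlag_space T state_metric" using topspace_path[OF elim(1)] by (simp add: p_def)
      have pe: "p t = (Xn ?n w t, Yn ?n w t, \<eta>n ?n w t)" if "t \<in> {0..T}" for t using that by (simp add: p_def Zn_def)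
      let ?R = "b + 5 * ?q * H0 w + H1 w"
      have g0: "0 \<le> H0 w" "0 \<le> H1 w" using elim(4,6) grid_dev_nonneg order_trans by blast+
      have R0: "0 \<le> ?R" using b0 g0 q(1) by simp
      have o0: "0 \<le> osc T k (gap p i)" by (rule osc_nonneg[OF T0 gap_bounded[OF pc i] k])
      have "Phi T lam x i (Zn j w) \<le> exp (1 + c) * osc T k (gap p i) + (8 * lam + 1) * (M0 / c) + ?R"
      proof (rule Phi_least[OF T0])
        fix s t assume st: "0 \<le> s" "s \<le> t" "t \<le> T"
        note v = prelimit_violation[OF T M c k K n(1) d(1)[OF n(1)] q(1) i elim(3) pc pe elim(2) elim(5,7) dj st, of lam x]
        have 1: "(5 * ?q + 1) * (M0 / c) \<le> (8 * lam + 1) * (M0 / c)"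
          using q M c lam(2) by (intro mult_right_mono) auto
        have 2: "5 * ?q * grid_dev T K (scaled_thinned T ?n ?q (D 0 w) (\<phi>n ?n w 0)) (control_measure T (\<phi>n ?n w 0)) \<le> 5 * ?q * H0 w"
          using elim(4) q(1) by (intro mult_left_mono) auto
        show "min 1 (viol T lam x i (Zn j w) s t) \<le> exp (1 + c) * osc T k (gap p i) + (8 * lam + 1) * (M0 / c) + ?R"
          using v 1 2 elim(6) unfolding zp b_def kT_def \<rho>_def by linarith
      qed
      then have "Psi T lam x M0 c k i (Zn j w) \<le> ?R" unfolding Psi_def zp fst_conv using R0 by simp
      then show ?case using R0 by (auto simp: indicator_def)
    qed
    have "a j \<le> (LINT w|P. b + 5 * ?q * H0 w + H1 w)"
      unfolding a_def
    proof (rule integral_mono_AE'[OF _ AEb])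
      show "integrable P (\<lambda>w. b + 5 * ?q * H0 w + H1 w)" using H0(1) H1(1) by auto
      show "AE w in P. 0 \<le> b + 5 * ?q * H0 w + H1 w" using H0(3) H1(3)
      proof eventually_elim
        case (elim w)
        then have "0 \<le> H0 w" "0 \<le> H1 w" using grid_dev_nonneg order_trans by blast+
        then show ?case using b0 q(1) by simp
      qed
    qed
    also have "\<dots> = b + 5 * ?q * (LINT w|P. H0 w) + (LINT w|P. H1 w)"
      using H0(1) H1(1) by (simp add: P.prob_space)
    also have "\<dots> \<le> u K \<theta> j"
      unfolding u_def b_def using H0(2) H1(2) q(1) by (intro add_mono mult_left_mono) auto
    finally show ?thesis .
  qed
  have xlim: "(\<lambda>j. \<bar>xn (r j) i - x i\<bar>) \<longlonglongrightarrow> 0"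
  proof (rule tendsto_sandwich[OF _ _ tendsto_const])
    show "(\<lambda>j. ell1_norm (\<lambda>i. xn (r j) i - x i)) \<longlonglongrightarrow> 0" using LIMSEQ_subseq_LIMSEQ[OF x(3) r(1)] by (simp add: comp_def)
    show "\<forall>\<^sub>F j in sequentially. \<bar>xn (r j) i - x i\<bar> \<le> ell1_norm (\<lambda>i. xn (r j) i - x i)"
      using x rk_ge by (intro always_eventually allI abs_le_ell1_norm) (auto simp: ell1_down_def)
  qed auto
  have inv: "(\<lambda>j. kT / (real (r j) * y j * \<theta>)) \<longlonglongrightarrow> 0" if y: "y \<longlonglongrightarrow> y0" "0 < y0" and \<theta>: "0 < \<theta>" for y y0 \<theta>
  proof (rule tendsto_divide_0[OF tendsto_const])
    have "filterlim (\<lambda>j. real (r j)) at_top sequentially"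
      by (rule filterlim_compose[OF filterlim_real_sequentially rtop])
    then have "filterlim (\<lambda>j. (y j * \<theta>) * real (r j)) at_top sequentially"
      using y \<theta> by (intro filterlim_tendsto_pos_mult_at_top[where c = "y0 * \<theta>"] tendsto_intros) auto
    then have "filterlim (\<lambda>j. real (r j) * y j * \<theta>) at_top sequentially" by (simp add: mult_ac)
    then show "filterlim (\<lambda>j. real (r j) * y j * \<theta>) at_infinity sequentially" by (rule filterlim_at_top_imp_at_infinity)
  qed
  \<comment> \<open>As n grows, the initial error, the error of the rate and the variances vanish.
    The surviving \<theta> terms are those of one grid deviation weighted by 5 lam and one weighted
    by 1.\<close>
  have Lb: "L \<le> 1 / real K + (4 * lam + 1) * \<rho> K + lam * (exp (1 + c) * (T / real K)) + (5 * lam + 1) * (real K + 1)\<^sup>2 * \<theta>"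
    if K: "0 < K" and \<theta>: "0 < \<theta>" for K \<theta>
  proof -
    have "u K \<theta> \<longlonglongrightarrow> 0 + 3 * \<bar>lam - lam\<bar> * kT + 1 / real K + (4 * lam + 1) * \<rho> K + lam * (exp (1 + c) * (T / real K))
       + 5 * lam * ((real K + 1)\<^sup>2 * (0 + \<theta>)) + (real K + 1)\<^sup>2 * (0 + \<theta>)"
      unfolding u_def by (intro tendsto_intros xlim lamr inv[OF lamr lam(2) \<theta>] inv[OF tendsto_const _ \<theta>]) simp
    moreover have "\<forall>\<^sub>F j in sequentially. a j \<le> u K \<theta> j"
      using evl evd[OF K] by eventually_elim (use bound[OF K \<theta>] in blast)
    ultimately have "L \<le> 0 + 3 * \<bar>lam - lam\<bar> * kT + 1 / real K + (4 * lam + 1) * \<rho> K + lam * (exp (1 + c) * (T / real K))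
       + 5 * lam * ((real K + 1)\<^sup>2 * (0 + \<theta>)) + (real K + 1)\<^sup>2 * (0 + \<theta>)"
      using tendsto_le[OF _ _ aL] by simp
    then show ?thesis by (simp add: algebra_simps)
  qed
  \<comment> \<open>Here \<theta> is chosen, depending on K, so that its term equals the given
    e.\<close>
  have LK: "L \<le> 1 / real K + (4 * lam + 1) * \<rho> K + lam * (exp (1 + c) * (T / real K))" if K: "0 < K" for K :: nat
  proof (rule field_le_epsilon)
    fix e :: real assume e: "0 < e"
    have den: "0 < (5 * lam + 1) * (real K + 1)\<^sup>2" using lam by (intro mult_pos_pos) (auto simp: add_pos_nonneg)
    have "(5 * lam + 1) * (real K + 1)\<^sup>2 * (e / ((5 * lam + 1) * (real K + 1)\<^sup>2)) = e"
      using den by (metis less_irrefl nonzero_mult_div_cancel_left times_divide_eq_right)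
    then show "L \<le> 1 / real K + (4 * lam + 1) * \<rho> K + lam * (exp (1 + c) * (T / real K)) + e"
      using Lb[OF K, of "e / ((5 * lam + 1) * (real K + 1)\<^sup>2)"] e den divide_pos_pos[OF e den] by linarith
  qed
  \<comment> \<open>The factor \<open>exp (1 + c)\<close> stays bounded because \<open>c\<close> is
    fixed; everything else is of order 1/K.\<close>
  have "(\<lambda>K. 1 / real K + (4 * lam + 1) * \<rho> K + lam * (exp (1 + c) * (T / real K))) \<longlonglongrightarrow>
      0 + (4 * lam + 1) * (exp (1 + c) * (0 + 2 * T * 0)) + lam * (exp (1 + c) * 0)"
    unfolding \<rho>_def by (intro tendsto_intros lim_const_over_n)
  then have "(\<lambda>K. 1 / real K + (4 * lam + 1) * \<rho> K + lam * (exp (1 + c) * (T / real K))) \<longlonglongrightarrow> 0" by simp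
  moreover have "\<forall>\<^sub>F K in sequentially. L \<le> 1 / real K + (4 * lam + 1) * \<rho> K + lam * (exp (1 + c) * (T / real K))"
    using eventually_gt_at_top[of "0 :: nat"] by eventually_elim (rule LK)
  ultimately have "L \<le> 0" by (intro tendsto_lowerbound) auto
  then show ?thesis by (simp add: L_def)
qed

lemma AE_Z_topspace: "AE w in Q. Z w \<in> topspace path_space"
  using random_element_Z by (simp only: random_element_def)

lemma limit_Psi_zero:
  assumes i: "1 \<le> i" and k: "0 \<le> k" and c: "0 < c"
  shows "AE w in Q. Psi T lam x M0 c k i (Z w) = 0"
proof -
  interpret Q: prob_space Q by (rule Q)
  let ?g = "\<lambda>w. indicator (topspace path_space) (Z w) * Psi T lam x M0 c k i (Z w)"
  have M: "0 \<le> M0" using M0 by simp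
  have m: "?g \<in> borel_measurable Q"
    by (rule random_element_measurable[OF random_element_Z Psi_continuous[OF T M i k]])
  have g: "0 \<le> ?g w" "?g w \<le> 1" for w
    using Psi_bounds[OF _ i k c, of "Z w"] by (auto simp: indicator_def)
  have int: "integrable Q ?g"
  proof (rule Q.integrable_const_bound[OF _ m])
    show "AE w in Q. norm (?g w) \<le> 1" using g by (intro AE_I2) simp
  qed
  have "(LINT w|Q. ?g w) = 0"
    using limit_Psi_integral[OF assms] g(1) by (intro antisym integral_nonneg_AE) auto
  then have "AE w in Q. ?g w = 0" using integral_nonneg_eq_0_iff_AE[OF int] g(1) by simp
  then show ?thesis using AE_Z_topspace by eventually_elim simp
qed

text \<open>As k grows the oscillation of the regulated gap vanishes, although it is multiplied by
  \<open>exp (1 + c)\<close>; only afterwards may c grow and remove the remaining multiple of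
  1/c.\<close>

lemma limit_viol_zero:
  "AE w in Q. Z w \<in> topspace path_space \<and> (\<forall>i\<ge>1. \<forall>s t. 0 \<le> s \<longrightarrow> s \<le> t \<longrightarrow> t \<le> T \<longrightarrow> viol T lam x i (Z w) s t = 0)"
proof -
  \<comment> \<open>Natural number parameters leave countably many exceptional sets, hence a single
    null set. The successor keeps the truncation level positive.\<close>
  have "AE w in Q. \<forall>i k c. 1 \<le> i \<longrightarrow> Psi T lam x M0 (real (Suc c)) (real k) i (Z w) = 0"
    unfolding AE_all_countable using limit_Psi_zero by (intro allI) (auto intro!: AE_I2)
  then show ?thesis using AE_Z_topspace
  proof eventually_elim
    case (elim w)
    have T0: "0 \<le> T" using T by simp
    have "viol T lam x i (Z w) s t = 0" if i: "1 \<le> i" and st: "0 \<le> s" "s \<le> t" "t \<le> T" for i s t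
    proof -
      have p: "fst (Z w) \<in> cadlag_space T state_metric" using topspace_path[OF elim(2)] by simp
      have 1: "Phi T lam x i (Z w) \<le> exp (1 + real (Suc c)) * osc T (real k) (gap (fst (Z w)) i) + (8 * lam + 1) * (M0 / real (Suc c))" for c k
        using elim(1) i unfolding Psi_def by (smt (verit))
      have "(\<lambda>k. exp (1 + real (Suc c)) * osc T (real k) (gap (fst (Z w)) i) + (8 * lam + 1) * (M0 / real (Suc c))) \<longlonglongrightarrow>
          exp (1 + real (Suc c)) * 0 + (8 * lam + 1) * (M0 / real (Suc c))" for c
        by (intro tendsto_intros osc_tendsto[OF T0 gap_bounded[OF p i] gap_regulated[OF p]])
      from tendsto_lowerbound[OF this] 1
      have 2: "Phi T lam x i (Z w) \<le> (8 * lam + 1) * (M0 / real (Suc c))" for c by simp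
      have "(\<lambda>c. (8 * lam + 1) * (M0 / real (Suc c))) \<longlonglongrightarrow> (8 * lam + 1) * 0"
        by (intro tendsto_intros LIMSEQ_Suc lim_const_over_n)
      from tendsto_lowerbound[OF this] 2 have "Phi T lam x i (Z w) \<le> 0" by simp
      then show ?thesis using viol_le_Phi[OF st, of lam x i "Z w"] viol_nonneg[of T lam x i "Z w" s t] by linarith
    qed
    then show ?case using elim(2) by blast
  qed
qed

end

section \<open>Properties of the limit\<close>

definition variation_modulus :: "real \<Rightarrow> real \<Rightarrow> (real \<Rightarrow> real) \<Rightarrow> real \<Rightarrow> real \<Rightarrow> bool" where
  "variation_modulus a b f e d \<longleftrightarrow> 0 < d \<and> (\<forall>(n::nat) l r. (\<forall>k<n. a \<le> l k \<and> l k \<le> r k \<and> r k \<le> b) \<and>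
      disjoint_family_on (\<lambda>k. {l k<..<r k}) {..<n} \<and> (\<Sum>k<n. r k - l k) < d \<longrightarrow> (\<Sum>k<n. \<bar>f (r k) - f (l k)\<bar>) < e)"

lemma abs_continuous_on_iff: "abs_continuous_on a b f \<longleftrightarrow> (\<forall>e>0. \<exists>d. variation_modulus a b f e d)"
  unfolding abs_continuous_on_def variation_modulus_def ..

lemma variation_modulusD:
  assumes "variation_modulus a b f e d" "\<And>k. k < (n :: nat) \<Longrightarrow> a \<le> l k \<and> l k \<le> r k \<and> r k \<le> b"
    "disjoint_family_on (\<lambda>k. {l k<..<r k}) {..<n}" "(\<Sum>k<n. r k - l k) < d"
  shows "(\<Sum>k<n. \<bar>f (r k) - f (l k)\<bar>) < e"
  using assms(1)[unfolded variation_modulus_def, THEN conjunct2, THEN spec, THEN spec, THEN spec, THEN mp, of n l r] assms(2-) by simp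

lemma variation_modulusI:
  assumes "0 < d" "\<And>(n::nat) l r. (\<And>k. k < n \<Longrightarrow> a \<le> l k \<and> l k \<le> r k \<and> r k \<le> b) \<Longrightarrow>
      disjoint_family_on (\<lambda>k. {l k<..<r k}) {..<n} \<Longrightarrow> (\<Sum>k<n. r k - l k) < d \<Longrightarrow> (\<Sum>k<n. \<bar>f (r k) - f (l k)\<bar>) < e"
  shows "variation_modulus a b f e d"
  unfolding variation_modulus_def using assms by simp

text \<open>To be applied with arrivals and services, whose increments bound those of \<eta> and Y,
  and then with Y and a difference of two \<eta> coordinates to bound X.\<close>

lemma abs_continuous_on_dominated:
  assumes f: "abs_continuous_on a b f" and g: "abs_continuous_on a b g" and C: "0 < C"
    and le: "\<And>s t. a \<le> s \<Longrightarrow> s \<le> t \<Longrightarrow> t \<le> b \<Longrightarrow> \<bar>h t - h s\<bar> \<le> C * (\<bar>f t - f s\<bar> + \<bar>g t - g s\<bar>)"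
  shows "abs_continuous_on a b h"
  unfolding abs_continuous_on_iff
proof (intro allI impI)
  fix e :: real assume e: "0 < e"
  have e2: "0 < e / (2 * C)" using e C by simp
  obtain d1 where d1: "variation_modulus a b f (e / (2 * C)) d1" using f e2 by (auto simp: abs_continuous_on_iff)
  obtain d2 where d2: "variation_modulus a b g (e / (2 * C)) d2" using g e2 by (auto simp: abs_continuous_on_iff)
  have d0: "0 < d1" "0 < d2" using d1 d2 by (auto simp: variation_modulus_def)
  have "variation_modulus a b h e (min d1 d2)"
  proof (rule variation_modulusI)
    fix n :: nat and l r :: "nat \<Rightarrow> real"
    assume lr: "\<And>k. k < n \<Longrightarrow> a \<le> l k \<and> l k \<le> r k \<and> r k \<le> b" and dis: "disjoint_family_on (\<lambda>k. {l k<..<r k}) {..<n}"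
      and sm: "(\<Sum>k<n. r k - l k) < min d1 d2"
    have "(\<Sum>k<n. \<bar>h (r k) - h (l k)\<bar>) \<le> (\<Sum>k<n. C * (\<bar>f (r k) - f (l k)\<bar> + \<bar>g (r k) - g (l k)\<bar>))"
      using lr by (intro sum_mono le) auto
    also have "\<dots> = C * ((\<Sum>k<n. \<bar>f (r k) - f (l k)\<bar>) + (\<Sum>k<n. \<bar>g (r k) - g (l k)\<bar>))"
      by (simp add: sum_distrib_left[symmetric] sum.distrib)
    also have "\<dots> < C * (e / (2 * C) + e / (2 * C))"
      using variation_modulusD[OF d1 lr dis] variation_modulusD[OF d2 lr dis] sm C by (intro mult_strict_left_mono add_strict_mono) auto
    also have "\<dots> = e" using C by (simp add: field_simps)
    finally show "(\<Sum>k<n. \<bar>h (r k) - h (l k)\<bar>) < e" .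
  qed (use d0 in simp)
  then show "\<exists>d. variation_modulus a b h e d" ..
qed

lemma abs_continuous_on_imp_continuous_on:
  assumes "abs_continuous_on a b f" shows "continuous_on {a..b} f"
  unfolding continuous_on_iff
proof (intro ballI allI impI)
  fix t e :: real assume t: "t \<in> {a..b}" and e: "0 < e"
  obtain d where d: "variation_modulus a b f e d" using assms e by (auto simp: abs_continuous_on_iff)
  have *: "\<bar>f v - f u\<bar> < e" if "a \<le> u" "u \<le> v" "v \<le> b" "v - u < d" for u v
    using variation_modulusD[OF d, of 1 "\<lambda>_. u" "\<lambda>_. v"] that by (simp add: disjoint_family_on_def)
  show "\<exists>d>0. \<forall>s\<in>{a..b}. dist s t < d \<longrightarrow> dist (f s) (f t) < e"
  proof (intro exI[of _ d] conjI ballI impI)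
    show "0 < d" using d by (simp add: variation_modulus_def)
  next
    fix s assume "s \<in> {a..b}" "dist s t < d"
    then show "dist (f s) (f t) < e" using *[of s t] *[of t s] t by (cases "s \<le> t") (auto simp: dist_real_def)
  qed
qed

text \<open>A common point may be a shared right endpoint, but the midpoint between it and the
  larger left endpoint lies in both open intervals.\<close>

lemma disjoint_half_open:
  fixes l r l' r' :: real
  assumes "{l<..<r} \<inter> {l'<..<r'} = {}" shows "{l<..r} \<inter> {l'<..r'} = {}"
proof (rule ccontr)
  assume "{l<..r} \<inter> {l'<..r'} \<noteq> {}"
  then obtain x where "x \<in> {l<..r} \<inter> {l'<..r'}" by blast
  then have "(max l l' + x) / 2 \<in> {l<..<r} \<inter> {l'<..<r'}" by (auto simp: max_def field_simps)
  then show False using assms by (metis emptyE)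
qed

text \<open>Increments over disjoint intervals are bounded by the masses of disjoint vertical
  strips, whose union has Lebesgue measure at most the total length; uniform absolute continuity of
  the measure concludes. The strips are half-open since a region up to r contains the line at
  r.\<close>

lemma abs_continuous_on_region:
  assumes T: "0 \<le> T" and M: "0 \<le> M" and \<kappa>: "ac_measure T M \<kappa>" and a: "regulated T a"
  shows "abs_continuous_on 0 T (\<lambda>t. measure \<kappa> (region T a t))"
  unfolding abs_continuous_on_iff
proof (intro allI impI)
  fix e :: real assume e: "0 < e"
  define V where "V l r = {q \<in> XX T. l < fst q \<and> fst q \<le> r}" for l r
  have V: "V l r \<in> XX_sets T" "measure lborel (V l r) \<le> r - l" if "l \<le> r" for l r
  proof -
    note vs = vertical_strip[OF T that]
    have "V l r = {q \<in> XX T. l \<le> fst q \<and> fst q \<le> r} \<inter> (fst -` {l<..} \<inter> space borel)" by (auto simp: V_def)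
    moreover have "fst -` {l<..} \<inter> space (borel :: (real \<times> real) measure) \<in> sets borel"
      by (intro measurable_sets[of _ _ borel] borel_measurable_continuous_onI continuous_on_fst continuous_on_id) auto
    ultimately show 1: "V l r \<in> XX_sets T" using vs(1) by (auto simp: XX_sets_def V_def)
    have "measure lborel (V l r) \<le> measure lborel {q \<in> XX T. l \<le> fst q \<and> fst q \<le> r}"
      using vs(1) 1 XX_sets_finite[OF vs(1)] by (intro measure_mono_fmeasurable) (auto simp: V_def XX_sets_def fmeasurable_def)
    then show "measure lborel (V l r) \<le> r - l" using vs(2) by simp
  qed
  interpret \<kappa>: finite_measure \<kappa> by (rule ac_measureD(2)[OF \<kappa>])
  have sk: "sets \<kappa> = XX_sets T" by (rule ac_measureD(1)[OF \<kappa>])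
  have inc: "\<bar>measure \<kappa> (region T a r) - measure \<kappa> (region T a l)\<bar> \<le> measure \<kappa> (V l r)" if "l \<le> r" for l r
    using region_sets[OF regulated_measurable[OF a]] V(1)[OF that] sk that
    by (intro measure_diff_le[OF ac_measureD(2)[OF \<kappa>]]) (auto simp: region_def V_def)
  obtain d where d: "0 < d" "\<And>\<kappa> E. ac_measure T M \<kappa> \<Longrightarrow> E \<in> XX_sets T \<Longrightarrow> measure lborel E \<le> d \<Longrightarrow> measure \<kappa> E < e"
    using ac_modulus[OF M e, where T = T] by blast
  have "variation_modulus 0 T (\<lambda>t. measure \<kappa> (region T a t)) e d"
  proof (rule variation_modulusI[OF d(1)])
    fix n :: nat and l r :: "nat \<Rightarrow> real"
    assume lr: "\<And>k. k < n \<Longrightarrow> 0 \<le> l k \<and> l k \<le> r k \<and> r k \<le> T" and dis: "disjoint_family_on (\<lambda>k. {l k<..<r k}) {..<n}"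
      and sm: "(\<Sum>k<n. r k - l k) < d"
    have Vk: "V (l k) (r k) \<in> XX_sets T" "measure lborel (V (l k) (r k)) \<le> r k - l k" if "k < n" for k
      using V[of "l k" "r k"] lr that by auto
    have dV: "disjoint_family_on (\<lambda>k. V (l k) (r k)) {..<n}"
      unfolding disjoint_family_on_def
    proof (intro ballI impI)
      fix j k assume jk: "j \<in> {..<n}" "k \<in> {..<n}" "j \<noteq> k"
      have "{l j<..<r j} \<inter> {l k<..<r k} = {}" using dis jk unfolding disjoint_family_on_def by blast
      then have "{l j<..r j} \<inter> {l k<..r k} = {}" by (rule disjoint_half_open)
      then show "V (l j) (r j) \<inter> V (l k) (r k) = {}" unfolding V_def by fastforce
    qed
    have E: "(\<Union>k<n. V (l k) (r k)) \<in> XX_sets T" using Vk(1) sk by (metis (no_types, lifting) finite_lessThan lessThan_iff sets.finite_UN)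
    have "measure lborel (\<Union>k<n. V (l k) (r k)) \<le> (\<Sum>k<n. measure lborel (V (l k) (r k)))"
      using Vk(1) by (intro measure_UNION_le) (auto simp: XX_sets_def)
    also have "\<dots> \<le> (\<Sum>k<n. r k - l k)" using Vk(2) by (intro sum_mono) auto
    finally have small: "measure lborel (\<Union>k<n. V (l k) (r k)) \<le> d" using sm by simp
    have "(\<Sum>k<n. \<bar>measure \<kappa> (region T a (r k)) - measure \<kappa> (region T a (l k))\<bar>) \<le> (\<Sum>k<n. measure \<kappa> (V (l k) (r k)))"
      using lr by (intro sum_mono inc) auto
    also have "\<dots> = measure \<kappa> (\<Union>k<n. V (l k) (r k))"
      using Vk(1) sk dV by (intro \<kappa>.finite_measure_finite_Union[symmetric]) auto
    also have "\<dots> < e" by (rule d(2)[OF \<kappa> E small])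
    finally show "(\<Sum>k<n. \<bar>measure \<kappa> (region T a (r k)) - measure \<kappa> (region T a (l k))\<bar>) < e" .
  qed
  then show "\<exists>d. variation_modulus 0 T (\<lambda>t. measure \<kappa> (region T a t)) e d" ..
qed

lemma region_0_null:
  assumes M: "0 \<le> M" and \<kappa>: "ac_measure T M \<kappa>" and a: "regulated T a"
  shows "measure \<kappa> (region T a 0) = 0"
proof -
  interpret \<kappa>: finite_measure \<kappa> by (rule ac_measureD(2)[OF \<kappa>])
  let ?L = "XX T \<inter> ({0} \<times> UNIV)"
  note L = countable_lines_null[of "{0}" T, OF countable_finite, OF finite.insertI, OF finite.emptyI]
  have "measure \<kappa> (region T a 0) \<le> measure \<kappa> ?L"
    using L(1) ac_measureD(1)[OF \<kappa>] by (intro \<kappa>.finite_measure_mono) (auto simp: region_def XX_def)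
  also have "measure \<kappa> ?L = 0" by (rule ac_null[OF M \<kappa> L])
  finally show ?thesis by (simp add: measure_le_0_iff)
qed

lemma control_integral:
  assumes h: "h \<in> borel_measurable (restrict_space borel (XX T))" "\<And>p. p \<in> XX T \<Longrightarrow> 0 \<le> h p"
    and fin: "finite_measure (control_measure T h)" and E: "E \<in> XX_sets T"
  shows "integrable lborel (\<lambda>p. indicator E p * h p)" "(LINT p|lborel. indicator E p * h p) = measure (control_measure T h) E"
proof -
  have EX: "E \<in> sets borel" "E \<subseteq> XX T" using E by (auto simp: XX_sets_def)
  have XB: "XX T \<in> sets borel" by (simp add: XX_def borel_Times)
  have "(\<lambda>p. indicator (XX T) p *\<^sub>R h p) \<in> borel_measurable borel"
    using h(1) XB by (subst (asm) borel_measurable_restrict_space_iff) auto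
  then have "(\<lambda>p. indicator E p * (indicator (XX T) p *\<^sub>R h p)) \<in> borel_measurable borel"
    using EX(1) by (intro borel_measurable_times borel_measurable_indicator) auto
  moreover have "(\<lambda>p. indicator E p * (indicator (XX T) p *\<^sub>R h p)) = (\<lambda>p. indicator E p * h p)"
    using EX(2) by (auto simp: fun_eq_iff indicator_def)
  ultimately have m: "(\<lambda>p. indicator E p * h p) \<in> borel_measurable lborel" by simp
  have nn: "0 \<le> indicator E p * h p" for p using h(2)[of p] EX(2) by (cases "p \<in> E") auto
  have em: "(\<integral>\<^sup>+p. ennreal (indicator E p * h p) \<partial>lborel) = emeasure (control_measure T h) E"
    unfolding emeasure_control_measure[OF h(1) EX]
    by (intro nn_integral_cong) (auto simp: indicator_def)
  interpret finite_measure "control_measure T h" by (rule fin)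
  show "integrable lborel (\<lambda>p. indicator E p * h p)"
    using m nn em by (intro integrableI_nonneg) (auto simp: less_top[symmetric])
  show "(LINT p|lborel. indicator E p * h p) = measure (control_measure T h) E"
    using m nn em by (subst integral_eq_nn_integral) (auto simp: measure_def)
qed

lemma continuous_map_cadlag:
  assumes p: "p \<in> cadlag_space T m" and l: "\<And>t. t \<in> {0<..T} \<Longrightarrow> limitin (mtopology_of m) p (p t) (at_left t)"
  shows "continuous_map (top_of_set {0..T}) (mtopology_of m) p"
proof -
  interpret M: Metric_space "mspace m" "mdist m" by simp
  have top: "mtopology_of m = M.mtopology" by (simp add: mtopology_of_def)
  have pm: "p t \<in> mspace m" if "t \<in> {0..T}" for t using p that by (auto simp: cadlag_space_def)
  show ?thesis unfolding top
  proof (subst M.continuous_map_to_metric, intro ballI allI impI)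
    fix t e :: real assume t: "t \<in> topspace (top_of_set {0..T})" and e: "0 < e"
    have t: "t \<in> {0..T}" using t by simp
    have "\<exists>b. b < t \<and> (\<forall>s. b < s \<longrightarrow> s < t \<longrightarrow> s \<in> {0..T} \<longrightarrow> p s \<in> M.mball (p t) e)"
    proof (cases "t = 0")
      case True then show ?thesis by (intro exI[of _ "-1"]) auto
    next
      case False
      then have "limitin M.mtopology p (p t) (at_left t)" using l[of t] t by (simp add: top)
      then have "\<forall>\<^sub>F s in at_left t. p s \<in> M.mball (p t) e" using pm[OF t] e by (auto simp: limitin_def)
      then show ?thesis by (auto simp: eventually_at_left_field)
    qed
    then obtain b where b: "b < t" "\<And>s. b < s \<Longrightarrow> s < t \<Longrightarrow> s \<in> {0..T} \<Longrightarrow> p s \<in> M.mball (p t) e" by blast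
    have "\<exists>c>t. \<forall>s. t < s \<longrightarrow> s < c \<longrightarrow> s \<in> {0..T} \<longrightarrow> p s \<in> M.mball (p t) e"
    proof (cases "t = T")
      case True then show ?thesis by (intro exI[of _ "T + 1"]) auto
    next
      case False
      then have "limitin M.mtopology p (p t) (at_right t)" using p t by (simp add: top cadlag_space_def)
      then have "\<forall>\<^sub>F s in at_right t. p s \<in> M.mball (p t) e" using pm[OF t] e by (auto simp: limitin_def)
      then show ?thesis by (auto simp: eventually_at_right_field)
    qed
    then obtain c where c: "t < c" "\<And>s. t < s \<Longrightarrow> s < c \<Longrightarrow> s \<in> {0..T} \<Longrightarrow> p s \<in> M.mball (p t) e" by blast
    show "\<exists>U. openin (top_of_set {0..T}) U \<and> t \<in> U \<and> (\<forall>s\<in>U. p s \<in> M.mball (p t) e)"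
    proof (intro exI[of _ "{0..T} \<inter> {b<..<c}"] conjI ballI)
      show "openin (top_of_set {0..T}) ({0..T} \<inter> {b<..<c})" by (simp add: openin_open_Int)
      show "t \<in> {0..T} \<inter> {b<..<c}" using t b c by simp
      fix s assume "s \<in> {0..T} \<inter> {b<..<c}"
      then show "p s \<in> M.mball (p t) e" using b(2)[of s] c(2)[of s] pm[OF t] e by (cases s t rule: linorder_cases) auto
    qed
  qed
qed

text \<open>The set where f is positive is covered by countably many intervals on which the
  integrator is constant, so it is null for the Stieltjes measure.\<close>

lemma stieltjes_integral_zero:
  assumes T: "0 \<le> T" and G: "continuous_on {0..T} G" "mono_on {0..T} G" and f: "continuous_on {0..T} f" and t: "t \<in> {0..T}"
    and f0: "\<And>s. s \<in> {0..T} \<Longrightarrow> 0 \<le> f s"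
    and flat: "\<And>s u e. 0 \<le> s \<Longrightarrow> s \<le> u \<Longrightarrow> u \<le> T \<Longrightarrow> 0 < e \<Longrightarrow> (\<And>v. v \<in> {s..u} \<Longrightarrow> e \<le> f v) \<Longrightarrow> G u = G s"
  shows "stieltjes_integral T t f G = 0"
proof -
  define c where "c s = max 0 (min T s)" for s
  define F where "F s = G (c s)" for s
  have c_in: "c s \<in> {0..T}" for s using T by (auto simp: c_def)
  have cc: "continuous_on UNIV c" unfolding c_def by (intro continuous_intros)
  have F_cont: "continuous_on UNIV F" unfolding F_def
    by (rule continuous_on_compose2[OF G(1) cc]) (use c_in in auto)
  have F_right: "continuous (at_right s) F" for s
    using F_cont by (meson UNIV_I continuous_on_eq_continuous_within continuous_within_subset subset_UNIV)
  have F_mono: "F s \<le> F u" if "s \<le> u" for s u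
    unfolding F_def using that c_in by (intro mono_onD[OF G(2)]) (auto simp: c_def)
  \<comment> \<open>Rational endpoints make the cover countable.\<close>
  define J where "J = {(a :: real, b). a \<in> \<rat> \<and> b \<in> \<rat> \<and> a \<le> b \<and> F a = F b}"
  have "countable J" by (rule countable_subset[of _ "\<rat> \<times> \<rat>"]) (auto simp: J_def countable_rat)
  have null: "(\<Union>j\<in>J. {fst j<..snd j}) \<in> null_sets (interval_measure F)"
  proof (rule null_sets_UN'[OF \<open>countable J\<close>])
    fix j assume "j \<in> J"
    then show "{fst j<..snd j} \<in> null_sets (interval_measure F)"
      using F_mono F_right by (intro null_setsI) (auto simp: J_def emeasure_interval_measure_Ioc)
  qed
  have pos: "s \<in> (\<Union>j\<in>J. {fst j<..snd j})" if s: "s \<in> {0..T}" "0 < f s" for s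
  proof -
    obtain d where d: "0 < d" "\<And>v. v \<in> {0..T} \<Longrightarrow> dist v s < d \<Longrightarrow> dist (f v) (f s) < f s / 2"
      using f[unfolded continuous_on_iff, rule_format, OF s(1), of "f s / 2"] s(2) by auto
    obtain a where a: "a \<in> \<rat>" "s - d < a" "a < s" using Rats_dense_in_real[of "s - d" s] d(1) by auto
    obtain b where b: "b \<in> \<rat>" "s < b" "b < s + d" using Rats_dense_in_real[of s "s + d"] d(1) by auto
    \<comment> \<open>The rational points may lie outside [0,T]; clamping brings them back and
      leaves \<open>F\<close> unchanged. Near \<open>s\<close> continuity gives f > f s / 2, which
      serves as the lower bound in \<open>flat\<close>.\<close>
    have "G (c b) = G (c a)"
    proof (rule flat[of _ _ "f s / 2"])
      fix v assume v: "v \<in> {c a..c b}"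
      then have "v \<in> {0..T}" using c_in[of a] c_in[of b] by auto
      moreover have "dist v s < d" using v a b s by (auto simp: c_def dist_real_def max_def min_def split: if_splits)
      ultimately have "dist (f v) (f s) < f s / 2" by (rule d(2))
      then show "f s / 2 \<le> f v" by (simp add: dist_real_def abs_if split: if_splits)
    qed (use a b s(2) c_in[of a] c_in[of b] in \<open>auto simp: c_def\<close>)
    then have "(a, b) \<in> J" using a b by (simp add: J_def F_def)
    then show ?thesis using a b by (intro UN_I[of "(a, b)"]) auto
  qed
  have "AE s in interval_measure F. indicator {0..t} s *\<^sub>R f s = 0"
    using AE_not_in[OF null]
  proof eventually_elim
    case (elim s)
    show ?case
    proof (cases "s \<in> {0..t}")
      case True
      then have "s \<in> {0..T}" using t by simp
      then show ?thesis using pos[of s] f0[of s] elim by fastforce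
    qed simp
  qed
  then have "(LINT s|interval_measure F. indicator {0..t} s *\<^sub>R f s) = 0" by (rule integral_eq_zero_AE)
  then show ?thesis unfolding stieltjes_integral_def set_lebesgue_integral_def F_def[abs_def] c_def .
qed

section \<open>A deterministic path and control with vanishing violation\<close>

locale fluid_limit =
  fixes T lam M :: real and x :: "nat \<Rightarrow> real" and X Y \<eta> :: "real \<Rightarrow> nat \<Rightarrow> real" and \<phi> :: "nat \<Rightarrow> real \<times> real \<Rightarrow> real"
    and p :: "real \<Rightarrow> state"
  assumes T: "0 < T" and lam: "0 < lam" and M: "0 \<le> M" and x: "x \<in> ell1_down"
    and p: "p \<in> cadlag_space T state_metric" and p_eq: "\<And>t. t \<in> {0..T} \<Longrightarrow> p t = (X t, Y t, \<eta> t)"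
    and \<phi>: "\<phi> \<in> S_space T M"
    and viol: "\<And>i s t. 1 \<le> i \<Longrightarrow> 0 \<le> s \<Longrightarrow> s \<le> t \<Longrightarrow> t \<le> T \<Longrightarrow> viol T lam x i (p, \<phi>) s t = 0"
begin

lemma T0: "0 \<le> T" using T by simp

lemma control_ac_i: "ac_measure T M (control_measure T (\<phi> i))" by (rule control_ac[OF \<phi> M])

lemma coords: "t \<in> {0..T} \<Longrightarrow> cX p i t = X t i" "t \<in> {0..T} \<Longrightarrow> cY p i t = Y t i" "t \<in> {0..T} \<Longrightarrow> cE p i t = \<eta> t i"
  by (simp_all add: cX_def cY_def cE_def p_eq)

lemma state: "t \<in> {0..T} \<Longrightarrow> X t \<in> ell1_down \<and> Y t \<in> ell1 \<and> \<eta> t 0 = 0"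
  using cadlag_mem[OF p, of t] p_eq[of t] by (simp add: mspace_state)

lemma equations:
  assumes i: "1 \<le> i" and st: "0 \<le> s" "s \<le> t" "t \<le> T"
  shows "Y t i = x i + (if i = 1 then lam * arrivals T \<phi> t else 0) - services T p \<phi> i t"
    "X t i = Y t i + \<eta> t (i - 1) - \<eta> t i"
    "\<eta> s i \<le> \<eta> t i" "\<eta> t i - \<eta> s i \<le> lam * (arrivals T \<phi> t - arrivals T \<phi> s)"
    "min (\<eta> t i - \<eta> s i) (INF u\<in>{s..t}. 1 - X u i) \<le> 0" "\<eta> 0 i = 0"
proof -
  have m: "s \<in> {0..T}" "t \<in> {0..T}" "0 \<in> {0..T}" using st by auto
  have inf: "(INF u\<in>{s..t}. 1 - cX p i u) = (INF u\<in>{s..t}. 1 - X u i)" using st by (intro INF_cong) (auto simp: coords)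
  define A where "A = Y t i - x i - (if i = 1 then lam * arrivals T \<phi> t else 0) + services T p \<phi> i t"
  have "\<bar>A\<bar> + \<bar>X t i - Y t i - \<eta> t (i - 1) + \<eta> t i\<bar> + max 0 (\<eta> s i - \<eta> t i)
     + max 0 (\<eta> t i - \<eta> s i - lam * (arrivals T \<phi> t - arrivals T \<phi> s))
     + max 0 (min (\<eta> t i - \<eta> s i) (INF u\<in>{s..t}. 1 - X u i)) + \<bar>\<eta> 0 i\<bar> = 0"
    using viol[OF i st] unfolding viol_def prod.case inf coords[OF m(1)] coords[OF m(2)] coords[OF m(3)] A_def .
  then have z: "A = 0" "X t i - Y t i - \<eta> t (i - 1) + \<eta> t i = 0" "\<eta> s i - \<eta> t i \<le> 0"
    "\<eta> t i - \<eta> s i - lam * (arrivals T \<phi> t - arrivals T \<phi> s) \<le> 0"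
    "min (\<eta> t i - \<eta> s i) (INF u\<in>{s..t}. 1 - X u i) \<le> 0" "\<eta> 0 i = 0"
    by linarith+
  show "Y t i = x i + (if i = 1 then lam * arrivals T \<phi> t else 0) - services T p \<phi> i t"
    "X t i = Y t i + \<eta> t (i - 1) - \<eta> t i" "\<eta> s i \<le> \<eta> t i" "\<eta> t i - \<eta> s i \<le> lam * (arrivals T \<phi> t - arrivals T \<phi> s)"
    "min (\<eta> t i - \<eta> s i) (INF u\<in>{s..t}. 1 - X u i) \<le> 0" "\<eta> 0 i = 0"
    using z unfolding A_def by linarith+
qed

lemma arrivals_ac: "abs_continuous_on 0 T (arrivals T \<phi>)"
  using abs_continuous_on_region[OF T0 M control_ac_i const_regulated] by (simp add: arrivals_def[abs_def])

lemma services_ac: "1 \<le> i \<Longrightarrow> abs_continuous_on 0 T (services T p \<phi> i)"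
  using abs_continuous_on_region[OF T0 M control_ac_i gap_regulated[OF p]] by (simp add: services_def[abs_def])

text \<open>The increments lie between 0 and \<open>lam\<close> times those of the arrivals. The
  arrivals fill both slots of the domination lemma; coordinate 0 vanishes identically.\<close>

lemma eta_ac: "abs_continuous_on 0 T (\<lambda>t. \<eta> t i)"
proof (rule abs_continuous_on_dominated[OF arrivals_ac arrivals_ac lam])
  fix s t assume st: "0 \<le> s" "s \<le> t" "t \<le> T"
  show "\<bar>\<eta> t i - \<eta> s i\<bar> \<le> lam * (\<bar>arrivals T \<phi> t - arrivals T \<phi> s\<bar> + \<bar>arrivals T \<phi> t - arrivals T \<phi> s\<bar>)"
  proof (cases "i = 0")
    case True then show ?thesis using state[of s] state[of t] st lam by simp
  next
    case False
    then have i: "1 \<le> i" by simp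
    have "lam * (arrivals T \<phi> t - arrivals T \<phi> s) \<le> lam * (\<bar>arrivals T \<phi> t - arrivals T \<phi> s\<bar> + \<bar>arrivals T \<phi> t - arrivals T \<phi> s\<bar>)"
      using lam by (intro mult_left_mono) linarith+
    then show ?thesis using equations(3,4)[OF i st] by linarith
  qed
qed

lemma Y_ac:
  assumes i: "1 \<le> i" shows "abs_continuous_on 0 T (\<lambda>t. Y t i)"
proof (rule abs_continuous_on_dominated[OF arrivals_ac services_ac[OF i]])
  \<comment> \<open>One constant has to exceed both coefficients, \<open>lam\<close> for the
    arrivals and 1 for the services.\<close>
  show "0 < lam + 1" using lam by simp
  fix s t assume st: "0 \<le> s" "s \<le> t" "t \<le> T"
  let ?a = "\<bar>arrivals T \<phi> t - arrivals T \<phi> s\<bar>" and ?b = "\<bar>services T p \<phi> i t - services T p \<phi> i s\<bar>"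
  have s: "s \<le> s" "s \<le> T" using st by auto
  have "\<bar>Y t i - Y s i\<bar> \<le> \<bar>lam * (arrivals T \<phi> t - arrivals T \<phi> s)\<bar> + ?b"
    using equations(1)[OF i st] equations(1)[OF i st(1) s] by (auto simp: right_diff_distrib)
  also have "\<dots> = lam * ?a + ?b" using lam by (simp add: abs_mult)
  also have "\<dots> \<le> (lam + 1) * (?a + ?b)" using lam by (simp add: algebra_simps)
  finally show "\<bar>Y t i - Y s i\<bar> \<le> (lam + 1) * (?a + ?b)" .
qed

lemma X_ac:
  assumes i: "1 \<le> i" shows "abs_continuous_on 0 T (\<lambda>t. X t i)"
proof -
  have "abs_continuous_on 0 T (\<lambda>t. \<eta> t (i - 1) - \<eta> t i)"
    by (rule abs_continuous_on_dominated[OF eta_ac[of "i - 1"] eta_ac[of i] zero_less_one]) auto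
  note E = this
  show ?thesis
  proof (rule abs_continuous_on_dominated[OF Y_ac[OF i] E zero_less_one])
    fix s t assume st: "0 \<le> s" "s \<le> t" "t \<le> T"
    have "X t i - X s i = (Y t i - Y s i) + ((\<eta> t (i - 1) - \<eta> t i) - (\<eta> s (i - 1) - \<eta> s i))"
      unfolding equations(2)[OF i st] equations(2)[OF i st(1) order_refl order_trans[OF st(2,3)]] by simp
    then show "\<bar>X t i - X s i\<bar> \<le> 1 * (\<bar>Y t i - Y s i\<bar> + \<bar>(\<eta> t (i - 1) - \<eta> t i) - (\<eta> s (i - 1) - \<eta> s i)\<bar>)"
      by (simp only: mult_1 abs_triangle_ineq)
  qed
qed

lemma initial: "X 0 = x" "Y 0 = x"
proof -
  have "arrivals T \<phi> 0 = 0" unfolding arrivals_def by (rule region_0_null[OF M control_ac_i const_regulated])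
  moreover have "services T p \<phi> i 0 = 0" for i unfolding services_def by (rule region_0_null[OF M control_ac_i gap_regulated[OF p]])
  ultimately have Yi: "Y 0 i = x i" if "1 \<le> i" for i using equations(1)[OF that order_refl order_refl T0] by simp
  have 0: "X 0 0 = 0" "Y 0 0 = 0" "x 0 = 0" "\<eta> 0 0 = 0" using state[of 0] x T by (auto simp: ell1_down_def ell1_def)
  have e0: "\<eta> 0 i = 0" for i using equations(6)[OF _ order_refl order_refl T0, of i] 0 by (cases "i = 0") auto
  have "X 0 i = x i" if "1 \<le> i" for i using equations(2)[OF that order_refl order_refl T0] Yi[OF that] e0 by simp
  then show "X 0 = x" "Y 0 = x" using 0 Yi by (metis ext less_one not_le)+
qed

text \<open>The left limit exists in the state space, including the l1 norm, because the path is
  cadlag. Each of its coordinates is the value at t, as the coordinate functions are continuous;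
  coordinate 0 is pinned to 0. So norm convergence is inherited and not estimated.\<close>

lemma path_continuous: "continuous_map (top_of_set {0..T}) (mtopology_of state_metric) p"
proof (rule continuous_map_cadlag[OF p])
  fix t assume t: "t \<in> {0<..T}"
  then obtain l where l: "limitin (mtopology_of state_metric) p l (at_left t)"
    using p unfolding cadlag_space_def by blast
  have lm: "l \<in> mspace state_metric" using limitin_topspace[OF l] by simp
  obtain l1 l2 l3 where leq: "l = (l1, l2, l3)" by (cases l)
  have ne: "at_left t \<noteq> bot" by simp
  have lim: "((\<lambda>s. F s) \<longlongrightarrow> F t) (at_left t)" if F: "continuous_on {0..T} F" for F :: "real \<Rightarrow> real"
  proof -
    have "(F \<longlongrightarrow> F t) (at t within {0..T})" using F t by (auto simp: continuous_on_def)
    then have "(F \<longlongrightarrow> F t) (at t within {0..<t})" by (rule tendsto_within_subset) (use t in auto)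
    moreover have "at_left t = at t within {0..<t}" using t by (intro at_within_nhd[of _ "{0<..}"]) auto
    ultimately show ?thesis by (simp only:)
  qed
  have ev: "\<forall>\<^sub>F s in at_left t. s \<in> {0..T}" using t by (auto simp: eventually_at_left_field intro!: exI[of _ 0])
  have eq: "G l = f t" if G: "uc_coord G" and f: "continuous_on {0..T} f" "\<And>s. s \<in> {0..T} \<Longrightarrow> G (p s) = f s" for G f
  proof (rule tendsto_unique[OF ne])
    show "((\<lambda>s. G (p s)) \<longlongrightarrow> G l) (at_left t)" by (rule coord_tendsto[OF G l])
    show "((\<lambda>s. G (p s)) \<longlongrightarrow> f t) (at_left t)"
      by (rule Lim_transform_eventually[OF lim[OF f(1)]]) (use ev f(2) in \<open>auto elim: eventually_mono\<close>)
  qed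
  have t': "t \<in> {0..T}" using t by simp
  have st: "X t 0 = 0" "Y t 0 = 0" "\<eta> t 0 = 0" using state[OF t'] by (auto simp: ell1_down_def ell1_def)
  have l0: "l1 0 = 0" "l2 0 = 0" "l3 0 = 0" using lm by (auto simp: leq mspace_state ell1_down_def ell1_def)
  have "l1 i = X t i" if "1 \<le> i" for i
    using eq[OF uc_coord_X abs_continuous_on_imp_continuous_on[OF X_ac[OF that]]] by (simp add: leq p_eq)
  moreover have "l2 i = Y t i" if "1 \<le> i" for i
    using eq[OF uc_coord_Y abs_continuous_on_imp_continuous_on[OF Y_ac[OF that]]] by (simp add: leq p_eq)
  moreover have "l3 i = \<eta> t i" for i
    using eq[OF uc_coord_eta abs_continuous_on_imp_continuous_on[OF eta_ac]] by (simp add: leq p_eq)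
  ultimately have "l1 = X t" "l2 = Y t" "l3 = \<eta> t" using l0 st by (metis ext less_one not_le)+
  then show "limitin (mtopology_of state_metric) p (p t) (at_left t)" using l leq p_eq[OF t'] by simp
qed

lemma coordinate_paths_continuous:
  "continuous_map (top_of_set {0..T}) (mtopology_of (prod_metric ell1_down_metric ell1_metric)) (\<lambda>t. (X t, Y t))"
  "continuous_map (top_of_set {0..T}) (mtopology_of Rinf_metric) \<eta>"
proof -
  have "continuous_map (top_of_set {0..T}) (mtopology_of state_metric) (\<lambda>t. (X t, Y t, \<eta> t))"
    by (rule continuous_map_eq[OF path_continuous]) (simp add: p_eq)
  then have 1: "continuous_map (top_of_set {0..T}) (mtopology_of ell1_down_metric) X"
    "continuous_map (top_of_set {0..T}) (mtopology_of ell1_metric) Y"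
    "continuous_map (top_of_set {0..T}) (mtopology_of Rinf_metric) \<eta>"
    by (auto simp: state_metric_def continuous_map_pairwise comp_def)
  then show "continuous_map (top_of_set {0..T}) (mtopology_of (prod_metric ell1_down_metric ell1_metric)) (\<lambda>t. (X t, Y t))"
    "continuous_map (top_of_set {0..T}) (mtopology_of Rinf_metric) \<eta>"
    by (auto simp: continuous_map_pairwise comp_def)
qed

lemma eta_mono: "1 \<le> i \<Longrightarrow> mono_on {0..T} (\<lambda>t. \<eta> t i)"
  using equations(3) by (intro mono_onI) auto

lemma complementarity:
  assumes i: "1 \<le> i" and t: "t \<in> {0..T}"
  shows "stieltjes_integral T t (\<lambda>s. 1 - X s i) (\<lambda>s. \<eta> s i) = 0"
proof (rule stieltjes_integral_zero[OF T0 abs_continuous_on_imp_continuous_on[OF eta_ac] eta_mono[OF i] _ t])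
  show "continuous_on {0..T} (\<lambda>s. 1 - X s i)"
    by (intro continuous_intros abs_continuous_on_imp_continuous_on[OF X_ac[OF i]])
  show "0 \<le> 1 - X s i" if "s \<in> {0..T}" for s using state[OF that] i by (simp add: ell1_down_def)
  fix s u e assume su: "0 \<le> s" "s \<le> u" "u \<le> T" and e: "0 < e" "\<And>v. v \<in> {s..u} \<Longrightarrow> e \<le> 1 - X v i"
  \<comment> \<open>The infimum being positive, the nonpositive minimum must be the increment of
    \<eta>, and monotonicity makes it zero.\<close>
  have "e \<le> (INF v\<in>{s..u}. 1 - X v i)" using su e(2) by (intro cINF_greatest) auto
  then show "\<eta> u i = \<eta> s i" using equations(3,5)[OF i su] e(1) by linarith
qed

lemma fluid: "fluid_equations T lam x \<phi> X Y"
proof -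
  have hm: "\<phi> i \<in> borel_measurable (restrict_space borel (XX T))" "\<And>q. q \<in> XX T \<Longrightarrow> 0 \<le> \<phi> i q" for i
    using \<phi> by (auto simp: S_space_def control_functions_def)
  have ci: "integrable lborel (\<lambda>q. indicator E q * \<phi> i q)"
    "(LINT q|lborel. indicator E q * \<phi> i q) = measure (control_measure T (\<phi> i)) E" if "E \<in> XX_sets T" for E i
    by (rule control_integral[OF hm(1) hm(2) ac_measureD(2)[OF control_ac_i] that], assumption)+
  have rs: "region T (gap p i) t \<in> XX_sets T" "region T (\<lambda>_. 2) t \<in> XX_sets T" for i t
    by (rule region_sets[OF regulated_measurable[OF gap_regulated[OF p]]], rule region_sets[OF regulated_measurable[OF const_regulated]])
  have ind1: "indicator (XX t) q *\<^sub>R \<phi> 0 q = indicator (region T (\<lambda>_. 2) t) q * \<phi> 0 q" if "t \<le> T" for t q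
    using XX_region[OF that] by simp
  have ind2: "indicator (XX t) q *\<^sub>R (case q of (s, y) \<Rightarrow> indicator {0..<X s i - X s (i + 1)} y * \<phi> i (s, y)) =
      indicator (region T (gap p i) t) q * \<phi> i q" if "t \<le> T" for t i q
    using that by (cases q) (auto simp: region_def gap_def XX_def p_eq indicator_def)
  have e1: "(LINT q:XX t|lborel. \<phi> 0 q) = arrivals T \<phi> t" if "t \<le> T" for t
    unfolding set_lebesgue_integral_def ind1[OF that] arrivals_def by (rule ci(2)[OF rs(2)])
  have e2: "(LINT q:XX t|lborel. (case q of (s, y) \<Rightarrow> indicator {0..<X s i - X s (i + 1)} y * \<phi> i (s, y))) = services T p \<phi> i t" if "t \<le> T" for t i
    unfolding set_lebesgue_integral_def ind2[OF that] services_def by (rule ci(2)[OF rs(1)])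
  have i1: "set_integrable lborel (XX T) (\<phi> 0)"
    unfolding set_integrable_def ind1[OF order_refl] by (rule ci(1)[OF rs(2)])
  have i2: "set_integrable lborel (XX T) (\<lambda>q. case q of (s, y) \<Rightarrow> indicator {0..<X s i - X s (i + 1)} y * \<phi> i (s, y))" for i
    unfolding set_integrable_def ind2[OF order_refl] by (rule ci(1)[OF rs(1)])
  show ?thesis unfolding fluid_equations_def Let_def
  proof (intro conjI allI impI ballI i1 i2)
    fix t assume t: "t \<in> {0..T}"
    then have t': "0 \<le> t" "t \<le> T" by auto
    show "Y t 1 = x 1 + lam * (LINT p:XX t|lborel. \<phi> 0 p) -
        (LINT p:XX t|lborel. (case p of (s, y) \<Rightarrow> indicator {0..<X s 1 - X s (1 + 1)} y * \<phi> 1 (s, y)))"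
      unfolding e1[OF t'(2)] e2[OF t'(2)] using equations(1)[OF order_refl t'(1) order_refl t'(2)] by simp
    show "Y t i = x i - (LINT p:XX t|lborel. (case p of (s, y) \<Rightarrow> indicator {0..<X s i - X s (i + 1)} y * \<phi> i (s, y)))"
      if "2 \<le> i" for i
      unfolding e2[OF t'(2)] using equations(1)[of i, OF _ t'(1) order_refl t'(2)] that by simp
  qed
qed

lemma fluid_limit_properties:
  "fluid_equations T lam x \<phi> X Y \<and> (X, Y) \<in> C_set T x \<and> \<phi> \<in> S_set T lam x X Y \<and>
    (\<forall>t\<in>{0..T}. X t 1 = Y t 1 - \<eta> t 1 \<and> (\<forall>i\<ge>2. X t i = Y t i + \<eta> t (i - 1) - \<eta> t i)) \<and>
    (\<forall>i\<ge>1. \<eta> 0 i = 0 \<and> mono_on {0..T} (\<lambda>t. \<eta> t i) \<and>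
       (\<forall>t\<in>{0..T}. stieltjes_integral T t (\<lambda>s. 1 - X s i) (\<lambda>s. \<eta> s i) = 0))"
proof -
  have lin: "X t i = Y t i + \<eta> t (i - 1) - \<eta> t i" if "t \<in> {0..T}" "1 \<le> i" for t i
    using equations(2)[OF that(2), of t t] that(1) by simp
  have e0: "\<eta> 0 i = 0" if "1 \<le> i" for i by (rule equations(6)[OF that order_refl order_refl T0])
  have "(X, Y) \<in> C_set T x"
    unfolding C_set_def mem_Collect_eq prod.case
    using coordinate_paths_continuous initial X_ac Y_ac lin e0 eta_mono complementarity[of _ T] T
    by (intro conjI exI[of _ \<eta>]) auto
  moreover have "\<phi> \<in> S_set T lam x X Y" using fluid \<phi> by (simp add: S_set_def S_space_def)
  moreover have "X t 1 = Y t 1 - \<eta> t 1" if "t \<in> {0..T}" for t using lin[OF that order_refl] state[OF that] by simp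
  moreover have "X t i = Y t i + \<eta> t (i - 1) - \<eta> t i" if "t \<in> {0..T}" "2 \<le> i" for t i using lin[OF that(1), of i] that(2) by simp
  ultimately show ?thesis using fluid e0 eta_mono complementarity by blast
qed

end

theorem lemma3p4:
  fixes T lam M0 :: real
    and d :: "nat \<Rightarrow> nat" and lamn :: "nat \<Rightarrow> real"
    and x :: "nat \<Rightarrow> real" and xn :: "nat \<Rightarrow> nat \<Rightarrow> real"
    and P :: "'w measure" and Q :: "'v measure"
    and D :: "nat \<Rightarrow> 'w \<Rightarrow> (real \<times> real \<times> real) measure"
    and \<phi>n :: "nat \<Rightarrow> 'w \<Rightarrow> nat \<Rightarrow> real \<times> real \<Rightarrow> real"
    and Xn Yn \<eta>n :: "nat \<Rightarrow> 'w \<Rightarrow> real \<Rightarrow> nat \<Rightarrow> real"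
    and \<phi> :: "'v \<Rightarrow> nat \<Rightarrow> real \<times> real \<Rightarrow> real"
    and X Y \<eta> :: "'v \<Rightarrow> real \<Rightarrow> nat \<Rightarrow> real"
    and r :: "nat \<Rightarrow> nat"
  assumes T: "0 < T"
    and d: "\<And>n. 1 \<le> n \<Longrightarrow> d n \<in> {1..n}" "filterlim d at_top sequentially"
    and lam: "lamn \<longlonglongrightarrow> lam" "0 < lam"
    and x: "x \<in> ell1_down" "\<And>n. 1 \<le> n \<Longrightarrow> xn n \<in> ell1_down"
      "\<And>n i. 1 \<le> n \<Longrightarrow> 1 \<le> i \<Longrightarrow> real n * xn n i \<in> \<nat>"
      "(\<lambda>n. ell1_norm (\<lambda>i. xn n i - x i)) \<longlonglongrightarrow> 0"
    and P: "prob_space P" "complete_measure P"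
    and D: "iid_poisson_random_measures P T D"
    and controls: "\<And>n. 1 \<le> n \<Longrightarrow> \<phi>n n \<in> A_b P D T"
    and M0: "0 < M0" "AE w in P. \<forall>n\<ge>1. total_cost T (\<phi>n n w) \<le> ennreal M0"
    and controlled: "\<And>n. 1 \<le> n \<Longrightarrow> AE w in P.
      controlled_equations T n (d n) (lamn n) (xn n) (\<lambda>i. D i w) (\<phi>n n w) (Xn n w) (Yn n w) (\<eta>n n w)"
    and Q: "prob_space Q"
    and r: "strict_mono r" "1 \<le> r 0"
    and conv: "converges_in_distribution P
      (prod_topology (skorokhod_topology T state_metric) (S_topology T M0))
      (\<lambda>k w. (\<lambda>t\<in>{0..T}. (Xn (r k) w t, Yn (r k) w t, \<eta>n (r k) w t), \<phi>n (r k) w))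
      Q (\<lambda>w. (\<lambda>t\<in>{0..T}. (X w t, Y w t, \<eta> w t), \<phi> w))"
  shows "AE w in Q.
    fluid_equations T lam x (\<phi> w) (X w) (Y w) \<and>
    (X w, Y w) \<in> C_set T x \<and> \<phi> w \<in> S_set T lam x (X w) (Y w) \<and>
    (\<forall>t\<in>{0..T}. X w t 1 = Y w t 1 - \<eta> w t 1 \<and>
       (\<forall>i\<ge>2. X w t i = Y w t i + \<eta> w t (i - 1) - \<eta> w t i)) \<and>
    (\<forall>i\<ge>1. \<eta> w 0 i = 0 \<and> mono_on {0..T} (\<lambda>t. \<eta> w t i) \<and>
       (\<forall>t\<in>{0..T}. stieltjes_integral T t (\<lambda>s. 1 - X w s i) (\<lambda>s. \<eta> w s i) = 0))"
proof -
  interpret controlled_limit T lam M0 d lamn x xn P Q D \<phi>n Xn Yn \<eta>n \<phi> X Y \<eta> r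
    by (rule controlled_limit.intro[OF T d lam x(1,2,4) P(1) D controls M0 controlled Q r conv])
  from limit_viol_zero show ?thesis
  proof eventually_elim
    case (elim w)
    have Zw: "Z w = (fst (Z w), \<phi> w)" by (simp add: Z_def)
    have top: "fst (Z w) \<in> cadlag_space T state_metric" "\<phi> w \<in> S_space T M0"
      using topspace_path[OF conjunct1[OF elim]] topspace_S[of T M0] by (auto simp: Z_def)
    \<comment> \<open>Outside the single null set the remaining argument is deterministic and is
      applied to each sample point separately.\<close>
    interpret fluid_limit T lam M0 x "X w" "Y w" "\<eta> w" "\<phi> w" "fst (Z w)"
    proof (rule fluid_limit.intro[OF T lam(2) less_imp_le[OF M0(1)] x(1) top(1) _ top(2)])
      show "fst (Z w) t = (X w t, Y w t, \<eta> w t)" if "t \<in> {0..T}" for t using that by (simp add: Z_def)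
      show "viol T lam x i (fst (Z w), \<phi> w) s t = 0" if "1 \<le> i" "0 \<le> s" "s \<le> t" "t \<le> T" for i s t
        using conjunct2[OF elim] that unfolding Zw[symmetric] by simp
    qed
    show ?case by (rule fluid_limit_properties)
  qed
qed

end
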